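(* Let $n\geq 2$ and let $\Omega\subset\mathbb{R}^n$ be a domain that is a solution of Serrin's problem. Assume that $\Omega$ is weakly stable. Then $\Omega$ is a ball of radius $1$.
   Context: A domain in $\mathbb{R}^n$ is a nonempty open set $\Omega$ such that $\bar\Omega$ is a properly embedded $n$-dimensional smooth submanifold (with interior $\Omega$ and boundary $\partial\Omega$); $\Omega$ is not assumed to be bounded or connected. $\mu(\Omega)$ denotes the outward unit normal of $\partial\Omega$, and $H$ the mean curvature of $\partial\Omega$ with respect to $\mu(\Omega)$, i.e. the sum of the principal curvatures, $H=\operatorname{div}_{\partial\Omega}\mu(\Omega)$ (so $H=n-1$ for the unit ball). $\Omega$ is a solution of Serrin's problem if there is $u\in C^\infty(\bar\Omega)$ with $-\Delta u=n$ in $\Omega$, $u>0$ in $\Omega$, $u=0$ on $\partial\Omega$, and $|Du|=1$ on $\partial\Omega$. Such $\Omega$ is weakly stable if $$\int_{\partial\Omega}(n-H)\,\phi^2\leq\int_\Omega|D\phi|^2$$ for all $\phi\in C_c^\infty(\bar\Omega)$ (smooth up to the boundary, with compact support in $\bar\Omega$) such that $\int_{\partial\Omega}\phi=0$. *)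

theory Defs
  imports "HOL-Analysis.Analysis"
begin

section \<open>Smooth maps\<close>

text \<open>Meaningful for open \<open>S\<close>.  In finite dimension, \<open>k\<close>-fold continuous differentiability
  amounts to continuity of all iterated directional derivatives of order up to \<open>k\<close>.\<close>

primrec k_times_diff_on ::
  "nat \<Rightarrow> 'a::real_normed_vector set \<Rightarrow> ('a \<Rightarrow> 'b::real_normed_vector) \<Rightarrow> bool" where
  "k_times_diff_on 0 S f \<longleftrightarrow> continuous_on S f"
| "k_times_diff_on (Suc k) S f \<longleftrightarrow>
     (\<forall>x\<in>S. f differentiable (at x)) \<and>
     (\<forall>v. k_times_diff_on k S (\<lambda>x. frechet_derivative f (at x) v))"

definition smooth_on ::
  "'a::real_normed_vector set \<Rightarrow> ('a \<Rightarrow> 'b::real_normed_vector) \<Rightarrow> bool" where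
  "smooth_on S f \<longleftrightarrow> (\<forall>k. k_times_diff_on k S f)"

text \<open>Smoothness on an arbitrary subset (here: the closure of a domain, so smoothness up to
  the boundary): locally the function is the restriction of a smooth function on an open set.\<close>

definition smooth_on_subset ::
  "'a::real_normed_vector set \<Rightarrow> ('a \<Rightarrow> 'b::real_normed_vector) \<Rightarrow> bool" where
  "smooth_on_subset M f \<longleftrightarrow>
     (\<forall>x\<in>M. \<exists>U g. open U \<and> x \<in> U \<and> smooth_on U g \<and> (\<forall>y\<in>U \<inter> M. g y = f y))"

text \<open>\<open>C\<^sub>c\<^sup>\<infinity>(M)\<close> for closed \<open>M\<close>; values outside \<open>M\<close> are irrelevant.\<close>

definition smooth_compact_support ::
  "'a::real_normed_vector set \<Rightarrow> ('a \<Rightarrow> real) \<Rightarrow> bool" where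
  "smooth_compact_support M \<phi> \<longleftrightarrow>
     smooth_on_subset M \<phi> \<and> compact (closure {x \<in> M. \<phi> x \<noteq> 0})"

section \<open>Smooth domains\<close>

definition half_space_chart ::
  "'a::euclidean_space set \<Rightarrow> 'a set \<Rightarrow> ('a \<Rightarrow> 'a) \<Rightarrow> 'a \<Rightarrow> bool" where
  "half_space_chart M U \<Phi> e \<longleftrightarrow>
     open U \<and> open (\<Phi> ` U) \<and> e \<in> Basis \<and>
     (\<exists>\<Psi>. homeomorphism U (\<Phi> ` U) \<Phi> \<Psi> \<and> smooth_on U \<Phi> \<and> smooth_on (\<Phi> ` U) \<Psi>) \<and>
     \<Phi> ` (U \<inter> M) = \<Phi> ` U \<inter> {y. 0 \<le> e \<bullet> y}"

text \<open>Embedded submanifolds with boundary of full dimension.  Properly embedded means closed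
  in addition, so nothing is left to require of the closure of a domain below.\<close>

definition full_dim_submanifold :: "'a::euclidean_space set \<Rightarrow> bool" where
  "full_dim_submanifold M \<longleftrightarrow> (\<forall>x\<in>M. \<exists>U \<Phi> e. x \<in> U \<and> half_space_chart M U \<Phi> e)"

definition manifold_interior :: "'a::euclidean_space set \<Rightarrow> 'a set" where
  "manifold_interior M =
     {x \<in> M. \<exists>U \<Phi> e. x \<in> U \<and> half_space_chart M U \<Phi> e \<and> 0 < e \<bullet> \<Phi> x}"

definition manifold_boundary :: "'a::euclidean_space set \<Rightarrow> 'a set" where
  "manifold_boundary M =
     {x \<in> M. \<exists>U \<Phi> e. x \<in> U \<and> half_space_chart M U \<Phi> e \<and> e \<bullet> \<Phi> x = 0}"

definition smooth_domain :: "'a::euclidean_space set \<Rightarrow> bool" where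
  "smooth_domain \<Omega> \<longleftrightarrow>
     \<Omega> \<noteq> {} \<and> open \<Omega> \<and> full_dim_submanifold (closure \<Omega>) \<and>
     manifold_interior (closure \<Omega>) = \<Omega> \<and> manifold_boundary (closure \<Omega>) = frontier \<Omega>"

section \<open>Gradient and Laplacian\<close>

text \<open>Used with \<open>S = closure \<Omega>\<close>, where the derivative within \<open>S\<close> is unique up to the boundary.\<close>

definition gradient_within ::
  "'a::euclidean_space set \<Rightarrow> ('a \<Rightarrow> real) \<Rightarrow> 'a \<Rightarrow> 'a" where
  "gradient_within S f x = (THE g. (f has_derivative (\<lambda>h. g \<bullet> h)) (at x within S))"

text \<open>Used at interior points only.\<close>

definition laplacian :: "('a::euclidean_space \<Rightarrow> real) \<Rightarrow> 'a \<Rightarrow> real" where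
  "laplacian f x =
     (\<Sum>b\<in>Basis. frechet_derivative (\<lambda>y. frechet_derivative f (at y) b) (at x) b)"

section \<open>Outward normal and mean curvature\<close>

definition tangent_space :: "'a::euclidean_space set \<Rightarrow> 'a \<Rightarrow> 'a set" where
  "tangent_space M x =
     {v. \<exists>\<gamma> \<epsilon>. 0 < \<epsilon> \<and> smooth_on {-\<epsilon><..<\<epsilon>} \<gamma> \<and> \<gamma> ` {-\<epsilon><..<\<epsilon>} \<subseteq> M \<and> \<gamma> (0::real) = x \<and>
                 (\<gamma> has_vector_derivative v) (at 0)}"

definition outward_normal :: "'a::euclidean_space set \<Rightarrow> 'a \<Rightarrow> 'a" where
  "outward_normal \<Omega> x =
     (THE \<nu>. norm \<nu> = 1 \<and> (\<forall>v \<in> tangent_space (frontier \<Omega>) x. \<nu> \<bullet> v = 0) \<and>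
             (\<exists>\<epsilon>>0. \<forall>t\<in>{0<..<\<epsilon>}. x + t *\<^sub>R \<nu> \<notin> closure \<Omega>))"

text \<open>A derivative \<open>L\<close> of \<open>X\<close> within \<open>M\<close> is determined only on the tangent space, which is all
  that enters the trace below; the trace does not depend on the orthonormal basis \<open>B\<close>.\<close>

definition surface_divergence ::
  "'a::euclidean_space set \<Rightarrow> ('a \<Rightarrow> 'a) \<Rightarrow> 'a \<Rightarrow> real" where
  "surface_divergence M X x =
     (THE d. \<exists>L B. (X has_derivative L) (at x within M) \<and>
                   pairwise orthogonal B \<and> (\<forall>b\<in>B. norm b = 1) \<and> span B = tangent_space M x \<and>
                   d = (\<Sum>b\<in>B. L b \<bullet> b))"

definition mean_curvature :: "'a::euclidean_space set \<Rightarrow> 'a \<Rightarrow> real" where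
  "mean_curvature \<Omega> = surface_divergence (frontier \<Omega>) (outward_normal \<Omega>)"

section \<open>Surface measure\<close>

text \<open>Hausdorff measure of dimension \<open>d \<ge> 1\<close>, normalised to agree with Lebesgue measure on
  \<open>d\<close>-dimensional subspaces; on a smooth hypersurface the measure of dimension \<open>n - 1\<close> is the
  Riemannian surface measure.  Since \<open>diameter\<close> is unspecified for unbounded sets, covering
  sets are required to be bounded.\<close>

definition hausdorff_premeasure ::
  "nat \<Rightarrow> real \<Rightarrow> 'a::metric_space set \<Rightarrow> ennreal" where
  "hausdorff_premeasure d \<delta> A =
     (INF C \<in> {C :: nat \<Rightarrow> 'a set. A \<subseteq> (\<Union>i. C i) \<and> (\<forall>i. bounded (C i) \<and> diameter (C i) \<le> \<delta>)}.
        \<Sum>i. ennreal (unit_ball_vol (real d) * (diameter (C i) / 2) ^ d))"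

definition hausdorff_outer_measure :: "nat \<Rightarrow> 'a::metric_space set \<Rightarrow> ennreal" where
  "hausdorff_outer_measure d A = (SUP \<delta>\<in>{0<..}. hausdorff_premeasure d \<delta> A)"

definition hausdorff_measure :: "nat \<Rightarrow> 'a::metric_space measure" where
  "hausdorff_measure d = measure_of UNIV (sets borel) (hausdorff_outer_measure d)"

definition boundary_integral ::
  "'a::euclidean_space set \<Rightarrow> ('a \<Rightarrow> real) \<Rightarrow> real" where
  "boundary_integral \<Omega> f = (LINT x : frontier \<Omega> | hausdorff_measure (DIM('a) - 1). f x)"

section \<open>Serrin's problem\<close>

definition serrin_solution :: "'a::euclidean_space set \<Rightarrow> bool" where
  "serrin_solution \<Omega> \<longleftrightarrow>
     (\<exists>u. smooth_on_subset (closure \<Omega>) u \<and>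
          (\<forall>x\<in>\<Omega>. - laplacian u x = real DIM('a)) \<and>
          (\<forall>x\<in>\<Omega>. 0 < u x) \<and>
          (\<forall>x\<in>frontier \<Omega>. u x = 0) \<and>
          (\<forall>x\<in>frontier \<Omega>. norm (gradient_within (closure \<Omega>) u x) = 1))"

definition weakly_stable :: "'a::euclidean_space set \<Rightarrow> bool" where
  "weakly_stable \<Omega> \<longleftrightarrow>
     (\<forall>\<phi>. smooth_compact_support (closure \<Omega>) \<phi> \<and> boundary_integral \<Omega> \<phi> = 0 \<longrightarrow>
          boundary_integral \<Omega> (\<lambda>x. (real DIM('a) - mean_curvature \<Omega> x) * (\<phi> x)\<^sup>2)
          \<le> (LINT x : \<Omega> | lborel. (norm (gradient_within (closure \<Omega>) \<phi> x))\<^sup>2))"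

end

theory Submission
  imports Defs
begin

text \<open>Let \<open>M\<close> be the closure of the domain. For smooth compactly supported \<open>F\<close> on \<open>M\<close> put
  \<open>sig F = \<integral> (n F - DF \<bullet> Du)\<close>, an interior integral that ought to be the boundary integral of \<open>F\<close>.
  Straightening the boundary along \<open>Du\<close> shows that the Hausdorff boundary integral is \<open>c * sig F\<close>, where \<open>c\<close>
  compares Hausdorff with Lebesgue measure on hyperplanes; the isodiametric inequality gives \<open>c \<ge> 1\<close>,
  which is all that weak stability needs.

  On the boundary \<open>n - H = - D\<^sup>2u(Du, Du)\<close>, so the second variation becomes the integral over the domain of
  \<open>\<phi>\<^sup>2 |D\<^sup>2u|\<^sup>2 + 2 \<phi> D\<^sup>2u(Du, D\<phi>) - |D\<phi>|\<^sup>2\<close>. A Cheng-Yau estimate for \<open>log (1 + u)\<close> bounds \<open>u\<close> and \<open>Du\<close>; as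
  \<open>|D\<^sup>2u|\<^sup>2 \<ge> n\<close>, cutoffs then show that the domain has finite volume. Testing with a cutoff times \<open>1 + x \<bullet> Du - 2 u\<close>,
  corrected to mean zero by a multiple of a fixed cutoff, gives \<open>D\<^sup>2u = - Id\<close>. Hence each component is a unit ball, and
  two balls are destabilised by the function that is \<open>1\<close> on one and \<open>-1\<close> on the other.\<close>

text \<open>The boundary may be noncompact, and the hypothesis speaks of it through a Hausdorff
  integral. So all analysis is done with interior integrals, and the solution itself supplies the
  boundary terms: \<open>- Du\<close> is the outward normal and \<open>Du\<close> is a smooth field
  on the whole closure.

  Three consequences of the overdetermined data carry the estimates. The components of
  \<open>Du\<close> are harmonic, so the field D^2u Du has divergence |D^2u|^2. Since |Du| = 1 on
  the boundary, D^2u Du is normal there. Since D^2u has trace - n, its squared norm is at least n,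
  which makes the second variation coercive in L^2: a function that does not destabilise pays for
  its L^2 norm with its gradient. For cutoffs this becomes a doubling inequality for the volume.

  The last test function grows linearly. That is harmless: squared cutoff gradients are of order 1 /
  R^2, the weights of order R^2, and the volume outside the ball of radius R tends to 0. The
  function is harmonic and such that the boundary terms with n - H combine into the flux of a field
  with divergence |D^2u + Id|^2.\<close>

abbreviation sum_Basis :: "('a::euclidean_space \<Rightarrow> 'b::comm_monoid_add) \<Rightarrow> 'b" (binder "SB " 10) where
  "sum_Basis f \<equiv> sum f Basis"

abbreviation "fd f x \<equiv> frechet_derivative f (at x)"

section \<open>Closure properties of iterated differentiability\<close>

lemma k_times_diff_on_imp_continuous: "k_times_diff_on k S f ==> continuous_on S f"
proof (cases k)
 case (Suc m)
 assume "k_times_diff_on k S f"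
 hence "\<forall>x\<in>S. f differentiable (at x)" by (simp add: Suc)
 thus ?thesis
  by (meson continuous_at_imp_continuous_on differentiable_imp_continuous_within)
qed simp

lemma k_times_diff_on_SucD: "k_times_diff_on (Suc k) S f ==> k_times_diff_on k S f"
proof (induction k arbitrary: f)
 case 0
 thus ?case using k_times_diff_on_imp_continuous[of "Suc 0" S f] by simp
next
 case (Suc k)
 have "k_times_diff_on k S (%x. fd f x v)" for v
  by (rule Suc.IH) (use Suc.prems in simp)
 moreover have "\<forall>x\<in>S. f differentiable (at x)" using Suc.prems by simp
 ultimately show ?case by simp
qed

lemma k_times_diff_on_subset: "k_times_diff_on k S f ==> T \<subseteq> S ==> k_times_diff_on k T f"
proof (induction k arbitrary: f)
 case 0
 thus ?case using continuous_on_subset[of S f T] by simp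
next
 case (Suc k)
 have "k_times_diff_on k T (%x. fd f x v)" for v
  by (rule Suc.IH) (use Suc.prems in simp_all)
 moreover have "\<forall>x\<in>T. f differentiable (at x)" using Suc.prems by auto
 ultimately show ?case by simp
qed

lemma k_times_diff_on_cong:
 assumes "open S" "\<And>x. x \<in> S ==> f x = g x" "k_times_diff_on k S f"
 shows "k_times_diff_on k S g"
 using assms(2,3)
proof (induction k arbitrary: f g)
 case 0
 thus ?case using continuous_on_cong[of S S f g] by simp
next
 case (Suc k)
 have *: "(g has_derivative fd f x) (at x)" if "x \<in> S" for x
 proof (rule has_derivative_transform_within_open[OF _ assms(1) that])
  show "(f has_derivative fd f x) (at x)"
   using Suc.prems that frechet_derivative_works by auto
  show "f y = g y" if "y \<in> S" for y using Suc.prems that by simp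
 qed
 have eq: "fd f x = fd g x" if "x \<in> S" for x
  using frechet_derivative_at[OF *[OF that]] .
 show ?case
  unfolding k_times_diff_on.simps
 proof (intro conjI ballI allI)
  fix x assume "x \<in> S" thus "g differentiable (at x)" using * unfolding differentiable_def by blast
 next
  fix v
  show "k_times_diff_on k S (%x. fd g x v)"
   by (rule Suc.IH[of "%x. fd f x v"]) (use Suc.prems eq in auto)
 qed
qed

lemma k_times_diff_on_const: "k_times_diff_on k S (%x. c)"
 by (induction k arbitrary: c) (auto intro: continuous_intros)

lemma k_times_diff_on_bounded_linear: "bounded_linear f ==> k_times_diff_on k S f"
proof (induction k)
 case 0
 thus ?case by (simp add: linear_continuous_on)
next
 case (Suc k)
 have "fd f x = f" for x
  using frechet_derivative_at[OF bounded_linear_imp_has_derivative[OF Suc.prems]] by simp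
 thus ?case using Suc.prems
  by (auto simp: k_times_diff_on_const bounded_linear_imp_differentiable)
qed

lemma k_times_diff_on_add:
 assumes "open S" "k_times_diff_on k S f" "k_times_diff_on k S g"
 shows "k_times_diff_on k S (%x. f x + g x)"
 using assms(2,3)
proof (induction k arbitrary: f g)
 case 0
 thus ?case by (auto intro: continuous_intros)
next
 case (Suc k)
 have eq: "frechet_derivative (%x. f x + g x) (at x) = (%v. fd f x v + fd g x v)"
  if "x \<in> S" for x
  using Suc.prems that by (intro frechet_derivative_at[symmetric] derivative_eq_intros)
   (auto simp: frechet_derivative_works)
 show ?case
  unfolding k_times_diff_on.simps
 proof (intro conjI ballI allI)
  fix x assume "x \<in> S" thus "(%x. f x + g x) differentiable (at x)" using Suc.prems by auto
 next
  fix v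
  show "k_times_diff_on k S (%x. frechet_derivative (%x. f x + g x) (at x) v)"
   by (rule k_times_diff_on_cong[OF assms(1) _ Suc.IH]) (use Suc.prems eq in auto)
 qed
qed

text \<open>The product rule returns the same bilinear map, so one induction serves products, inner
  products and scalings. Besides the derivatives it needs \<open>f\<close> and \<open>g\<close>
  themselves at order \<open>k\<close>, which is \<open>k_times_diff_on_SucD\<close>.\<close>

lemma k_times_diff_on_bilinear:
 assumes "bounded_bilinear bil" "open S" "k_times_diff_on k S f" "k_times_diff_on k S g"
 shows "k_times_diff_on k S (%x. bil (f x) (g x))"
 using assms(3,4)
proof (induction k arbitrary: f g)
 case 0
 thus ?case using bounded_bilinear.continuous_on[OF assms(1)] by auto
next
 case (Suc k)
 have der: "((%x. bil (f x) (g x)) has_derivative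
   (%v. bil (f x) (fd g x v) + bil (fd f x v) (g x))) (at x)"
  if "x \<in> S" for x
  using Suc.prems that by (intro bounded_bilinear.FDERIV[OF assms(1)])
   (auto simp: frechet_derivative_works)
 note eq = frechet_derivative_at[OF der, symmetric]
 show ?case
  unfolding k_times_diff_on.simps
 proof (intro conjI ballI allI)
  fix x assume "x \<in> S" thus "(%x. bil (f x) (g x)) differentiable (at x)"
   using der by (auto simp: differentiable_def)
 next
  fix v
  have "k_times_diff_on k S (%x. bil (f x) (fd g x v) + bil (fd f x v) (g x))"
   using Suc.prems k_times_diff_on_SucD[OF Suc.prems(1)] k_times_diff_on_SucD[OF Suc.prems(2)]
   by (intro k_times_diff_on_add assms Suc.IH) simp_all
  thus "k_times_diff_on k S (%x. frechet_derivative (%x. bil (f x) (g x)) (at x) v)"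
   by (rule k_times_diff_on_cong[OF assms(2), rotated]) (use eq in auto)
 qed
qed

lemma smooth_on_imp_continuous: "smooth_on S f ==> continuous_on S f"
 unfolding smooth_on_def using k_times_diff_on_imp_continuous by blast

lemma smooth_on_differentiable: "smooth_on S f ==> x \<in> S ==> f differentiable (at x)"
 unfolding smooth_on_def by (metis k_times_diff_on.simps(2))

lemma smooth_on_has_derivative:
 "smooth_on S f ==> x \<in> S ==> (f has_derivative fd f x) (at x)"
 using smooth_on_differentiable frechet_derivative_works by blast

lemma smooth_on_frechet: "smooth_on S f ==> smooth_on S (%x. fd f x v)"
 unfolding smooth_on_def by (metis k_times_diff_on.simps(2))

lemma smooth_on_subset_mono: "smooth_on S f ==> T \<subseteq> S ==> smooth_on T f"
 unfolding smooth_on_def using k_times_diff_on_subset by blast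

lemma smooth_on_const: "smooth_on S (%x. c)"
 unfolding smooth_on_def using k_times_diff_on_const by blast

lemma smooth_on_bounded_linear: "bounded_linear f ==> smooth_on S f"
 unfolding smooth_on_def using k_times_diff_on_bounded_linear by blast

lemma smooth_on_add: "open S ==> smooth_on S f ==> smooth_on S g ==> smooth_on S (%x. f x + g x)"
 unfolding smooth_on_def using k_times_diff_on_add by blast

lemma smooth_on_bilinear:
 "bounded_bilinear bil ==> open S ==> smooth_on S f ==> smooth_on S g ==> smooth_on S (%x. bil (f x) (g x))"
 unfolding smooth_on_def using k_times_diff_on_bilinear by blast

lemma smooth_on_mult:
 fixes f g :: "_ \<Rightarrow> real"
 shows "open S ==> smooth_on S f ==> smooth_on S g ==> smooth_on S (%x. f x * g x)"
 by (rule smooth_on_bilinear[OF bounded_bilinear_mult])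

text \<open>For a scalar outer function the derivative of the composite is h'(g) times Dg. With
  \<open>h\<close> arbitrary in the induction, h' is covered by the induction hypothesis, and the
  product rule closes the step.\<close>

lemma smooth_on_compose_real:
 fixes h :: "real \<Rightarrow> real" and g :: "'a::real_normed_vector \<Rightarrow> real"
 assumes "smooth_on T h" "open S" "smooth_on S g" "g ` S \<subseteq> T"
 shows "smooth_on S (%x. h (g x))"
proof -
 have "k_times_diff_on k S (%x. h (g x))" if "smooth_on T h" for k and h :: "real \<Rightarrow> real"
  using that
 proof (induction k arbitrary: h)
  case 0
  have "continuous_on S (%x. h (g x))"
   by (rule continuous_on_compose2[OF smooth_on_imp_continuous[OF 0] smooth_on_imp_continuous[OF assms(3)] assms(4)])
  thus ?case by simp
 next
  case (Suc k)
  have der: "((%x. h (g x)) has_derivative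
    (%v. frechet_derivative h (at (g x)) 1 * fd g x v)) (at x)"
   if "x \<in> S" for x
  proof -
   have h: "(h has_derivative frechet_derivative h (at (g x))) (at (g x))"
    using smooth_on_has_derivative[OF Suc.prems] that assms(4) by (simp add: image_subset_iff)
   have "((%x. h (g x)) has_derivative (%v. frechet_derivative h (at (g x)) (fd g x v))) (at x)"
    by (rule has_derivative_compose[OF smooth_on_has_derivative[OF assms(3) that] h])
   also have "(%v. frechet_derivative h (at (g x)) (fd g x v))
     = (%v. frechet_derivative h (at (g x)) 1 * fd g x v)"
   proof
    fix v
    show "frechet_derivative h (at (g x)) (fd g x v)
     = frechet_derivative h (at (g x)) 1 * fd g x v"
     using linear_scale[OF has_derivative_linear[OF h], of "fd g x v" 1]
     by (metis mult.commute mult.right_neutral real_scaleR_def)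
   qed
   finally show ?thesis .
  qed
  note eq = frechet_derivative_at[OF der, symmetric]
  show ?case
   unfolding k_times_diff_on.simps
  proof (intro conjI ballI allI)
   fix x assume "x \<in> S" thus "(%x. h (g x)) differentiable (at x)"
    using der by (auto simp: differentiable_def)
  next
   fix v
   have "k_times_diff_on k S (%x. frechet_derivative h (at (g x)) 1 * fd g x v)"
    using Suc.IH[OF smooth_on_frechet[OF Suc.prems, of 1]] smooth_on_frechet[OF assms(3), of v]
    unfolding smooth_on_def
    by (intro k_times_diff_on_bilinear[OF bounded_bilinear_mult assms(2)]) blast+
   thus "k_times_diff_on k S (%x. frechet_derivative (%x. h (g x)) (at x) v)"
    by (rule k_times_diff_on_cong[OF assms(2), rotated]) (use eq in auto)
  qed
 qed
 with assms(1) show ?thesis unfolding smooth_on_def by blast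
qed

text \<open>The derivative is built from the function itself, as minus its square, so the induction
  hypothesis applies to both factors.\<close>

lemma smooth_on_inverse_real: "smooth_on (- {0}) (inverse :: real \<Rightarrow> real)"
proof -
 have "k_times_diff_on k (- {0}) (inverse :: real \<Rightarrow> real)" for k
 proof (induction k)
  case 0
  thus ?case by (auto intro!: continuous_intros)
 next
  case (Suc k)
  have der: "(inverse has_derivative (%v. (inverse x * inverse x) * (- v))) (at x)" if "x \<noteq> 0" for x :: real
   using that by (auto intro!: derivative_eq_intros simp: power2_eq_square)
  note eq = frechet_derivative_at[OF der, symmetric]
  show ?case
   unfolding k_times_diff_on.simps
  proof (intro conjI ballI allI)
   fix x :: real assume "x \<in> - {0}" thus "inverse differentiable (at x)"
    using der by (auto simp: differentiable_def)
  next
   fix v :: real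
   have "k_times_diff_on k (- {0}) (%x::real. (inverse x * inverse x) * (-v))"
    by (intro k_times_diff_on_bilinear[OF bounded_bilinear_mult] Suc k_times_diff_on_const) auto
   thus "k_times_diff_on k (- {0}) (%x::real. fd inverse x v)"
    by (rule k_times_diff_on_cong[rotated 2]) (use eq in auto)
  qed
 qed
 thus ?thesis by (simp add: smooth_on_def)
qed

lemma smooth_on_inverse:
 fixes g :: "_ \<Rightarrow> real"
 assumes "open S" "smooth_on S g" "\<And>x. x \<in> S ==> g x \<noteq> 0"
 shows "smooth_on S (%x. inverse (g x))"
proof (rule smooth_on_compose_real[OF smooth_on_inverse_real assms(1,2)])
 show "g ` S \<subseteq> - {0}" using assms(3) by (metis ComplI image_subsetI singletonD)
qed

text \<open>The form \<open>y + t *\<^sub>R w\<close> is the one in which curves in charts and, for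
  real arguments, rescaled step functions are written.\<close>

lemma smooth_on_compose_affine:
 fixes f :: "'a::real_normed_vector \<Rightarrow> 'b::real_normed_vector" and w :: 'a
 assumes "smooth_on S f" "\<And>t. t \<in> T ==> y + t *\<^sub>R w \<in> S" "open T"
 shows "smooth_on T (%t::real. f (y + t *\<^sub>R w))"
proof -
 have "k_times_diff_on k T (%t::real. f (y + t *\<^sub>R w))" if "smooth_on S f" for k and f :: "'a \<Rightarrow> 'b"
  using that
 proof (induction k arbitrary: f)
  case 0
  have "continuous_on T (%t. y + t *\<^sub>R w)" by (intro continuous_intros)
  from continuous_on_compose2[OF smooth_on_imp_continuous[OF 0] this] assms(2)
  show ?case by auto
 next
  case (Suc k)
  have der: "((%t. f (y + t *\<^sub>R w)) has_derivative
    (%s. s *\<^sub>R frechet_derivative f (at (y + t *\<^sub>R w)) w)) (at t)"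
   if "t \<in> T" for t
  proof -
   have h: "(f has_derivative frechet_derivative f (at (y + t *\<^sub>R w))) (at (y + t *\<^sub>R w))"
    using smooth_on_has_derivative[OF Suc.prems assms(2)[OF that]] .
   have "((%t. y + t *\<^sub>R w) has_derivative (%s. s *\<^sub>R w)) (at t)"
    by (auto intro!: derivative_eq_intros)
   from has_derivative_compose[OF this h] show ?thesis
    by (simp add: linear_scale[OF has_derivative_linear[OF h]])
  qed
  note eq = frechet_derivative_at[OF der, symmetric]
  show ?case
   unfolding k_times_diff_on.simps
  proof (intro conjI ballI allI)
   fix t assume "t \<in> T" thus "(%t. f (y + t *\<^sub>R w)) differentiable (at t)"
    using der by (auto simp: differentiable_def)
  next
   fix s
   have "k_times_diff_on k T (%t. s *\<^sub>R frechet_derivative f (at (y + t *\<^sub>R w)) w)"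
    by (intro k_times_diff_on_bilinear[OF bounded_bilinear_scaleR \<open>open T\<close>] k_times_diff_on_const
      Suc.IH[OF smooth_on_frechet[OF Suc.prems]])
   thus "k_times_diff_on k T (%t. frechet_derivative (%t. f (y + t *\<^sub>R w)) (at t) s)"
    by (rule k_times_diff_on_cong[OF assms(3), rotated]) (use eq in auto)
  qed
 qed
 from this[OF assms(1)] show ?thesis unfolding smooth_on_def by blast
qed

lemma smooth_on_line_derivative:
 fixes g :: "'a::real_normed_vector \<Rightarrow> real"
 assumes "smooth_on U g" "y + s *\<^sub>R w \<in> U"
 shows "((%s. g (y + s *\<^sub>R w)) has_real_derivative frechet_derivative g (at (y + s *\<^sub>R w)) w) (at s)"
proof -
 have h: "(g has_derivative frechet_derivative g (at (y + s *\<^sub>R w))) (at (y + s *\<^sub>R w))"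
  by (rule smooth_on_has_derivative[OF assms])
 have "((%s. y + s *\<^sub>R w) has_derivative (%s. s *\<^sub>R w)) (at s)"
  by (auto intro!: derivative_eq_intros)
 from has_derivative_compose[OF this h] show ?thesis
  by (simp add: linear_scale[OF has_derivative_linear[OF h]] has_field_derivative_def mult_commute_abs)
qed

text \<open>The mean value theorem twice, first in direction \<open>v\<close>, then in direction
  \<open>w\<close>. The left side is symmetric in \<open>v\<close> and \<open>w\<close> and the
  right side is not, which is the source of the symmetry of second derivatives.\<close>

lemma second_difference_quotient:
 fixes g :: "'a::real_normed_vector \<Rightarrow> real"
 assumes g: "smooth_on U g" and U: "ball x r \<subseteq> U" and t: "0 < t" "t * (norm v + norm w) < r"
 obtains \<xi> where "dist \<xi> x \<le> t * (norm v + norm w)"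
  "g (x + t *\<^sub>R w + t *\<^sub>R v) - g (x + t *\<^sub>R v) - g (x + t *\<^sub>R w) + g x =
   t * t * frechet_derivative (%y. fd g y v) (at \<xi>) w"
proof -
 have near: "norm (a *\<^sub>R v + b *\<^sub>R w) \<le> t * (norm v + norm w)" if "0 \<le> a" "a \<le> t" "0 \<le> b" "b \<le> t" for a b
 proof -
  have "norm (a *\<^sub>R v + b *\<^sub>R w) \<le> a * norm v + b * norm w"
   using norm_triangle_ineq[of "a *\<^sub>R v" "b *\<^sub>R w"] that by simp
  also have "... \<le> t * norm v + t * norm w" using that by (intro add_mono mult_right_mono) auto
  finally show ?thesis by (simp add: distrib_left)
 qed
 have inU: "x + a *\<^sub>R v + b *\<^sub>R w \<in> U" if "0 \<le> a" "a \<le> t" "0 \<le> b" "b \<le> t" for a b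
 proof -
  have "dist (x + a *\<^sub>R v + b *\<^sub>R w) x < r"
   using near[OF that] t by (simp add: dist_norm algebra_simps)
  thus ?thesis using U by (auto simp: dist_commute)
 qed
 define \<phi> where "\<phi> = (%s. g ((x + t *\<^sub>R w) + s *\<^sub>R v) - g (x + s *\<^sub>R v))"
 have "\<exists>z. 0 < z \<and> z < t \<and> \<phi> t - \<phi> 0 = (t - 0) *
   (frechet_derivative g (at ((x + t *\<^sub>R w) + z *\<^sub>R v)) v - frechet_derivative g (at (x + z *\<^sub>R v)) v)"
 proof (rule MVT2[OF t(1)])
  fix s assume s: "0 \<le> s" "s \<le> t"
  have "(x + t *\<^sub>R w) + s *\<^sub>R v \<in> U" "x + s *\<^sub>R v \<in> U"
   using inU[of s t] inU[of s 0] s t by (auto simp: algebra_simps)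
  thus "(\<phi> has_real_derivative
   (frechet_derivative g (at ((x + t *\<^sub>R w) + s *\<^sub>R v)) v - frechet_derivative g (at (x + s *\<^sub>R v)) v)) (at s)"
   unfolding \<phi>_def by (intro DERIV_diff smooth_on_line_derivative[OF g])
 qed
 then obtain z where z: "0 < z" "z < t" "\<phi> t - \<phi> 0 = t *
   (frechet_derivative g (at ((x + t *\<^sub>R w) + z *\<^sub>R v)) v - frechet_derivative g (at (x + z *\<^sub>R v)) v)" by auto
 define G where "G = (%y. fd g y v)"
 have sG: "smooth_on U G" unfolding G_def by (rule smooth_on_frechet[OF g])
 have "\<exists>z'. 0 < z' \<and> z' < t \<and> G ((x + z *\<^sub>R v) + t *\<^sub>R w) - G ((x + z *\<^sub>R v) + 0 *\<^sub>R w) = (t - 0) *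
   frechet_derivative G (at ((x + z *\<^sub>R v) + z' *\<^sub>R w)) w"
  by (rule MVT2[OF t(1)], rule smooth_on_line_derivative[OF sG], rule inU) (use z in auto)
 then obtain z' where z': "0 < z'" "z' < t" "G ((x + z *\<^sub>R v) + t *\<^sub>R w) - G (x + z *\<^sub>R v) = t *
   frechet_derivative G (at ((x + z *\<^sub>R v) + z' *\<^sub>R w)) w" by auto
 show ?thesis
 proof (rule that)
  show "dist (x + z *\<^sub>R v + z' *\<^sub>R w) x \<le> t * (norm v + norm w)"
   using near[of z z'] z z' by (simp add: dist_norm algebra_simps)
  have "g (x + t *\<^sub>R w + t *\<^sub>R v) - g (x + t *\<^sub>R v) - g (x + t *\<^sub>R w) + g x = \<phi> t - \<phi> 0"
   by (simp add: \<phi>_def)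
  also have "... = t * (t * frechet_derivative G (at ((x + z *\<^sub>R v) + z' *\<^sub>R w)) w)"
   using z(3) z'(3) by (simp add: G_def algebra_simps)
  finally show "g (x + t *\<^sub>R w + t *\<^sub>R v) - g (x + t *\<^sub>R v) - g (x + t *\<^sub>R w) + g x = t * t *
   frechet_derivative (%y. fd g y v) (at (x + z *\<^sub>R v + z' *\<^sub>R w)) w"
   by (simp add: G_def)
 qed
qed

lemma frechet_derivative_commute:
 fixes g :: "'a::real_normed_vector \<Rightarrow> real"
 assumes g: "smooth_on U g" and U: "open U" "x \<in> U"
 shows "frechet_derivative (%y. fd g y v) (at x) w =
    frechet_derivative (%y. fd g y w) (at x) v"
proof -
 define H where "H = (%v w y. frechet_derivative (%y. fd g y v) (at y) w)"
 have cont: "isCont (H v w) x" for v w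
  using smooth_on_imp_continuous[OF smooth_on_frechet[OF smooth_on_frechet[OF g]], of v w] U
  by (simp add: H_def continuous_on_eq_continuous_at)
 have "dist (H v w x) (H w v x) < e" if e: "0 < e" for e
 proof -
  obtain d1 where d1: "0 < d1" "\<And>y. dist y x < d1 ==> dist (H v w y) (H v w x) < e/2"
   using cont[of v w] e unfolding continuous_at_eps_delta by (metis half_gt_zero)
  obtain d2 where d2: "0 < d2" "\<And>y. dist y x < d2 ==> dist (H w v y) (H w v x) < e/2"
   using cont[of w v] e unfolding continuous_at_eps_delta by (metis half_gt_zero)
  obtain r where r: "0 < r" "ball x r \<subseteq> U" using U open_contains_ball by blast
  define m where "m = min r (min d1 d2)"
   \<comment> \<open>The summand 1 keeps the division by \<open>N\<close> meaningful when
     \<open>v\<close> and \<open>w\<close> are both 0.\<close>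
   define N where "N = norm v + norm w + 1"
  define t where "t = m / (2 * N)"
  have m: "0 < m" using r d1 d2 by (simp add: m_def)
  have n0: "0 \<le> norm v + norm w" by simp
  have N0: "0 < N" using add_nonneg_pos[OF n0 zero_less_one] by (simp add: N_def)
  have t0: "0 < t" using m N0 by (simp add: t_def)
  have "t * (norm v + norm w) \<le> t * N" using t0 by (simp add: N_def)
  also have "... = m / 2" using N0 by (simp add: t_def)
  also have "... < m" using m by simp
  finally have t: "t * (norm v + norm w) < m" .
  have tr1: "t * (norm v + norm w) < r" using t by (simp add: m_def)
  hence tr2: "t * (norm w + norm v) < r" by (simp only: add.commute)
  obtain \<xi> where 1: "dist \<xi> x \<le> t * (norm v + norm w)"
   "g (x + t *\<^sub>R w + t *\<^sub>R v) - g (x + t *\<^sub>R v) - g (x + t *\<^sub>R w) + g x = t * t * H v w \<xi>"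
   using second_difference_quotient[OF g r(2) t0 tr1] unfolding H_def by blast
  obtain \<eta> where 2: "dist \<eta> x \<le> t * (norm w + norm v)"
   "g (x + t *\<^sub>R v + t *\<^sub>R w) - g (x + t *\<^sub>R w) - g (x + t *\<^sub>R v) + g x = t * t * H w v \<eta>"
   using second_difference_quotient[OF g r(2) t0 tr2] unfolding H_def by blast
  have comm: "x + t *\<^sub>R w + t *\<^sub>R v = x + t *\<^sub>R v + t *\<^sub>R w" by (simp add: algebra_simps)
  have "t * t * H v w \<xi> = t * t * H w v \<eta>"
   unfolding 1(2)[symmetric] 2(2)[symmetric] comm by simp
  hence "H v w \<xi> = H w v \<eta>" using t0 by simp
  moreover have "dist (H v w \<xi>) (H v w x) < e/2" using d1(2)[of \<xi>] 1(1) t by (simp add: m_def)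
  moreover have "dist (H w v \<eta>) (H w v x) < e/2" using d2(2)[of \<eta>] 2(1) t by (simp add: m_def add.commute)
  ultimately show ?thesis using dist_triangle_half_r[of "H v w \<xi>" "H v w x" e "H w v x"] by simp
 qed
 note small = this
 have "H v w x = H w v x"
 proof (rule ccontr)
  assume "H v w x \<noteq> H w v x"
  hence "0 < dist (H v w x) (H w v x)" by simp
  from small[OF this] show False by simp
 qed
 thus ?thesis by (simp add: H_def)
qed

section \<open>Flat functions, smooth steps and bumps\<close>

definition flat_exp :: "nat \<Rightarrow> real \<Rightarrow> real" where
 "flat_exp m t = (if t \<le> 0 then 0 else inverse t ^ m * exp (- inverse t))"

text \<open>Put s = 1 / t in exp s \<ge> (s / (m + 1))^(m + 1). A linear bound for every
  \<open>m\<close> is enough: the difference quotient of \<open>flat_exp m\<close> at 0 is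
  \<open>flat_exp (Suc m)\<close>. The powers of 1 / t are in the family because they make it closed
  under differentiation.\<close>

lemma flat_exp_bound: "\<bar>flat_exp m t\<bar> \<le> real (Suc m) ^ Suc m * \<bar>t\<bar>"
proof (cases "t \<le> 0")
 case False
 define s where "s = inverse t"
 have s: "0 < s" using False by (simp add: s_def)
 have "(s / real (Suc m)) ^ Suc m \<le> (1 + s / real (Suc m)) ^ Suc m"
  using s by (intro power_mono) auto
 also have "... \<le> exp s"
  using s by (intro exp_ge_one_plus_x_over_n_power_n) auto
 finally have "s ^ Suc m \<le> real (Suc m) ^ Suc m * exp s"
  by (simp add: power_divide field_simps del: power_Suc of_nat_Suc)
 hence "s ^ m * exp (- s) \<le> real (Suc m) ^ Suc m / s"
  using s by (simp add: exp_minus field_simps)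
 thus ?thesis using False s
  by (simp add: flat_exp_def s_def divide_inverse del: power_Suc of_nat_Suc)
next
 case True
 hence "flat_exp m t = 0" by (simp add: flat_exp_def)
 moreover have "0 \<le> real (Suc m) ^ Suc m * \<bar>t\<bar>"
  by (intro mult_nonneg_nonneg zero_le_power of_nat_0_le_iff abs_ge_zero)
 ultimately show ?thesis by (simp only: abs_zero)
qed

lemma flat_exp_has_derivative:
 "(flat_exp m has_real_derivative (flat_exp (m + 2) t - real m * flat_exp (m + 1) t)) (at t)"
proof -
 consider "t < 0" | "t = 0" | "t > 0" by linarith
 thus ?thesis
 proof cases
  case 1
  have "((%t. 0) has_real_derivative 0) (at t)" by simp
  hence "(flat_exp m has_real_derivative 0) (at t)"
   by (rule has_field_derivative_transform_within_open[of _ _ _ "{..<0}"])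
    (use 1 in \<open>auto simp: flat_exp_def\<close>)
  thus ?thesis using 1 by (simp add: flat_exp_def)
 next
  case 3
  have "((%t. inverse t ^ m * exp (- inverse t)) has_real_derivative
    (flat_exp (m + 2) t - real m * flat_exp (m + 1) t)) (at t)"
   using 3 by (cases m) (auto intro!: derivative_eq_intros simp: flat_exp_def power2_eq_square algebra_simps,
    metis mult.commute neq0_conv power_minus_mult One_nat_def)
  thus ?thesis
   by (rule has_field_derivative_transform_within_open[of _ _ _ "{0<..}"])
    (use 3 in \<open>auto simp: flat_exp_def\<close>)
 next
  case 2
  have "(flat_exp m has_real_derivative 0) (at 0)"
   unfolding DERIV_def
  proof (rule Lim_null_comparison)
   show "((%h. real (Suc (Suc m)) ^ Suc (Suc m) * \<bar>h\<bar>) \<longlongrightarrow> 0) (at 0)"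
    by (auto intro!: tendsto_eq_intros)
   have "norm ((flat_exp m (0 + h) - flat_exp m 0) / h) \<le> real (Suc (Suc m)) ^ Suc (Suc m) * \<bar>h\<bar>" if "h \<noteq> 0" for h
   proof -
    have "(flat_exp m (0 + h) - flat_exp m 0) / h = flat_exp (Suc m) h"
     by (simp add: flat_exp_def divide_inverse)
    thus ?thesis using flat_exp_bound[of "Suc m" h] by (simp del: power_Suc of_nat_Suc)
   qed
   thus "\<forall>\<^sub>F h in at 0. norm ((flat_exp m (0 + h) - flat_exp m 0) / h) \<le> real (Suc (Suc m)) ^ Suc (Suc m) * \<bar>h\<bar>"
    by (auto simp: eventually_at_filter)
  qed
  thus ?thesis using 2 by (simp add: flat_exp_def)
 qed
qed

lemma smooth_on_flat_exp: "smooth_on UNIV (flat_exp m)"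
proof -
 have "k_times_diff_on k UNIV (flat_exp m)" for k m
 proof (induction k arbitrary: m)
  case 0
  have "isCont (flat_exp m) t" for t using flat_exp_has_derivative DERIV_isCont by blast
  thus ?case by (simp add: continuous_on_eq_continuous_at)
 next
  case (Suc k)
  have der: "(flat_exp m has_derivative (%v. (flat_exp (m + 2) t + (- real m) * flat_exp (m + 1) t) * v)) (at t)" for t
   using flat_exp_has_derivative[of m t] by (simp add: has_field_derivative_def)
  have "k_times_diff_on k UNIV (%t. (flat_exp (m + 2) t + (- real m) * flat_exp (m + 1) t) * v)" for v
   by (intro k_times_diff_on_bilinear[OF bounded_bilinear_mult] k_times_diff_on_add Suc k_times_diff_on_const open_UNIV)
  thus ?case
   using der unfolding k_times_diff_on.simps frechet_derivative_at[OF der, symmetric] differentiable_def by blast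
 qed
 thus ?thesis by (simp add: smooth_on_def)
qed

text \<open>The quotient e(t) / (e(t) + e(1 - t)) with \<open>e = flat_exp 0\<close>. The derivative
  is kept as a function \<open>sst'\<close> because its sign is used later for fluxes through level
  sets and its bound for gradients of cutoffs; the bound comes from compactness, \<open>sst'\<close>
  being 0 off the unit interval.\<close>

lemma smooth_step_exists:
 obtains sst sst' :: "real \<Rightarrow> real" and K :: real where
  "smooth_on UNIV sst" "\<And>t. (sst has_real_derivative sst' t) (at t)"
  "\<And>t. t \<le> 0 ==> sst t = 0" "\<And>t. 1 \<le> t ==> sst t = 1" "\<And>t. 0 \<le> sst t \<and> sst t \<le> 1"
  "\<And>t. 0 \<le> sst' t \<and> sst' t \<le> K"
proof -
 define e where "e = flat_exp 0"
 have e0: "e t = 0" if "t \<le> 0" for t using that by (simp add: e_def flat_exp_def)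
 have epos: "0 < e t" if "0 < t" for t using that by (simp add: e_def flat_exp_def)
 have enn: "0 \<le> e t" for t using e0[of t] epos[of t] by linarith
 \<comment> \<open>\<open>1 + t * (-1)\<close> has the shape that
   \<open>smooth_on_compose_affine\<close> asks for.\<close>
 define d where "d = (%t. e t + e (1 + t * (-1)))"
 have dpos: "0 < d t" for t
  using epos[of t] epos[of "1 - t"] enn[of t] enn[of "1 - t"] by (cases "0 < t") (auto simp: d_def intro: add_pos_nonneg add_nonneg_pos)
 have se: "smooth_on UNIV e" unfolding e_def by (rule smooth_on_flat_exp)
 have se1: "smooth_on UNIV (%t. e (1 + t * (-1)))"
  using smooth_on_compose_affine[OF se, of UNIV 1 "-1"] by simp
 have sd: "smooth_on UNIV d" unfolding d_def by (intro smooth_on_add se se1 open_UNIV)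
 define sst where "sst = (%t. e t * inverse (d t))"
 define e' where "e' = flat_exp 2"
 have e'nn: "0 \<le> e' t" for t by (simp add: e'_def flat_exp_def)
 have De: "(e has_real_derivative e' t) (at t)" for t
  using flat_exp_has_derivative[of 0 t] by (simp add: e_def e'_def numeral_2_eq_2)
 define sst' where "sst' = (%t. (e' t * e (1 + t * (-1)) + e t * e' (1 + t * (-1))) * (inverse (d t) * inverse (d t)))"
 have D: "(sst has_real_derivative sst' t) (at t)" for t
 proof -
  have D1: "((%t. e (1 + t * (-1))) has_real_derivative e' (1 + t * (-1)) * (-1)) (at t)"
   by (rule DERIV_chain'[OF _ De]) (auto intro!: derivative_eq_intros)
  define I where "I = inverse (d t)"
  have I: "I * d t = 1" using dpos[of t] by (simp add: I_def)
  have Dd: "(d has_real_derivative e' t + e' (1 + t * (-1)) * (-1)) (at t)"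
   unfolding d_def by (intro DERIV_add De D1)
  have "(sst has_real_derivative e' t * inverse (d t) +
    - (inverse (d t) * (e' t + e' (1 + t * (-1)) * (-1)) * inverse (d t)) * e t) (at t)"
   unfolding sst_def using DERIV_mult[OF De DERIV_inverse'[OF Dd]] dpos[of t] by simp
  also have "e' t * inverse (d t) + - (inverse (d t) * (e' t + e' (1 + t * (-1)) * (-1)) * inverse (d t)) * e t = sst' t"
  proof -
   define a b a' b' where "a = e t" "b = e (1 + t * (-1))" "a' = e' t" "b' = e' (1 + t * (-1))"
   note abb = this
   have "a' * I = a' * I * (I * d t)" unfolding I by simp
   also have "... = a' * (a + b) * (I * I)" by (simp add: d_def abb)
   finally have *: "a' * I = a' * (a + b) * (I * I)" .
   have "a' * I + - (I * (a' + b' * (-1)) * I) * a = a' * (a + b) * (I * I) + - (I * (a' + b' * (-1)) * I) * a"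
    by (simp only: *)
   also have "... = (a' * b + a * b') * (I * I)" by (simp add: algebra_simps)
   finally show ?thesis unfolding sst'_def by (simp only: I_def abb)
  qed
  finally show ?thesis .
 qed
 have s: "smooth_on UNIV sst" unfolding sst_def
  using dpos by (intro smooth_on_mult smooth_on_inverse se sd open_UNIV) (auto simp: less_imp_neq[symmetric])
 have c: "continuous_on UNIV sst'"
 proof -
  have "isCont e' t" for t unfolding e'_def using flat_exp_has_derivative DERIV_isCont by blast
  hence ce': "continuous_on UNIV e'" by (simp add: continuous_on_eq_continuous_at)
  have "continuous_on UNIV (%t. e' (1 + t * (-1)))"
   by (rule continuous_on_compose2[OF ce']) (auto intro!: continuous_intros)
  with ce' show ?thesis unfolding sst'_def
   using dpos smooth_on_imp_continuous[OF se] smooth_on_imp_continuous[OF se1] smooth_on_imp_continuous[OF sd]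
   by (intro continuous_intros) (auto simp: less_imp_neq[symmetric])
 qed
 have "bounded (sst' ` {0..1})"
  by (intro compact_imp_bounded compact_continuous_image continuous_on_subset[OF c]) auto
 then obtain K where "\<forall>y\<in>sst' ` {0..1}. norm y \<le> K" unfolding bounded_iff by blast
 hence K: "norm (sst' t) \<le> K" if "t \<in> {0..1}" for t using that by blast
 have K0: "0 \<le> K" using K[of 0] by (smt (verit) atLeastAtMost_iff norm_ge_zero)
 have z: "sst' t = 0" if "t \<notin> {0..1}" for t
  using that e0[of t] e0[of "1 - t"] by (auto simp: sst'_def e'_def flat_exp_def)
 show ?thesis
 proof (rule that[OF s D])
  show "sst t = 0" if "t \<le> 0" for t using e0[OF that] by (simp add: sst_def)
  show "sst t = 1" if "1 \<le> t" for t
   using e0[of "1 - t"] epos[of t] that by (simp add: sst_def d_def)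
  show "0 \<le> sst t \<and> sst t \<le> 1" for t
  proof -
   have "e t \<le> d t" using enn[of "1 - t"] by (simp add: d_def)
   thus ?thesis using enn[of t] dpos[of t] by (simp add: sst_def field_simps)
  qed
  show "0 \<le> sst' t \<and> sst' t \<le> K" for t
  proof
   show "0 \<le> sst' t" unfolding sst'_def
    using dpos[of t] by (intro mult_nonneg_nonneg add_nonneg_nonneg enn e'nn) auto
   show "sst' t \<le> K" using K[of t] z[of t] K0 by (cases "t \<in> {0..1}") auto
  qed
 qed
qed

lemma smooth_on_inner_self: "smooth_on UNIV (%x::'a::real_inner. (x - p) \<bullet> (x - p))"
proof -
 have *: "smooth_on UNIV (%x::'a. x - p)"
  using smooth_on_add[OF open_UNIV smooth_on_bounded_linear[OF bounded_linear_ident] smooth_on_const, of "-p"] by simp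
 show ?thesis by (rule smooth_on_bilinear[OF bounded_bilinear_inner open_UNIV * *])
qed

text \<open>The exact positivity set is what a partition of unity needs: finitely many of these
  functions have a positive sum on every compact set covered by the balls, and one may divide by the
  sum there.\<close>

lemma smooth_ball_function:
 fixes p :: "'a::euclidean_space"
 assumes "0 < r"
 obtains b :: "'a \<Rightarrow> real" where "smooth_on UNIV b" "\<And>x. 0 \<le> b x" "\<And>x. 0 < b x \<longleftrightarrow> x \<in> ball p r"
proof
 define b :: "'a \<Rightarrow> real" where "b = (%x. flat_exp 0 (r\<^sup>2 + (-1) * ((x - p) \<bullet> (x - p))))"
 show "smooth_on UNIV b" unfolding b_def
  by (rule smooth_on_compose_real[OF smooth_on_flat_exp[of 0] open_UNIV _ subset_UNIV],
    intro smooth_on_add smooth_on_mult smooth_on_const smooth_on_inner_self open_UNIV)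
 show "0 \<le> b x" for x by (simp add: b_def flat_exp_def)
 show "0 < b x \<longleftrightarrow> x \<in> ball p r" for x
 proof -
  have "0 < b x \<longleftrightarrow> (norm (x - p))\<^sup>2 < r\<^sup>2"
   by (simp add: b_def flat_exp_def dot_square_norm not_le)
  also have "... \<longleftrightarrow> norm (x - p) < r"
   using power2_less_imp_less[of "norm (x - p)" r] power_strict_mono[of "norm (x - p)" r 2] assms by auto
  finally show ?thesis by (simp add: dist_norm norm_minus_commute)
 qed
qed

section \<open>Lebesgue measure on hyperplanes and integration along lines\<close>

lemma nn_integral_lborel_shift:
 fixes f :: "'a::euclidean_space \<Rightarrow> ennreal"
 assumes [measurable]: "f \<in> borel_measurable borel"
 shows "(\<integral>\<^sup>+x. f (c + x) \<partial>lborel) = (\<integral>\<^sup>+x. f x \<partial>lborel)"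
proof -
 have "(\<integral>\<^sup>+x. f x \<partial>lborel) = (\<integral>\<^sup>+x. f x \<partial>distr lborel borel ((+) c))"
  by (simp only: lborel_distr_plus)
 also have "... = (\<integral>\<^sup>+x. f (c + x) \<partial>lborel)" by (subst nn_integral_distr) auto
 finally show ?thesis ..
qed

lemma sigma_finite_measure_balls:
 fixes M :: "'a::real_normed_vector measure"
 assumes "sets M = sets borel" "\<And>R::nat. emeasure M (ball 0 (real R)) < \<infinity>"
 shows "sigma_finite_measure M"
proof
 have sp: "space M = UNIV" using sets_eq_imp_space_eq[OF assms(1)] by simp
 have "\<exists>R::nat. x \<in> ball 0 (real R)" for x :: 'a using reals_Archimedean2[of "norm x"] by auto
 hence U: "\<Union>(range (%R::nat. ball (0::'a) (real R))) = space M" unfolding sp by blast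
 show "\<exists>A. countable A \<and> A \<subseteq> sets M \<and> \<Union>A = space M \<and> (\<forall>a\<in>A. emeasure M a \<noteq> \<infinity>)"
  using U assms by (intro exI[of _ "range (%R::nat. ball (0::'a) (real R))"]) (auto simp: less_top[symmetric])
qed

text \<open>Uniqueness of Haar measure by Tonelli's theorem; the measures may live on a subspace \<open>E\<close>.\<close>

lemma translation_invariant_proportional:
 fixes M N :: "'a::euclidean_space measure"
 assumes sM: "sets M = sets borel" and sN: "sets N = sets borel"
  and sfM: "sigma_finite_measure M" and sfN: "sigma_finite_measure N"
  and EM: "AE x in M. x \<in> E" and EN: "AE x in N. x \<in> E"
  and tM: "\<And>x. x \<in> E ==> distr M borel ((+) x) = M"
  and tN: "\<And>x. x \<in> E ==> distr N borel ((+) x) = N"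
  and B: "B \<in> sets borel" and Q: "Q \<in> sets borel"
 shows "emeasure M B * emeasure N Q = emeasure M (uminus -` Q) * emeasure N B"
proof -
 interpret M: sigma_finite_measure M by fact
 interpret N: sigma_finite_measure N by fact
 interpret P: pair_sigma_finite M N ..
 note [measurable] = B Q
 have mM[measurable_cong]: "sets M = sets borel" by fact
 have mN[measurable_cong]: "sets N = sets borel" by fact
 have uQ[measurable]: "uminus -` Q \<in> sets borel"
  using measurable_sets_borel[OF _ Q, of "uminus"] by simp
 have shM: "(\<integral>\<^sup>+y. f (x + y) \<partial>M) = (\<integral>\<^sup>+y. f y \<partial>M)" if "x \<in> E" "f \<in> borel_measurable borel" for x and f :: "'a \<Rightarrow> ennreal"
 proof -
  have "(\<integral>\<^sup>+y. f y \<partial>M) = (\<integral>\<^sup>+y. f y \<partial>distr M borel ((+) x))" by (simp only: tM[OF that(1)])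
  also have "... = (\<integral>\<^sup>+y. f (x + y) \<partial>M)" using that(2) by (subst nn_integral_distr) auto
  finally show ?thesis ..
 qed
 have shN: "(\<integral>\<^sup>+y. f (x + y) \<partial>N) = (\<integral>\<^sup>+y. f y \<partial>N)" if "x \<in> E" "f \<in> borel_measurable borel" for x and f :: "'a \<Rightarrow> ennreal"
 proof -
  have "(\<integral>\<^sup>+y. f y \<partial>N) = (\<integral>\<^sup>+y. f y \<partial>distr N borel ((+) x))" by (simp only: tN[OF that(1)])
  also have "... = (\<integral>\<^sup>+y. f (x + y) \<partial>N)" using that(2) by (subst nn_integral_distr) auto
  finally show ?thesis ..
 qed
 have "emeasure M B * emeasure N Q = (\<integral>\<^sup>+y. emeasure M B * indicator Q y \<partial>N)"
  by (subst nn_integral_cmult_indicator) (auto simp: sN)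
 \<comment> \<open>\<open>M\<close> does not notice the shift of \<open>B\<close> by
   \<open>y\<close>. After the exchange of integrals, a translation by \<open>x\<close> under
   \<open>N\<close> moves the shift over to \<open>Q\<close>, and a translation by \<open>y\<close>
   under \<open>M\<close> turns \<open>Q\<close> into its reflection.\<close>
 also have "... = (\<integral>\<^sup>+y. (\<integral>\<^sup>+x. indicator Q y * indicator B (y + x) \<partial>M) \<partial>N)"
 proof (rule nn_integral_cong_AE, use EN in eventually_elim)
  fix y assume y: "y \<in> E"
  have "(\<integral>\<^sup>+x. indicator Q y * indicator B (y + x) \<partial>M) = (\<integral>\<^sup>+x. indicator Q y * indicator B x \<partial>M)"
   by (rule shM[OF y]) measurable
  also have "... = indicator Q y * emeasure M B"
   by (subst nn_integral_cmult_indicator) (auto simp: sM)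
  finally show "emeasure M B * indicator Q y = (\<integral>\<^sup>+x. indicator Q y * indicator B (y + x) \<partial>M)"
   by (simp add: mult.commute)
 qed
 also have "... = (\<integral>\<^sup>+x. (\<integral>\<^sup>+y. indicator Q y * indicator B (y + x) \<partial>N) \<partial>M)"
  by (rule P.Fubini') measurable
 also have "... = (\<integral>\<^sup>+x. (\<integral>\<^sup>+y. indicator Q (y - x) * indicator B y \<partial>N) \<partial>M)"
 proof (rule nn_integral_cong_AE, use EM in eventually_elim)
  fix x assume x: "x \<in> E"
  have "(\<integral>\<^sup>+y. indicator Q ((x + y) - x) * indicator B (x + y) \<partial>N) = (\<integral>\<^sup>+y. indicator Q (y - x) * indicator B y \<partial>N)"
   by (rule shN[OF x]) measurable
  thus "(\<integral>\<^sup>+y. indicator Q y * indicator B (y + x) \<partial>N) = (\<integral>\<^sup>+y. indicator Q (y - x) * indicator B y \<partial>N)"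
   by (simp add: add.commute)
 qed
 also have "... = (\<integral>\<^sup>+y. (\<integral>\<^sup>+x. indicator Q (y - x) * indicator B y \<partial>M) \<partial>N)"
  by (rule P.Fubini'[symmetric]) measurable
 also have "... = (\<integral>\<^sup>+y. emeasure M (uminus -` Q) * indicator B y \<partial>N)"
 proof (rule nn_integral_cong_AE, use EN in eventually_elim)
  fix y assume y: "y \<in> E"
  have "(\<integral>\<^sup>+x. indicator Q (y - x) * indicator B y \<partial>M) = (\<integral>\<^sup>+x. indicator Q (y - (y + x)) * indicator B y \<partial>M)"
   by (rule shM[OF y, symmetric]) measurable
  also have "... = (\<integral>\<^sup>+x. indicator B y * indicator (uminus -` Q) x \<partial>M)"
   by (intro nn_integral_cong) (auto simp: indicator_def)
  also have "... = indicator B y * emeasure M (uminus -` Q)"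
   by (subst nn_integral_cmult_indicator) (auto simp: sM)
  finally show "(\<integral>\<^sup>+x. indicator Q (y - x) * indicator B y \<partial>M) = emeasure M (uminus -` Q) * indicator B y"
   by (simp add: mult.commute)
 qed
 also have "... = emeasure M (uminus -` Q) * emeasure N B"
  by (subst nn_integral_cmult_indicator) (auto simp: sN)
 finally show ?thesis .
qed

lemma orthogonal_transformation_measurable:
 fixes T :: "'a::euclidean_space \<Rightarrow> 'a"
 assumes "orthogonal_transformation T"
 shows "T \<in> borel_measurable borel"
 using assms linear_continuous_on[of T UNIV]
 by (intro borel_measurable_continuous_onI)
  (auto simp: orthogonal_transformation_linear linear_conv_bounded_linear[symmetric])

text \<open>Since \<open>T\<close> is onto, the image of Lebesgue measure is again invariant under
  all translations, hence proportional to it. The unit ball equals its preimage under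
  \<open>T\<close> and its own reflection, so the factor is 1.\<close>

lemma distr_lborel_orthogonal:
 fixes T :: "'a::euclidean_space \<Rightarrow> 'a"
 assumes T: "orthogonal_transformation T"
 shows "distr lborel borel T = lborel"
proof (rule measure_eqI)
 note [measurable] = orthogonal_transformation_measurable[OF T]
 have pre: "T -` cball 0 r = cball 0 r" "T -` ball 0 r = ball 0 r" for r
  using orthogonal_transformation_norm[OF T] by auto
 fix B :: "'a set" assume "B \<in> sets (distr lborel borel T)"
 hence B: "B \<in> sets borel" by simp
 let ?M = "distr lborel borel T" and ?Q = "cball (0::'a) 1"
 have sfM: "sigma_finite_measure ?M"
 proof (rule sigma_finite_measure_balls)
  show "emeasure ?M (ball 0 (real R)) < \<infinity>" for R
   using emeasure_lborel_ball_finite[of "0::'a" "real R"] by (simp add: emeasure_distr pre)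
 qed simp
 have tM: "distr ?M borel ((+) x) = ?M" for x
 proof -
  obtain y where y: "T y = x" using orthogonal_transformation_surj[OF T] by (metis surjD)
  have "distr ?M borel ((+) x) = distr lborel borel (%z. x + T z)"
   by (subst distr_distr) (auto simp: comp_def)
  also have "(%z. x + T z) = (%z. T (y + z))"
   using orthogonal_transformation_linear[OF T] y by (auto simp: linear_add)
  also have "distr lborel borel (%z. T (y + z)) = distr (distr lborel borel ((+) y)) borel T"
   by (subst distr_distr) (auto simp: comp_def)
  finally show ?thesis by (simp only: lborel_distr_plus)
 qed
 have "emeasure ?M B * emeasure lborel ?Q = emeasure ?M (uminus -` ?Q) * emeasure lborel B"
  by (rule translation_invariant_proportional[where E=UNIV, OF _ _ sfM])
   (use B tM in \<open>auto simp: lborel_distr_plus intro: lborel.sigma_finite_measure_axioms\<close>)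
 moreover have "uminus -` ?Q = ?Q" by auto
 moreover have "emeasure ?M ?Q = emeasure lborel ?Q" by (simp add: emeasure_distr pre)
 moreover have "emeasure lborel ?Q \<noteq> 0" "emeasure lborel ?Q \<noteq> \<infinity>"
  by (simp_all add: emeasure_cball less_imp_neq[symmetric])
 ultimately show "emeasure ?M B = emeasure lborel B"
  by (simp add: mult.commute[of _ "emeasure lborel ?Q"] ennreal_mult_cancel_left)
qed simp

definition proj :: "'a::euclidean_space \<Rightarrow> 'a \<Rightarrow> 'a" where
 "proj \<nu> y = y - (y \<bullet> \<nu>) *\<^sub>R \<nu>"

text \<open>For a unit vector \<open>\<nu>\<close>, this is Lebesgue measure of the hyperplane orthogonal to \<open>\<nu>\<close>,
 as a measure on the ambient space.\<close>

definition plane_meas :: "'a::euclidean_space \<Rightarrow> 'a measure" where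
 "plane_meas \<nu> =
  distr (density lborel (indicator {y. 0 \<le> y \<bullet> \<nu> \<and> y \<bullet> \<nu> \<le> 1})) borel (proj \<nu>)"

lemma proj_measurable [measurable]: "proj \<nu> \<in> borel_measurable borel"
 unfolding proj_def by measurable

lemma proj_inner: "norm \<nu> = 1 ==> proj \<nu> y \<bullet> \<nu> = 0"
 by (simp add: proj_def inner_diff_left norm_eq_1)

lemma proj_linear: "linear (proj \<nu>)"
 unfolding proj_def by (rule linearI) (auto simp: algebra_simps inner_add_left)

lemma proj_id: "y \<bullet> \<nu> = 0 ==> proj \<nu> y = y"
 by (simp add: proj_def)

lemma proj_norm: "norm \<nu> = 1 ==> (norm (proj \<nu> y))\<^sup>2 = (norm y)\<^sup>2 - (y \<bullet> \<nu>)\<^sup>2"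
 unfolding proj_def power2_norm_eq_inner
 by (simp add: norm_eq_1 algebra_simps inner_commute power2_eq_square)

lemma proj_norm_le: "norm \<nu> = 1 ==> norm (proj \<nu> y) \<le> norm y"
proof (rule power2_le_imp_le)
 assume "norm \<nu> = 1"
 thus "(norm (proj \<nu> y))\<^sup>2 \<le> (norm y)\<^sup>2" using proj_norm[of \<nu> y] by simp
qed simp

lemma sets_plane_meas [simp, measurable_cong]: "sets (plane_meas \<nu>) = sets borel"
 by (simp add: plane_meas_def)

lemma space_plane_meas [simp]: "space (plane_meas \<nu>) = UNIV"
 by (simp add: plane_meas_def)

lemma nn_integral_hyperplane:
 assumes [measurable]: "f \<in> borel_measurable borel"
 shows "(\<integral>\<^sup>+y. f y \<partial>plane_meas \<nu>) =
  (\<integral>\<^sup>+y. indicator {y. 0 \<le> y \<bullet> \<nu> \<and> y \<bullet> \<nu> \<le> 1} y * f (proj \<nu> y) \<partial>lborel)"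
 unfolding plane_meas_def by (subst nn_integral_distr) (auto simp: nn_integral_density)

lemma emeasure_plane_meas:
 assumes "B \<in> sets borel"
 shows "emeasure (plane_meas \<nu>) B =
  emeasure lborel {y. 0 \<le> y \<bullet> \<nu> \<and> y \<bullet> \<nu> \<le> 1 \<and> proj \<nu> y \<in> B}"
proof -
 note [measurable] = assms
 have "emeasure (plane_meas \<nu>) B = (\<integral>\<^sup>+y. indicator B y \<partial>plane_meas \<nu>)"
  using assms by (simp add: nn_integral_indicator)
 also have "... = (\<integral>\<^sup>+y. indicator {y. 0 \<le> y \<bullet> \<nu> \<and> y \<bullet> \<nu> \<le> 1 \<and> proj \<nu> y \<in> B} y \<partial>lborel)"
  by (subst nn_integral_hyperplane, measurable, rule nn_integral_cong, simp add: indicator_def)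
 also have "... = emeasure lborel {y. 0 \<le> y \<bullet> \<nu> \<and> y \<bullet> \<nu> \<le> 1 \<and> proj \<nu> y \<in> B}"
  by (rule nn_integral_indicator) measurable
 finally show ?thesis .
qed

lemma AE_plane_meas: "norm \<nu> = 1 ==> AE y in plane_meas \<nu>. y \<bullet> \<nu> = 0"
 unfolding plane_meas_def by (subst AE_distr_iff) (auto simp: proj_inner)

lemma plane_meas_shift:
 assumes "x \<bullet> \<nu> = 0"
 shows "distr (plane_meas \<nu>) borel ((+) x) = plane_meas \<nu>"
proof (rule measure_eqI)
 fix B assume "B \<in> sets (distr (plane_meas \<nu>) borel ((+) x))"
 hence B[measurable]: "B \<in> sets borel" by simp
 have "emeasure (distr (plane_meas \<nu>) borel ((+) x)) B = (\<integral>\<^sup>+y. indicator B (x + y) \<partial>plane_meas \<nu>)"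
  by (subst nn_integral_distr[symmetric, of _ _ borel]) auto
 also have "... = (\<integral>\<^sup>+y. indicator {y. 0 \<le> y \<bullet> \<nu> \<and> y \<bullet> \<nu> \<le> 1} (x + y) * indicator B (proj \<nu> (x + y)) \<partial>lborel)"
  using assms by (subst nn_integral_hyperplane)
   (auto intro!: nn_integral_cong simp: indicator_def inner_add_left proj_def add_diff_eq)
 also have "... = (\<integral>\<^sup>+y. indicator {y. 0 \<le> y \<bullet> \<nu> \<and> y \<bullet> \<nu> \<le> 1} y * indicator B (proj \<nu> y) \<partial>lborel)"
  by (rule nn_integral_lborel_shift) measurable
 also have "... = (\<integral>\<^sup>+y. indicator B y \<partial>plane_meas \<nu>)"
  by (rule nn_integral_hyperplane[symmetric]) measurable
 also have "... = emeasure (plane_meas \<nu>) B" by (rule nn_integral_indicator) simp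
 finally show "emeasure (distr (plane_meas \<nu>) borel ((+) x)) B = emeasure (plane_meas \<nu>) B" .
qed simp

lemma plane_meas_bounded_finite:
 fixes \<nu> :: "'a::euclidean_space"
 assumes "norm \<nu> = 1" "B \<in> sets borel" "bounded B"
 shows "emeasure (plane_meas \<nu>) B < \<infinity>"
proof -
 obtain R where R: "\<And>x. x \<in> B ==> norm x \<le> R" using assms(3) bounded_iff by blast
 have "{y. 0 \<le> y \<bullet> \<nu> \<and> y \<bullet> \<nu> \<le> 1 \<and> proj \<nu> y \<in> B} \<subseteq> cball 0 (R + 1)"
 proof
  fix y assume y: "y \<in> {y. 0 \<le> y \<bullet> \<nu> \<and> y \<bullet> \<nu> \<le> 1 \<and> proj \<nu> y \<in> B}"
  have "y = proj \<nu> y + (y \<bullet> \<nu>) *\<^sub>R \<nu>" by (simp add: proj_def)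
  hence "norm y \<le> norm (proj \<nu> y) + norm ((y \<bullet> \<nu>) *\<^sub>R \<nu>)" by (metis norm_triangle_ineq)
  also have "... \<le> R + 1" using y R[of "proj \<nu> y"] assms(1) by auto
  finally show "y \<in> cball 0 (R + 1)" by simp
 qed
 hence "emeasure (plane_meas \<nu>) B \<le> emeasure lborel (cball (0::'a) (R + 1))"
  unfolding emeasure_plane_meas[OF assms(2)] by (rule emeasure_mono) simp
 also have "... < \<infinity>" by (rule emeasure_lborel_cball_finite)
 finally show ?thesis .
qed

lemma sigma_finite_plane_meas: "norm \<nu> = 1 ==> sigma_finite_measure (plane_meas \<nu>)"
 by (rule sigma_finite_measure_balls, simp, rule plane_meas_bounded_finite) simp_all

lemma plane_meas_orthogonal:
 fixes T :: "'a::euclidean_space \<Rightarrow> 'a"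
 assumes T: "orthogonal_transformation T" and B: "B \<in> sets borel"
 shows "emeasure (plane_meas (T \<nu>)) B = emeasure (plane_meas \<nu>) (T -` B)"
proof -
 note [measurable] = orthogonal_transformation_measurable[OF T] B
 have inn: "T x \<bullet> T y = x \<bullet> y" for x y using T by (simp add: orthogonal_transformation_def)
 have pr: "proj (T \<nu>) (T y) = T (proj \<nu> y)" for y
  using orthogonal_transformation_linear[OF T] by (simp add: proj_def inn linear_diff linear_scale)
 let ?S = "{y. 0 \<le> y \<bullet> T \<nu> \<and> y \<bullet> T \<nu> \<le> 1 \<and> proj (T \<nu>) y \<in> B}"
 have S[measurable]: "?S \<in> sets borel" by measurable
 have vB: "T -` B \<in> sets borel"
  using measurable_sets_borel[OF orthogonal_transformation_measurable[OF T] B] by simp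
 have "emeasure (plane_meas (T \<nu>)) B = emeasure (distr lborel borel T) ?S"
  using B by (simp add: emeasure_plane_meas distr_lborel_orthogonal[OF T])
 also have "... = emeasure lborel (T -` ?S)" by (subst emeasure_distr) auto
 also have "T -` ?S = {y. 0 \<le> y \<bullet> \<nu> \<and> y \<bullet> \<nu> \<le> 1 \<and> proj \<nu> y \<in> T -` B}"
  by (auto simp: inn pr)
 finally show ?thesis using vB by (simp add: emeasure_plane_meas)
qed

text \<open>Fubini along the direction \<open>\<nu>\<close> without coordinates. Recentring each
  line at a point of the unit slab replaces the projection by a shift of the parameter; after
  exchanging the integrals, a point \<open>z\<close> is counted for those \<open>t\<close> that put
  z - t \<nu> into the slab, an interval of length 1.\<close>

lemma nn_integral_lines:
 fixes \<nu> :: "'a::euclidean_space"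
 assumes \<nu>: "norm \<nu> = 1" and [measurable]: "F \<in> borel_measurable borel"
 shows "(\<integral>\<^sup>+y. (\<integral>\<^sup>+s. F (y + s *\<^sub>R \<nu>) \<partial>lborel) \<partial>plane_meas \<nu>) = (\<integral>\<^sup>+x. F x \<partial>lborel)"
proof -
 let ?S = "{y. 0 \<le> y \<bullet> \<nu> \<and> y \<bullet> \<nu> \<le> 1}"
 have "(\<integral>\<^sup>+y. (\<integral>\<^sup>+s. F (y + s *\<^sub>R \<nu>) \<partial>lborel) \<partial>plane_meas \<nu>) =
   (\<integral>\<^sup>+y. indicator ?S y * (\<integral>\<^sup>+s. F (proj \<nu> y + s *\<^sub>R \<nu>) \<partial>lborel) \<partial>lborel)"
  by (rule nn_integral_hyperplane) measurable
 also have "... = (\<integral>\<^sup>+y. (\<integral>\<^sup>+t. indicator ?S y * F (y + t *\<^sub>R \<nu>) \<partial>lborel) \<partial>lborel)"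
 proof (rule nn_integral_cong)
  fix y :: 'a
  have "(\<integral>\<^sup>+s. F (proj \<nu> y + s *\<^sub>R \<nu>) \<partial>lborel) = (\<integral>\<^sup>+t. F (proj \<nu> y + (y \<bullet> \<nu> + t) *\<^sub>R \<nu>) \<partial>lborel)"
   by (rule nn_integral_lborel_shift[symmetric]) measurable
  also have "(%t. F (proj \<nu> y + (y \<bullet> \<nu> + t) *\<^sub>R \<nu>)) = (%t. F (y + t *\<^sub>R \<nu>))"
   by (simp add: proj_def algebra_simps)
  finally show "indicator ?S y * (\<integral>\<^sup>+s. F (proj \<nu> y + s *\<^sub>R \<nu>) \<partial>lborel) =
    (\<integral>\<^sup>+t. indicator ?S y * F (y + t *\<^sub>R \<nu>) \<partial>lborel)"
   by (simp add: nn_integral_cmult)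
 qed
 also have "... = (\<integral>\<^sup>+t. (\<integral>\<^sup>+y. indicator ?S y * F (y + t *\<^sub>R \<nu>) \<partial>lborel) \<partial>lborel)"
  by (rule lborel_pair.Fubini'[symmetric]) measurable
 also have "... = (\<integral>\<^sup>+t. (\<integral>\<^sup>+z. indicator {0..1} (z \<bullet> \<nu> - t) * F z \<partial>lborel) \<partial>lborel)"
 proof (rule nn_integral_cong)
  fix t :: real
  have "(\<integral>\<^sup>+y. indicator {0..1} ((t *\<^sub>R \<nu> + y) \<bullet> \<nu> - t) * F (t *\<^sub>R \<nu> + y) \<partial>lborel) =
   (\<integral>\<^sup>+z. indicator {0..1} (z \<bullet> \<nu> - t) * F z \<partial>lborel)"
   by (rule nn_integral_lborel_shift) measurable
  moreover have "indicator {0..1} ((t *\<^sub>R \<nu> + y) \<bullet> \<nu> - t) = (indicator ?S y :: ennreal)" for y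
   using \<nu> by (auto simp: indicator_def inner_add_left norm_eq_1)
  ultimately show "(\<integral>\<^sup>+y. indicator ?S y * F (y + t *\<^sub>R \<nu>) \<partial>lborel) = (\<integral>\<^sup>+z. indicator {0..1} (z \<bullet> \<nu> - t) * F z \<partial>lborel)"
   by (simp add: add.commute)
 qed
 also have "... = (\<integral>\<^sup>+z. (\<integral>\<^sup>+t. indicator {0..1} (z \<bullet> \<nu> - t) * F z \<partial>lborel) \<partial>lborel)"
  by (rule lborel_pair.Fubini') measurable
 also have "... = (\<integral>\<^sup>+z. F z \<partial>lborel)"
 proof (rule nn_integral_cong)
  fix z :: 'a
  have "(\<integral>\<^sup>+t. indicator {0..1} (z \<bullet> \<nu> - t) * F z \<partial>lborel) = (\<integral>\<^sup>+t. F z * indicator {z \<bullet> \<nu> - 1..z \<bullet> \<nu>} t \<partial>lborel)"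
   by (rule nn_integral_cong) (auto simp: indicator_def)
  also have "... = F z" by (subst nn_integral_cmult_indicator) auto
  finally show "(\<integral>\<^sup>+t. indicator {0..1} (z \<bullet> \<nu> - t) * F z \<partial>lborel) = F z" .
 qed
 finally show ?thesis .
qed

lemma lborel_eq_distr_lines:
 fixes \<nu> :: "'a::euclidean_space"
 assumes \<nu>: "norm \<nu> = 1"
 shows "distr (plane_meas \<nu> \<Otimes>\<^sub>M lborel) borel (%(y, s). y + s *\<^sub>R \<nu>) = lborel"
proof (rule measure_eqI)
 fix B :: "'a set" assume "B \<in> sets (distr (plane_meas \<nu> \<Otimes>\<^sub>M lborel) borel (%(y, s). y + s *\<^sub>R \<nu>))"
 hence B[measurable]: "B \<in> sets borel" by simp
 have "emeasure (distr (plane_meas \<nu> \<Otimes>\<^sub>M lborel) borel (%(y, s). y + s *\<^sub>R \<nu>)) B =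
  (\<integral>\<^sup>+z. indicator B ((%(y, s). y + s *\<^sub>R \<nu>) z) \<partial>(plane_meas \<nu> \<Otimes>\<^sub>M lborel))"
  by (subst nn_integral_distr[symmetric, of _ _ borel]) auto
 also have "... = (\<integral>\<^sup>+y. (\<integral>\<^sup>+s. indicator B (y + s *\<^sub>R \<nu>) \<partial>lborel) \<partial>plane_meas \<nu>)"
  by (subst lborel.nn_integral_fst[symmetric]) auto
 also have "... = (\<integral>\<^sup>+x. indicator B x \<partial>lborel)" by (rule nn_integral_lines[OF \<nu>]) measurable
 also have "... = emeasure lborel B" by (rule nn_integral_indicator) simp
 finally show "emeasure (distr (plane_meas \<nu> \<Otimes>\<^sub>M lborel) borel (%(y, s). y + s *\<^sub>R \<nu>)) B = emeasure lborel B" .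
qed simp

lemma integral_lines:
 fixes \<nu> :: "'a::euclidean_space" and f :: "'a \<Rightarrow> real"
 assumes \<nu>: "norm \<nu> = 1" and f: "integrable lborel f"
 shows "(LINT y|plane_meas \<nu>. (LINT s|lborel. f (y + s *\<^sub>R \<nu>))) = (LINT x|lborel. f x)"
proof -
 interpret H: sigma_finite_measure "plane_meas \<nu>" by (rule sigma_finite_plane_meas[OF \<nu>])
 interpret P: pair_sigma_finite "plane_meas \<nu>" "lborel :: real measure" ..
 have [measurable]: "f \<in> borel_measurable borel" using f by auto
 let ?g = "%(y, s). y + s *\<^sub>R \<nu>"
 have "integrable (distr (plane_meas \<nu> \<Otimes>\<^sub>M lborel) borel ?g) f"
  unfolding lborel_eq_distr_lines[OF \<nu>] by fact
 hence i: "integrable (plane_meas \<nu> \<Otimes>\<^sub>M lborel) (%z. f (?g z))"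
  by (subst (asm) integrable_distr_eq) auto
 have "(LINT x|lborel. f x) = (LINT x|distr (plane_meas \<nu> \<Otimes>\<^sub>M lborel) borel ?g. f x)"
  unfolding lborel_eq_distr_lines[OF \<nu>] ..
 also have "... = (LINT z|(plane_meas \<nu> \<Otimes>\<^sub>M lborel). f (?g z))" by (rule integral_distr) auto
 also have "... = (LINT y|plane_meas \<nu>. (LINT s|lborel. f (?g (y, s))))"
  using P.integral_fst'[OF i] by simp
 finally show ?thesis by simp
qed

section \<open>Hausdorff outer measure and measurability of Borel sets\<close>

abbreviation hausdorff_size :: "nat \<Rightarrow> 'a::metric_space set \<Rightarrow> ennreal" where
 "hausdorff_size d C \<equiv> ennreal (unit_ball_vol (real d) * (diameter C / 2) ^ d)"

lemma hausdorff_premeasure_le: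
 assumes "A \<subseteq> (\<Union>i. C i)" "\<And>i. bounded (C i)" "\<And>i. diameter (C i) \<le> \<delta>"
 shows "hausdorff_premeasure d \<delta> A \<le> (\<Sum>i. hausdorff_size d (C i))"
 unfolding hausdorff_premeasure_def by (rule INF_lower) (use assms in auto)

lemma hausdorff_premeasure_approx:
 assumes "hausdorff_premeasure d \<delta> A \<noteq> \<infinity>" "0 < e"
 obtains C where "A \<subseteq> (\<Union>i. C i)" "\<And>i. bounded (C i)" "\<And>i. diameter (C i) \<le> \<delta>"
  "(\<Sum>i. hausdorff_size d (C i)) \<le> hausdorff_premeasure d \<delta> A + ennreal e"
proof -
 obtain C where "C \<in> {C :: nat \<Rightarrow> _. A \<subseteq> (\<Union>i. C i) \<and> (\<forall>i. bounded (C i) \<and> diameter (C i) \<le> \<delta>)}"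
  "(\<Sum>i. hausdorff_size d (C i)) < hausdorff_premeasure d \<delta> A + ennreal e"
  using INF_approx_ennreal[OF assms(2) hausdorff_premeasure_def assms(1)] by blast
 thus ?thesis by (intro that[of C]) auto
qed

lemma hausdorff_premeasure_mono: "A \<subseteq> B ==> hausdorff_premeasure d \<delta> A \<le> hausdorff_premeasure d \<delta> B"
 unfolding hausdorff_premeasure_def by (rule INF_superset_mono) auto

lemma hausdorff_premeasure_antimono: "\<delta> \<le> \<delta>' ==> hausdorff_premeasure d \<delta>' A \<le> hausdorff_premeasure d \<delta> A"
 unfolding hausdorff_premeasure_def by (rule INF_superset_mono) (auto intro: order_trans)

lemma hausdorff_premeasure_le_outer: "0 < \<delta> ==> hausdorff_premeasure d \<delta> A \<le> hausdorff_outer_measure d A"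
 unfolding hausdorff_outer_measure_def by (rule SUP_upper) simp

lemma hausdorff_outer_measure_mono: "A \<subseteq> B ==> hausdorff_outer_measure d A \<le> hausdorff_outer_measure d B"
 unfolding hausdorff_outer_measure_def by (rule SUP_mono) (blast intro: hausdorff_premeasure_mono)

lemma hausdorff_outer_measure_empty: "1 \<le> d ==> hausdorff_outer_measure d {} = 0"
proof -
 assume d: "1 \<le> d"
 have "hausdorff_premeasure d \<delta> {} \<le> 0" if "0 < \<delta>" for \<delta>
  using hausdorff_premeasure_le[of "{}" "%_. {}" \<delta> d] that d by (simp add: power_0_left)
 thus ?thesis unfolding hausdorff_outer_measure_def by (intro antisym SUP_least) auto
qed

lemma hausdorff_premeasure_subadditive:
 "hausdorff_premeasure d \<delta> (\<Union>i. A i) \<le> (\<Sum>i. hausdorff_premeasure d \<delta> (A i))"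
proof (rule ennreal_le_epsilon)
 fix e :: real assume e: "0 < e" and fin: "(\<Sum>n. hausdorff_premeasure d \<delta> (A n)) < top"
 have "hausdorff_premeasure d \<delta> (A n) \<noteq> \<infinity>" for n
  using ennreal_suminf_lessD[OF fin, of n] by simp
 hence "\<exists>C. A n \<subseteq> (\<Union>i. C i) \<and> (\<forall>i. bounded (C i)) \<and> (\<forall>i. diameter (C i) \<le> \<delta>) \<and>
  (\<Sum>i. hausdorff_size d (C i)) \<le> hausdorff_premeasure d \<delta> (A n) + ennreal (e * (1/2)^Suc n)" for n
  using hausdorff_premeasure_approx[of d \<delta> "A n" "e * (1/2)^Suc n"] e by (metis mult_pos_pos zero_less_power half_gt_zero zero_less_one)
 then obtain B where B: "\<And>n. A n \<subseteq> (\<Union>i. B n i)" "\<And>n i. bounded (B n i)" "\<And>n i. diameter (B n i) \<le> \<delta>"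
  and Ble: "\<And>n. (\<Sum>i. hausdorff_size d (B n i)) \<le> hausdorff_premeasure d \<delta> (A n) + ennreal (e * (1/2)^Suc n)"
  by metis
 define C where "C = case_prod B o prod_decode"
 have sub: "(\<Union>i. A i) \<subseteq> (\<Union>i. C i)"
 proof
  fix x assume "x \<in> (\<Union>i. A i)"
  then obtain n i where "x \<in> B n i" using B(1) by blast
  hence "x \<in> C (prod_encode (n, i))" by (simp add: C_def)
  thus "x \<in> (\<Union>i. C i)" by blast
 qed
 have "hausdorff_premeasure d \<delta> (\<Union>i. A i) \<le> (\<Sum>i. hausdorff_size d (C i))"
  by (rule hausdorff_premeasure_le[OF sub]) (auto simp: C_def B split: prod.split)
 also have "... = (\<Sum>n. \<Sum>i. hausdorff_size d (B n i))"
  unfolding C_def comp_def by (rule suminf_ennreal_2dimen[where f="%p. hausdorff_size d (case_prod B p)"]) simp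
 also have "... \<le> (\<Sum>n. hausdorff_premeasure d \<delta> (A n) + ennreal (e * (1/2) ^ Suc n))"
  by (intro suminf_le allI Ble) auto
 also have "... = (\<Sum>n. hausdorff_premeasure d \<delta> (A n)) + (\<Sum>n. ennreal (e * (1/2) ^ Suc n))"
  by (rule suminf_add[symmetric]) auto
 also have "(\<Sum>n. ennreal (e * (1/2) ^ Suc n)) = ennreal e"
  using sums_mult[OF power_half_series, of e] e by (intro suminf_ennreal_eq) auto
 finally show "hausdorff_premeasure d \<delta> (\<Union>i. A i) \<le> (\<Sum>i. hausdorff_premeasure d \<delta> (A i)) + ennreal e" .
qed

lemma hausdorff_outer_measure_subadditive:
 "hausdorff_outer_measure d (\<Union>i. A i) \<le> (\<Sum>i. hausdorff_outer_measure d (A i))"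
proof -
 have "hausdorff_premeasure d \<delta> (\<Union>i. A i) \<le> (\<Sum>i. hausdorff_outer_measure d (A i))" if "0 < \<delta>" for \<delta>
  by (rule order_trans[OF hausdorff_premeasure_subadditive suminf_le])
   (auto intro: hausdorff_premeasure_le_outer that)
 thus ?thesis unfolding hausdorff_outer_measure_def[of d "\<Union>i. A i"] by (intro SUP_least) auto
qed

lemma hausdorff_outer_measure_subadditive2:
 assumes "1 \<le> d"
 shows "hausdorff_outer_measure d (A \<union> B) \<le> hausdorff_outer_measure d A + hausdorff_outer_measure d B"
proof -
 have "hausdorff_outer_measure d (\<Union>i. binaryset A B i) \<le> (\<Sum>i. hausdorff_outer_measure d (binaryset A B i))"
  by (rule hausdorff_outer_measure_subadditive)
 also have "... = hausdorff_outer_measure d A + hausdorff_outer_measure d B"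
  by (rule suminf_binaryset_eq) (simp add: hausdorff_outer_measure_empty[OF assms])
 finally show ?thesis by (simp add: UN_binaryset_eq)
qed

text \<open>A covering set of diameter below \<open>r\<close> meets at most one of \<open>A\<close>
  and \<open>B\<close>, so every fine cover of the union splits into a cover of each.\<close>

lemma hausdorff_outer_measure_separated:
 fixes A B :: "'a::metric_space set"
 assumes d: "1 \<le> d" and r: "0 < r" "\<And>x y. x \<in> A ==> y \<in> B ==> r \<le> dist x y"
 shows "hausdorff_outer_measure d A + hausdorff_outer_measure d B \<le> hausdorff_outer_measure d (A \<union> B)"
proof -
 have small: "hausdorff_premeasure d \<delta> A + hausdorff_premeasure d \<delta> B \<le> hausdorff_premeasure d \<delta> (A \<union> B)"
  if \<delta>: "0 < \<delta>" "\<delta> < r" for \<delta>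
  unfolding hausdorff_premeasure_def[of d \<delta> "A \<union> B"]
 proof (rule INF_greatest)
  fix C :: "nat \<Rightarrow> 'a set"
  assume "C \<in> {C. A \<union> B \<subseteq> (\<Union>i. C i) \<and> (\<forall>i. bounded (C i) \<and> diameter (C i) \<le> \<delta>)}"
  hence C: "A \<union> B \<subseteq> (\<Union>i. C i)" "\<And>i. bounded (C i)" "\<And>i. diameter (C i) \<le> \<delta>" by auto
  define CA where "CA i = (if C i \<inter> A = {} then {} else C i)" for i
  define CB where "CB i = (if C i \<inter> B = {} then {} else C i)" for i
  have "hausdorff_premeasure d \<delta> A \<le> (\<Sum>i. hausdorff_size d (CA i))"
   by (rule hausdorff_premeasure_le) (use C \<delta> in \<open>auto simp: CA_def, blast\<close>)
  moreover have "hausdorff_premeasure d \<delta> B \<le> (\<Sum>i. hausdorff_size d (CB i))"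
   by (rule hausdorff_premeasure_le) (use C \<delta> in \<open>auto simp: CB_def, blast\<close>)
  ultimately have "hausdorff_premeasure d \<delta> A + hausdorff_premeasure d \<delta> B
    \<le> (\<Sum>i. hausdorff_size d (CA i)) + (\<Sum>i. hausdorff_size d (CB i))" by (rule add_mono)
  also have "... = (\<Sum>i. hausdorff_size d (CA i) + hausdorff_size d (CB i))"
   by (rule suminf_add) auto
  also have "... \<le> (\<Sum>i. hausdorff_size d (C i))"
  proof (rule suminf_le)
   fix i
   have "C i \<inter> A = {} \<or> C i \<inter> B = {}"
   proof (rule ccontr)
    assume "\<not> ?thesis"
    then obtain x y where xy: "x \<in> C i" "x \<in> A" "y \<in> C i" "y \<in> B" by blast
    have "r \<le> dist x y" using r xy by blast
    also have "... \<le> \<delta>" using diameter_bounded_bound[OF C(2) xy(1,3)] C(3)[of i] by simp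
    finally show False using \<delta> by simp
   qed
   thus "hausdorff_size d (CA i) + hausdorff_size d (CB i) \<le> hausdorff_size d (C i)"
    using d by (auto simp: CA_def CB_def power_0_left)
  qed auto
  finally show "hausdorff_premeasure d \<delta> A + hausdorff_premeasure d \<delta> B \<le> (\<Sum>i. hausdorff_size d (C i))" .
 qed
 \<comment> \<open>Two scales, because each summand on the left is a supremum of its own; the common
   scale \<open>m\<close> is below both and below \<open>r\<close>.\<close>
 have "hausdorff_premeasure d \<delta> A + hausdorff_premeasure d \<delta>' B \<le> hausdorff_outer_measure d (A \<union> B)"
  if "0 < \<delta>" "0 < \<delta>'" for \<delta> \<delta>'
 proof -
  define m where "m = min (r / 2) (min \<delta> \<delta>')"
  have m: "0 < m" "m < r" "m \<le> \<delta>" "m \<le> \<delta>'" using r that by (auto simp: m_def)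
  have "hausdorff_premeasure d \<delta> A + hausdorff_premeasure d \<delta>' B \<le> hausdorff_premeasure d m A + hausdorff_premeasure d m B"
   by (intro add_mono hausdorff_premeasure_antimono m)
  also have "... \<le> hausdorff_premeasure d m (A \<union> B)" by (rule small[OF m(1,2)])
  also have "... \<le> hausdorff_outer_measure d (A \<union> B)" by (rule hausdorff_premeasure_le_outer[OF m(1)])
  finally show ?thesis .
 qed
 note * = this
 have ne: "{0<..} \<noteq> ({} :: real set)" by (simp add: greaterThan_non_empty)
 show ?thesis
  unfolding hausdorff_outer_measure_def[of d A] hausdorff_outer_measure_def[of d B]
  unfolding ennreal_SUP_add_left[OF ne, symmetric] ennreal_SUP_add_right[OF ne]
  by (intro SUP_least) (auto intro: *)
qed

text \<open>Caratheodory's criterion for metric outer measures. The part of \<open>A\<close> close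
  to \<open>F\<close> is cut into the shells \<open>D k\<close>. Shells of equal parity are
  separated, so the even and the odd ones each have total measure at most that of \<open>A\<close>,
  and the series over all shells converges. Replacing A - F by \<open>a k\<close>, which has
  positive distance from \<open>F\<close>, then costs only a tail of this series.\<close>

lemma closed_hausdorff_caratheodory:
 fixes F A :: "'a::metric_space set"
 assumes d: "1 \<le> d" and F: "closed F"
 shows "hausdorff_outer_measure d (F \<inter> A) + hausdorff_outer_measure d (A - F) \<le> hausdorff_outer_measure d A"
proof (cases "F = {} \<or> hausdorff_outer_measure d A = \<infinity>")
 case True
 thus ?thesis using hausdorff_outer_measure_empty[OF d] by auto
next
 case False
 let ?h = "hausdorff_outer_measure d"
 have Fne: "F \<noteq> {}" and fin: "?h A < top" using False by (auto simp: less_top)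
 define a where "a k = {x \<in> A - F. 1 / real (k + 1) \<le> infdist x F}" for k
 define D where "D k = a (Suc k) - a k" for k
 have sep: "?h X + ?h Y \<le> ?h (X \<union> Y)" if "\<And>x. x \<in> X ==> s \<le> infdist x F" "\<And>y. y \<in> Y ==> infdist y F \<le> t" "t < s" for X Y s t
 proof (rule hausdorff_outer_measure_separated[OF d, of "s - t"])
  show "0 < s - t" using that by simp
  fix x y assume xy: "x \<in> X" "y \<in> Y"
  show "s - t \<le> dist x y" using infdist_triangle[of x F y] that(1)[OF xy(1)] that(2)[OF xy(2)] by linarith
 qed
 \<comment> \<open>\<open>e\<close> is the parity, 0 for the even shells and 1 for the odd ones. The
   skipped shell between consecutive ones provides the gap.\<close>
 have part: "(\<Sum>j<N. ?h (D (2 * j + e))) \<le> ?h (\<Union>j<N. D (2 * j + e))" for N e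
 proof (induction N)
  case (Suc N)
  have "(\<Sum>j<Suc N. ?h (D (2 * j + e))) \<le> ?h (\<Union>j<N. D (2 * j + e)) + ?h (D (2 * N + e))"
   using Suc by (simp add: add_mono)
  also have "... \<le> ?h ((\<Union>j<N. D (2 * j + e)) \<union> D (2 * N + e))"
  proof (cases "2 * N + e = 0")
   case True
   thus ?thesis by (simp add: hausdorff_outer_measure_empty[OF d])
  next
   case pos: False
   show ?thesis
   proof (rule sep)
    fix x assume "x \<in> (\<Union>j<N. D (2 * j + e))"
    then obtain j where j: "j < N" "x \<in> D (2 * j + e)" by blast
    have "1 / real (2 * N + e) \<le> 1 / real (Suc (2 * j + e) + 1)"
     using j(1) by (intro divide_left_mono) auto
    also have "... \<le> infdist x F" using j(2) by (simp add: D_def a_def)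
    finally show "1 / real (2 * N + e) \<le> infdist x F" .
   next
    fix y assume "y \<in> D (2 * N + e)"
    thus "infdist y F \<le> 1 / real (2 * N + e + 1)" by (auto simp: D_def a_def)
   next
    show "1 / real (2 * N + e + 1) < 1 / real (2 * N + e)"
     using pos by (intro divide_strict_left_mono) auto
   qed
  qed
  also have "(\<Union>j<N. D (2 * j + e)) \<union> D (2 * N + e) = (\<Union>j<Suc N. D (2 * j + e))"
   by (auto simp: lessThan_Suc)
  finally show ?case .
 qed simp
 have "D k \<subseteq> A" for k by (auto simp: D_def a_def)
 hence part': "(\<Sum>j<N. ?h (D (2 * j + e))) \<le> ?h A" for N e
  by (intro order_trans[OF part] hausdorff_outer_measure_mono) blast
 have "(\<Sum>j<2 * N. ?h (D j)) = (\<Sum>j<N. ?h (D (2 * j + 0))) + (\<Sum>j<N. ?h (D (2 * j + 1)))" for N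
  by (induction N) (auto simp: algebra_simps)
 hence part2: "(\<Sum>j<2 * N. ?h (D j)) \<le> ?h A + ?h A" for N
  using add_mono[OF part'[of 0 N] part'[of 1 N]] by simp
 have "(\<Sum>j. ?h (D j)) \<le> ?h A + ?h A"
  unfolding suminf_eq_SUP
 proof (rule SUP_least)
  fix N
  have "(\<Sum>j<N. ?h (D j)) \<le> (\<Sum>j<2 * N. ?h (D j))" by (rule sum_mono2) auto
  thus "(\<Sum>j<N. ?h (D j)) \<le> ?h A + ?h A" using part2[of N] by (rule order_trans)
 qed
 hence sfin: "(\<Sum>j. ?h (D j)) < top" using fin by (meson ennreal_add_less_top le_less_trans)
 define b where "b j = enn2real (?h (D j))" for j
 have hb: "?h (D j) = ennreal (b j)" for j
  using ennreal_suminf_lessD[OF sfin, of j] by (simp add: b_def less_top)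
 have b0: "0 \<le> b j" for j by (simp add: b_def)
 have sb: "summable b"
  by (rule summable_suminf_not_top[OF b0]) (use sfin hb in simp)
 have bound: "?h (F \<inter> A) + ?h (A - F) \<le> ?h A + ennreal (\<Sum>j. b (j + k))" for k
 proof -
  have "A - F \<subseteq> a k \<union> (\<Union>j. D (j + k))"
  proof
   fix x assume x: "x \<in> A - F"
   hence "0 < infdist x F" using infdist_pos_not_in_closed[OF F Fne] by simp
   then obtain n where n: "1 / real (n + 1) < infdist x F" by (metis Suc_eq_plus1 nat_approx_posE)
   have ex: "x \<in> a n" using x n by (simp add: a_def)
   show "x \<in> a k \<union> (\<Union>j. D (j + k))"
   proof (rule ccontr)
    assume no: "x \<notin> a k \<union> (\<Union>j. D (j + k))"
    have "x \<notin> a (k + j)" for j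
    proof (induction j)
     case 0 thus ?case using no by simp
    next
     case (Suc j)
     have "x \<notin> D (j + k)" using no by blast
     thus ?case using Suc by (simp add: D_def add.commute)
    qed
    moreover have "a n \<subseteq> a (k + n)"
    proof
     fix z assume z: "z \<in> a n"
     have "1 / real (k + n + 1) \<le> 1 / real (n + 1)" by (intro divide_left_mono) auto
     thus "z \<in> a (k + n)" using z by (simp add: a_def)
    qed
    ultimately show False using ex by blast
   qed
  qed
  hence "?h (A - F) \<le> ?h (a k \<union> (\<Union>j. D (j + k)))" by (rule hausdorff_outer_measure_mono)
  also have "... \<le> ?h (a k) + ?h (\<Union>j. D (j + k))" by (rule hausdorff_outer_measure_subadditive2[OF d])
  also have "?h (\<Union>j. D (j + k)) \<le> (\<Sum>j. ?h (D (j + k)))" by (rule hausdorff_outer_measure_subadditive)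
  also have "(\<Sum>j. ?h (D (j + k))) = ennreal (\<Sum>j. b (j + k))"
   unfolding hb using b0 sb by (intro suminf_ennreal2) (simp_all add: summable_iff_shift)
  finally have 1: "?h (A - F) \<le> ?h (a k) + ennreal (\<Sum>j. b (j + k))" by (simp add: add_left_mono)
  have "?h (a k) + ?h (F \<inter> A) \<le> ?h (a k \<union> (F \<inter> A))"
   by (rule sep[of _ "1 / real (k + 1)" _ 0]) (auto simp: a_def)
  also have "... \<le> ?h A" by (rule hausdorff_outer_measure_mono) (auto simp: a_def)
  finally have 2: "?h (F \<inter> A) + ?h (a k) \<le> ?h A" by (simp add: add.commute)
  have "?h (F \<inter> A) + ?h (A - F) \<le> ?h (F \<inter> A) + (?h (a k) + ennreal (\<Sum>j. b (j + k)))"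
   by (rule add_left_mono[OF 1])
  also have "... \<le> ?h A + ennreal (\<Sum>j. b (j + k))"
   unfolding add.assoc[symmetric] by (rule add_right_mono[OF 2])
  finally show ?thesis .
 qed
 show ?thesis
 proof (rule ennreal_le_epsilon)
  fix e :: real assume "0 < e"
  then obtain k where "norm (\<Sum>i. b (i + k)) < e" using suminf_exist_split[OF _ sb] by blast
  hence "ennreal (\<Sum>i. b (i + k)) \<le> ennreal e" by (intro ennreal_leI) simp
  thus "?h (F \<inter> A) + ?h (A - F) \<le> ?h A + ennreal e"
   using bound[of k] by (meson add_left_mono order_trans)
 qed
qed

lemma measure_space_hausdorff:
 assumes d: "1 \<le> d"
 shows "measure_space (UNIV :: 'a::metric_space set) (sets borel) (hausdorff_outer_measure d)"
proof -
 let ?h = "hausdorff_outer_measure d :: 'a set \<Rightarrow> ennreal"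
 let ?L = "lambda_system UNIV UNIV ?h"
 have oms: "outer_measure_space UNIV ?h"
  unfolding outer_measure_space_def positive_def increasing_def countably_subadditive_def
  using hausdorff_outer_measure_empty[OF d] hausdorff_outer_measure_mono hausdorff_outer_measure_subadditive
  by blast
 interpret S: sigma_algebra "UNIV :: 'a set" UNIV using sigma_algebra_Pow[of UNIV] by simp
 have ms: "measure_space UNIV ?L ?h" by (rule S.caratheodory_lemma[OF oms])
 hence sa: "sigma_algebra UNIV ?L" by (simp add: measure_space_def)
 have "closed F ==> F \<in> ?L" for F
 proof -
  assume F: "closed F"
  have "?h (F \<inter> x) + ?h ((UNIV - F) \<inter> x) = ?h x" for x
  proof (rule antisym)
   have "(UNIV - F) \<inter> x = x - F" by auto
   thus "?h (F \<inter> x) + ?h ((UNIV - F) \<inter> x) \<le> ?h x"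
    using closed_hausdorff_caratheodory[OF d F, of x] by simp
   have "x = (F \<inter> x) \<union> ((UNIV - F) \<inter> x)" by auto
   thus "?h x \<le> ?h (F \<inter> x) + ?h ((UNIV - F) \<inter> x)"
    using hausdorff_outer_measure_subadditive2[OF d, of "F \<inter> x" "(UNIV - F) \<inter> x"] by simp
  qed
  thus "F \<in> ?L" by (simp add: lambda_system_def)
 qed
 hence "sigma_sets UNIV {F. closed F} \<subseteq> ?L" by (intro sigma_algebra.sigma_sets_subset[OF sa]) auto
 hence "sets borel \<subseteq> ?L" by (simp add: borel_eq_closed)
 thus ?thesis
  using sets.sigma_algebra_axioms[of "borel :: 'a measure"] by (intro measure_down[OF ms]) auto
qed

lemma sets_hausdorff_measure [simp, measurable_cong]: "sets (hausdorff_measure d) = sets borel"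
 unfolding hausdorff_measure_def using sets.sigma_sets_eq[of borel] by (subst sets_measure_of) auto

lemma space_hausdorff_measure [simp]: "space (hausdorff_measure d) = UNIV"
 by (simp add: hausdorff_measure_def space_measure_of_conv)

lemma emeasure_hausdorff_measure:
 assumes "1 \<le> d" "A \<in> sets borel"
 shows "emeasure (hausdorff_measure d) (A :: 'a::metric_space set) = hausdorff_outer_measure d A"
 using measure_space_hausdorff[OF assms(1), where 'a='a] assms(2)
 unfolding hausdorff_measure_def measure_space_def by (intro emeasure_measure_of_sigma) auto

text \<open>Covering sets are cut down to \<open>A\<close>, where the Lipschitz bound holds, and
  then mapped; the scale changes from \<open>\<delta>\<close> to \<open>L * \<delta>\<close>, which
  the supremum over scales absorbs.\<close>

lemma hausdorff_outer_measure_lipschitz: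
 fixes f :: "'a::real_normed_vector \<Rightarrow> 'b::real_normed_vector"
 assumes d: "1 \<le> d" and L: "0 < L" "\<And>x y. x \<in> A ==> y \<in> A ==> dist (f x) (f y) \<le> L * dist x y"
 shows "hausdorff_outer_measure d (f ` A) \<le> ennreal (L ^ d) * hausdorff_outer_measure d A"
proof -
 have pre: "ennreal (1 / L ^ d) * hausdorff_premeasure d (L * \<delta>) (f ` A) \<le> hausdorff_premeasure d \<delta> A"
  if \<delta>: "0 < \<delta>" for \<delta>
  unfolding hausdorff_premeasure_def[of d \<delta> A]
 proof (rule INF_greatest)
  fix C :: "nat \<Rightarrow> 'a set"
  assume "C \<in> {C. A \<subseteq> (\<Union>i. C i) \<and> (\<forall>i. bounded (C i) \<and> diameter (C i) \<le> \<delta>)}"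
  hence C: "A \<subseteq> (\<Union>i. C i)" "\<And>i. bounded (C i)" "\<And>i. diameter (C i) \<le> \<delta>" by auto
  have dd: "diameter (f ` (C i \<inter> A)) \<le> L * diameter (C i)" for i
  proof (rule diameter_le)
   show "f ` (C i \<inter> A) \<noteq> {} \<or> 0 \<le> L * diameter (C i)" using L C(2) by (simp add: diameter_ge_0)
   fix x y assume "x \<in> f ` (C i \<inter> A)" "y \<in> f ` (C i \<inter> A)"
   then obtain x' y' where *: "x = f x'" "y = f y'" "x' \<in> C i" "x' \<in> A" "y' \<in> C i" "y' \<in> A" by blast
   have "norm (x - y) \<le> L * dist x' y'" using L(2)[OF *(4,6)] * by (simp add: dist_norm)
   also have "... \<le> L * diameter (C i)"
    using diameter_bounded_bound[OF C(2) *(3,5)] L by (intro mult_left_mono) auto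
   finally show "norm (x - y) \<le> L * diameter (C i)" .
  qed
  have bd: "bounded (f ` (C i \<inter> A))" for i
  proof (cases "C i \<inter> A = {}")
   case False
   then obtain z where z: "z \<in> C i" "z \<in> A" by blast
   have "dist (f z) y \<le> L * diameter (C i)" if yin: "y \<in> f ` (C i \<inter> A)" for y
   proof -
    obtain y' where y: "y = f y'" "y' \<in> C i" "y' \<in> A" using yin by blast
    have "dist (f z) y \<le> L * dist z y'" using L(2)[OF z(2) y(3)] y(1) by simp
    also have "... \<le> L * diameter (C i)"
     using diameter_bounded_bound[OF C(2) z(1) y(2)] L by (intro mult_left_mono) auto
    finally show ?thesis .
   qed
   thus ?thesis unfolding bounded_def by blast
  qed simp
  have "hausdorff_premeasure d (L * \<delta>) (f ` A) \<le> (\<Sum>i. hausdorff_size d (f ` (C i \<inter> A)))"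
  proof (rule hausdorff_premeasure_le[OF _ bd])
   show "f ` A \<subseteq> (\<Union>i. f ` (C i \<inter> A))" using C(1) by blast
   show "diameter (f ` (C i \<inter> A)) \<le> L * \<delta>" for i
    using order_trans[OF dd[of i] mult_left_mono[OF C(3)[of i], of L]] L(1) by simp
  qed
  also have "... \<le> (\<Sum>i. ennreal (L ^ d) * hausdorff_size d (C i))"
  proof (rule suminf_le)
   fix i
   have "(diameter (f ` (C i \<inter> A)) / 2) ^ d \<le> (L * (diameter (C i) / 2)) ^ d"
    using dd[of i] diameter_ge_0[OF bd] by (intro power_mono) auto
   hence "(diameter (f ` (C i \<inter> A)) / 2) ^ d \<le> L ^ d * (diameter (C i) / 2) ^ d"
    by (simp only: power_mult_distrib)
   hence "unit_ball_vol (real d) * (diameter (f ` (C i \<inter> A)) / 2) ^ d \<le>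
     unit_ball_vol (real d) * (L ^ d * (diameter (C i) / 2) ^ d)"
    by (rule mult_left_mono) simp
   hence "unit_ball_vol (real d) * (diameter (f ` (C i \<inter> A)) / 2) ^ d \<le> L ^ d * (unit_ball_vol (real d) * (diameter (C i) / 2) ^ d)"
    by (simp only: mult.left_commute)
   thus "hausdorff_size d (f ` (C i \<inter> A)) \<le> ennreal (L ^ d) * hausdorff_size d (C i)"
    using L by (simp add: ennreal_mult'[symmetric] ennreal_leI)
  qed auto
  also have "... = ennreal (L ^ d) * (\<Sum>i. hausdorff_size d (C i))" by (rule ennreal_suminf_cmult)
  finally have "ennreal (1 / L ^ d) * hausdorff_premeasure d (L * \<delta>) (f ` A) \<le>
    ennreal (1 / L ^ d) * (ennreal (L ^ d) * (\<Sum>i. hausdorff_size d (C i)))" by (rule mult_left_mono) simp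
  also have "... = (\<Sum>i. hausdorff_size d (C i))"
   using L by (simp add: mult.assoc[symmetric] ennreal_mult'[symmetric])
  finally show "ennreal (1 / L ^ d) * hausdorff_premeasure d (L * \<delta>) (f ` A) \<le> (\<Sum>i. hausdorff_size d (C i))" .
 qed
 have "hausdorff_premeasure d \<epsilon> (f ` A) \<le> ennreal (L ^ d) * hausdorff_outer_measure d A" if "0 < \<epsilon>" for \<epsilon>
 proof -
  have "ennreal (1 / L ^ d) * hausdorff_premeasure d \<epsilon> (f ` A) \<le> hausdorff_premeasure d (\<epsilon> / L) A"
   using pre[of "\<epsilon> / L"] L that by simp
  also have "... \<le> hausdorff_outer_measure d A" using L that by (intro hausdorff_premeasure_le_outer) simp
  finally have "ennreal (L ^ d) * (ennreal (1 / L ^ d) * hausdorff_premeasure d \<epsilon> (f ` A)) \<le> ennreal (L ^ d) * hausdorff_outer_measure d A"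
   by (rule mult_left_mono) simp
  thus ?thesis using L by (simp add: mult.assoc[symmetric] ennreal_mult'[symmetric])
 qed
 thus ?thesis unfolding hausdorff_outer_measure_def[of d "f ` A"] by (intro SUP_least) auto
qed

subsection \<open>The isodiametric inequality in a coordinate hyperplane\<close>

definition slice_length :: "'a::euclidean_space \<Rightarrow> 'a set \<Rightarrow> 'a \<Rightarrow> real" where
 "slice_length b A x = enn2real (\<integral>\<^sup>+s. indicator A (proj b x + s *\<^sub>R b) \<partial>lborel)"

text \<open>Lines that miss \<open>A\<close> have slice length 0. Without the second conjunct every
  such line would contribute its point with \<open>x \<bullet> b = 0\<close>, and the diameter could
  grow.\<close>

definition steiner :: "'a::euclidean_space \<Rightarrow> 'a set \<Rightarrow> 'a set" where
 "steiner b A = {x. 2 * \<bar>x \<bullet> b\<bar> \<le> slice_length b A x \<and> 0 < slice_length b A x}"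

definition reflection :: "'a::euclidean_space \<Rightarrow> 'a \<Rightarrow> 'a" where
 "reflection b x = x - (2 * (x \<bullet> b)) *\<^sub>R b"

lemma slice_length_measurable:
 assumes [measurable]: "A \<in> sets borel"
 shows "slice_length b A \<in> borel_measurable borel"
 unfolding slice_length_def by measurable

lemma steiner_measurable:
 assumes "A \<in> sets borel"
 shows "steiner b A \<in> sets borel"
proof -
 note [measurable] = slice_length_measurable[OF assms, of b]
 show ?thesis unfolding steiner_def by measurable
qed

lemma slice_bounds:
 fixes b :: "'a::euclidean_space"
 assumes b: "norm b = 1" and A: "A \<in> sets borel" "bounded A"
 shows "(\<integral>\<^sup>+s. indicator A (proj b x + s *\<^sub>R b) \<partial>lborel) = ennreal (slice_length b A x)"
  and "0 < slice_length b A x ==> \<exists>s. proj b x + s *\<^sub>R b \<in> A"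
  and "0 < slice_length b A x ==> bdd_below {s. proj b x + s *\<^sub>R b \<in> A} \<and>
   bdd_above {s. proj b x + s *\<^sub>R b \<in> A} \<and>
   slice_length b A x \<le> Sup {s. proj b x + s *\<^sub>R b \<in> A} - Inf {s. proj b x + s *\<^sub>R b \<in> A}"
proof -
 let ?S = "{s. proj b x + s *\<^sub>R b \<in> A}"
 obtain R where R: "\<And>y. y \<in> A ==> norm y \<le> R" using A(2) bounded_iff by blast
 have sR: "\<bar>s\<bar> \<le> R" if "s \<in> ?S" for s
 proof -
  have "(proj b x + s *\<^sub>R b) \<bullet> b = s"
   using b by (simp add: inner_add_left proj_inner norm_eq_1)
  thus ?thesis
   using Cauchy_Schwarz_ineq2[of "proj b x + s *\<^sub>R b" b] b R[of "proj b x + s *\<^sub>R b"] that by simp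
 qed
 have bd: "bdd_below ?S" "bdd_above ?S"
  using sR by (auto intro!: bdd_belowI[of _ "-R"] bdd_aboveI[of _ R] dest!: sR simp: abs_le_iff)
 note [measurable] = A(1)
 have S: "?S \<in> sets borel" by measurable
 have e: "(\<integral>\<^sup>+s. indicator A (proj b x + s *\<^sub>R b) \<partial>lborel) = emeasure lborel ?S"
 proof -
  have "(\<integral>\<^sup>+s. indicator A (proj b x + s *\<^sub>R b) \<partial>lborel) = (\<integral>\<^sup>+s. indicator ?S s \<partial>lborel)"
   by (rule nn_integral_cong) (simp add: indicator_def)
  also have "... = emeasure lborel ?S" using S by (intro nn_integral_indicator) simp
  finally show ?thesis .
 qed
 have "?S \<subseteq> {-R..R}" using sR by (force simp: abs_le_iff)
 hence "emeasure lborel ?S \<le> emeasure lborel {-R..R}" by (rule emeasure_mono) simp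
 also have "... < top" by (simp add: emeasure_lborel_Icc_eq)
 finally have fin: "emeasure lborel ?S < top" .
 show eq: "(\<integral>\<^sup>+s. indicator A (proj b x + s *\<^sub>R b) \<partial>lborel) = ennreal (slice_length b A x)"
  unfolding slice_length_def using fin by (simp add: e)
 assume pos: "0 < slice_length b A x"
 have ne: "?S \<noteq> {}"
 proof
  assume "?S = {}"
  hence "emeasure lborel ?S = 0" by (simp only: emeasure_empty)
  thus False using pos eq e by simp
 qed
 thus "\<exists>s. proj b x + s *\<^sub>R b \<in> A" by blast
 have "?S \<subseteq> {Inf ?S..Sup ?S}" using bd by (auto intro: cInf_lower cSup_upper)
 hence up: "emeasure lborel ?S \<le> emeasure lborel {Inf ?S..Sup ?S}" by (rule emeasure_mono) simp
 have le: "Inf ?S \<le> Sup ?S" by (rule cInf_le_cSup[OF ne bd(2,1)])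
 have "ennreal (slice_length b A x) \<le> ennreal (Sup ?S - Inf ?S)"
  using up unfolding eq[symmetric] e emeasure_lborel_Icc[OF le] .
 hence "slice_length b A x \<le> Sup ?S - Inf ?S" using le by (simp add: ennreal_le_iff)
 thus "bdd_below ?S \<and> bdd_above ?S \<and> slice_length b A x \<le> Sup ?S - Inf ?S" using bd by blast
qed

lemma emeasure_steiner:
 fixes b :: "'a::euclidean_space"
 assumes b: "norm b = 1" and A: "A \<in> sets borel" "bounded A"
 shows "emeasure lborel (steiner b A) = emeasure lborel A"
proof -
 note [measurable] = A(1) steiner_measurable[OF A(1), of b]
 have "emeasure lborel (steiner b A) = (\<integral>\<^sup>+x. indicator (steiner b A) x \<partial>lborel)" by simp
 also have "... = (\<integral>\<^sup>+y. (\<integral>\<^sup>+s. indicator (steiner b A) (y + s *\<^sub>R b) \<partial>lborel) \<partial>plane_meas b)"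
  by (rule nn_integral_lines[OF b, symmetric]) measurable
 also have "... = (\<integral>\<^sup>+y. (\<integral>\<^sup>+s. indicator A (y + s *\<^sub>R b) \<partial>lborel) \<partial>plane_meas b)"
 proof (rule nn_integral_cong_AE, use AE_plane_meas[OF b] in eventually_elim)
  fix y assume y: "y \<bullet> b = 0"
  define l where "l = slice_length b A y"
  have pr: "proj b (y + s *\<^sub>R b) = y" "(y + s *\<^sub>R b) \<bullet> b = s" for s
   using y b by (simp_all add: proj_def inner_add_left norm_eq_1)
  have l: "slice_length b A (y + s *\<^sub>R b) = l" for s
   unfolding l_def slice_length_def pr proj_id[OF y] ..
  have l0: "0 \<le> l" by (simp add: l_def slice_length_def)
  have "(\<integral>\<^sup>+s. indicator (steiner b A) (y + s *\<^sub>R b) \<partial>lborel) = (\<integral>\<^sup>+s. indicator (if 0 < l then {-l/2..l/2} else {}) s \<partial>lborel)"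
   by (rule nn_integral_cong) (auto simp: indicator_def steiner_def l pr)
  also have "... = ennreal l" using l0 by (auto simp: nn_integral_indicator)
  also have "... = (\<integral>\<^sup>+s. indicator A (y + s *\<^sub>R b) \<partial>lborel)"
   using slice_bounds(1)[OF b A, of y] by (simp add: l_def proj_id[OF y])
  finally show "(\<integral>\<^sup>+s. indicator (steiner b A) (y + s *\<^sub>R b) \<partial>lborel) = (\<integral>\<^sup>+s. indicator A (y + s *\<^sub>R b) \<partial>lborel)" .
 qed
 also have "... = (\<integral>\<^sup>+x. indicator A x \<partial>lborel)" by (rule nn_integral_lines[OF b]) measurable
 also have "... = emeasure lborel A" by simp
 finally show ?thesis .
qed

text \<open>\<open>plane_meas\<close> is computed in the unit slab, so the symmetrisation acts on
  full-dimensional sets inside that slab. Only the projection along \<open>e\<close> enters the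
  diameter, since the thickness of the slab is not related to \<open>D\<close>.\<close>

definition cylinder_diam :: "'a::euclidean_space \<Rightarrow> real \<Rightarrow> 'a set \<Rightarrow> bool" where
 "cylinder_diam e D A \<longleftrightarrow> (\<forall>x\<in>A. 0 \<le> x \<bullet> e \<and> x \<bullet> e \<le> 1) \<and>
  (\<forall>x\<in>A. \<forall>y\<in>A. norm (proj e (x - y)) \<le> D)"

lemma cylinder_diam_bounded:
 fixes e :: "'a::euclidean_space"
 assumes e: "norm e = 1" and A: "cylinder_diam e D A"
 shows "bounded A"
proof (cases "A = {}")
 case False
 then obtain a where a: "a \<in> A" by blast
 have "norm x \<le> D + norm (proj e a) + 1" if x: "x \<in> A" for x
 proof -
  have "x = proj e (x - a) + proj e a + (x \<bullet> e) *\<^sub>R e"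
   by (simp add: proj_def algebra_simps)
  hence "norm x \<le> norm (proj e (x - a)) + norm (proj e a) + norm ((x \<bullet> e) *\<^sub>R e)"
   by (metis norm_triangle_le norm_triangle_ineq add_right_mono)
  also have "... \<le> D + norm (proj e a) + 1"
   using A x a e by (auto simp: cylinder_diam_def intro!: add_mono)
  finally show ?thesis .
 qed
 thus ?thesis unfolding bounded_iff by blast
qed simp

text \<open>On each line the symmetrised set is a centred interval no longer than the distance
  between the extremes of the original slice. Hence two of its points differ along \<open>b\<close>
  by at most the average of \<open>Sup (S x) - Inf (S y)\<close> and
  \<open>Sup (S y) - Inf (S x)\<close>, and both are limits of differences within \<open>A\<close>.
  The part orthogonal to \<open>b\<close> is unchanged.\<close>

lemma cylinder_diam_steiner:
 fixes b e :: "'a::euclidean_space"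
 assumes b: "norm b = 1" and e: "norm e = 1" and be: "b \<bullet> e = 0"
  and A: "A \<in> sets borel" "cylinder_diam e D A"
 shows "cylinder_diam e D (steiner b A)"
proof -
 have bA: "bounded A" by (rule cylinder_diam_bounded[OF e A(2)])
 define S where "S x = {s. proj b x + s *\<^sub>R b \<in> A}" for x
 have S: "S x \<noteq> {}" "bdd_below (S x)" "bdd_above (S x)" "2 * \<bar>x \<bullet> b\<bar> \<le> Sup (S x) - Inf (S x)" if "x \<in> steiner b A" for x
 proof -
  have p: "0 < slice_length b A x" "2 * \<bar>x \<bullet> b\<bar> \<le> slice_length b A x" using that by (auto simp: steiner_def)
  show "S x \<noteq> {}" using slice_bounds(2)[OF b A(1) bA p(1)] by (auto simp: S_def)
  show "bdd_below (S x)" "bdd_above (S x)" "2 * \<bar>x \<bullet> b\<bar> \<le> Sup (S x) - Inf (S x)"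
   using slice_bounds(3)[OF b A(1) bA p(1)] p(2) by (auto simp: S_def)
 qed
 have bb: "b \<bullet> b = 1" and ee: "e \<bullet> e = 1" and eb: "e \<bullet> b = 0" using b e be by (auto simp: norm_eq_1 inner_commute)
 have split: "(norm (proj e z))\<^sup>2 = (z \<bullet> b)\<^sup>2 + (norm (proj e (proj b z)))\<^sup>2" for z
  unfolding proj_norm[OF e] proj_norm[OF b]
  by (simp add: proj_def inner_diff_left bb be)
 show ?thesis
  unfolding cylinder_diam_def
 proof (intro conjI ballI)
  fix x assume x: "x \<in> steiner b A"
  obtain s where "proj b x + s *\<^sub>R b \<in> A" using S(1)[OF x] by (auto simp: S_def)
  moreover have "(proj b x + s *\<^sub>R b) \<bullet> e = x \<bullet> e"
   by (simp add: proj_def inner_diff_left inner_add_left be)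
  ultimately show "0 \<le> x \<bullet> e" "x \<bullet> e \<le> 1" using A(2) by (metis cylinder_diam_def)+
 next
  fix x y assume x: "x \<in> steiner b A" and y: "y \<in> steiner b A"
  define N where "N = (norm (proj e (proj b (x - y))))\<^sup>2"
  have st: "(s - t)\<^sup>2 + N \<le> D\<^sup>2" "0 \<le> D" if "s \<in> S x" "t \<in> S y" for s t
  proof -
   let ?u = "proj b x + s *\<^sub>R b" and ?v = "proj b y + t *\<^sub>R b"
   have uv: "norm (proj e (?u - ?v)) \<le> D" using A(2) that by (auto simp: S_def cylinder_diam_def)
   thus "0 \<le> D" using norm_ge_zero order_trans by blast
   have "(?u - ?v) \<bullet> b = s - t"
    by (simp add: inner_diff_left inner_add_left proj_inner[OF b] bb)
   moreover have "proj b (?u - ?v) = proj b (x - y)"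
    by (simp add: proj_def inner_diff_left inner_add_left bb algebra_simps)
   ultimately have "(s - t)\<^sup>2 + N = (norm (proj e (?u - ?v)))\<^sup>2"
    unfolding split[of "?u - ?v"] N_def by simp
   thus "(s - t)\<^sup>2 + N \<le> D\<^sup>2" using uv by (simp add: power_mono)
  qed
  \<comment> \<open>The largest difference along \<open>b\<close> that the bound \<open>D\<close>
    leaves once the orthogonal part \<open>N\<close> is fixed.\<close>
  define R where "R = sqrt (D\<^sup>2 - N)"
  obtain s0 t0 where st0: "s0 \<in> S x" "t0 \<in> S y" using S(1)[OF x] S(1)[OF y] by blast
  have DN: "0 \<le> D\<^sup>2 - N" using st(1)[OF st0] zero_le_power2[of "s0 - t0"] by linarith
  have R: "\<bar>s - t\<bar> \<le> R" if "s \<in> S x" "t \<in> S y" for s t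
   unfolding R_def using st(1)[OF that] by (intro real_le_rsqrt) simp
  have "Sup (S x) \<le> R + t" if "t \<in> S y" for t
   using R[OF _ that] by (intro cSup_least S(1)[OF x]) (force simp: abs_le_iff)
  hence 1: "Sup (S x) - R \<le> Inf (S y)" by (intro cInf_greatest S(1)[OF y]) force
  have "Sup (S y) \<le> R + s" if "s \<in> S x" for s
   using R[OF that] by (intro cSup_least S(1)[OF y]) (force simp: abs_le_iff)
  hence 2: "Sup (S y) - R \<le> Inf (S x)" by (intro cInf_greatest S(1)[OF x]) force
  have "\<bar>(x - y) \<bullet> b\<bar> \<le> R"
   using 1 2 S(4)[OF x] S(4)[OF y] unfolding inner_diff_left by linarith
  hence "((x - y) \<bullet> b)\<^sup>2 \<le> R\<^sup>2" using power_mono[of "\<bar>(x - y) \<bullet> b\<bar>" R 2] by simp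
  also have "R\<^sup>2 = D\<^sup>2 - N" unfolding R_def using DN by simp
  finally have "(norm (proj e (x - y)))\<^sup>2 \<le> D\<^sup>2" unfolding split[of "x - y"] N_def[symmetric] by simp
  thus "norm (proj e (x - y)) \<le> D" using st(2)[OF st0] by (rule power2_le_imp_le)
 qed
qed

lemma reflection_steiner_same:
 assumes "norm b = 1"
 shows "reflection b x \<in> steiner b A \<longleftrightarrow> x \<in> steiner b A"
proof -
 have 1: "proj b (reflection b x) = proj b x" and 2: "reflection b x \<bullet> b = - (x \<bullet> b)"
  using assms by (simp_all add: proj_def reflection_def inner_diff_left norm_eq_1 algebra_simps flip: scaleR_add_left)
 show ?thesis by (simp add: steiner_def slice_length_def 1 2)
qed

text \<open>Symmetries in orthogonal directions survive the next symmetrisation, so they accumulate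
  when the basis directions are treated one after another.\<close>

lemma reflection_steiner_other:
 assumes "b \<bullet> b' = 0" and sym: "\<And>x. reflection b' x \<in> A \<longleftrightarrow> x \<in> A"
 shows "reflection b' x \<in> steiner b A \<longleftrightarrow> x \<in> steiner b A"
proof -
 have b': "b' \<bullet> b = 0" using assms(1) by (simp add: inner_commute)
 have 1: "proj b (reflection b' x) + s *\<^sub>R b = reflection b' (proj b x + s *\<^sub>R b)" for s
  using assms(1) b' by (simp add: proj_def reflection_def inner_diff_left inner_add_left algebra_simps)
 have 2: "reflection b' x \<bullet> b = x \<bullet> b" using b' by (simp add: reflection_def inner_diff_left)
 have "indicator A (reflection b' y) = (indicator A y :: ennreal)" for y using sym[of y] by (simp add: indicator_def)
 thus ?thesis by (simp add: steiner_def slice_length_def 1 2)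
qed

lemma steiner_iterate:
 fixes e :: "'a::euclidean_space"
 assumes e: "e \<in> Basis" and A: "A \<in> sets borel" "cylinder_diam e D A" and F: "F \<subseteq> Basis - {e}"
 shows "\<exists>A'. A' \<in> sets borel \<and> cylinder_diam e D A' \<and> emeasure lborel A' = emeasure lborel A \<and>
  (\<forall>b\<in>F. \<forall>x. reflection b x \<in> A' \<longleftrightarrow> x \<in> A')"
proof -
 have "finite F" using F finite_subset finite_Basis by blast
 thus ?thesis using F
 proof (induction F rule: finite_induct)
  case empty
  thus ?case using A by blast
 next
  case (insert b F)
  then obtain A' where A': "A' \<in> sets borel" "cylinder_diam e D A'" "emeasure lborel A' = emeasure lborel A"
   "\<And>b x. b \<in> F ==> reflection b x \<in> A' \<longleftrightarrow> x \<in> A'" by blast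
  have b: "norm b = 1" "b \<bullet> e = 0" and en: "norm e = 1"
   using insert.prems e by (auto simp: inner_not_same_Basis)
  have bA: "bounded A'" by (rule cylinder_diam_bounded[OF en A'(2)])
  have "b \<bullet> b' = 0" if "b' \<in> F" for b'
  proof -
   have "b \<in> Basis" "b' \<in> Basis" "b \<noteq> b'" using that insert by auto
   thus ?thesis by (rule inner_not_same_Basis)
  qed
  hence "\<forall>b'\<in>insert b F. \<forall>x. reflection b' x \<in> steiner b A' \<longleftrightarrow> x \<in> steiner b A'"
   using reflection_steiner_same[OF b(1)] reflection_steiner_other A'(4) by blast
  thus ?case
   using steiner_measurable[OF A'(1)] cylinder_diam_steiner[OF b(1) en b(2) A'(1,2)]
    emeasure_steiner[OF b(1) A'(1) bA] A'(3) by metis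
 qed
qed

text \<open>In coordinates the slab over the ball is [0,1] times a ball in the remaining
  coordinates, whose volume is known for the product measure on a finite index set. Other directions
  are reached later by rotation.\<close>

lemma plane_meas_cball:
 fixes e :: "'a::euclidean_space"
 assumes e: "e \<in> Basis" and r: "0 < r"
 shows "emeasure (plane_meas e) (cball 0 r) = ennreal (unit_ball_vol (real (DIM('a) - 1)) * r ^ (DIM('a) - 1))"
proof -
 interpret product_sigma_finite "%_::'a. lborel :: real measure" by standard
 let ?F = "Basis - {e}"
 have ins: "insert e ?F = Basis" using e by auto
 let ?Z = "{y. 0 \<le> y \<bullet> e \<and> y \<bullet> e \<le> 1 \<and> proj e y \<in> cball 0 r}"
 let ?S = "%f. SB b. f b *\<^sub>R b"
 have [measurable]: "cball (0::'a) r \<in> sets borel" by simp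
 have Z[measurable]: "?Z \<in> sets borel" by measurable
 have Se: "?S f \<bullet> e = f e" for f using e by (simp add: inner_sum_left inner_Basis if_distrib sum.If_cases cong: if_cong)
 have Sb: "?S f \<bullet> b = f b" if "b \<in> Basis" for f b using that by (simp add: inner_sum_left inner_Basis if_distrib sum.If_cases cong: if_cong)
 have n: "norm (proj e (?S f)) = sqrt (\<Sum>b\<in>?F. (f b)\<^sup>2)" for f
 proof -
  have "(norm (?S f))\<^sup>2 = (SB b. (f b)\<^sup>2)"
   unfolding power2_norm_eq_inner by (subst euclidean_inner) (auto simp: Sb power2_eq_square intro!: sum.cong)
  also have "... = (f e)\<^sup>2 + (\<Sum>b\<in>?F. (f b)\<^sup>2)" using e by (simp add: sum.remove)
  finally have "(norm (proj e (?S f)))\<^sup>2 = (\<Sum>b\<in>?F. (f b)\<^sup>2)"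
   using e by (simp add: proj_norm Se)
  thus ?thesis by (metis norm_ge_zero real_sqrt_unique)
 qed
 let ?B = "{f. sqrt (\<Sum>b\<in>?F. (f b)\<^sup>2) \<le> r} \<inter> space (Pi\<^sub>M ?F (%_. lborel))"
 have [measurable]: "?S \<in> measurable (Pi\<^sub>M Basis (%_. lborel)) borel" by measurable
 have "emeasure (plane_meas e) (cball 0 r) = emeasure lborel ?Z"
  by (rule emeasure_plane_meas) simp
 also have "... = (\<integral>\<^sup>+y. indicator ?Z y \<partial>lborel)" by simp
 also have "... = (\<integral>\<^sup>+f. indicator ?Z (?S f) \<partial>Pi\<^sub>M Basis (%_. lborel))"
  by (subst lborel_eq, subst nn_integral_distr) auto
 also have "... = (\<integral>\<^sup>+f. indicator {f. 0 \<le> f e \<and> f e \<le> 1 \<and> sqrt (\<Sum>b\<in>?F. (f b)\<^sup>2) \<le> r} f \<partial>Pi\<^sub>M (insert e ?F) (%_. lborel))"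
  unfolding ins by (rule nn_integral_cong) (auto simp: indicator_def Se n)
 also have "... = (\<integral>\<^sup>+y. (\<integral>\<^sup>+f. indicator {f. 0 \<le> f e \<and> f e \<le> 1 \<and> sqrt (\<Sum>b\<in>?F. (f b)\<^sup>2) \<le> r} (f(e := y)) \<partial>Pi\<^sub>M ?F (%_. lborel)) \<partial>lborel)"
  by (rule product_nn_integral_insert_rev) auto
 also have "... = (\<integral>\<^sup>+y. emeasure (Pi\<^sub>M ?F (%_. lborel)) ?B * indicator {0..1::real} y \<partial>lborel)"
 proof (rule nn_integral_cong)
  fix y :: real
  have "(\<integral>\<^sup>+f. indicator {f. 0 \<le> f e \<and> f e \<le> 1 \<and> sqrt (\<Sum>b\<in>?F. (f b)\<^sup>2) \<le> r} (f(e := y)) \<partial>Pi\<^sub>M ?F (%_. lborel)) =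
    (\<integral>\<^sup>+f. indicator {0..1} y * indicator ?B f \<partial>Pi\<^sub>M ?F (%_. lborel))"
  proof (rule nn_integral_cong)
   fix f assume f: "f \<in> space (Pi\<^sub>M ?F (%_. lborel :: real measure))"
   have "(\<Sum>b\<in>?F. ((f(e := y)) b)\<^sup>2) = (\<Sum>b\<in>?F. (f b)\<^sup>2)" by (rule sum.cong) auto
   thus "indicator {f. 0 \<le> f e \<and> f e \<le> 1 \<and> sqrt (\<Sum>b\<in>?F. (f b)\<^sup>2) \<le> r} (f(e := y)) =
     (indicator {0..1} y * indicator ?B f :: ennreal)" using f by (simp add: indicator_def)
  qed
  also have "... = indicator {0..1} y * emeasure (Pi\<^sub>M ?F (%_. lborel)) ?B"
   by (rule nn_integral_cmult_indicator) measurable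
  finally show "(\<integral>\<^sup>+f. indicator {f. 0 \<le> f e \<and> f e \<le> 1 \<and> sqrt (\<Sum>b\<in>?F. (f b)\<^sup>2) \<le> r} (f(e := y)) \<partial>Pi\<^sub>M ?F (%_. lborel)) =
    emeasure (Pi\<^sub>M ?F (%_. lborel)) ?B * indicator {0..1} y" by (simp add: mult.commute)
 qed
 also have "... = emeasure (Pi\<^sub>M ?F (%_. lborel)) ?B"
  by (subst nn_integral_cmult_indicator) auto
 also have "... = ennreal (unit_ball_vol (real (card ?F)) * r ^ card ?F)"
  by (rule emeasure_cball_aux[OF _ r]) simp
 also have "card ?F = DIM('a) - 1" using e by (simp add: card_Diff_singleton)
 finally show ?thesis .
qed

text \<open>Symmetrising in all coordinate directions of the hyperplane makes a set centrally symmetric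
 there, so that it lies in a ball of half its diameter.\<close>

lemma isodiametric_hyperplane:
 fixes e :: "'a::euclidean_space"
 assumes e: "e \<in> Basis" and K: "closed K" "bounded K" and d: "2 \<le> DIM('a)"
 shows "emeasure (plane_meas e) K \<le> hausdorff_size (DIM('a) - 1) K"
proof (cases "K = {}")
 case True
 thus ?thesis by simp
next
 case False
 let ?d = "DIM('a) - 1" and ?D = "diameter K"
 have en: "norm e = 1" using e by simp
 have D0: "0 \<le> ?D" using K by (simp add: diameter_ge_0)
 let ?A = "{y. 0 \<le> y \<bullet> e \<and> y \<bullet> e \<le> 1 \<and> proj e y \<in> K}"
 have Kb: "K \<in> sets borel" using K by simp
 note [measurable] = Kb borel_closed[OF closed_cball]
 have A: "?A \<in> sets borel" by measurable
 have "cylinder_diam e ?D ?A"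
  unfolding cylinder_diam_def linear_diff[OF proj_linear]
  using diameter_bounded_bound[OF K(2)] by (auto simp: dist_norm)
 from steiner_iterate[OF e A this subset_refl] obtain A' where A': "A' \<in> sets borel" "cylinder_diam e ?D A'"
  "emeasure lborel A' = emeasure lborel ?A" "\<And>b x. b \<in> Basis - {e} ==> reflection b x \<in> A' \<longleftrightarrow> x \<in> A'" by blast
 \<comment> \<open>Reflecting in the directions of \<open>F\<close> one at a time. For
   \<open>F = Basis - {e}\<close> the result is \<open>x - 2 *\<^sub>R proj e x\<close>, the point
   opposite to \<open>x\<close> with respect to the axis \<open>e\<close>.\<close>
 have refl: "x - 2 *\<^sub>R (\<Sum>b\<in>F. (x \<bullet> b) *\<^sub>R b) \<in> A'" if x: "x \<in> A'" and F: "F \<subseteq> Basis - {e}" for x F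
 proof -
  have "finite F" using F finite_subset finite_Basis by blast
  thus ?thesis using F
  proof (induction F rule: finite_induct)
   case (insert b F)
   let ?y = "x - 2 *\<^sub>R (\<Sum>b\<in>F. (x \<bullet> b) *\<^sub>R b)"
   have "(\<Sum>b\<in>F. (x \<bullet> b) *\<^sub>R b) \<bullet> b = 0"
    unfolding inner_sum_left
   proof (intro sum.neutral ballI)
    fix c assume "c \<in> F"
    hence "c \<in> Basis" "b \<in> Basis" "c \<noteq> b" using insert by auto
    thus "(x \<bullet> c) *\<^sub>R c \<bullet> b = 0" by (simp add: inner_not_same_Basis)
   qed
   hence "reflection b ?y = x - 2 *\<^sub>R (\<Sum>b\<in>insert b F. (x \<bullet> b) *\<^sub>R b)"
    using insert by (simp add: reflection_def inner_diff_left algebra_simps)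
   moreover have "?y \<in> A'" using insert by simp
   ultimately show ?case using A'(4)[of b ?y] insert.prems by simp
  qed (simp add: x)
 qed
 have pr: "(\<Sum>b\<in>Basis - {e}. (x \<bullet> b) *\<^sub>R b) = proj e x" for x
 proof -
  have "x = (SB b. (x \<bullet> b) *\<^sub>R b)" by (simp add: euclidean_representation)
  also have "... = (x \<bullet> e) *\<^sub>R e + (\<Sum>b\<in>Basis - {e}. (x \<bullet> b) *\<^sub>R b)" using e by (simp add: sum.remove)
  finally show ?thesis unfolding proj_def by (metis add_diff_cancel_left')
 qed
 have half: "norm (proj e x) \<le> ?D / 2" if x: "x \<in> A'" for x
 proof -
  have "x - 2 *\<^sub>R proj e x \<in> A'" using refl[OF x subset_refl] pr by simp
  hence "norm (proj e (x - (x - 2 *\<^sub>R proj e x))) \<le> ?D"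
   using A'(2) x unfolding cylinder_diam_def by blast
  moreover have "proj e (x - (x - 2 *\<^sub>R proj e x)) = 2 *\<^sub>R proj e x"
   using proj_id[OF proj_inner[OF en], of x]
   by (simp add: linear_scale[OF proj_linear])
  ultimately show ?thesis by simp
 qed
 \<comment> \<open>\<open>plane_meas_cball\<close> wants a positive radius, while the diameter may
   be 0; hence a margin \<open>\<eta>\<close> that is sent to 0 at the end.\<close>
 have bound: "emeasure (plane_meas e) K \<le> ennreal (unit_ball_vol (real ?d) * (?D / 2 + \<eta>) ^ ?d)" if \<eta>: "0 < \<eta>" for \<eta>
 proof -
  have "emeasure (plane_meas e) K = emeasure lborel A'"
   using A'(3) by (simp add: emeasure_plane_meas[OF Kb])
  also have "... \<le> emeasure (plane_meas e) (cball 0 (?D / 2 + \<eta>))"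
   unfolding emeasure_plane_meas[OF borel_closed[OF closed_cball]]
  proof (rule emeasure_mono)
   show "A' \<subseteq> {y. 0 \<le> y \<bullet> e \<and> y \<bullet> e \<le> 1 \<and> proj e y \<in> cball 0 (?D / 2 + \<eta>)}"
    using A'(2) half \<eta> by (force simp: cylinder_diam_def)
  qed measurable
  also have "... = ennreal (unit_ball_vol (real ?d) * (?D / 2 + \<eta>) ^ ?d)"
   using D0 \<eta> by (intro plane_meas_cball[OF e]) simp
  finally show ?thesis .
 qed
 have "(%n. ?D / 2 + 1 / real (Suc n)) \<longlonglongrightarrow> ?D / 2 + 0"
  by (intro tendsto_add tendsto_const LIMSEQ_Suc lim_1_over_n)
 hence "(%n. ennreal (unit_ball_vol (real ?d) * (?D / 2 + 1 / real (Suc n)) ^ ?d)) \<longlonglongrightarrow>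
   ennreal (unit_ball_vol (real ?d) * (?D / 2 + 0) ^ ?d)"
  by (intro tendsto_ennrealI tendsto_mult tendsto_const tendsto_power)
 hence "emeasure (plane_meas e) K \<le> ennreal (unit_ball_vol (real ?d) * (?D / 2 + 0) ^ ?d)"
  by (rule LIMSEQ_le_const) (use bound in auto)
 thus ?thesis by simp
qed

subsection \<open>Hausdorff measure of hyperplanes\<close>

lemma hausdorff_premeasure_le_finite:
 assumes d: "1 \<le> d" and I: "finite I" and \<delta>: "0 \<le> \<delta>" and A: "A \<subseteq> (\<Union>i\<in>I. C i)"
  and C: "\<And>i. i \<in> I ==> bounded (C i)" "\<And>i. i \<in> I ==> diameter (C i) \<le> \<delta>"
 shows "hausdorff_premeasure d \<delta> A \<le> (\<Sum>i\<in>I. hausdorff_size d (C i))"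
proof -
 obtain h where h: "bij_betw h {0..<card I} I" using ex_bij_betw_nat_finite[OF I] by blast
 define C' where "C' k = (if k < card I then C (h k) else {})" for k
 have hI: "h k \<in> I" if "k < card I" for k using h that by (auto simp: bij_betw_def)
 have "A \<subseteq> (\<Union>k. C' k)"
 proof
  fix x assume "x \<in> A"
  then obtain i where i: "i \<in> I" "x \<in> C i" using A by blast
  hence "i \<in> h ` {0..<card I}" using h by (simp add: bij_betw_def)
  then obtain k where "k < card I" "h k = i" by auto
  hence "x \<in> C' k" using i by (simp add: C'_def)
  thus "x \<in> (\<Union>k. C' k)" by blast
 qed
 hence "hausdorff_premeasure d \<delta> A \<le> (\<Sum>k. hausdorff_size d (C' k))"
  by (rule hausdorff_premeasure_le) (use C hI \<delta> in \<open>auto simp: C'_def\<close>)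
 also have "... = (\<Sum>k\<in>{0..<card I}. hausdorff_size d (C' k))"
  by (rule suminf_finite) (use d in \<open>auto simp: C'_def power_0_left\<close>)
 also have "... = (\<Sum>k\<in>{0..<card I}. hausdorff_size d (C (h k)))"
  by (rule sum.cong) (auto simp: C'_def)
 also have "... = (\<Sum>i\<in>I. hausdorff_size d (C i))" by (rule sum.reindex_bij_betw[OF h])
 finally show ?thesis .
qed

text \<open>In a grid of mesh 1 / m at most (2m + 1)^(n - 1) cells are needed, each of diameter at
  most n / m, and the resulting sum is bounded independently of \<open>m\<close>. Only finiteness is
  at stake: it makes the comparison factor below a real number.\<close>

lemma hausdorff_hyperplane_cball_finite:
 fixes e :: "'a::euclidean_space"
 assumes e: "e \<in> Basis" and n2: "2 \<le> DIM('a)"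
 shows "hausdorff_outer_measure (DIM('a) - 1) {x \<in> cball 0 1. x \<bullet> e = 0} < \<infinity>"
proof -
 let ?d = "DIM('a) - 1" and ?n = "real DIM('a)" and ?F = "Basis - {e}" and ?A = "{x \<in> cball (0::'a) 1. x \<bullet> e = 0}"
 let ?K = "unit_ball_vol (real ?d) * (3 * ?n / 2) ^ ?d"
 have d1: "1 \<le> ?d" using n2 by simp
 have "hausdorff_premeasure ?d \<delta> ?A \<le> ennreal ?K" if \<delta>: "0 < \<delta>" for \<delta>
 proof -
  obtain m :: nat where m: "?n / \<delta> < real m" using reals_Archimedean2 by blast
  have "0 < ?n / \<delta>" using \<delta> by simp
  hence m0: "0 < real m" using m by linarith
  have m1: "1 \<le> real m" using m0 by simp
  have nm: "?n / real m \<le> \<delta>" using m m0 \<delta> by (simp add: field_simps)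
  define Z where "Z = PiE ?F (%_. {- int m..int m})"
  have finZ: "finite Z" unfolding Z_def by (intro finite_PiE) auto
  have cardF: "card ?F = ?d" using e by (simp add: card_Diff_singleton)
  have cardZ: "card Z = (2 * m + 1) ^ ?d"
  proof -
   have "card {- int m..int m} = 2 * m + 1" by (simp add: nat_eq_iff)
   moreover have "card Z = (\<Prod>b\<in>?F. card {- int m..int m})" unfolding Z_def by (rule card_PiE) simp
   ultimately show ?thesis by (simp add: cardF)
  qed
  define C where "C z = {x. x \<bullet> e = 0 \<and> (\<forall>b\<in>?F. of_int (z b) \<le> real m * (x \<bullet> b) \<and> real m * (x \<bullet> b) \<le> of_int (z b) + 1)}" for z :: "'a \<Rightarrow> int"
  have close: "norm (x - y) \<le> ?n / real m" if "x \<in> C z" "y \<in> C z" for x y z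
  proof -
   have "\<bar>(x - y) \<bullet> b\<bar> \<le> 1 / real m" if b: "b \<in> Basis" for b
   proof (cases "b = e")
    case True
    thus ?thesis using \<open>x \<in> C z\<close> \<open>y \<in> C z\<close> by (simp add: C_def inner_diff_left)
   next
    case False
    hence "b \<in> ?F" using b by simp
    hence "of_int (z b) \<le> real m * (x \<bullet> b)" "real m * (x \<bullet> b) \<le> of_int (z b) + 1"
     "of_int (z b) \<le> real m * (y \<bullet> b)" "real m * (y \<bullet> b) \<le> of_int (z b) + 1"
     using \<open>x \<in> C z\<close> \<open>y \<in> C z\<close> by (auto simp: C_def)
    hence "\<bar>real m * (x \<bullet> b) - real m * (y \<bullet> b)\<bar> \<le> 1" by linarith
    hence "real m * \<bar>(x - y) \<bullet> b\<bar> \<le> 1"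
     using m0 by (simp add: inner_diff_left abs_mult right_diff_distrib[symmetric])
    thus ?thesis using m0 by (simp add: field_simps)
   qed
   hence "(SB b. \<bar>(x - y) \<bullet> b\<bar>) \<le> (\<Sum>b\<in>(Basis::'a set). 1 / real m)" by (rule sum_mono)
   thus ?thesis using norm_le_l1[of "x - y"] by simp
  qed
  have bdd: "bounded (C z)" for z
  proof (cases "C z = {}")
   case False
   then obtain x where "x \<in> C z" by blast
   thus ?thesis unfolding bounded_def dist_norm using close by blast
  qed simp
  have diam: "diameter (C z) \<le> ?n / real m" for z
   using close m0 by (intro diameter_le) auto
  have "?A \<subseteq> (\<Union>z\<in>Z. C z)"
  proof
   fix x assume x: "x \<in> ?A"
   define z where "z = (\<lambda>b\<in>?F. \<lfloor>real m * (x \<bullet> b)\<rfloor>)"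
   have "z \<in> Z" unfolding Z_def z_def
   proof (rule PiE_I)
    fix b assume b: "b \<in> ?F"
    hence "\<bar>x \<bullet> b\<bar> \<le> 1" using x Basis_le_norm[of b x] by simp
    hence "real m * \<bar>x \<bullet> b\<bar> \<le> real m * 1" by (intro mult_left_mono) auto
    hence "\<bar>real m * (x \<bullet> b)\<bar> \<le> real m" by (simp add: abs_mult)
    thus "(\<lambda>b\<in>?F. \<lfloor>real m * (x \<bullet> b)\<rfloor>) b \<in> {- int m..int m}"
     using b by (simp add: le_floor_iff floor_le_iff abs_le_iff)
   qed auto
   moreover have "x \<in> C z" using x by (auto simp: C_def z_def intro: order_less_imp_le[OF floor_less_iff[THEN iffD1]])
   ultimately show "x \<in> (\<Union>z\<in>Z. C z)" by blast
  qed
  hence "hausdorff_premeasure ?d \<delta> ?A \<le> (\<Sum>z\<in>Z. hausdorff_size ?d (C z))"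
   using order_trans[OF diam nm] \<delta> bdd by (intro hausdorff_premeasure_le_finite[OF d1 finZ]) auto
  also have "... \<le> (\<Sum>z\<in>Z. ennreal (unit_ball_vol (real ?d) * (?n / (2 * real m)) ^ ?d))"
  proof (intro sum_mono ennreal_leI mult_left_mono power_mono)
   show "diameter (C z) / 2 \<le> ?n / (2 * real m)" for z using diam[of z] by (simp add: field_simps)
  qed (auto simp: diameter_ge_0 bdd)
  also have "... = ennreal (real (card Z) * (unit_ball_vol (real ?d) * (?n / (2 * real m)) ^ ?d))"
   by (simp add: ennreal_mult' ennreal_of_nat_eq_real_of_nat)
  also have "... \<le> ennreal ?K"
  proof (rule ennreal_leI)
   have "real (card Z) = (2 * real m + 1) ^ ?d" by (simp add: cardZ add.commute)
   also have "... \<le> (3 * real m) ^ ?d" using m1 by (intro power_mono) auto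
   finally have "real (card Z) * (?n / (2 * real m)) ^ ?d \<le> (3 * real m) ^ ?d * (?n / (2 * real m)) ^ ?d"
    by (rule mult_right_mono) simp
   also have "... = (3 * real m * (?n / (2 * real m))) ^ ?d" by (rule power_mult_distrib[symmetric])
   also have "3 * real m * (?n / (2 * real m)) = 3 * ?n / 2" using m0 by simp
   finally have "unit_ball_vol (real ?d) * (real (card Z) * (?n / (2 * real m)) ^ ?d) \<le> ?K"
    by (rule mult_left_mono) simp
   thus "real (card Z) * (unit_ball_vol (real ?d) * (?n / (2 * real m)) ^ ?d) \<le> ?K"
    by (simp only: mult.left_commute)
  qed
  finally show ?thesis .
 qed
 hence "hausdorff_outer_measure ?d ?A \<le> ennreal ?K"
  unfolding hausdorff_outer_measure_def by (intro SUP_least) auto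
 also have "... < \<infinity>" by simp
 finally show ?thesis .
qed

lemma hausdorff_outer_measure_isometry:
 fixes f :: "'a::real_normed_vector \<Rightarrow> 'b::real_normed_vector"
 assumes d: "1 \<le> d" and f: "\<And>x y. dist (f x) (f y) = dist x y"
 shows "hausdorff_outer_measure d (f ` A) = hausdorff_outer_measure d A"
proof (rule antisym)
 show "hausdorff_outer_measure d (f ` A) \<le> hausdorff_outer_measure d A"
  using hausdorff_outer_measure_lipschitz[OF d, of 1 A f] f by simp
 have inj: "inj f" using f by (metis dist_eq_0_iff injI)
 hence "A = inv f ` (f ` A)" by (simp add: image_inv_f_f)
 moreover have "hausdorff_outer_measure d (inv f ` (f ` A)) \<le> ennreal (1 ^ d) * hausdorff_outer_measure d (f ` A)"
 proof (rule hausdorff_outer_measure_lipschitz[OF d])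
  fix x y assume "x \<in> f ` A" "y \<in> f ` A"
  thus "dist (inv f x) (inv f y) \<le> 1 * dist x y" using inj f by (auto simp: inv_f_f)
 qed simp
 ultimately show "hausdorff_outer_measure d A \<le> hausdorff_outer_measure d (f ` A)" by simp
qed

text \<open>The isodiametric inequality, applied to the closure of each covering set, bounds its
  plane measure by its Hausdorff size; then countable subadditivity. The inequality holds at every
  scale, so the premeasure at scale 1 already dominates.\<close>

lemma hausdorff_hyperplane_cball_ge:
 fixes e :: "'a::euclidean_space"
 assumes e: "e \<in> Basis" and n2: "2 \<le> DIM('a)"
 shows "emeasure (plane_meas e) (cball 0 1) \<le> hausdorff_outer_measure (DIM('a) - 1) {x \<in> cball 0 1. x \<bullet> e = 0}"
proof -
 let ?d = "DIM('a) - 1" and ?A = "{x \<in> cball (0::'a) 1. x \<bullet> e = 0}"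
 have en: "norm e = 1" using e by simp
 have "emeasure (plane_meas e) (cball 0 1) \<le> hausdorff_premeasure ?d 1 ?A"
  unfolding hausdorff_premeasure_def
 proof (rule INF_greatest)
  fix C :: "nat \<Rightarrow> 'a set"
  assume "C \<in> {C. ?A \<subseteq> (\<Union>i. C i) \<and> (\<forall>i. bounded (C i) \<and> diameter (C i) \<le> 1)}"
  hence C: "?A \<subseteq> (\<Union>i. C i)" "\<And>i. bounded (C i)" by auto
  have U: "(\<Union>i. closure (C i)) \<in> sets borel" by (intro sets.countable_UN) auto
  have "emeasure (plane_meas e) (cball 0 1) \<le> emeasure (plane_meas e) (\<Union>i. closure (C i))"
  proof (rule emeasure_mono_AE)
   show "AE x in plane_meas e. x \<in> cball 0 1 \<longrightarrow> x \<in> (\<Union>i. closure (C i))"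
    using AE_plane_meas[OF en]
   proof eventually_elim
    fix x assume "x \<bullet> e = 0"
    thus "x \<in> cball 0 1 \<longrightarrow> x \<in> (\<Union>i. closure (C i))" using C(1) closure_subset by blast
   qed
  qed (use U in simp)
  also have "... \<le> (\<Sum>i. emeasure (plane_meas e) (closure (C i)))"
   by (rule emeasure_subadditive_countably) auto
  also have "... \<le> (\<Sum>i. hausdorff_size ?d (C i))"
  proof (rule suminf_le)
   fix i
   show "emeasure (plane_meas e) (closure (C i)) \<le> hausdorff_size ?d (C i)"
    using isodiametric_hyperplane[OF e closed_closure bounded_closure[OF C(2)] n2, of i]
    by (simp add: diameter_closure[OF C(2)])
  qed auto
  finally show "emeasure (plane_meas e) (cball 0 1) \<le> (\<Sum>i. hausdorff_size ?d (C i))" .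
 qed
 also have "... \<le> hausdorff_outer_measure ?d ?A" by (rule hausdorff_premeasure_le_outer) simp
 finally show ?thesis .
qed

text \<open>Hausdorff measure restricted to a hyperplane is invariant under the translations of that
  hyperplane, hence a multiple of \<open>plane_meas\<close>. The factor
  \<open>\<kappa> / \<omega>\<close> is read off on the unit ball; as both measures are compatible
  with rotations, the factor found for one coordinate direction is valid for all
  \<open>\<nu>\<close>.\<close>

lemma hausdorff_hyperplane:
 assumes n2: "2 \<le> CARD('n)"
 obtains c :: real where "1 \<le> c"
  "\<And>\<nu> B. norm \<nu> = 1 ==> B \<in> sets borel ==>
   hausdorff_outer_measure (CARD('n) - 1) (B \<inter> {y. y \<bullet> \<nu> = 0}) =
   ennreal c * emeasure (plane_meas (\<nu> :: real ^ 'n)) B"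
proof -
 let ?d = "CARD('n) - 1"
 have D: "DIM(real ^ 'n) = CARD('n)" by simp
 have d1: "1 \<le> ?d" using n2 by simp
 let ?h = "hausdorff_outer_measure ?d :: (real ^ 'n) set \<Rightarrow> ennreal"
 let ?Q = "cball (0 :: real ^ 'n) 1"
 define P where "P = (%\<nu> :: real ^ 'n. {y. y \<bullet> \<nu> = 0})"
 have Pb: "P \<nu> \<in> sets borel" for \<nu>
 proof -
  have "closed (P \<nu>)" unfolding P_def by (intro closed_Collect_eq continuous_intros)
  thus ?thesis by simp
 qed
 obtain e :: "real ^ 'n" where e: "e \<in> Basis" using nonempty_Basis by blast
 have en: "norm e = 1" using e by simp
 define \<kappa> where "\<kappa> = enn2real (?h (?Q \<inter> P e))"
 define \<omega> where "\<omega> = unit_ball_vol (real ?d)"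
 have \<omega>: "0 < \<omega>" by (simp add: \<omega>_def)
 have Qe: "?Q \<inter> P e = {x \<in> ?Q. x \<bullet> e = 0}" by (auto simp: P_def)
 have n2': "2 \<le> DIM(real ^ 'n)" using n2 by simp
 have \<kappa>: "?h (?Q \<inter> P e) = ennreal \<kappa>"
  using hausdorff_hyperplane_cball_finite[OF e n2'] unfolding \<kappa>_def Qe D by simp
 have le: "emeasure (plane_meas e) ?Q = ennreal \<omega>"
  using plane_meas_cball[OF e, of 1] by (simp add: \<omega>_def)
 have "ennreal \<omega> \<le> ennreal \<kappa>"
  using hausdorff_hyperplane_cball_ge[OF e n2'] unfolding le[symmetric] \<kappa>[symmetric] Qe D .
 hence \<omega>\<kappa>: "\<omega> \<le> \<kappa>" by (simp add: ennreal_le_iff \<kappa>_def)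
 show ?thesis
 proof (rule that[of "\<kappa> / \<omega>"])
  show "1 \<le> \<kappa> / \<omega>" using \<omega> \<omega>\<kappa> by simp
  fix \<nu> :: "real ^ 'n" and B :: "(real ^ 'n) set"
  assume \<nu>: "norm \<nu> = 1" and B: "B \<in> sets borel"
  obtain T where T: "orthogonal_transformation T" "T e = \<nu>"
   using orthogonal_transformation_exists[of e \<nu>] \<nu> en by metis
  have Tn: "norm (T x) = norm x" for x by (rule orthogonal_transformation_norm[OF T(1)])
  have Ti: "T x \<bullet> T y = x \<bullet> y" for x y using T(1) by (simp add: orthogonal_transformation_def)
  have Tsurj: "surj T" by (rule orthogonal_transformation_surj[OF T(1)])
  have TQ: "T -` ?Q = ?Q" using Tn by auto
  have l\<nu>: "emeasure (plane_meas \<nu>) ?Q = ennreal \<omega>"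
   using plane_meas_orthogonal[OF T(1), of ?Q e] T(2) le TQ by simp
  have "?Q \<inter> P \<nu> = T ` (?Q \<inter> P e)"
  proof
   show "T ` (?Q \<inter> P e) \<subseteq> ?Q \<inter> P \<nu>" using Tn Ti T(2) by (auto simp: P_def)
   show "?Q \<inter> P \<nu> \<subseteq> T ` (?Q \<inter> P e)"
   proof
    fix y assume y: "y \<in> ?Q \<inter> P \<nu>"
    obtain x where x: "y = T x" using Tsurj by (metis surjD)
    hence "x \<in> ?Q \<inter> P e" using y Tn[of x] Ti[of x e] T(2) by (auto simp: P_def)
    thus "y \<in> T ` (?Q \<inter> P e)" using x by blast
   qed
  qed
  moreover have "dist (T x) (T y) = dist x y" for x y
   using Tn[of "x - y"] by (simp add: dist_norm linear_diff[OF orthogonal_transformation_linear[OF T(1)]])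
  ultimately have h\<nu>: "?h (?Q \<inter> P \<nu>) = ennreal \<kappa>"
   using hausdorff_outer_measure_isometry[OF d1, of T "?Q \<inter> P e"] \<kappa> by simp
  define M where "M = density (hausdorff_measure ?d) (indicator (P \<nu>))"
  have sM: "sets M = sets borel" by (simp add: M_def)
  have eM: "emeasure M X = ?h (X \<inter> P \<nu>)" if "X \<in> sets borel" for X
  proof -
   have "emeasure M X = emeasure (hausdorff_measure ?d) (P \<nu> \<inter> X)"
    unfolding M_def using that Pb[of \<nu>] by (intro emeasure_restricted) auto
   also have "... = ?h (P \<nu> \<inter> X)" using that Pb[of \<nu>] by (intro emeasure_hausdorff_measure[OF d1]) auto
   finally show ?thesis by (simp only: Int_commute)
  qed
  have tM: "distr M borel ((+) x) = M" if x: "x \<in> P \<nu>" for x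
  proof (rule measure_eqI)
   fix X assume "X \<in> sets (distr M borel ((+) x))"
   hence X: "X \<in> sets borel" by simp
   have vX: "(+) x -` X \<in> sets borel" using measurable_sets_borel[OF _ X, of "(+) x"] by simp
   have "emeasure (distr M borel ((+) x)) X = ?h ((+) x -` X \<inter> P \<nu>)"
   proof -
    have "(+) x \<in> measurable M borel" by (subst measurable_cong_sets[OF sM refl]) simp
    from emeasure_distr[OF this X] show ?thesis
     using vX by (simp add: eM sets_eq_imp_space_eq[OF sM])
   qed
   also have "... = ?h ((+) x ` ((+) x -` X \<inter> P \<nu>))"
    by (rule hausdorff_outer_measure_isometry[OF d1, symmetric]) (simp add: dist_norm)
   also have "(+) x ` ((+) x -` X \<inter> P \<nu>) = X \<inter> P \<nu>"
   proof
    show "(+) x ` ((+) x -` X \<inter> P \<nu>) \<subseteq> X \<inter> P \<nu>" using x by (auto simp: P_def inner_add_left)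
    show "X \<inter> P \<nu> \<subseteq> (+) x ` ((+) x -` X \<inter> P \<nu>)"
    proof
     fix y assume "y \<in> X \<inter> P \<nu>"
     hence "y - x \<in> (+) x -` X \<inter> P \<nu>" using x by (simp add: P_def inner_diff_left)
     moreover have "y = x + (y - x)" by simp
     ultimately show "y \<in> (+) x ` ((+) x -` X \<inter> P \<nu>)" by blast
    qed
   qed
   finally show "emeasure (distr M borel ((+) x)) X = emeasure M X" using X by (simp add: eM)
  qed (simp add: sM)
  have sfM: "sigma_finite_measure M"
  proof (rule sigma_finite_measure_balls[OF sM])
   fix R :: nat
   have "ball 0 (real R) \<inter> P \<nu> \<subseteq> (%x. real (Suc R) *\<^sub>R x) ` (?Q \<inter> P \<nu>)"
   proof
    fix y assume y: "y \<in> ball 0 (real R) \<inter> P \<nu>"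
    hence "inverse (real (Suc R)) *\<^sub>R y \<in> ?Q \<inter> P \<nu>"
     by (auto simp: P_def field_simps)
    moreover have "y = real (Suc R) *\<^sub>R (inverse (real (Suc R)) *\<^sub>R y)" by simp
    ultimately show "y \<in> (%x. real (Suc R) *\<^sub>R x) ` (?Q \<inter> P \<nu>)" by blast
   qed
   hence "?h (ball 0 (real R) \<inter> P \<nu>) \<le> ?h ((%x. real (Suc R) *\<^sub>R x) ` (?Q \<inter> P \<nu>))"
    by (rule hausdorff_outer_measure_mono)
   also have "... \<le> ennreal (real (Suc R) ^ ?d) * ?h (?Q \<inter> P \<nu>)"
    by (rule hausdorff_outer_measure_lipschitz[OF d1]) (auto simp: dist_norm simp flip: scaleR_diff_right)
   also have "... < \<infinity>" unfolding h\<nu> by (simp add: ennreal_mult'[symmetric])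
   finally show "emeasure M (ball 0 (real R)) < \<infinity>" by (simp add: eM)
  qed
  have "AE x in hausdorff_measure ?d. x \<in> P \<nu> \<longrightarrow> x \<in> P \<nu>" by simp
  hence aeM: "AE x in M. x \<in> P \<nu>"
   unfolding M_def using Pb[of \<nu>] by (subst AE_density) (auto simp: indicator_def)
  have aeL: "AE x in plane_meas \<nu>. x \<in> P \<nu>"
   using AE_plane_meas[OF \<nu>] by (simp add: P_def)
  have tL: "distr (plane_meas \<nu>) borel ((+) x) = plane_meas \<nu>" if "x \<in> P \<nu>" for x
   using plane_meas_shift[of x \<nu>] that by (simp add: P_def)
  have "emeasure M B * emeasure (plane_meas \<nu>) ?Q = emeasure M (uminus -` ?Q) * emeasure (plane_meas \<nu>) B"
   by (rule translation_invariant_proportional[OF sM sets_plane_meas sfM sigma_finite_plane_meas[OF \<nu>] aeM aeL tM tL B])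
    auto
  moreover have "uminus -` ?Q = ?Q" by auto
  moreover have "emeasure M ?Q = ennreal \<kappa>" by (subst eM) (simp, rule h\<nu>)
  ultimately have eq: "emeasure M B * ennreal \<omega> = ennreal \<kappa> * emeasure (plane_meas \<nu>) B"
   unfolding l\<nu> by (simp only:)
  have "emeasure M B = emeasure M B * ennreal \<omega> * ennreal (1 / \<omega>)"
   using \<omega> by (simp add: mult.assoc ennreal_mult'[symmetric])
  also have "... = (ennreal \<kappa> * ennreal (1 / \<omega>)) * emeasure (plane_meas \<nu>) B"
   unfolding eq by (simp only: ac_simps)
  also have "ennreal \<kappa> * ennreal (1 / \<omega>) = ennreal (\<kappa> / \<omega>)"
   using \<omega> by (subst ennreal_mult''[symmetric]) simp_all
  finally show "?h (B \<inter> {y. y \<bullet> \<nu> = 0}) = ennreal (\<kappa> / \<omega>) * emeasure (plane_meas \<nu>) B"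
   using eM[OF B] by (simp add: P_def)
 qed
qed

subsection \<open>Calculus up to the boundary of a smooth domain\<close>

lemma has_derivative_transform_local:
 assumes "(f has_derivative A) (at x within S)" "open U" "x \<in> U" "x \<in> S" "\<And>y. y \<in> U \<inter> S ==> f y = g y"
 shows "(g has_derivative A) (at x within S)"
proof -
 obtain e where e: "0 < e" "ball x e \<subseteq> U" using openE[OF assms(2,3)] by metis
 show ?thesis
 proof (rule has_derivative_transform_within[OF assms(1) e(1) assms(4)])
  fix y assume "y \<in> S" "dist y x < e"
  hence "y \<in> U \<inter> S" using e(2) by (metis IntI dist_commute mem_ball subsetD)
  thus "f y = g y" by (rule assms(5))
 qed
qed

locale smooth_dom =
 fixes \<Omega> :: "'a::euclidean_space set"
 assumes dom: "smooth_domain \<Omega>"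
begin

abbreviation "M \<equiv> closure \<Omega>"

text \<open>Taken from \<open>gradient_within\<close>, so that it makes sense up to the boundary
  and, for functions smooth up to the boundary, can be iterated there.\<close>

definition pd :: "'a \<Rightarrow> ('a \<Rightarrow> real) \<Rightarrow> 'a \<Rightarrow> real" where
 "pd b f x = gradient_within M f x \<bullet> b"

lemma open_dom: "open \<Omega>" and dom_nonempty: "\<Omega> \<noteq> {}"
 using dom by (auto simp: smooth_domain_def)

lemma frontier_dom: "frontier \<Omega> = M - \<Omega>"
 using open_dom by (simp add: frontier_def interior_open)

lemma frontier_sub: "frontier \<Omega> \<subseteq> M" and dom_sub: "\<Omega> \<subseteq> M"
 using frontier_dom closure_subset by auto

lemma chart:
 assumes "x \<in> M"
 obtains U \<Phi> \<Psi> e where "half_space_chart M U \<Phi> e" "open U" "x \<in> U" "open (\<Phi> ` U)" "e \<in> Basis" "homeomorphism U (\<Phi> ` U) \<Phi> \<Psi>"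
  "smooth_on U \<Phi>" "smooth_on (\<Phi> ` U) \<Psi>" "\<Phi> ` (U \<inter> M) = \<Phi> ` U \<inter> {y. 0 \<le> e \<bullet> y}"
  "x \<in> frontier \<Omega> \<longrightarrow> e \<bullet> \<Phi> x = 0"
proof -
 have "\<exists>U \<Phi> e. x \<in> U \<and> half_space_chart M U \<Phi> e \<and> (x \<in> frontier \<Omega> \<longrightarrow> e \<bullet> \<Phi> x = 0)"
 proof (cases "x \<in> frontier \<Omega>")
  case True
  hence "x \<in> manifold_boundary M" using dom by (simp add: smooth_domain_def)
  thus ?thesis unfolding manifold_boundary_def by blast
 next
  case False
  have "full_dim_submanifold M" using dom by (simp add: smooth_domain_def)
  thus ?thesis using assms False unfolding full_dim_submanifold_def by blast
 qed
 thus ?thesis unfolding half_space_chart_def using that[unfolded half_space_chart_def] by metis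
qed

text \<open>In a chart, every \<open>w\<close> with \<open>0 \<le> e \<bullet> w\<close> is the
  velocity of a ray that starts within the half space and stays there for a short time. Pulled back,
  it is a one-sided curve in \<open>M\<close> along which \<open>A\<close> and \<open>B\<close> must
  agree. Such vectors and their negatives exhaust the space.\<close>

lemma derivative_unique:
 fixes f :: "'a \<Rightarrow> real"
 assumes x: "x \<in> M" and A: "(f has_derivative A) (at x within M)" and B: "(f has_derivative B) (at x within M)"
 shows "A = B"
proof -
 obtain U \<Phi> \<Psi> e where "half_space_chart M U \<Phi> e" and c: "open U" "x \<in> U" "open (\<Phi> ` U)" "e \<in> Basis" "homeomorphism U (\<Phi> ` U) \<Phi> \<Psi>"
  "smooth_on U \<Phi>" "smooth_on (\<Phi> ` U) \<Psi>" "\<Phi> ` (U \<inter> M) = \<Phi> ` U \<inter> {y. 0 \<le> e \<bullet> y}"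
  and "x \<in> frontier \<Omega> \<longrightarrow> e \<bullet> \<Phi> x = 0"
  by (rule chart[OF x])
 define y where "y = \<Phi> x"
 have y: "y \<in> \<Phi> ` U" "0 \<le> e \<bullet> y" using c(2,8) x by (auto simp: y_def)
 have \<Psi>\<Phi>: "\<Psi> (\<Phi> z) = z" if "z \<in> U" for z using c(5) that by (simp add: homeomorphism_def)
 define D\<Psi> where "D\<Psi> = frechet_derivative \<Psi> (at y)"
 define D\<Phi> where "D\<Phi> = frechet_derivative \<Phi> (at x)"
 have d\<Psi>: "(\<Psi> has_derivative D\<Psi>) (at y)" unfolding D\<Psi>_def by (rule smooth_on_has_derivative[OF c(7) y(1)])
 have d\<Phi>: "(\<Phi> has_derivative D\<Phi>) (at x)" unfolding D\<Phi>_def by (rule smooth_on_has_derivative[OF c(6,2)])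
 have "((%z. \<Psi> (\<Phi> z)) has_derivative (%v. D\<Psi> (D\<Phi> v))) (at x)"
  by (rule has_derivative_compose[OF d\<Phi>]) (use d\<Psi> y_def in simp)
 hence "((%z. z) has_derivative (%v. D\<Psi> (D\<Phi> v))) (at x)"
  by (rule has_derivative_transform_within_open[OF _ c(1,2)]) (rule \<Psi>\<Phi>)
 from has_derivative_unique[OF this has_derivative_ident] have inv: "D\<Psi> (D\<Phi> v) = v" for v by (metis)
 have half: "A (D\<Psi> w) = B (D\<Psi> w)" if w: "0 \<le> e \<bullet> w" for w
 proof -
  have "open ((%t::real. y + t *\<^sub>R w) -` (\<Phi> ` U))"
   by (rule open_vimage[OF c(3)]) (intro continuous_intros)
  moreover have "0 \<in> (%t::real. y + t *\<^sub>R w) -` (\<Phi> ` U)" using y by simp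
  ultimately obtain \<epsilon> where \<epsilon>: "0 < \<epsilon>" "ball 0 \<epsilon> \<subseteq> (%t::real. y + t *\<^sub>R w) -` (\<Phi> ` U)"
   using open_contains_ball by blast
  define I where "I = {0..\<epsilon>/2}"
  define \<gamma> where "\<gamma> = (%t::real. \<Psi> (y + t *\<^sub>R w))"
  have \<gamma>M: "\<gamma> t \<in> M" if "t \<in> I" for t
  proof -
   have t: "0 \<le> t" "t \<in> ball 0 \<epsilon>" using that \<epsilon>(1) by (auto simp: I_def)
   have "0 \<le> e \<bullet> (y + t *\<^sub>R w)" using y(2) w t by (simp add: inner_add_right)
   hence "y + t *\<^sub>R w \<in> \<Phi> ` (U \<inter> M)" unfolding c(8) using \<epsilon>(2) t by blast
   thus ?thesis using \<Psi>\<Phi> by (auto simp: \<gamma>_def)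
  qed
  have \<gamma>0: "\<gamma> 0 = x" using \<Psi>\<Phi>[OF c(2)] by (simp add: \<gamma>_def y_def)
  have l\<Psi>: "linear D\<Psi>" by (rule has_derivative_linear[OF d\<Psi>])
  have "((%t::real. y + t *\<^sub>R w) has_derivative (%s. s *\<^sub>R w)) (at 0 within I)"
   by (auto intro!: derivative_eq_intros)
  from has_derivative_compose[OF this, of \<Psi> D\<Psi>] d\<Psi>
  have d\<gamma>: "(\<gamma> has_derivative (%s. s *\<^sub>R D\<Psi> w)) (at 0 within I)"
   by (simp add: \<gamma>_def linear_scale[OF l\<Psi>])
  have comp: "((%t. f (\<gamma> t)) has_derivative (%s. F (s *\<^sub>R D\<Psi> w))) (at 0 within I)"
   if "(f has_derivative F) (at x within M)" for F
  proof (rule has_derivative_in_compose[OF d\<gamma>])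
   show "(f has_derivative F) (at (\<gamma> 0) within \<gamma> ` I)"
    unfolding \<gamma>0 by (rule has_derivative_subset[OF that]) (use \<gamma>M in blast)
  qed
  have "(%s. A (s *\<^sub>R D\<Psi> w)) = (%s. B (s *\<^sub>R D\<Psi> w))"
  proof (rule frechet_derivative_unique_within_closed_interval[where x="0::real" and a=0 and b="\<epsilon>/2"])
   show "((%t. f (\<gamma> t)) has_derivative (%s. A (s *\<^sub>R D\<Psi> w))) (at 0 within cbox 0 (\<epsilon>/2))"
    using comp[OF A] by (simp add: I_def)
   show "((%t. f (\<gamma> t)) has_derivative (%s. B (s *\<^sub>R D\<Psi> w))) (at 0 within cbox 0 (\<epsilon>/2))"
    using comp[OF B] by (simp add: I_def)
  qed (use \<epsilon> in auto)
  from fun_cong[OF this, of 1] show ?thesis by simp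
 qed
 have lA: "linear A" "linear B" "linear D\<Psi>" using A B d\<Psi> has_derivative_linear by blast+
 have "A v = B v" for v
 proof (cases "0 \<le> e \<bullet> D\<Phi> v")
  case True
  from half[OF this] show ?thesis by (simp add: inv)
 next
  case False
  hence "0 \<le> e \<bullet> (- D\<Phi> v)" by simp
  from half[OF this] show ?thesis by (simp add: inv linear_neg[OF lA(1)] linear_neg[OF lA(2)] linear_neg[OF lA(3)])
 qed
 thus ?thesis by blast
qed

lemma gradient_within_eq:
 assumes x: "x \<in> M" and A: "(f has_derivative A) (at x within M)"
 shows "A = (%h. gradient_within M f x \<bullet> h)"
proof -
 define g where "g = (SB b. A b *\<^sub>R b)"
 have l: "linear A" using A has_derivative_linear by blast
 have Ag: "A h = g \<bullet> h" for h
 proof -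
  have "A h = A (SB b. (h \<bullet> b) *\<^sub>R b)" by (simp add: euclidean_representation)
  also have "... = (SB b. (h \<bullet> b) * A b)" by (simp add: linear_sum[OF l] linear_scale[OF l])
  also have "... = g \<bullet> h" unfolding g_def inner_sum_left
   by (intro sum.cong) (auto simp: inner_commute mult.commute)
  finally show ?thesis .
 qed
 have gd: "(f has_derivative (%h. g \<bullet> h)) (at x within M)" using A Ag by (metis (no_types, lifting) ext)
 have "gradient_within M f x = g" unfolding gradient_within_def
 proof (rule the_equality)
  show "(f has_derivative (%h. g \<bullet> h)) (at x within M)" by (rule gd)
  fix g' assume "(f has_derivative (%h. g' \<bullet> h)) (at x within M)"
  from fun_cong[OF derivative_unique[OF x this gd]] show "g' = g" by (metis vector_eq_rdot)
 qed
 thus ?thesis using Ag by auto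
qed

lemma pd_eqI:
 assumes "x \<in> M" "(f has_derivative A) (at x within M)"
 shows "pd b f x = A b"
 using fun_cong[OF gradient_within_eq[OF assms], of b] by (simp add: pd_def)

abbreviation sm :: "('a \<Rightarrow> real) \<Rightarrow> bool" where "sm \<equiv> smooth_on_subset M"

lemma sm_ext:
 assumes "sm f" "x \<in> M"
 obtains U g where "open U" "x \<in> U" "smooth_on U g" "\<forall>y\<in>U \<inter> M. g y = f y"
proof -
 from assms have "\<exists>U g. open U \<and> x \<in> U \<and> smooth_on U g \<and> (\<forall>y\<in>U \<inter> M. g y = f y)"
  unfolding smooth_on_subset_def by (rule bspec)
 then obtain U g where "open U \<and> x \<in> U \<and> smooth_on U g \<and> (\<forall>y\<in>U \<inter> M. g y = f y)" by (elim exE)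
 thus ?thesis by (intro that[of U g]) simp_all
qed

lemma sm_local:
 assumes "sm f" "x \<in> M"
 obtains U g where "open U" "x \<in> U" "smooth_on U g" "\<forall>y\<in>U \<inter> M. g y = f y"
  "\<forall>y\<in>U \<inter> M. (f has_derivative fd g y) (at y within M)"
  "\<forall>y\<in>U \<inter> M. \<forall>b. pd b f y = fd g y b"
proof -
 obtain U g where g: "open U" "x \<in> U" "smooth_on U g" "\<forall>y\<in>U \<inter> M. g y = f y"
  by (rule sm_ext[OF assms])
 have d: "(f has_derivative fd g y) (at y within M)" if y: "y \<in> U \<inter> M" for y
 proof (rule has_derivative_transform_local[OF _ g(1) _ _ bspec[OF g(4)]])
  show "(g has_derivative fd g y) (at y within M)"
   by (rule has_derivative_at_withinI[OF smooth_on_has_derivative[OF g(3)]]) (use y in simp)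
 qed (use y in simp_all)
 have e: "pd b f y = fd g y b" if "y \<in> U \<inter> M" for y b
  using that by (intro pd_eqI[OF _ d[OF that]]) simp
 show ?thesis by (rule that[OF g]) (intro ballI d, assumption, intro ballI allI e, assumption)
qed

lemma sm_has_derivative:
 assumes "sm f" "x \<in> M"
 shows "(f has_derivative (%h. gradient_within M f x \<bullet> h)) (at x within M)"
proof -
 obtain U g where g: "open U" "x \<in> U" "smooth_on U g" "\<forall>y\<in>U \<inter> M. g y = f y"
  "\<forall>y\<in>U \<inter> M. (f has_derivative fd g y) (at y within M)"
  "\<forall>y\<in>U \<inter> M. \<forall>b. pd b f y = fd g y b"
  by (rule sm_local[OF assms])
 have d: "(f has_derivative fd g x) (at x within M)" by (rule bspec[OF g(5)]) (use g(2) assms(2) in simp)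
 show ?thesis using d gradient_within_eq[OF assms(2) d] by simp
qed

lemma sm_has_derivative_interior:
 assumes "sm f" "x \<in> \<Omega>"
 shows "(f has_derivative (%h. gradient_within M f x \<bullet> h)) (at x)"
proof -
 have "(f has_derivative (%h. gradient_within M f x \<bullet> h)) (at x within M)"
  by (rule sm_has_derivative) (use assms dom_sub in auto)
 hence "(f has_derivative (%h. gradient_within M f x \<bullet> h)) (at x within \<Omega>)"
  by (rule has_derivative_subset) (rule dom_sub)
 thus ?thesis using at_within_open[OF assms(2) open_dom] by simp
qed

lemma sm_continuous: "sm f ==> continuous_on M f"
 unfolding continuous_on_eq_continuous_within
 using has_derivative_continuous[OF sm_has_derivative] by simp

lemma sm_pd: assumes "sm f" shows "sm (pd b f)"
 unfolding smooth_on_subset_def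
proof
 fix x assume "x \<in> M"
 then obtain U g where g: "open U" "x \<in> U" "smooth_on U g" and "\<forall>y\<in>U \<inter> M. g y = f y"
  and "\<forall>y\<in>U \<inter> M. (f has_derivative fd g y) (at y within M)"
  and g4: "\<forall>y\<in>U \<inter> M. \<forall>b. pd b f y = fd g y b"
  by (rule sm_local[OF assms])
 have "smooth_on U (%y. fd g y b)" by (rule smooth_on_frechet[OF g(3)])
 thus "\<exists>U g. open U \<and> x \<in> U \<and> smooth_on U g \<and> (\<forall>y\<in>U \<inter> M. g y = pd b f y)"
  using g g4 by (intro exI[of _ U] exI[of _ "%y. fd g y b"]) simp
qed

lemma sm_of_smooth: "smooth_on UNIV f ==> sm f"
 unfolding smooth_on_subset_def by (intro ballI exI[of _ UNIV] exI[of _ f]) auto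

lemma sm_const: "sm (%x. c)" by (rule sm_of_smooth[OF smooth_on_const])

lemma sm_inner: "sm (%x. x \<bullet> v)" by (rule sm_of_smooth[OF smooth_on_bounded_linear[OF bounded_linear_inner_left]])

lemma sm_binary:
 assumes op: "\<And>(U :: 'a set) f g. open U ==> smooth_on U f ==> smooth_on U g ==> smooth_on U (%x. F (f x) (g x))"
  and f: "sm f" and g: "sm g"
 shows "sm (%x. F (f x) (g x))"
 unfolding smooth_on_subset_def
proof
 fix x assume x: "x \<in> M"
 obtain U f' where f': "open U" "x \<in> U" "smooth_on U f'" "\<forall>y\<in>U \<inter> M. f' y = f y"
  by (rule sm_ext[OF f x])
 obtain V g' where g': "open V" "x \<in> V" "smooth_on V g'" "\<forall>y\<in>V \<inter> M. g' y = g y"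
  by (rule sm_ext[OF g x])
 have "smooth_on (U \<inter> V) (%x. F (f' x) (g' x))"
  by (rule op[OF open_Int[OF f'(1) g'(1)] smooth_on_subset_mono[OF f'(3)] smooth_on_subset_mono[OF g'(3)]]) auto
 thus "\<exists>U h. open U \<and> x \<in> U \<and> smooth_on U h \<and> (\<forall>y\<in>U \<inter> M. h y = F (f y) (g y))"
  using f' g' by (intro exI[of _ "U \<inter> V"] exI[of _ "%x. F (f' x) (g' x)"]) auto
qed

lemma sm_add: "sm f ==> sm g ==> sm (%x. f x + g x)"
 by (rule sm_binary[where F="(+)"], rule smooth_on_add, assumption+)

lemma sm_mult: "sm f ==> sm g ==> sm (%x. f x * g x)"
 by (rule sm_binary[where F="(*)"], rule smooth_on_mult, assumption+)

lemma sm_minus: "sm f ==> sm (%x. - f x)"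
 using sm_mult[OF sm_const[of "-1"], of f] by simp

lemma sm_diff: "sm f ==> sm g ==> sm (%x. f x - g x)"
 using sm_add[OF _ sm_minus, of f g] by simp

lemma sm_power2: "sm f ==> sm (%x. (f x)\<^sup>2)"
 using sm_mult[of f f] by (simp only: power2_eq_square)

lemma sm_sum: "(\<And>i. i \<in> I ==> sm (f i)) ==> sm (%x. \<Sum>i\<in>I. f i x)"
 by (induction I rule: infinite_finite_induct) (simp_all add: sm_const sm_add)

lemma sm_compose:
 assumes "smooth_on UNIV h" "sm f"
 shows "sm (%x. h (f x))"
proof -
 have "sm (%x. (%a b. h a) (f x) (f x))"
  by (rule sm_binary[OF _ assms(2,2)], rule smooth_on_compose_real[OF assms(1)], assumption, assumption, rule subset_UNIV)
 thus ?thesis by simp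
qed

lemma sm_inverse_local:
 assumes f: "sm f" and x: "x \<in> M" "f x \<noteq> 0"
 shows "\<exists>U g. open U \<and> x \<in> U \<and> smooth_on U g \<and> (\<forall>y\<in>U \<inter> M. g y = inverse (f y))"
proof -
 obtain U g where g: "open U" "x \<in> U" "smooth_on U g" "\<forall>y\<in>U \<inter> M. g y = f y"
  by (rule sm_ext[OF f x(1)])
 define V where "V = {y \<in> U. g y \<noteq> 0}"
 have "open (U \<inter> g -` (- {0}))"
  by (rule continuous_open_preimage[OF smooth_on_imp_continuous[OF g(3)] g(1)]) auto
 moreover have "U \<inter> g -` (- {0}) = V" by (auto simp: V_def)
 ultimately have V: "open V" by simp
 have "smooth_on V (%y. inverse (g y))"
  by (rule smooth_on_inverse[OF V smooth_on_subset_mono[OF g(3)]]) (auto simp: V_def)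
 moreover have "x \<in> V" using g(2,4) x by (simp add: V_def)
 ultimately show ?thesis using V g(4) by (intro exI[of _ V] exI[of _ "%y. inverse (g y)"]) (auto simp: V_def)
qed

lemma sm_inverse: "sm f ==> (\<And>x. x \<in> M ==> f x \<noteq> 0) ==> sm (%x. inverse (f x))"
 unfolding smooth_on_subset_def[of M "%x. inverse (f x)"] by (intro ballI sm_inverse_local) simp_all

text \<open>Off \<open>K\<close> the product is locally 0 whatever \<open>g\<close> does there,
  zeros included. So a denominator has to be controlled only on a closed set that carries the
  numerator, as in the partition of unity and in the division by a component of
  \<open>Du\<close>.\<close>

lemma sm_quotient:
 assumes f: "sm f" and g: "sm g" and K: "closed K" "\<And>x. x \<in> M ==> x \<notin> K ==> f x = 0" "\<And>x. x \<in> M ==> x \<in> K ==> g x \<noteq> 0"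
 shows "sm (%x. f x * inverse (g x))"
 unfolding smooth_on_subset_def
proof
 fix x assume x: "x \<in> M"
 show "\<exists>U h. open U \<and> x \<in> U \<and> smooth_on U h \<and> (\<forall>y\<in>U \<inter> M. h y = f y * inverse (g y))"
 proof (cases "x \<in> K")
  case True
  obtain U h where h: "open U" "x \<in> U" "smooth_on U h" "\<forall>y\<in>U \<inter> M. h y = inverse (g y)"
   using sm_inverse_local[OF g x K(3)[OF x True]] by blast
  obtain V k where k: "open V" "x \<in> V" "smooth_on V k" "\<forall>y\<in>V \<inter> M. k y = f y" by (rule sm_ext[OF f x])
  have "smooth_on (U \<inter> V) (%y. k y * h y)"
   by (intro smooth_on_mult open_Int h k smooth_on_subset_mono[OF h(3)] smooth_on_subset_mono[OF k(3)]) auto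
  thus ?thesis using h k by (intro exI[of _ "U \<inter> V"] exI[of _ "%y. k y * h y"]) (simp add: open_Int)
 next
  case False
  thus ?thesis using K(1,2)
   by (intro exI[of _ "- K"] exI[of _ "%_. 0"]) (simp add: smooth_on_const open_Compl)
 qed
qed

lemma pd_const: "x \<in> M ==> pd b (%x. c) x = 0"
 by (rule pd_eqI[OF _ has_derivative_const])

lemma pd_inner: "x \<in> M ==> pd b (%x. x \<bullet> v) x = b \<bullet> v"
 by (rule pd_eqI[where A="%h. h \<bullet> v"]) (auto intro!: derivative_eq_intros)

lemma pd_add: "sm f ==> sm g ==> x \<in> M ==> pd b (%x. f x + g x) x = pd b f x + pd b g x"
 unfolding pd_def[of b f] pd_def[of b g]
 by (rule pd_eqI, assumption, rule has_derivative_add) (rule sm_has_derivative, assumption+)+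

lemma pd_mult: "sm f ==> sm g ==> x \<in> M ==> pd b (%x. f x * g x) x = f x * pd b g x + pd b f x * g x"
 unfolding pd_def[of b f] pd_def[of b g]
 by (rule pd_eqI, assumption, rule has_derivative_mult) (rule sm_has_derivative, assumption+)+

lemma pd_cmult: "sm f ==> x \<in> M ==> pd b (%x. c * f x) x = c * pd b f x"
 using pd_mult[OF sm_const[of c]] pd_const by simp

lemma pd_minus: "sm f ==> x \<in> M ==> pd b (%x. - f x) x = - pd b f x"
 using pd_cmult[of f x b "-1"] by simp

lemma pd_diff: "sm f ==> sm g ==> x \<in> M ==> pd b (%x. f x - g x) x = pd b f x - pd b g x"
 using pd_add[OF _ sm_minus, of f g x b] pd_minus[of g x b] by simp

lemma pd_power2: "sm f ==> x \<in> M ==> pd b (%x. (f x)\<^sup>2) x = 2 * f x * pd b f x"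
 using pd_mult[of f f x b] by (simp add: power2_eq_square)

lemma pd_sum:
 "finite I ==> (\<And>i. i \<in> I ==> sm (f i)) ==> x \<in> M ==> pd b (%x. \<Sum>i\<in>I. f i x) x = (\<Sum>i\<in>I. pd b (f i) x)"
 by (induction I rule: finite_induct) (simp_all add: pd_const pd_add sm_sum)

lemma pd_compose:
 assumes h: "\<And>t. (h has_real_derivative h' t) (at t)" and f: "sm f" and x: "x \<in> M"
 shows "pd b (%x. h (f x)) x = h' (f x) * pd b f x"
proof -
 have "(h has_derivative (%t. h' (f x) * t)) (at (f x))" using h[of "f x"] by (simp add: has_field_derivative_def)
 from has_derivative_compose[OF sm_has_derivative[OF f x] this]
 show ?thesis unfolding pd_def[of b f] by (rule pd_eqI[OF x])
qed

lemma pd_inverse: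
 assumes f: "sm f" and x: "x \<in> M" "f x \<noteq> 0"
 shows "pd b (%x. inverse (f x)) x = - (inverse (f x) * pd b f x * inverse (f x))"
 unfolding pd_def[of b f] by (rule pd_eqI[OF x(1) Deriv.has_derivative_inverse[OF x(2) sm_has_derivative[OF f x(1)]]])

lemma pd_cong:
 assumes "x \<in> M" "\<And>y. y \<in> M ==> f y = g y"
 shows "pd b f x = pd b g x"
proof -
 have "(f has_derivative A) (at x within M) \<longleftrightarrow> (g has_derivative A) (at x within M)" for A
  by (rule iffI; erule has_derivative_transform[rotated 2]) (use assms in simp_all)
 thus ?thesis by (simp add: pd_def gradient_within_def)
qed

lemma pd_cong_local:
 assumes "x \<in> U" "open U" "x \<in> M" "\<And>y. y \<in> U \<inter> M ==> f y = g y" "sm f"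
 shows "pd b f x = pd b g x"
proof -
 have "(g has_derivative (%h. gradient_within M f x \<bullet> h)) (at x within M)"
  by (rule has_derivative_transform_local[OF sm_has_derivative[OF assms(5,3)] assms(2,1,3,4)])
 from pd_eqI[OF assms(3) this, of b] show ?thesis by (simp add: pd_def)
qed

lemma pd_commute:
 assumes f: "sm f" and x: "x \<in> M"
 shows "pd b (pd c f) x = pd c (pd b f) x"
proof -
 obtain U g where g: "open U" "x \<in> U" "smooth_on U g" and "\<forall>y\<in>U \<inter> M. g y = f y"
  and "\<forall>y\<in>U \<inter> M. (f has_derivative fd g y) (at y within M)"
  and g4: "\<forall>y\<in>U \<inter> M. \<forall>b. pd b f y = fd g y b"
  by (rule sm_local[OF f x])
 have second: "pd b (pd c f) x = frechet_derivative (%y. fd g y c) (at x) b" for b c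
 proof (rule pd_eqI[OF x])
  have "((%y. fd g y c) has_derivative frechet_derivative (%y. fd g y c) (at x)) (at x within M)"
   by (rule has_derivative_at_withinI[OF smooth_on_has_derivative[OF smooth_on_frechet[OF g(3)] g(2)]])
  thus "(pd c f has_derivative frechet_derivative (%y. fd g y c) (at x)) (at x within M)"
   by (rule has_derivative_transform_local[OF _ g(1,2) x]) (simp add: g4)
 qed
 show ?thesis unfolding second by (rule frechet_derivative_commute[OF g(3,1,2)])
qed

lemma gradient_inner: "gradient_within M f x \<bullet> h = (SB b. pd b f x * (h \<bullet> b))"
 unfolding pd_def by (subst euclidean_inner) (rule sum.cong, auto)

lemma norm_gradient: "(norm (gradient_within M f x))\<^sup>2 = (SB b. (pd b f x)\<^sup>2)"
 unfolding power2_norm_eq_inner by (subst euclidean_inner) (simp add: pd_def power2_eq_square)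

lemma laplacian_eq:
 assumes f: "sm f" and x: "x \<in> \<Omega>"
 shows "laplacian f x = (SB b. pd b (pd b f) x)"
 unfolding laplacian_def
proof (rule sum.cong[OF refl])
 fix b :: 'a
 have e: "fd f y b = pd b f y" if "y \<in> \<Omega>" for y
  using fun_cong[OF frechet_derivative_at[OF sm_has_derivative_interior[OF f that]], of b] by (simp add: pd_def)
 have "((%y. fd f y b) has_derivative (%h. gradient_within M (pd b f) x \<bullet> h)) (at x)"
  by (rule has_derivative_transform_within_open[OF sm_has_derivative_interior[OF sm_pd[OF f, of b] x] open_dom x])
   (simp add: e)
 from fun_cong[OF frechet_derivative_at[OF this], of b]
 show "frechet_derivative (%y. fd f y b) (at x) b = pd b (pd b f) x" by (simp add: pd_def)
qed

end

text \<open>Expand the standard basis in \<open>B\<close> and exchange the sums. It will be applied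
  to a basis of the tangent space completed by the normal.\<close>

lemma trace_orthonormal:
 fixes A :: "'a::euclidean_space \<Rightarrow> 'a"
 assumes A: "linear A" and B: "pairwise orthogonal B" "\<And>b. b \<in> B ==> norm b = 1" "span B = UNIV"
 shows "(\<Sum>b\<in>B. A b \<bullet> b) = (SB b. A b \<bullet> b)"
proof -
 have "0 \<notin> B" using B(2) by force
 hence fB: "finite B" using B(1) pairwise_orthogonal_independent independent_imp_finite by blast
 have ex: "(\<Sum>i\<in>B. (x \<bullet> i) *\<^sub>R i) = x" for x
  by (rule orthonormal_basis_expand[OF B(1,2) _ fB]) (simp_all add: B(3))
 have "(SB c. A c \<bullet> c) = (SB c. A (\<Sum>i\<in>B. (c \<bullet> i) *\<^sub>R i) \<bullet> c)" by (simp only: ex)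
 also have "... = (SB c. \<Sum>i\<in>B. (c \<bullet> i) * (A i \<bullet> c))"
  by (simp add: linear_sum[OF A] linear_scale[OF A] inner_sum_left)
 also have "... = (\<Sum>i\<in>B. SB c. (c \<bullet> i) * (A i \<bullet> c))" by (rule sum.swap)
 also have "... = (\<Sum>i\<in>B. A i \<bullet> i)"
 proof (rule sum.cong[OF refl])
  fix i
  show "(SB c. (c \<bullet> i) * (A i \<bullet> c)) = A i \<bullet> i"
   by (subst euclidean_inner) (rule sum.cong, simp_all add: inner_commute mult.commute)
 qed
 finally show ?thesis ..
qed

subsection \<open>Boundary geometry of a solution of Serrin's problem\<close>

locale serrin_dom = smooth_dom \<Omega> for \<Omega> :: "'a::euclidean_space set" +
 fixes u :: "'a \<Rightarrow> real"
 assumes smu: "smooth_on_subset (closure \<Omega>) u"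
  and lap_interior: "\<And>x. x \<in> \<Omega> ==> - laplacian u x = real DIM('a)"
  and u_pos: "\<And>x. x \<in> \<Omega> ==> 0 < u x"
  and u_zero: "\<And>x. x \<in> frontier \<Omega> ==> u x = 0"
  and grad_one: "\<And>x. x \<in> frontier \<Omega> ==> norm (gradient_within (closure \<Omega>) u x) = 1"
begin

abbreviation "Du x \<equiv> gradient_within M u x"

text \<open>The equation extends to the closure by continuity of the second derivatives; the mean
  curvature is computed from it on the boundary.\<close>

lemma lap: assumes "x \<in> M" shows "(SB b. pd b (pd b u) x) = - real DIM('a)"
proof (rule continuous_constant_on_closure[OF _ _ assms])
 show "continuous_on M (%x. SB b. pd b (pd b u) x)"
  by (rule sm_continuous, rule sm_sum, rule sm_pd, rule sm_pd, rule smu)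
 show "(SB b. pd b (pd b u) x) = - real DIM('a)" if "x \<in> \<Omega>" for x
  using lap_interior[OF that] laplacian_eq[OF smu that] by simp
qed

lemma u_nonneg: "x \<in> M ==> 0 \<le> u x"
 using u_pos[of x] u_zero[of x] frontier_dom by (cases "x \<in> \<Omega>") auto

lemma u_zero_iff: "x \<in> M ==> u x = 0 \<longleftrightarrow> x \<in> frontier \<Omega>"
 using u_pos[of x] u_zero[of x] frontier_dom by (cases "x \<in> \<Omega>") auto

lemma grad_sq: "x \<in> frontier \<Omega> ==> (SB b. (pd b u x)\<^sup>2) = 1"
 using norm_gradient[of u x] grad_one[of x] by simp

lemma Du_continuous: "continuous_on M (%x. Du x)"
proof -
 have eq: "Du x = (SB b. pd b u x *\<^sub>R b)" for x by (simp add: pd_def euclidean_representation)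
 show ?thesis unfolding eq by (intro continuous_intros sm_continuous sm_pd smu)
qed

text \<open>The increment estimate rests on the mean value inequality, which wants a convex set, and
  \<open>ball p r \<inter> M\<close> need not be one. So it is proved for a smooth extension of
  \<open>u\<close> on the full ball, where each partial derivative varies from its value at
  \<open>p\<close> by at most \<open>\<eta> = \<delta> / n\<close>.\<close>

lemma boundary_ball:
 assumes p: "p \<in> frontier \<Omega>" and \<delta>: "0 < \<delta>"
 obtains r where "0 < r"
  "\<forall>x\<in>ball p r \<inter> M. \<forall>y\<in>ball p r \<inter> M. \<bar>u x - u y - Du p \<bullet> (x - y)\<bar> \<le> \<delta> * norm (x - y)"
  "\<forall>x\<in>ball p r \<inter> M. \<forall>h. \<bar>Du x \<bullet> h - Du p \<bullet> h\<bar> \<le> \<delta> * norm h"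
proof -
 have pM: "p \<in> M" using p frontier_sub by blast
 obtain U g where g: "open U" "p \<in> U" "smooth_on U g" and g3: "\<forall>y\<in>U \<inter> M. g y = u y"
  and g4: "\<forall>y\<in>U \<inter> M. (u has_derivative fd g y) (at y within M)"
  and g5: "\<forall>y\<in>U \<inter> M. \<forall>b. pd b u y = fd g y b"
  by (rule sm_local[OF smu pM])
 define \<eta> where "\<eta> = \<delta> / real DIM('a)"
 have \<eta>: "0 < \<eta>" using \<delta> by (simp add: \<eta>_def)
 have "\<exists>d>0. \<forall>x\<in>ball p d. \<bar>fd g x b - fd g p b\<bar> < \<eta>" for b
 proof -
  have "continuous_on U (%x. fd g x b)"
   by (rule smooth_on_imp_continuous[OF smooth_on_frechet[OF g(3)]])
  hence "isCont (%x. fd g x b) p" using g(1,2) by (simp add: continuous_on_eq_continuous_at)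
  then obtain d where "0 < d" "\<forall>x. dist x p < d \<longrightarrow> dist (fd g x b) (fd g p b) < \<eta>"
   using \<eta> unfolding continuous_at_eps_delta by blast
  thus ?thesis by (intro exI[of _ d]) (auto simp: dist_commute dist_real_def)
 qed
 then obtain d where d: "\<And>b. 0 < d b" "\<And>b x. x \<in> ball p (d b) ==> \<bar>fd g x b - fd g p b\<bar> < \<eta>"
  by metis
 obtain r0 where r0: "0 < r0" "ball p r0 \<subseteq> U" using openE[OF g(1,2)] by metis
 define r where "r = min r0 (Min (d ` Basis))"
 have "0 < Min (d ` Basis)" using d(1) by (subst Min_gr_iff) auto
 hence r: "0 < r" using r0 by (simp add: r_def)
 have rd: "r \<le> d b" if "b \<in> Basis" for b
 proof -
  have "Min (d ` Basis) \<le> d b" using that by (intro Min_le) auto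
  thus ?thesis by (simp add: r_def)
 qed
 have rU: "ball p r \<subseteq> U" using r0(2) by (auto simp: r_def)
 have lin: "linear (fd g x)" if "x \<in> U" for x
  by (rule has_derivative_linear[OF smooth_on_has_derivative[OF g(3) that]])
 have expand: "fd g x h = (SB b. (h \<bullet> b) * fd g x b)" if "x \<in> U" for x h
 proof -
  have "fd g x h = fd g x (SB b. (h \<bullet> b) *\<^sub>R b)"
   by (simp only: euclidean_representation)
  also have "... = (SB b. (h \<bullet> b) * fd g x b)"
   by (simp add: linear_sum[OF lin[OF that]] linear_scale[OF lin[OF that]])
  finally show ?thesis .
 qed
 have close: "\<bar>fd g x h - fd g p h\<bar> \<le> \<delta> * norm h" if x: "x \<in> ball p r" for x h
 proof -
  have xU: "x \<in> U" using x rU by blast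
  have "fd g x h - fd g p h =
    (SB b. (h \<bullet> b) * (fd g x b - fd g p b))"
   unfolding expand[OF xU, of h] expand[OF g(2), of h] by (simp add: sum_subtractf right_diff_distrib)
  also have "\<bar>...\<bar> \<le> (SB b. \<bar>(h \<bullet> b) * (fd g x b - fd g p b)\<bar>)"
   by (rule sum_abs)
  also have "... \<le> (\<Sum>b\<in>(Basis::'a set). norm h * \<eta>)"
  proof (rule sum_mono)
   fix b :: 'a assume b: "b \<in> Basis"
   have "\<bar>fd g x b - fd g p b\<bar> \<le> \<eta>"
    by (rule less_imp_le[OF d(2)]) (use x rd[OF b] in auto)
   thus "\<bar>(h \<bullet> b) * (fd g x b - fd g p b)\<bar> \<le> norm h * \<eta>"
    unfolding abs_mult using Basis_le_norm[OF b, of h] by (intro mult_mono) auto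
  qed
  also have "... = \<delta> * norm h" by (simp add: \<eta>_def)
  finally show ?thesis .
 qed
 have gp: "fd g x h = Du x \<bullet> h" if "x \<in> U \<inter> M" for x h
 proof -
  have "x \<in> U" using that by simp
  have "Du x \<bullet> h = (SB b. pd b u x * (h \<bullet> b))" by (rule gradient_inner)
  also have "... = (SB b. (h \<bullet> b) * fd g x b)"
   using g5 that by (intro sum.cong) (simp_all add: mult.commute)
  finally show ?thesis unfolding expand[OF \<open>x \<in> U\<close>, of h] by simp
 qed
 have gpp: "fd g p h = Du p \<bullet> h" for h by (rule gp) (use g(2) pM in simp)
 show ?thesis
 proof (rule that[OF r])
  show "\<forall>x\<in>ball p r \<inter> M. \<forall>h. \<bar>Du x \<bullet> h - Du p \<bullet> h\<bar> \<le> \<delta> * norm h"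
  proof (intro ballI allI)
   fix x h assume x: "x \<in> ball p r \<inter> M"
   hence "x \<in> U \<inter> M" using rU by blast
   thus "\<bar>Du x \<bullet> h - Du p \<bullet> h\<bar> \<le> \<delta> * norm h" using close[of x h] x gp[of x h] gpp[of h] by simp
  qed
  show "\<forall>x\<in>ball p r \<inter> M. \<forall>y\<in>ball p r \<inter> M. \<bar>u x - u y - Du p \<bullet> (x - y)\<bar> \<le> \<delta> * norm (x - y)"
  proof (intro ballI)
   fix x y assume x: "x \<in> ball p r \<inter> M" and y: "y \<in> ball p r \<inter> M"
   define G where "G = (%z. g z - Du p \<bullet> z)"
   have "norm (G x - G y) \<le> \<delta> * norm (x - y)"
   proof (rule differentiable_bound[OF convex_ball[of p r], where f'="%z h. fd g z h - Du p \<bullet> h"])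
    fix z assume z: "z \<in> ball p r"
    hence "z \<in> U" using rU by blast
    show "(G has_derivative (%h. fd g z h - Du p \<bullet> h)) (at z within ball p r)"
     unfolding G_def
     by (intro has_derivative_diff has_derivative_at_withinI[OF smooth_on_has_derivative[OF g(3) \<open>z \<in> U\<close>]]
       has_derivative_inner_right has_derivative_ident)
    show "onorm (%h. fd g z h - Du p \<bullet> h) \<le> \<delta>"
     by (rule onorm_le) (use close[OF z] gpp in simp)
   qed (use x y in auto)
   moreover have "g x = u x" "g y = u y" using x y g3 rU by auto
   ultimately show "\<bar>u x - u y - Du p \<bullet> (x - y)\<bar> \<le> \<delta> * norm (x - y)"
    by (simp add: G_def inner_diff_right algebra_simps)
  qed
 qed
qed

text \<open>This replaces a graph representation of the boundary: near \<open>p\<close> the function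
  \<open>u\<close> increases along \<open>Du p\<close> with slope between 1 - \<delta> and 1 +
  \<delta>, so lines in that direction cross the boundary at most once. The bound 1/2 keeps the
  slope positive.\<close>

definition bball :: "'a \<Rightarrow> real \<Rightarrow> real \<Rightarrow> bool" where
 "bball p \<delta> r \<longleftrightarrow> p \<in> frontier \<Omega> \<and> 0 < r \<and> 0 < \<delta> \<and> \<delta> \<le> 1/2 \<and>
  (\<forall>x\<in>ball p r \<inter> M. \<forall>y\<in>ball p r \<inter> M. \<bar>u x - u y - Du p \<bullet> (x - y)\<bar> \<le> \<delta> * norm (x - y)) \<and>
  (\<forall>x\<in>ball p r \<inter> M. \<forall>h. \<bar>Du x \<bullet> h - Du p \<bullet> h\<bar> \<le> \<delta> * norm h)"

lemma bball_exists: assumes "p \<in> frontier \<Omega>" "0 < \<delta>" "\<delta> \<le> 1/2" shows "\<exists>r. bball p \<delta> r"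
proof -
 obtain r where "0 < r"
  "\<forall>x\<in>ball p r \<inter> M. \<forall>y\<in>ball p r \<inter> M. \<bar>u x - u y - Du p \<bullet> (x - y)\<bar> \<le> \<delta> * norm (x - y)"
  "\<forall>x\<in>ball p r \<inter> M. \<forall>h. \<bar>Du x \<bullet> h - Du p \<bullet> h\<bar> \<le> \<delta> * norm h"
  by (rule boundary_ball[OF assms(1,2)])
 thus ?thesis unfolding bball_def using assms by (intro exI[of _ r]) simp
qed

lemma bball_line:
 assumes b: "bball p \<delta> r" and x: "x \<in> ball p r \<inter> M" "x + t *\<^sub>R Du p \<in> ball p r \<inter> M" and t: "0 \<le> t"
 shows "u (x + t *\<^sub>R Du p) \<ge> u x + (1 - \<delta>) * t" "u (x + t *\<^sub>R Du p) \<le> u x + (1 + \<delta>) * t"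
proof -
 have n: "norm (Du p) = 1" using b grad_one by (simp add: bball_def)
 have "\<bar>u (x + t *\<^sub>R Du p) - u x - Du p \<bullet> (x + t *\<^sub>R Du p - x)\<bar> \<le> \<delta> * norm (x + t *\<^sub>R Du p - x)"
  using b x unfolding bball_def by blast
 hence "\<bar>u (x + t *\<^sub>R Du p) - u x - t\<bar> \<le> \<delta> * t" using n t by (simp add: norm_eq_1)
 thus "u (x + t *\<^sub>R Du p) \<ge> u x + (1 - \<delta>) * t" "u (x + t *\<^sub>R Du p) \<le> u x + (1 + \<delta>) * t"
  unfolding left_diff_distrib distrib_right by linarith+
qed

lemma bball_delta: "bball p \<delta> r ==> 0 < 1 - \<delta>" "bball p \<delta> r ==> 0 < \<delta>" "bball p \<delta> r ==> 0 < r"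
  "bball p \<delta> r ==> p \<in> frontier \<Omega>" "bball p \<delta> r ==> norm (Du p) = 1"
 by (simp_all add: bball_def grad_one)

text \<open>Along \<open>Du p\<close> from the lower point to \<open>x\<close> the function
  \<open>u\<close> would grow strictly, yet it is nonnegative at the lower point and 0 at
  \<open>x\<close>.\<close>

lemma bball_below:
 assumes b: "bball p \<delta> r" and x: "x \<in> ball p r \<inter> frontier \<Omega>" and t: "0 < t" "x - t *\<^sub>R Du p \<in> ball p r"
 shows "x - t *\<^sub>R Du p \<notin> M"
proof
 assume M: "x - t *\<^sub>R Du p \<in> M"
 have "u ((x - t *\<^sub>R Du p) + t *\<^sub>R Du p) \<ge> u (x - t *\<^sub>R Du p) + (1 - \<delta>) * t"
  by (rule bball_line(1)[OF b]) (use M x t frontier_sub in auto)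
 moreover have "u x = 0" using x u_zero by simp
 moreover have "0 < (1 - \<delta>) * t" using bball_delta(1)[OF b] t by simp
 ultimately show False using u_nonneg[OF M] by simp
qed

text \<open>A segment leaving \<Omega> meets the frontier; there \<open>u\<close> is 0, although by
  \<open>bball_line\<close> it is at least its positive value at \<open>x\<close>.\<close>

lemma bball_up:
 assumes b: "bball p \<delta> r" and x: "x \<in> ball p r \<inter> \<Omega>" and t: "0 \<le> t" "x + t *\<^sub>R Du p \<in> ball p r"
 shows "x + t *\<^sub>R Du p \<in> \<Omega>"
proof (rule ccontr)
 assume no: "x + t *\<^sub>R Du p \<notin> \<Omega>"
 let ?S = "closed_segment x (x + t *\<^sub>R Du p)"
 have "?S \<inter> frontier \<Omega> \<noteq> {}"
 proof (rule connected_Int_frontier)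
  show "?S \<inter> \<Omega> \<noteq> {}" using x by (intro ex_in_conv[THEN iffD1] exI[of _ x]) simp
  show "?S - \<Omega> \<noteq> {}" using no by (intro ex_in_conv[THEN iffD1] exI[of _ "x + t *\<^sub>R Du p"]) simp
 qed simp
 then obtain z where z: "z \<in> ?S" "z \<in> frontier \<Omega>" by blast
 then obtain a where a: "0 \<le> a" "a \<le> 1" "z = (1 - a) *\<^sub>R x + a *\<^sub>R (x + t *\<^sub>R Du p)" by (auto simp: in_segment)
 hence zx: "z = x + (a * t) *\<^sub>R Du p" by (simp add: algebra_simps)
 have "?S \<subseteq> ball p r" using x t by (intro closed_segment_subset convex_ball) auto
 hence zb: "z \<in> ball p r" using z by blast
 have "u z \<ge> u x + (1 - \<delta>) * (a * t)"
  unfolding zx by (rule bball_line(1)[OF b]) (use x zb z zx a t frontier_sub dom_sub in auto)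
 moreover have "0 \<le> (1 - \<delta>) * (a * t)" using bball_delta(1)[OF b] a t by simp
 ultimately show False using u_zero[OF z(2)] u_pos[of x] x by simp
qed

lemma bball_frontier_unique:
 assumes b: "bball p \<delta> r" and x: "x \<in> ball p r \<inter> frontier \<Omega>" "x + t *\<^sub>R Du p \<in> ball p r \<inter> frontier \<Omega>"
 shows "t = 0"
proof (rule ccontr)
 assume "t \<noteq> 0"
 then consider "0 < t" | "0 < - t" by linarith
 thus False
 proof cases
  case 1
  show ?thesis using bball_below[OF b x(2) 1] x(1) frontier_sub by auto
 next
  case 2
  show ?thesis using bball_below[OF b x(1) 2] x(2) frontier_sub by auto
 qed
qed

text \<open>The frontier point \<open>x\<close> is approximated by points of \<Omega>, to which
  \<open>bball_up\<close> applies. This puts the shifted point into the closure, and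
  \<open>bball_frontier_unique\<close> keeps it off the frontier.\<close>

lemma bball_above:
 assumes b: "bball p \<delta> r" and x: "x \<in> ball p r \<inter> frontier \<Omega>" and t: "0 < t" "x + t *\<^sub>R Du p \<in> ball p r"
 shows "x + t *\<^sub>R Du p \<in> \<Omega>"
proof -
 have "x + t *\<^sub>R Du p \<in> M"
  unfolding closure_approachable
 proof (intro allI impI)
  fix e :: real assume e: "0 < e"
  obtain e1 where e1: "0 < e1" "ball x e1 \<subseteq> ball p r" using openE[OF open_ball, of x p r] x by blast
  obtain e2 where e2: "0 < e2" "ball (x + t *\<^sub>R Du p) e2 \<subseteq> ball p r" using openE[OF open_ball t(2)] by blast
  have "0 < min e (min e1 e2)" using e e1 e2 by simp
  moreover have "x \<in> closure \<Omega>" using x frontier_sub by blast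
  ultimately obtain y where y: "y \<in> \<Omega>" "dist y x < min e (min e1 e2)" unfolding closure_approachable by blast
  have "y \<in> ball x e1" using y by (simp add: dist_commute)
  hence yb: "y \<in> ball p r" using e1 by blast
  have dd: "dist (y + t *\<^sub>R Du p) (x + t *\<^sub>R Du p) = dist y x" by (simp add: dist_norm)
  hence "y + t *\<^sub>R Du p \<in> ball (x + t *\<^sub>R Du p) e2" using y by (simp add: dist_commute)
  hence "y + t *\<^sub>R Du p \<in> ball p r" using e2 by blast
  hence "y + t *\<^sub>R Du p \<in> \<Omega>" using bball_up[OF b] yb y t by simp
  thus "\<exists>z\<in>\<Omega>. dist z (x + t *\<^sub>R Du p) < e" using dd y by (intro bexI) auto
 qed
 moreover have "x + t *\<^sub>R Du p \<notin> frontier \<Omega>" using bball_frontier_unique[OF b x, of t] t by auto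
 ultimately show ?thesis using frontier_dom by blast
qed

lemma curve_derivative:
 assumes f: "sm f" and p: "\<gamma> 0 = p" "p \<in> M" and \<epsilon>: "0 < \<epsilon>" and \<gamma>: "\<gamma> ` {-\<epsilon><..<\<epsilon>} \<subseteq> M" "(\<gamma> has_vector_derivative v) (at (0::real))"
 shows "((%t. f (\<gamma> t)) has_derivative (%s. gradient_within M f p \<bullet> (s *\<^sub>R v))) (at 0)"
proof -
 let ?I = "{-\<epsilon><..<\<epsilon>}"
 have d: "(\<gamma> has_derivative (%s. s *\<^sub>R v)) (at 0 within ?I)"
  using \<gamma>(2) has_derivative_at_withinI unfolding has_vector_derivative_def by blast
 have "((%t. f (\<gamma> t)) has_derivative (%s. gradient_within M f p \<bullet> (s *\<^sub>R v))) (at 0 within ?I)"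
  by (rule has_derivative_in_compose[OF d], unfold p(1), rule has_derivative_subset[OF sm_has_derivative[OF f p(2)] \<gamma>(1)])
 thus ?thesis using at_within_open[of 0 ?I] \<epsilon> by simp
qed

lemma tangent_orthogonal:
 assumes f: "sm f" "\<And>x. x \<in> frontier \<Omega> ==> f x = c" and p: "p \<in> frontier \<Omega>" and v: "v \<in> tangent_space (frontier \<Omega>) p"
 shows "gradient_within M f p \<bullet> v = 0"
proof -
 obtain \<gamma> \<epsilon> where \<gamma>: "0 < \<epsilon>" "\<gamma> ` {-\<epsilon><..<\<epsilon>} \<subseteq> frontier \<Omega>" "\<gamma> (0::real) = p" "(\<gamma> has_vector_derivative v) (at 0)"
  using v unfolding tangent_space_def by blast
 have "((%t. f (\<gamma> t)) has_derivative (%s. gradient_within M f p \<bullet> (s *\<^sub>R v))) (at 0)"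
  by (rule curve_derivative[OF f(1) \<gamma>(3) _ \<gamma>(1) _ \<gamma>(4)]) (use \<gamma>(2) p frontier_sub in auto)
 moreover have "((%t. f (\<gamma> t)) has_derivative (%s. 0)) (at 0)"
 proof (rule has_derivative_transform_within_open)
  show "((%_. c) has_derivative (%s. 0)) (at (0::real))" by (rule has_derivative_const)
  show "open {-\<epsilon><..<\<epsilon>}" "0 \<in> {-\<epsilon><..<\<epsilon>}" using \<gamma>(1) by simp_all
  show "c = f (\<gamma> t)" if "t \<in> {-\<epsilon><..<\<epsilon>}" for t
   by (rule f(2)[symmetric]) (use \<gamma>(2) that in blast)
 qed
 ultimately have "(%s. gradient_within M f p \<bullet> (s *\<^sub>R v)) = (%s. 0)" by (rule has_derivative_unique)
 from fun_cong[OF this, of 1] show ?thesis by simp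
qed

text \<open>One inclusion holds since \<open>u\<close> vanishes along curves in the boundary. For
  the other, the derivative of the inverse chart maps the hyperplane orthogonal to \<open>e\<close>
  into the tangent space, where \<open>Du p\<close> vanishes; so \<open>Du p\<close> pulled back is
  \<open>\<kappa>\<close> times the \<open>e\<close> component. As \<open>Du p\<close> is not 0,
  neither is \<open>\<kappa>\<close>, and the two hyperplanes correspond.\<close>

lemma tangent_space_eq:
 assumes p: "p \<in> frontier \<Omega>"
 shows "tangent_space (frontier \<Omega>) p = {v. Du p \<bullet> v = 0}"
proof
 show "tangent_space (frontier \<Omega>) p \<subseteq> {v. Du p \<bullet> v = 0}"
  using tangent_orthogonal[OF smu u_zero p] by blast
 have pM: "p \<in> M" using p frontier_sub by blast
 obtain U \<Phi> \<Psi> e where hc: "half_space_chart M U \<Phi> e" and c: "open U" "p \<in> U" "open (\<Phi> ` U)" "e \<in> Basis" "homeomorphism U (\<Phi> ` U) \<Phi> \<Psi>"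
  "smooth_on U \<Phi>" "smooth_on (\<Phi> ` U) \<Psi>" "\<Phi> ` (U \<inter> M) = \<Phi> ` U \<inter> {y. 0 \<le> e \<bullet> y}"
  and c9: "p \<in> frontier \<Omega> \<longrightarrow> e \<bullet> \<Phi> p = 0"
  by (rule chart[OF pM])
 define y where "y = \<Phi> p"
 have y: "y \<in> \<Phi> ` U" "e \<bullet> y = 0" using c(2) c9 p by (auto simp: y_def)
 have \<Psi>\<Phi>: "\<Psi> (\<Phi> z) = z" if "z \<in> U" for z using c(5) that by (simp add: homeomorphism_def)
 have \<Phi>\<Psi>: "\<Phi> (\<Psi> z) = z" if "z \<in> \<Phi> ` U" for z using \<Psi>\<Phi> that by force
 define D\<Psi> where "D\<Psi> = frechet_derivative \<Psi> (at y)"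
 define D\<Phi> where "D\<Phi> = frechet_derivative \<Phi> (at p)"
 have d\<Psi>: "(\<Psi> has_derivative D\<Psi>) (at y)" unfolding D\<Psi>_def by (rule smooth_on_has_derivative[OF c(7) y(1)])
 have d\<Phi>: "(\<Phi> has_derivative D\<Phi>) (at p)" unfolding D\<Phi>_def by (rule smooth_on_has_derivative[OF c(6,2)])
 have l\<Psi>: "linear D\<Psi>" by (rule has_derivative_linear[OF d\<Psi>])
 have "((%z. \<Psi> (\<Phi> z)) has_derivative (%v. D\<Psi> (D\<Phi> v))) (at p)"
  by (rule has_derivative_compose[OF d\<Phi>]) (use d\<Psi> y_def in simp)
 hence "((%z. z) has_derivative (%v. D\<Psi> (D\<Phi> v))) (at p)"
  by (rule has_derivative_transform_within_open[OF _ c(1,2)]) (rule \<Psi>\<Phi>)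
 from has_derivative_unique[OF this has_derivative_ident] have inv: "D\<Psi> (D\<Phi> v) = v" for v by (metis)
 have tang: "D\<Psi> w \<in> tangent_space (frontier \<Omega>) p" if w: "e \<bullet> w = 0" for w
 proof -
  have "open ((%t::real. y + t *\<^sub>R w) -` (\<Phi> ` U))"
   by (rule open_vimage[OF c(3)]) (intro continuous_intros)
  moreover have "0 \<in> (%t::real. y + t *\<^sub>R w) -` (\<Phi> ` U)" using y by simp
  ultimately obtain \<epsilon> where \<epsilon>: "0 < \<epsilon>" "ball 0 \<epsilon> \<subseteq> (%t::real. y + t *\<^sub>R w) -` (\<Phi> ` U)"
   using openE by metis
  have in_chart: "y + t *\<^sub>R w \<in> \<Phi> ` U" if "t \<in> {-\<epsilon><..<\<epsilon>}" for t
  proof -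
   have "t \<in> ball 0 \<epsilon>" using that by (auto simp: dist_real_def)
   thus ?thesis using \<epsilon>(2) by blast
  qed
  define \<gamma> where "\<gamma> = (%t::real. \<Psi> (y + t *\<^sub>R w))"
  have fr: "\<gamma> t \<in> frontier \<Omega>" if t: "t \<in> {-\<epsilon><..<\<epsilon>}" for t
  proof -
   have e0: "e \<bullet> (y + t *\<^sub>R w) = 0" using y(2) w by (simp add: inner_add_right)
   hence "y + t *\<^sub>R w \<in> \<Phi> ` (U \<inter> M)" unfolding c(8) using in_chart[OF t] by simp
   hence gU: "\<gamma> t \<in> U \<inter> M" using \<Psi>\<Phi> by (auto simp: \<gamma>_def)
   moreover have "e \<bullet> \<Phi> (\<gamma> t) = 0" using e0 \<Phi>\<Psi>[OF in_chart[OF t]] by (simp add: \<gamma>_def)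
   ultimately have "\<gamma> t \<in> manifold_boundary M" unfolding manifold_boundary_def using hc by blast
   thus ?thesis using dom by (simp add: smooth_domain_def)
  qed
  have sm\<gamma>: "smooth_on {-\<epsilon><..<\<epsilon>} \<gamma>" unfolding \<gamma>_def
   by (rule smooth_on_compose_affine[OF c(7) in_chart open_greaterThanLessThan])
  have "((%t::real. y + t *\<^sub>R w) has_derivative (%s. s *\<^sub>R w)) (at 0)"
   by (auto intro!: derivative_eq_intros)
  from has_derivative_compose[OF this, of \<Psi> D\<Psi>] d\<Psi>
  have "(\<gamma> has_vector_derivative D\<Psi> w) (at 0)"
   by (simp add: \<gamma>_def linear_scale[OF l\<Psi>] has_vector_derivative_def)
  moreover have "\<gamma> 0 = p" using \<Psi>\<Phi>[OF c(2)] by (simp add: \<gamma>_def y_def)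
  ultimately show ?thesis unfolding tangent_space_def using \<epsilon>(1) sm\<gamma> fr by blast
 qed
 define \<kappa> where "\<kappa> = Du p \<bullet> D\<Psi> e"
 have ee: "e \<bullet> e = 1" using c(4) by simp
 have key: "Du p \<bullet> D\<Psi> h = (h \<bullet> e) * \<kappa>" for h
 proof -
  have "e \<bullet> (h - (h \<bullet> e) *\<^sub>R e) = 0" by (simp add: inner_diff_right ee inner_commute)
  hence "Du p \<bullet> D\<Psi> (h - (h \<bullet> e) *\<^sub>R e) = 0" using tangent_orthogonal[OF smu u_zero p tang] by blast
  thus ?thesis by (simp add: linear_diff[OF l\<Psi>] linear_scale[OF l\<Psi>] inner_diff_right \<kappa>_def)
 qed
 have "\<kappa> \<noteq> 0"
 proof
  assume "\<kappa> = 0"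
  hence "Du p \<bullet> Du p = 0" using key[of "D\<Phi> (Du p)"] inv by simp
  thus False using grad_one[OF p] by (simp add: norm_eq_1)
 qed
 show "{v. Du p \<bullet> v = 0} \<subseteq> tangent_space (frontier \<Omega>) p"
 proof
  fix v assume "v \<in> {v. Du p \<bullet> v = 0}"
  hence "(D\<Phi> v \<bullet> e) * \<kappa> = 0" using key[of "D\<Phi> v"] inv by simp
  hence "e \<bullet> D\<Phi> v = 0" using \<open>\<kappa> \<noteq> 0\<close> by (simp add: inner_commute)
  from tang[OF this] show "v \<in> tangent_space (frontier \<Omega>) p" by (simp add: inv)
 qed
qed

text \<open>A unit vector orthogonal to the tangent space is \<open>Du p\<close> or its negative.
  \<open>bball_below\<close> shows that the negative points outward and \<open>bball_above\<close>
  that \<open>Du p\<close> does not, so the definite description is resolved.\<close>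

lemma outward_normal_eq:
 assumes p: "p \<in> frontier \<Omega>"
 shows "outward_normal \<Omega> p = - Du p"
 unfolding outward_normal_def tangent_space_eq[OF p]
proof (rule the_equality)
 obtain r where b: "bball p (1/2) r" using bball_exists[OF p, of "1/2"] by auto
 have n: "norm (Du p) = 1" "Du p \<bullet> Du p = 1" using grad_one[OF p] by (simp_all add: norm_eq_1)
 have r: "0 < r" and pb: "p \<in> ball p r \<inter> frontier \<Omega>" using b p by (simp_all add: bball_def)
 have inb: "p + t *\<^sub>R Du p \<in> ball p r" "p - t *\<^sub>R Du p \<in> ball p r" if "t \<in> {0<..<r}" for t
  using that n by (simp_all add: dist_norm)
 have low: "\<forall>t\<in>{0<..<r}. p + t *\<^sub>R (- Du p) \<notin> M"
 proof
  fix t assume t: "t \<in> {0<..<r}"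
  thus "p + t *\<^sub>R (- Du p) \<notin> M" using bball_below[OF b pb _ inb(2)[OF t]] by simp
 qed
 show "norm (- Du p) = 1 \<and> (\<forall>v\<in>{v. Du p \<bullet> v = 0}. - Du p \<bullet> v = 0) \<and> (\<exists>\<epsilon>>0. \<forall>t\<in>{0<..<\<epsilon>}. p + t *\<^sub>R (- Du p) \<notin> M)"
  using n r low by auto
 fix \<nu> assume \<nu>: "norm \<nu> = 1 \<and> (\<forall>v\<in>{v. Du p \<bullet> v = 0}. \<nu> \<bullet> v = 0) \<and> (\<exists>\<epsilon>>0. \<forall>t\<in>{0<..<\<epsilon>}. p + t *\<^sub>R \<nu> \<notin> M)"
 define a where "a = \<nu> \<bullet> Du p"
 define v where "v = \<nu> - a *\<^sub>R Du p"
 have dv: "Du p \<bullet> v = 0" by (simp add: v_def a_def inner_diff_right n(2) inner_commute)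
 hence "\<nu> \<bullet> v = 0" using \<nu> by blast
 moreover have "v \<bullet> v = \<nu> \<bullet> v - a * (Du p \<bullet> v)" by (subst v_def) (simp only: inner_diff_left inner_scaleR_left)
 ultimately have "v \<bullet> v = 0" using dv by simp
 hence \<nu>a: "\<nu> = a *\<^sub>R Du p" by (simp add: v_def)
 hence "\<bar>a\<bar> = 1" using \<nu> n by simp
 moreover have "a \<noteq> 1"
 proof
  assume "a = 1"
  obtain \<epsilon> where \<epsilon>: "0 < \<epsilon>" "\<forall>t\<in>{0<..<\<epsilon>}. p + t *\<^sub>R \<nu> \<notin> M" using \<nu> by blast
  define t where "t = min \<epsilon> r / 2"
  have t: "t \<in> {0<..<\<epsilon>}" "t \<in> {0<..<r}" "0 < t" using \<epsilon>(1) r by (auto simp: t_def)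
  have "p + t *\<^sub>R Du p \<in> M" using bball_above[OF b pb t(3) inb(1)[OF t(2)]] dom_sub by blast
  thus False using \<epsilon>(2) t(1) \<nu>a \<open>a = 1\<close> by simp
 qed
 ultimately have "a = -1" by linarith
 thus "\<nu> = - Du p" using \<nu>a by simp
qed

text \<open>|Du|^2 is constant on the boundary, so its gradient 2 D^2u Du has no tangential part:
  \<open>Du\<close> is an eigenvector of D^2u there.\<close>

lemma hessian_normal:
 assumes p: "p \<in> frontier \<Omega>" and c: "c \<in> Basis"
 shows "(SB b. pd c (pd b u) p * pd b u p) = (SB b. SB c. pd c (pd b u) p * pd b u p * pd c u p) * pd c u p"
proof -
 have pM: "p \<in> M" using p frontier_sub by blast
 define q where "q = (%x. SB b. (pd b u x)\<^sup>2)"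
 have smq: "sm q" unfolding q_def by (intro sm_sum sm_power2 sm_pd smu)
 have pdq: "pd c q p = 2 * (SB b. pd c (pd b u) p * pd b u p)" for c
  unfolding q_def
  by (subst pd_sum) (simp_all add: pM pd_power2 sm_power2 sm_pd smu sum_distrib_left mult.assoc mult.commute mult.left_commute)
 define \<alpha> where "\<alpha> = gradient_within M q p \<bullet> Du p"
 have n: "Du p \<bullet> Du p = 1" using grad_one[OF p] by (simp add: norm_eq_1)
 have "c - (c \<bullet> Du p) *\<^sub>R Du p \<in> tangent_space (frontier \<Omega>) p"
  unfolding tangent_space_eq[OF p] by (simp add: inner_diff_right n inner_commute)
 from tangent_orthogonal[OF smq _ p this, of 1] have "gradient_within M q p \<bullet> c = (c \<bullet> Du p) * \<alpha>"
  using grad_sq by (simp add: q_def \<alpha>_def inner_diff_right)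
 hence "pd c q p = pd c u p * \<alpha>" by (simp add: pd_def inner_commute)
 moreover have "\<alpha> = 2 * (SB b. SB c. pd c (pd b u) p * pd b u p * pd c u p)"
 proof -
  have "\<alpha> = (SB c. pd c q p * (Du p \<bullet> c))" unfolding \<alpha>_def by (rule gradient_inner)
  also have "... = (SB c. pd c q p * pd c u p)" by (simp only: pd_def)
  also have "... = 2 * (SB c. SB b. pd c (pd b u) p * pd b u p * pd c u p)"
   unfolding pdq by (simp add: sum_distrib_left sum_distrib_right mult.assoc)
  also have "(SB c. SB b. pd c (pd b u) p * pd b u p * pd c u p) = (SB b. SB c. pd c (pd b u) p * pd b u p * pd c u p)"
   by (rule sum.swap)
  finally show ?thesis .
 qed
 ultimately show ?thesis using pdq[of c] by (simp add: mult.commute)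
qed

text \<open>The normal field equals \<open>- Du\<close> on the boundary, so its divergence there is
  the full trace n of - D^2u minus the normal entry - D^2u(Du, Du).\<close>

lemma mean_curvature_eq:
 assumes p: "p \<in> frontier \<Omega>"
 shows "real DIM('a) - mean_curvature \<Omega> p = - (SB b. SB c. pd c (pd b u) p * pd b u p * pd c u p)"
proof -
 let ?F = "frontier \<Omega>" and ?X = "outward_normal \<Omega>" and ?T = "{v. Du p \<bullet> v = 0}"
 define \<kappa> where "\<kappa> = (SB b. SB c. pd c (pd b u) p * pd b u p * pd c u p)"
 have pM: "p \<in> M" using p frontier_sub by blast
 have n: "norm (Du p) = 1" "Du p \<bullet> Du p = 1" using grad_one[OF p] by (simp_all add: norm_eq_1)
 define A where "A = (%v. SB b. (gradient_within M (pd b u) p \<bullet> v) *\<^sub>R b)"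
 have linA: "linear A" unfolding A_def
  by (rule linearI) (simp_all add: inner_add_right scaleR_left_distrib sum.distrib scaleR_sum_right)
 have eqX: "?X x = - (SB b. pd b u x *\<^sub>R b)" if "x \<in> ?F" for x
  unfolding outward_normal_eq[OF that] by (simp add: pd_def euclidean_representation)
 have "((%x. - (SB b. pd b u x *\<^sub>R b)) has_derivative (%v. - A v)) (at p within M)"
  unfolding A_def
  by (intro has_derivative_minus has_derivative_sum has_derivative_scaleR_left sm_has_derivative[OF sm_pd[OF smu] pM])
 hence dX0: "((%x. - (SB b. pd b u x *\<^sub>R b)) has_derivative (%v. - A v)) (at p within ?F)"
  by (rule has_derivative_subset[OF _ frontier_sub])
 have dX: "(?X has_derivative (%v. - A v)) (at p within ?F)"
  by (rule has_derivative_transform[OF p eqX dX0])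
 \<comment> \<open>Derivatives within the boundary need not be unique as linear maps, but a curve
   realising a tangent vector fixes their value on it.\<close>
 have Lunique: "L v = - A v" if L: "(?X has_derivative L) (at p within ?F)" and v: "v \<in> ?T" for L v
 proof -
  obtain \<gamma> \<epsilon> where \<gamma>: "0 < \<epsilon>" "\<gamma> ` {-\<epsilon><..<\<epsilon>} \<subseteq> ?F" "\<gamma> (0::real) = p" "(\<gamma> has_vector_derivative v) (at 0)"
   using v unfolding tangent_space_eq[OF p, symmetric] tangent_space_def by blast
  let ?I = "{-\<epsilon><..<\<epsilon>}"
  have d: "(\<gamma> has_derivative (%s. s *\<^sub>R v)) (at 0 within ?I)"
   using \<gamma>(4) has_derivative_at_withinI unfolding has_vector_derivative_def by blast
  have at0: "at 0 within ?I = at (0::real)" by (rule at_within_open) (use \<gamma>(1) in auto)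
  have comp: "((%t. ?X (\<gamma> t)) has_derivative (%s. K (s *\<^sub>R v))) (at 0)"
   if K: "(?X has_derivative K) (at p within ?F)" for K
  proof -
   have "((%t. ?X (\<gamma> t)) has_derivative (%s. K (s *\<^sub>R v))) (at 0 within ?I)"
    by (rule has_derivative_in_compose[OF d], unfold \<gamma>(3), rule has_derivative_subset[OF K \<gamma>(2)])
   thus ?thesis unfolding at0 .
  qed
  from has_derivative_unique[OF comp[OF L] comp[OF dX]] have "(%s. L (s *\<^sub>R v)) = (%s. - A (s *\<^sub>R v))" .
  from fun_cong[OF this, of 1] show ?thesis by simp
 qed
 have trA: "(SB b. A b \<bullet> b) = - real DIM('a)"
 proof -
  have "A b \<bullet> b = pd b (pd b u) p" if "b \<in> Basis" for b
   unfolding A_def using that by (simp add: inner_sum_left inner_Basis pd_def if_distrib cong: if_cong)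
  thus ?thesis using lap[OF pM] by simp
 qed
 have An: "A (Du p) \<bullet> Du p = \<kappa>"
 proof -
  have "A (Du p) \<bullet> Du p = (SB b. (gradient_within M (pd b u) p \<bullet> Du p) * (b \<bullet> Du p))"
   unfolding A_def inner_sum_left by simp
  also have "... = (SB b. SB c. pd c (pd b u) p * pd b u p * pd c u p)"
  proof (rule sum.cong[OF refl])
   fix b :: 'a
   have "gradient_within M (pd b u) p \<bullet> Du p = (SB c. pd c (pd b u) p * (Du p \<bullet> c))"
    by (rule gradient_inner)
   also have "... = (SB c. pd c (pd b u) p * pd c u p)" by (simp only: pd_def[of _ u])
   finally have "(gradient_within M (pd b u) p \<bullet> Du p) * (b \<bullet> Du p) = (SB c. pd c (pd b u) p * pd c u p) * pd b u p"
    by (simp only: pd_def[of b u] inner_commute)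
   also have "... = (SB c. pd c (pd b u) p * pd b u p * pd c u p)"
    unfolding sum_distrib_right by (rule sum.cong[OF refl]) simp
   finally show "(gradient_within M (pd b u) p \<bullet> Du p) * (b \<bullet> Du p) = (SB c. pd c (pd b u) p * pd b u p * pd c u p)" .
  qed
  finally show ?thesis by (simp add: \<kappa>_def)
 qed
 have sumB: "(\<Sum>b\<in>B. L b \<bullet> b) = real DIM('a) + \<kappa>"
  if L: "(?X has_derivative L) (at p within ?F)" and B: "pairwise orthogonal B" "\<forall>b\<in>B. norm b = 1" "span B = ?T" for L B
 proof -
  have BT: "b \<in> ?T" if "b \<in> B" for b using that B(3) span_base by blast
  have nB: "Du p \<notin> B" using BT n(2) by fastforce
  let ?B = "insert (Du p) B"
  have po: "pairwise orthogonal ?B" using B(1) BT unfolding pairwise_def orthogonal_def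
   by (auto simp: inner_commute)
  have nb: "norm b = 1" if "b \<in> ?B" for b using that B(2) n by auto
  have sp: "span ?B = UNIV"
  proof -
   have "x \<in> span ?B" for x
   proof -
    have "x - (x \<bullet> Du p) *\<^sub>R Du p \<in> ?T" by (simp add: inner_diff_right n(2) inner_commute)
    hence "x - (x \<bullet> Du p) *\<^sub>R Du p \<in> span B" using B(3) by blast
    thus ?thesis unfolding span_insert by blast
   qed
   thus ?thesis by blast
  qed
  have fB: "finite B"
  proof -
   have "0 \<notin> B" using B(2) by force
   thus ?thesis using B(1) pairwise_orthogonal_independent independent_imp_finite by blast
  qed
  have "(\<Sum>b\<in>B. L b \<bullet> b) = (\<Sum>b\<in>B. - (A b \<bullet> b))"
   by (rule sum.cong[OF refl]) (simp add: Lunique[OF L BT])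
  also have "... = - ((\<Sum>b\<in>?B. A b \<bullet> b) - A (Du p) \<bullet> Du p)"
   using fB nB by (simp add: sum_negf)
  also have "(\<Sum>b\<in>?B. A b \<bullet> b) = - real DIM('a)" using trace_orthonormal[OF linA po nb sp] trA by simp
  finally show ?thesis using An by simp
 qed
 have "subspace ?T" by (rule subspace_hyperplane)
 then obtain B where B: "pairwise orthogonal B" "\<forall>b\<in>B. norm b = 1" "span B = ?T"
  using orthonormal_basis_subspace[of ?T] by metis
 have "surface_divergence ?F ?X p = real DIM('a) + \<kappa>"
  unfolding surface_divergence_def tangent_space_eq[OF p]
 proof (rule the_equality)
  show "\<exists>L B. (?X has_derivative L) (at p within ?F) \<and> pairwise orthogonal B \<and> (\<forall>b\<in>B. norm b = 1) \<and> span B = ?T \<and> real DIM('a) + \<kappa> = (\<Sum>b\<in>B. L b \<bullet> b)"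
   by (rule exI[of _ "%v. - A v"], rule exI[of _ B]) (use dX B sumB[OF dX B] in simp)
  fix d assume "\<exists>L B. (?X has_derivative L) (at p within ?F) \<and> pairwise orthogonal B \<and> (\<forall>b\<in>B. norm b = 1) \<and> span B = ?T \<and> d = (\<Sum>b\<in>B. L b \<bullet> b)"
  then obtain L B where "(?X has_derivative L) (at p within ?F) \<and> pairwise orthogonal B \<and> (\<forall>b\<in>B. norm b = 1) \<and> span B = ?T \<and> d = (\<Sum>b\<in>B. L b \<bullet> b)"
   by (elim exE)
  thus "d = real DIM('a) + \<kappa>" using sumB[of L B] by simp
 qed
 thus ?thesis by (simp add: mean_curvature_def \<kappa>_def)
qed

end

subsection \<open>Integration by parts inside the domain\<close>

context smooth_dom
begin

definition smc :: "('a \<Rightarrow> real) \<Rightarrow> bool" where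
 "smc f \<longleftrightarrow> sm f \<and> bounded {x \<in> M. f x \<noteq> 0}"

definition ig :: "('a \<Rightarrow> real) \<Rightarrow> real" where
 "ig f = (LINT x:\<Omega>|lborel. f x)"

lemma smc_sm: "smc f ==> sm f" by (simp add: smc_def)

lemma smc_bound: assumes "smc f" obtains R where "0 < R" "\<forall>x\<in>M. f x \<noteq> 0 \<longrightarrow> norm x \<le> R"
proof -
 have "bounded {x \<in> M. f x \<noteq> 0}" using assms by (simp add: smc_def)
 then obtain R where "0 < R" "\<forall>x\<in>{x \<in> M. f x \<noteq> 0}. norm x \<le> R" unfolding bounded_pos by blast
 thus ?thesis by (intro that[of R]) auto
qed

lemma smcI: "sm f ==> (\<And>x. x \<in> M ==> f x \<noteq> 0 ==> norm x \<le> R) ==> smc f"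
 unfolding smc_def bounded_iff by (intro conjI exI[of _ R]) auto

lemma smc_add: assumes "smc f" "smc g" shows "smc (%x. f x + g x)"
proof -
 have "bounded ({x \<in> M. f x \<noteq> 0} \<union> {x \<in> M. g x \<noteq> 0})" using assms by (simp add: smc_def)
 hence "bounded {x \<in> M. f x + g x \<noteq> 0}" by (rule bounded_subset) auto
 thus ?thesis using assms sm_add by (simp add: smc_def)
qed

lemma smc_mult: assumes "smc f" "sm g" shows "smc (%x. f x * g x)"
proof -
 have "bounded {x \<in> M. f x \<noteq> 0}" using assms by (simp add: smc_def)
 hence "bounded {x \<in> M. f x * g x \<noteq> 0}" by (rule bounded_subset) auto
 thus ?thesis using assms sm_mult by (simp add: smc_def)
qed

lemma smc_mult': "sm f ==> smc g ==> smc (%x. f x * g x)"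
 using smc_mult[of g f] by (simp add: mult.commute)

lemma smc_power2: "smc f ==> smc (%x. (f x)\<^sup>2)"
 using smc_mult[of f f] smc_sm by (simp only: power2_eq_square)

lemma smc_cmult: "smc f ==> smc (%x. c * f x)"
 using smc_mult'[OF sm_const[of c]] by simp

lemma smc_minus: "smc f ==> smc (%x. - f x)"
 using smc_cmult[of f "-1"] by simp

lemma smc_diff: "smc f ==> smc g ==> smc (%x. f x - g x)"
 using smc_add[OF _ smc_minus, of f g] by simp

lemma smc_zero: "smc (%x. 0)" by (simp add: smc_def sm_const)

lemma smc_sum: "(\<And>i. i \<in> I ==> smc (f i)) ==> smc (%x. \<Sum>i\<in>I. f i x)"
 by (induction I rule: infinite_finite_induct) (simp_all add: smc_zero smc_add)

lemma pd_zero_outside: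
 assumes K: "closed K" "\<And>x. x \<in> M ==> x \<notin> K ==> f x = 0" and x: "x \<in> M" "x \<notin> K"
 shows "pd b f x = 0"
proof -
 have "pd b (%x. 0) x = pd b f x"
  by (rule pd_cong_local[of x "- K"]) (use K x sm_const in auto)
 thus ?thesis by (simp add: pd_const x)
qed

lemma smc_pd: assumes "smc f" shows "smc (pd b f)"
proof -
 obtain R where R: "0 < R" "\<forall>x\<in>M. f x \<noteq> 0 \<longrightarrow> norm x \<le> R" by (rule smc_bound[OF assms])
 have "norm x \<le> R" if "x \<in> M" "pd b f x \<noteq> 0" for x
 proof (rule ccontr)
  assume "\<not> norm x \<le> R"
  hence "pd b f x = 0" by (intro pd_zero_outside[of "cball 0 R"]) (use R that in auto)
  thus False using that by simp
 qed
 thus ?thesis by (intro smcI[OF sm_pd[OF smc_sm[OF assms]]])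
qed

lemma continuous_bounded_support:
 assumes c: "continuous_on M f" and b: "\<And>x. x \<in> M ==> f x \<noteq> 0 ==> norm x \<le> R"
 shows "\<exists>B. \<forall>x\<in>M. \<bar>f x :: real\<bar> \<le> B"
proof -
 have "compact (M \<inter> cball 0 R)" by (intro closed_Int_compact) auto
 hence "bounded (f ` (M \<inter> cball 0 R))"
  by (intro compact_imp_bounded compact_continuous_image continuous_on_subset[OF c]) auto
 then obtain B where B: "\<forall>y\<in>f ` (M \<inter> cball 0 R). norm y \<le> B" unfolding bounded_iff by blast
 have "\<bar>f x\<bar> \<le> max B 0" if "x \<in> M" for x
 proof (cases "f x = 0")
  case False
  hence "f x \<in> f ` (M \<inter> cball 0 R)" using that b by simp
  hence "norm (f x) \<le> B" by (rule bspec[OF B])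
  thus ?thesis by simp
 qed simp
 thus ?thesis by blast
qed

lemma continuous_integrable:
 fixes f :: "'a \<Rightarrow> real"
 assumes c: "continuous_on M f" and b: "\<And>x. x \<in> M ==> f x \<noteq> 0 ==> norm x \<le> R"
 shows "set_integrable lborel \<Omega> f"
proof -
 obtain B where B: "\<forall>x\<in>M. \<bar>f x\<bar> \<le> B" using continuous_bounded_support[OF c b] by blast
 show ?thesis unfolding set_integrable_def
 proof (rule Bochner_Integration.integrable_bound[where f="%x. B * indicator (cball 0 R) x"])
  show "integrable lborel (%x::'a. B * indicator (cball 0 R) x)"
   by (intro integrable_mult_right integrable_real_indicator) (simp_all add: emeasure_lborel_cball_finite[unfolded infinity_ennreal_def])
  have "(%x. indicator \<Omega> x *\<^sub>R f x) \<in> borel_measurable borel"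
   by (rule borel_measurable_continuous_on_indicator) (use open_dom continuous_on_subset[OF c dom_sub] in auto)
  thus "(%x. indicator \<Omega> x *\<^sub>R f x) \<in> borel_measurable lborel" by simp
  have "norm (indicator \<Omega> x *\<^sub>R f x) \<le> norm (B * indicator (cball 0 R) x)" for x
  proof (cases "x \<in> \<Omega> \<and> f x \<noteq> 0")
   case True
   hence "x \<in> M" "norm x \<le> R" using b dom_sub by auto
   thus ?thesis using True B by fastforce
  qed auto
  thus "AE x in lborel. norm (indicator \<Omega> x *\<^sub>R f x) \<le> norm (B * indicator (cball 0 R) x)" by simp
 qed
qed

lemma smc_integrable: assumes "smc f" shows "set_integrable lborel \<Omega> f"
proof -
 obtain R where R: "0 < R" "\<forall>x\<in>M. f x \<noteq> 0 \<longrightarrow> norm x \<le> R" by (rule smc_bound[OF assms])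
 show ?thesis by (rule continuous_integrable[OF sm_continuous[OF smc_sm[OF assms]], of R]) (use R in simp)
qed

lemma smc_abs_integrable: "smc f ==> set_integrable lborel \<Omega> (%x. \<bar>f x\<bar>)"
 using set_integrable_abs[OF smc_integrable] by simp

lemma ig_add: "smc f ==> smc g ==> ig (%x. f x + g x) = ig f + ig g"
 unfolding ig_def by (intro set_integral_add smc_integrable)

lemma ig_diff: "smc f ==> smc g ==> ig (%x. f x - g x) = ig f - ig g"
 unfolding ig_def by (intro set_integral_diff smc_integrable)

lemma ig_cmult: "ig (%x. c * f x) = c * ig f"
 unfolding ig_def by (cases "c = 0") simp_all

lemma ig_minus: "ig (%x. - f x) = - ig f"
 using ig_cmult[of "-1" f] by simp

lemma ig_sum: "(\<And>i. i \<in> I ==> smc (f i)) ==> ig (%x. \<Sum>i\<in>I. f i x) = (\<Sum>i\<in>I. ig (f i))"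
 by (induction I rule: infinite_finite_induct) (simp_all add: ig_add smc_sum, simp_all add: ig_def)

lemma ig_cong: "(\<And>x. x \<in> \<Omega> ==> x \<in> M ==> f x = g x) ==> ig f = ig g"
 unfolding ig_def set_lebesgue_integral_def by (rule Bochner_Integration.integral_cong) (use dom_sub in \<open>auto simp: indicator_def\<close>)

lemma ig_mono:
 "set_integrable lborel \<Omega> f ==> set_integrable lborel \<Omega> g ==> (\<And>x. x \<in> \<Omega> ==> x \<in> M ==> f x \<le> g x) ==> ig f \<le> ig g"
 unfolding ig_def by (rule set_integral_mono) (use dom_sub in auto)

lemma ig_mono': "smc f ==> smc g ==> (\<And>x. x \<in> \<Omega> ==> x \<in> M ==> f x \<le> g x) ==> ig f \<le> ig g"
 by (rule ig_mono[OF smc_integrable smc_integrable])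

lemma ig_abs: "smc f ==> \<bar>ig f\<bar> \<le> ig (%x. \<bar>f x\<bar>)"
 unfolding ig_def using set_integral_norm_bound[OF smc_integrable, of f] by simp

text \<open>One constant \<open>C\<close> serves all radii, so squared gradients are of order 1 /
  R^2. The derivatives vanish off the shell between radii R and 2 R; gradient integrals can
  therefore be charged either to the ball of radius 2 R or to the complement of the ball of radius
  R.\<close>

definition cutoff :: "(real \<Rightarrow> 'a \<Rightarrow> real) \<Rightarrow> real \<Rightarrow> bool" where
 "cutoff \<zeta> C \<longleftrightarrow> 0 < C \<and> (\<forall>R>0. smooth_on UNIV (\<zeta> R) \<and> (\<forall>x. 0 \<le> \<zeta> R x \<and> \<zeta> R x \<le> 1) \<and>
  (\<forall>x. norm x \<le> R \<longrightarrow> \<zeta> R x = 1) \<and> (\<forall>x. 2 * R \<le> norm x \<longrightarrow> \<zeta> R x = 0) \<and>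
  (\<forall>x\<in>M. norm x < R \<or> 2 * R < norm x \<longrightarrow> (\<forall>b. pd b (\<zeta> R) x = 0)) \<and>
  (\<forall>x\<in>M. (SB b. (pd b (\<zeta> R) x)\<^sup>2) \<le> C / R\<^sup>2))"

lemma cutoff_exists: "\<exists>\<zeta> C. cutoff \<zeta> C"
proof -
 obtain h h' :: "real \<Rightarrow> real" and K where h: "smooth_on UNIV h" "\<And>t. (h has_real_derivative h' t) (at t)"
  "\<And>t. t \<le> 0 ==> h t = 0" "\<And>t. 1 \<le> t ==> h t = 1" "\<And>t. 0 \<le> h t \<and> h t \<le> 1" "\<And>t. 0 \<le> h' t \<and> h' t \<le> K"
  using smooth_step_exists by metis
 have K0: "0 \<le> K" using h(6)[of 0] by linarith
 \<comment> \<open>Quadratic in \<open>x\<close> to be smooth at the origin, and normalised to be 1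
   at norm R and 0 at norm 2 R.\<close>
 define T where "T R x = (4 * R\<^sup>2 + (-1) * ((x - 0) \<bullet> (x - 0))) * inverse (3 * R\<^sup>2)" for R and x :: 'a
 define \<zeta> where "\<zeta> R x = h (T R x)" for R and x :: 'a
 have sT: "smooth_on UNIV (T R)" for R unfolding T_def
  by (intro smooth_on_mult smooth_on_add smooth_on_const smooth_on_inner_self open_UNIV)
 have sz: "smooth_on UNIV (\<zeta> R)" for R
  unfolding \<zeta>_def by (rule smooth_on_compose_real[OF h(1) open_UNIV sT subset_UNIV])
 have Teq: "T R x = (4 * R\<^sup>2 - (norm x)\<^sup>2) / (3 * R\<^sup>2)" for R and x :: 'a
  unfolding T_def divide_inverse dot_square_norm by simp
 have one: "\<zeta> R x = 1" if "0 < R" "norm x \<le> R" for R x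
 proof -
  have "(norm x)\<^sup>2 \<le> R\<^sup>2" using that by (intro power_mono) auto
  hence "1 \<le> T R x" unfolding Teq using that by (simp add: field_simps)
  thus ?thesis unfolding \<zeta>_def by (rule h(4))
 qed
 have zero: "\<zeta> R x = 0" if "0 < R" "2 * R \<le> norm x" for R x
 proof -
  have "(2 * R)\<^sup>2 \<le> (norm x)\<^sup>2" using that by (intro power_mono) auto
  hence "T R x \<le> 0" unfolding Teq using that by (simp add: field_simps power_mult_distrib)
  thus ?thesis unfolding \<zeta>_def by (rule h(3))
 qed
 have outside: "pd b (\<zeta> R) x = 0" if R: "0 < R" and x: "x \<in> M" "norm x < R \<or> 2 * R < norm x" for R x b
 proof (cases "norm x < R")
  case True
  have "pd b (%x. 1) x = pd b (\<zeta> R) x"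
   by (rule pd_cong_local[of x "ball 0 R"]) (use True x one[OF R] sm_const in auto)
  thus ?thesis by (simp add: pd_const x)
 next
  case False
  show ?thesis by (rule pd_zero_outside[of "cball 0 (2 * R)"]) (use False x zero[OF R] in auto)
 qed
 have pdT: "pd b (T R) x = (- 2 * (x \<bullet> b)) * inverse (3 * R\<^sup>2)" if x: "x \<in> M" for R x b
 proof -
  have "(T R has_derivative (%v. (-1) * (x \<bullet> v + v \<bullet> x) * inverse (3 * R\<^sup>2))) (at x within M)"
   unfolding T_def by (auto intro!: derivative_eq_intros)
  from pd_eqI[OF x this, of b] show ?thesis by (simp add: inner_commute)
 qed
 \<comment> \<open>On the shell the gradient is at most 2 K / (3 R^2) times 2 R, whence 16/9 K^2.
   The 1 is added because \<open>K\<close> is only known to be nonnegative while a cutoff constant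
   has to be positive.\<close>
 have grad: "(SB b. (pd b (\<zeta> R) x)\<^sup>2) \<le> (16 / 9 * K\<^sup>2 + 1) / R\<^sup>2" if R: "0 < R" and x: "x \<in> M" for R x
 proof (cases "norm x < R \<or> 2 * R < norm x")
  case True
  have z: "pd b (\<zeta> R) x = 0" for b by (rule outside[OF R x True])
  show ?thesis unfolding z using R by (simp add: add_nonneg_nonneg)
 next
  case False
  have pdz: "pd b (\<zeta> R) x = (- 2 * h' (T R x) * inverse (3 * R\<^sup>2)) * (x \<bullet> b)" for b
   unfolding \<zeta>_def using pd_compose[OF h(2) sm_of_smooth[OF sT] x, of b R] pdT[OF x, of b R] by simp
  have "(SB b. (pd b (\<zeta> R) x)\<^sup>2) = (- 2 * h' (T R x) * inverse (3 * R\<^sup>2))\<^sup>2 * (SB b. (x \<bullet> b)\<^sup>2)"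
   unfolding pdz by (simp only: power_mult_distrib sum_distrib_left)
  also have "(SB b. (x \<bullet> b)\<^sup>2) = (norm x)\<^sup>2"
   unfolding power2_norm_eq_inner by (subst euclidean_inner[of x x]) (simp add: power2_eq_square)
  also have "(- 2 * h' (T R x) * inverse (3 * R\<^sup>2))\<^sup>2 * (norm x)\<^sup>2 \<le> (2 * K * inverse (3 * R\<^sup>2))\<^sup>2 * (2 * R)\<^sup>2"
  proof (rule mult_mono)
   have "(- 2 * h' (T R x) * inverse (3 * R\<^sup>2))\<^sup>2 = (2 * h' (T R x) * inverse (3 * R\<^sup>2))\<^sup>2"
    by (simp add: power2_eq_square)
   also have "... \<le> (2 * K * inverse (3 * R\<^sup>2))\<^sup>2"
    using h(6)[of "T R x"] by (intro power_mono mult_right_mono mult_left_mono mult_nonneg_nonneg) auto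
   finally show "(- 2 * h' (T R x) * inverse (3 * R\<^sup>2))\<^sup>2 \<le> (2 * K * inverse (3 * R\<^sup>2))\<^sup>2" .
   show "(norm x)\<^sup>2 \<le> (2 * R)\<^sup>2" using False by (intro power_mono) auto
  qed auto
  also have "... = (16 / 9 * K\<^sup>2) / R\<^sup>2" using R by (simp add: field_simps power2_eq_square)
  also have "... \<le> (16 / 9 * K\<^sup>2 + 1) / R\<^sup>2" by (intro divide_right_mono) auto
  finally show ?thesis .
 qed
 have "0 < 16 / 9 * K\<^sup>2 + 1" by (simp add: add_nonneg_pos)
 moreover have "0 \<le> \<zeta> R x \<and> \<zeta> R x \<le> 1" for R x unfolding \<zeta>_def by (rule h(5))
 ultimately have "cutoff \<zeta> (16 / 9 * K\<^sup>2 + 1)" unfolding cutoff_def using sz one zero outside grad by simp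
 thus ?thesis by blast
qed

lemma cutoffD:
 assumes "cutoff \<zeta> C"
 shows "0 < C" "0 < R ==> smooth_on UNIV (\<zeta> R)" "0 < R ==> 0 \<le> \<zeta> R x" "0 < R ==> \<zeta> R x \<le> 1"
  "0 < R ==> norm x \<le> R ==> \<zeta> R x = 1" "0 < R ==> 2 * R \<le> norm x ==> \<zeta> R x = 0"
  "0 < R ==> x \<in> M ==> norm x < R \<or> 2 * R < norm x ==> pd b (\<zeta> R) x = 0"
  "0 < R ==> x \<in> M ==> (SB b. (pd b (\<zeta> R) x)\<^sup>2) \<le> C / R\<^sup>2"
 using assms by (simp_all add: cutoff_def, blast)

lemma cutoff_smc: "cutoff \<zeta> C ==> 0 < R ==> smc (\<zeta> R)"
 by (rule smcI[OF sm_of_smooth[OF cutoffD(2)], of _ _ _ "2 * R"], assumption, assumption)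
  (metis cutoffD(6) linear)

text \<open>Extended by 0, the function is differentiable on the whole space and vanishes off a
  compact set, so its derivative integrates to 0 along every line in direction \<open>b\<close>;
  then Fubini along lines.\<close>

lemma integral_pd_interior:
 assumes F: "sm F" and K: "compact K" "K \<subseteq> \<Omega>" "\<And>x. x \<in> M ==> x \<notin> K ==> F x = 0" and b: "b \<in> Basis"
 shows "ig (pd b F) = 0"
proof -
 have nb: "norm b = 1" using b by simp
 obtain R where R: "0 < R" "\<forall>x\<in>K. norm x \<le> R" using compact_imp_bounded[OF K(1)] unfolding bounded_pos by blast
 have smcF: "smc F" by (rule smcI[OF F, of R]) (use K R in auto)
 define E where "E x = (if x \<in> \<Omega> then F x else 0)" for x
 define G where "G x = indicator \<Omega> x *\<^sub>R pd b F x" for x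
 have zG: "G x = 0" if "x \<notin> K" for x
  using that K pd_zero_outside[where f=F and x=x and b=b, OF compact_imp_closed[OF K(1)] K(3)] dom_sub by (cases "x \<in> \<Omega>") (auto simp: G_def)
 have dE: "(E has_derivative (%h. indicator \<Omega> x *\<^sub>R (gradient_within M F x \<bullet> h))) (at x)" for x
 proof (cases "x \<in> \<Omega>")
  case True
  have "(E has_derivative (%h. gradient_within M F x \<bullet> h)) (at x)"
   by (rule has_derivative_transform_within_open[OF sm_has_derivative_interior[OF F True] open_dom True])
    (simp add: E_def)
  thus ?thesis using True by simp
 next
  case False
  have "((%x. 0) has_derivative (%h. 0)) (at x)" by simp
  hence "(E has_derivative (%h. 0)) (at x)"
   by (rule has_derivative_transform_within_open[of _ _ _ _ "- K"])
    (use False K dom_sub compact_imp_closed[OF K(1)] in \<open>auto simp: E_def\<close>)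
  thus ?thesis using False by simp
 qed
 have contG: "isCont G x" for x
 proof (cases "x \<in> \<Omega>")
  case True
  have "continuous_on \<Omega> (pd b F)" by (rule continuous_on_subset[OF sm_continuous[OF sm_pd[OF F]] dom_sub])
  hence "isCont (pd b F) x" using True open_dom by (simp add: continuous_on_eq_continuous_at)
  moreover have "\<forall>\<^sub>F y in nhds x. G y = pd b F y"
   using eventually_nhds_in_open[OF open_dom True] by eventually_elim (simp add: G_def)
  ultimately show ?thesis using isCont_cong[of G "pd b F" x] by blast
 next
  case False
  hence "x \<in> - K" "open (- K)" using K compact_imp_closed by auto
  from eventually_nhds_in_open[OF this(2,1)] have "\<forall>\<^sub>F y in nhds x. G y = 0"
   by eventually_elim (simp add: zG)
  thus ?thesis using isCont_cong[of G "%_. 0" x] by simp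
 qed
 have iG: "integrable lborel G"
  using smc_integrable[OF smc_pd[OF smcF, of b]] unfolding set_integrable_def G_def .
 have inner: "(LINT s|lborel. G (y + s *\<^sub>R b)) = 0" for y
 proof -
  define A where "A = R + norm y + 1"
  have out: "y + s *\<^sub>R b \<notin> K" if "A \<le> \<bar>s\<bar>" for s
  proof
   assume "y + s *\<^sub>R b \<in> K"
   hence "norm (y + s *\<^sub>R b) \<le> R" using R by blast
   moreover have "\<bar>s\<bar> \<le> norm (y + s *\<^sub>R b) + norm y"
    using norm_triangle_ineq4[of "y + s *\<^sub>R b" y] nb by simp
   ultimately show False using that by (simp add: A_def)
  qed
  have A0: "- A \<le> A" using R by (simp add: A_def add_nonneg_nonneg)
  have "(LINT s|lborel. indicator {-A..A} s *\<^sub>R G (y + s *\<^sub>R b)) = E (y + A *\<^sub>R b) - E (y + (-A) *\<^sub>R b)"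
  proof (rule integral_FTC_Icc[OF A0])
   fix s :: real
   have "((%s. y + s *\<^sub>R b) has_derivative (%h. h *\<^sub>R b)) (at s within {-A..A})"
    by (auto intro!: derivative_eq_intros)
   from has_derivative_compose[OF this dE]
   show "((%s. E (y + s *\<^sub>R b)) has_vector_derivative G (y + s *\<^sub>R b)) (at s within {-A..A})"
    by (simp add: has_vector_derivative_def G_def pd_def mult.left_commute)
   have "continuous_on UNIV G" using contG by (simp add: continuous_on_eq_continuous_at)
   thus "continuous_on {-A..A} (%s. G (y + s *\<^sub>R b))"
    by (rule continuous_on_compose2) (auto intro!: continuous_intros)
  qed
  also have "E (y + A *\<^sub>R b) = 0" using out[of A] K(3) dom_sub by (auto simp: E_def)
  also have "E (y + (-A) *\<^sub>R b) = 0" using out[of "-A"] K(3) dom_sub by (auto simp: E_def)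
  also have "(LINT s|lborel. indicator {-A..A} s *\<^sub>R G (y + s *\<^sub>R b)) = (LINT s|lborel. G (y + s *\<^sub>R b))"
  proof (rule Bochner_Integration.integral_cong)
   fix s :: real
   show "indicator {-A..A} s *\<^sub>R G (y + s *\<^sub>R b) = G (y + s *\<^sub>R b)"
    using zG[OF out[of s]] by (cases "s \<in> {-A..A}") auto
  qed simp
  finally show ?thesis by simp
 qed
 have "ig (pd b F) = (LINT x|lborel. G x)" unfolding ig_def set_lebesgue_integral_def G_def ..
 also have "... = (LINT y|plane_meas b. (LINT s|lborel. G (y + s *\<^sub>R b)))"
  by (rule integral_lines[OF nb iG, symmetric])
 finally show ?thesis using inner by simp
qed

end

context serrin_dom
begin

text \<open>The divergence theorem in the case without boundary term. The field is cut off by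
  \<open>H \<epsilon> (u x)\<close>, which gives it compact support in \<Omega> and leaves the error
  \<integral> H'(u) w with w = Y \<bullet> Du. The mass of the weight H'(u) near the boundary is
  bounded uniformly in \<epsilon> by the same identity for the field \<zeta> Du, and
  \<open>w\<close> is small there because it vanishes on the boundary.\<close>

lemma integral_divergence_tangential:
 assumes Y: "\<And>b. b \<in> Basis ==> smc (Y b)"
  and tang: "\<And>x. x \<in> frontier \<Omega> ==> (SB b. Y b x * pd b u x) = 0"
 shows "ig (%x. SB b. pd b (Y b) x) = 0"
proof -
 obtain h h' :: "real \<Rightarrow> real" and K where h: "smooth_on UNIV h" "\<And>t. (h has_real_derivative h' t) (at t)"
  "\<And>t. t \<le> 0 ==> h t = 0" "\<And>t. 1 \<le> t ==> h t = 1" "\<And>t. 0 \<le> h t \<and> h t \<le> 1" "\<And>t. 0 \<le> h' t \<and> h' t \<le> K"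
  using smooth_step_exists by metis
 obtain \<zeta> C where \<zeta>: "cutoff \<zeta> C" using cutoff_exists by blast
 have "\<forall>b\<in>Basis. \<exists>R. 0 < R \<and> (\<forall>x\<in>M. Y b x \<noteq> 0 \<longrightarrow> norm x \<le> R)"
 proof
  fix b :: 'a assume "b \<in> Basis"
  obtain R where "0 < R" "\<forall>x\<in>M. Y b x \<noteq> 0 \<longrightarrow> norm x \<le> R" by (rule smc_bound[OF Y[OF \<open>b \<in> Basis\<close>]])
  thus "\<exists>R. 0 < R \<and> (\<forall>x\<in>M. Y b x \<noteq> 0 \<longrightarrow> norm x \<le> R)" by blast
 qed
 then obtain Rb where Rb: "\<And>b. b \<in> Basis ==> 0 < Rb b" "\<And>b x. b \<in> Basis ==> x \<in> M ==> Y b x \<noteq> 0 ==> norm x \<le> Rb b"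
  by metis
 define R where "R = (SB b. Rb b) + 1"
 have R0: "0 < R" unfolding R_def using Rb(1) by (intro add_nonneg_pos sum_nonneg) (auto intro: less_imp_le)
 have YR: "norm x \<le> R" if "b \<in> Basis" "x \<in> M" "Y b x \<noteq> 0" for b x
 proof -
  have "Rb b \<le> (SB b. Rb b)" using that(1) Rb(1) by (intro member_le_sum) (auto intro: less_imp_le)
  thus ?thesis using Rb(2)[OF that] by (simp add: R_def)
 qed
 define w where "w x = (SB b. Y b x * pd b u x)" for x
 \<comment> \<open>The comparison density, belonging to the field \<zeta> Du. It equals 1 at the
   boundary points of norm at most \<open>R\<close>, and \<open>Y\<close> is supported within that
   norm.\<close>
 define q where "q x = (SB b. (\<zeta> R x * pd b u x) * pd b u x)" for x
 define div1 where "div1 x = (SB b. pd b (Y b) x)" for x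
 define div2 where "div2 x = (SB b. pd b (%x. \<zeta> R x * pd b u x) x)" for x
 have sz: "smc (\<zeta> R)" by (rule cutoff_smc[OF \<zeta> R0])
 have smY2: "smc (%x. \<zeta> R x * pd b u x)" for b by (rule smc_mult[OF sz sm_pd[OF smu]])
 have smcw: "smc w" unfolding w_def by (intro smc_sum smc_mult Y sm_pd smu)
 have smcq: "smc q" unfolding q_def by (intro smc_sum smc_mult smY2 sm_pd smu)
 have smcd1: "smc div1" unfolding div1_def by (intro smc_sum smc_pd Y)
 have smcd2: "smc div2" unfolding div2_def by (intro smc_sum smc_pd smY2)
 \<comment> \<open>The step rescaled: 0 up to \<epsilon> / 2 and 1 from \<epsilon> on.\<close>
 define H where "H \<epsilon> t = h (-1 + t * (2 / \<epsilon>))" for \<epsilon> t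
 define H' where "H' \<epsilon> t = (2 / \<epsilon>) * h' (-1 + t * (2 / \<epsilon>))" for \<epsilon> t
 have sH: "smooth_on UNIV (H \<epsilon>)" for \<epsilon>
  unfolding H_def using smooth_on_compose_affine[OF h(1), of UNIV "-1" "2 / \<epsilon>"] by simp
 have dH: "(H \<epsilon> has_real_derivative H' \<epsilon> t) (at t)" for \<epsilon> t
 proof -
  have "((%t. -1 + t * k) has_real_derivative k) (at t)" for k :: real
   by (auto intro!: derivative_eq_intros)
  note D = this[of "2 / \<epsilon>"]
  show ?thesis unfolding H_def H'_def
   by (rule DERIV_cong[OF DERIV_chain'[OF D h(2)]]) (simp add: mult.commute)
 qed
 have H'0: "0 \<le> H' \<epsilon> t" if "0 < \<epsilon>" for \<epsilon> t using h(6) that by (simp add: H'_def)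
 have Hlow: "H \<epsilon> t = 0" if "0 < \<epsilon>" "t \<le> \<epsilon> / 2" for \<epsilon> t
  unfolding H_def using that by (intro h(3)) (simp add: field_simps)
 have Hhigh: "H \<epsilon> t = 1" if "0 < \<epsilon>" "\<epsilon> \<le> t" for \<epsilon> t
  unfolding H_def using that by (intro h(4)) (simp add: field_simps)
 have H'high: "H' \<epsilon> t = 0" if "0 < \<epsilon>" "\<epsilon> < t" for \<epsilon> t
 proof -
  have "((%t. 1) has_real_derivative 0) (at t)" by simp
  hence "(H \<epsilon> has_real_derivative 0) (at t)"
   by (rule has_field_derivative_transform_within_open[of _ _ _ "{\<epsilon><..}"]) (use Hhigh that in auto)
  thus ?thesis using dH DERIV_unique by blast
 qed
 have smHu: "sm (%x. H \<epsilon> (u x))" for \<epsilon> by (rule sm_compose[OF sH smu])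
 have smHu': "sm (%x. H' \<epsilon> (u x))" for \<epsilon>
 proof -
  have eq: "frechet_derivative (H \<epsilon>) (at t) 1 = H' \<epsilon> t" for t
   using frechet_derivative_at[OF dH[of \<epsilon> t, unfolded has_field_derivative_def]] by (metis mult.right_neutral)
  have "smooth_on UNIV (%t. frechet_derivative (H \<epsilon>) (at t) 1)" by (rule smooth_on_frechet[OF sH])
  thus ?thesis using sm_compose[OF _ smu, of "H' \<epsilon>"] by (simp add: eq)
 qed
 have flux: "ig (%x. H \<epsilon> (u x) * (SB b. pd b (Z b) x)) = - ig (%x. H' \<epsilon> (u x) * (SB b. Z b x * pd b u x))"
  if \<epsilon>: "0 < \<epsilon>" and Z: "\<And>b. b \<in> Basis ==> smc (Z b)" for \<epsilon> Z
 proof -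
  have each: "ig (%x. H \<epsilon> (u x) * pd b (Z b) x) + ig (%x. H' \<epsilon> (u x) * (Z b x * pd b u x)) = 0" if b: "b \<in> Basis" for b
  proof -
   obtain Rz where Rz: "0 < Rz" "\<forall>x\<in>M. Z b x \<noteq> 0 \<longrightarrow> norm x \<le> Rz" by (rule smc_bound[OF Z[OF b]])
   define F where "F = (%x. H \<epsilon> (u x) * Z b x)"
   define Kc where "Kc = (M \<inter> cball 0 Rz) \<inter> u -` {\<epsilon>/2..}"
   have "closed (M \<inter> u -` {\<epsilon>/2..})"
    by (rule continuous_closed_preimage[OF sm_continuous[OF smu]]) auto
   hence "compact ((M \<inter> u -` {\<epsilon>/2..}) \<inter> cball 0 Rz)" by (rule closed_Int_compact) simp
   moreover have "(M \<inter> u -` {\<epsilon>/2..}) \<inter> cball 0 Rz = Kc" by (auto simp: Kc_def)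
   ultimately have Kc: "compact Kc" by simp
   have "Kc \<subseteq> \<Omega>"
   proof
    fix x assume "x \<in> Kc"
    hence "x \<in> M" "u x \<noteq> 0" using \<epsilon> by (auto simp: Kc_def)
    thus "x \<in> \<Omega>" using u_zero frontier_dom by blast
   qed
   moreover have "F x = 0" if "x \<in> M" "x \<notin> Kc" for x
    using that Rz Hlow[OF \<epsilon>, of "u x"] by (auto simp: F_def Kc_def)
   moreover have "sm F" unfolding F_def by (intro sm_mult smHu smc_sm Z b)
   ultimately have "ig (pd b F) = 0" using integral_pd_interior[OF _ Kc _ _ b] by blast
   moreover have "ig (pd b F) = ig (%x. H \<epsilon> (u x) * pd b (Z b) x + H' \<epsilon> (u x) * (Z b x * pd b u x))"
   proof (rule ig_cong)
    fix x assume x: "x \<in> M"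
    show "pd b F x = H \<epsilon> (u x) * pd b (Z b) x + H' \<epsilon> (u x) * (Z b x * pd b u x)"
     unfolding F_def pd_mult[OF smHu smc_sm[OF Z[OF b]] x] pd_compose[OF dH smu x] by simp
   qed
   ultimately show ?thesis
    using ig_add[of "%x. H \<epsilon> (u x) * pd b (Z b) x" "%x. H' \<epsilon> (u x) * (Z b x * pd b u x)"]
    by (simp add: smc_mult'[OF smHu smc_pd[OF Z[OF b]]] smc_mult'[OF smHu' smc_mult[OF Z[OF b] sm_pd[OF smu]]])
  qed
  have "ig (%x. H \<epsilon> (u x) * (SB b. pd b (Z b) x)) = (SB b. ig (%x. H \<epsilon> (u x) * pd b (Z b) x))"
   unfolding sum_distrib_left by (rule ig_sum) (intro smc_mult' smHu smc_pd Z)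
  also have "... = (SB b. - ig (%x. H' \<epsilon> (u x) * (Z b x * pd b u x)))"
   by (rule sum.cong[OF refl]) (use each in \<open>simp add: eq_neg_iff_add_eq_0\<close>)
  also have "... = - ig (%x. H' \<epsilon> (u x) * (SB b. Z b x * pd b u x))"
  proof -
   have "smc (%x. H' \<epsilon> (u x) * (Z b x * pd b u x))" if "b \<in> Basis" for b
    by (rule smc_mult'[OF smHu' smc_mult[OF Z[OF that] sm_pd[OF smu]]])
   from ig_sum[of Basis "%b x. H' \<epsilon> (u x) * (Z b x * pd b u x)", OF this]
   show ?thesis by (simp only: sum_distrib_left sum_negf)
  qed
  finally show ?thesis .
 qed
 define C2 where "C2 = ig (%x. \<bar>div2 x\<bar>)"
 have q_bound: "ig (%x. H' \<epsilon> (u x) * q x) \<le> C2" if \<epsilon>: "0 < \<epsilon>" for \<epsilon>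
 proof -
  have "ig (%x. H' \<epsilon> (u x) * q x) = - ig (%x. H \<epsilon> (u x) * div2 x)"
   unfolding q_def div2_def flux[OF \<epsilon> smY2] by simp
  also have "... = ig (%x. - (H \<epsilon> (u x) * div2 x))" by (simp add: ig_minus)
  also have "... \<le> C2" unfolding C2_def
  proof (rule ig_mono)
   show "set_integrable lborel \<Omega> (%x. - (H \<epsilon> (u x) * div2 x))"
    by (intro smc_integrable smc_minus smc_mult' smHu smcd2)
   show "set_integrable lborel \<Omega> (%x. \<bar>div2 x\<bar>)" by (rule smc_abs_integrable[OF smcd2])
   fix x
   have "\<bar>H \<epsilon> (u x) * div2 x\<bar> \<le> 1 * \<bar>div2 x\<bar>"
    unfolding abs_mult using h(5) by (intro mult_right_mono) (auto simp: H_def)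
   thus "- (H \<epsilon> (u x) * div2 x) \<le> \<bar>div2 x\<bar>" by linarith
  qed
  finally show ?thesis .
 qed
 have C20: "0 \<le> C2" unfolding C2_def ig_def set_lebesgue_integral_def by (intro integral_nonneg_AE) auto
 \<comment> \<open>\<open>B\<close> is the compact set where the strict estimate fails. It avoids
   the boundary, since \<open>w\<close> is 0 and \<open>q\<close> is 1 there, so \<open>u\<close>
   has a positive minimum on it; half of that minimum serves as threshold.\<close>
 have small: "\<exists>\<epsilon>0>0. \<forall>x\<in>M \<inter> cball 0 R. u x \<le> \<epsilon>0 \<longrightarrow> \<bar>w x\<bar> \<le> \<eta> * q x" if \<eta>: "0 < \<eta>" for \<eta>
 proof -
  define B where "B = (M \<inter> cball 0 R) \<inter> (%x. \<eta> * q x - \<bar>w x\<bar>) -` {..0}"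
  have "continuous_on M (%x. \<eta> * q x - \<bar>w x\<bar>)"
   by (intro continuous_intros sm_continuous smc_sm smcq smcw)
  hence "closed (M \<inter> (%x. \<eta> * q x - \<bar>w x\<bar>) -` {..0})" by (rule continuous_closed_preimage) auto
  hence "compact ((M \<inter> (%x. \<eta> * q x - \<bar>w x\<bar>) -` {..0}) \<inter> cball 0 R)" by (rule closed_Int_compact) simp
  moreover have "(M \<inter> (%x. \<eta> * q x - \<bar>w x\<bar>) -` {..0}) \<inter> cball 0 R = B" by (auto simp: B_def)
  ultimately have B: "compact B" by simp
  have BM: "B \<subseteq> M" by (auto simp: B_def)
  have upos: "0 < u x" if x: "x \<in> B" for x
  proof (rule ccontr)
   assume "\<not> 0 < u x"
   hence fr: "x \<in> frontier \<Omega>" using u_zero_iff[of x] u_nonneg[of x] x BM by force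
   have "norm x \<le> R" using x by (simp add: B_def)
   hence "q x = 1" unfolding q_def using grad_sq[OF fr] cutoffD(5)[OF \<zeta> R0] by (simp add: power2_eq_square)
   moreover have "w x = 0" unfolding w_def by (rule tang[OF fr])
   ultimately show False using x \<eta> by (simp add: B_def)
  qed
  show ?thesis
  proof (cases "B = {}")
   case True
   have "\<bar>w x\<bar> \<le> \<eta> * q x" if "x \<in> M \<inter> cball 0 R" for x
   proof (rule ccontr)
    assume "\<not> \<bar>w x\<bar> \<le> \<eta> * q x"
    hence "x \<in> B" using that by (simp add: B_def)
    thus False using True by simp
   qed
   thus ?thesis by (intro exI[of _ 1]) simp
  next
   case False
   obtain x0 where x0: "x0 \<in> B" "\<forall>x\<in>B. u x0 \<le> u x"
    using continuous_attains_inf[OF B False continuous_on_subset[OF sm_continuous[OF smu] BM]] by blast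
   have "\<bar>w x\<bar> \<le> \<eta> * q x" if "x \<in> M \<inter> cball 0 R" "u x \<le> u x0 / 2" for x
   proof (rule ccontr)
    assume "\<not> \<bar>w x\<bar> \<le> \<eta> * q x"
    hence "x \<in> B" using that by (simp add: B_def)
    thus False using x0 that upos[OF x0(1)] by fastforce
   qed
   thus ?thesis using upos[OF x0(1)] by (intro exI[of _ "u x0 / 2"]) simp
  qed
 qed
 have wbound: "\<bar>ig (%x. H' \<epsilon> (u x) * w x)\<bar> \<le> \<eta> * C2"
  if \<eta>: "0 < \<eta>" and \<epsilon>: "0 < \<epsilon>" and \<epsilon>0: "\<forall>x\<in>M \<inter> cball 0 R. u x \<le> \<epsilon> \<longrightarrow> \<bar>w x\<bar> \<le> \<eta> * q x" for \<epsilon> \<eta>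
 proof -
  have q0: "0 \<le> q x" for x unfolding q_def using cutoffD(3)[OF \<zeta> R0]
   by (intro sum_nonneg) (simp add: mult.assoc)
  have "\<bar>ig (%x. H' \<epsilon> (u x) * w x)\<bar> \<le> ig (%x. \<bar>H' \<epsilon> (u x) * w x\<bar>)"
   by (rule ig_abs[OF smc_mult'[OF smHu' smcw]])
  also have "... \<le> ig (%x. \<eta> * (H' \<epsilon> (u x) * q x))"
  proof (rule ig_mono)
   show "set_integrable lborel \<Omega> (%x. \<bar>H' \<epsilon> (u x) * w x\<bar>)" by (rule smc_abs_integrable[OF smc_mult'[OF smHu' smcw]])
   show "set_integrable lborel \<Omega> (%x. \<eta> * (H' \<epsilon> (u x) * q x))" by (intro smc_integrable smc_cmult smc_mult' smHu' smcq)
   fix x assume x: "x \<in> M"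
   show "\<bar>H' \<epsilon> (u x) * w x\<bar> \<le> \<eta> * (H' \<epsilon> (u x) * q x)"
   proof (cases "u x \<le> \<epsilon> \<and> norm x \<le> R")
    case True
    hence "\<bar>w x\<bar> \<le> \<eta> * q x" using \<epsilon>0 x by simp
    hence "H' \<epsilon> (u x) * \<bar>w x\<bar> \<le> H' \<epsilon> (u x) * (\<eta> * q x)" by (rule mult_left_mono[OF _ H'0[OF \<epsilon>]])
    thus ?thesis using H'0[OF \<epsilon>, of "u x"] by (simp add: abs_mult mult.left_commute)
   next
    case False
    have "H' \<epsilon> (u x) * w x = 0"
    proof (cases "u x \<le> \<epsilon>")
     case True
     hence "\<not> norm x \<le> R" using False by simp
     hence "Y b x = 0" if "b \<in> Basis" for b using YR[OF that x] by blast
     thus ?thesis by (simp add: w_def)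
    next
     case False
     thus ?thesis using H'high[OF \<epsilon>, of "u x"] by simp
    qed
    moreover have "0 \<le> \<eta> * (H' \<epsilon> (u x) * q x)"
     using \<eta> by (intro mult_nonneg_nonneg H'0[OF \<epsilon>] q0) simp
    ultimately show ?thesis by (simp only: abs_zero)
   qed
  qed
  also have "... = \<eta> * ig (%x. H' \<epsilon> (u x) * q x)" by (rule ig_cmult)
  also have "... \<le> \<eta> * C2" using q_bound[OF \<epsilon>] \<eta> by (intro mult_left_mono) auto
  finally show ?thesis .
 qed
 have lim: "(%n. ig (%x. H (1 / real (Suc n)) (u x) * div1 x)) \<longlonglongrightarrow> ig div1"
  unfolding ig_def set_lebesgue_integral_def
 proof (rule integral_dominated_convergence[where w="%x. norm (indicator \<Omega> x *\<^sub>R div1 x)"])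
  have i1: "integrable lborel (%x. indicator \<Omega> x *\<^sub>R div1 x)" using smc_integrable[OF smcd1] by (simp add: set_integrable_def)
  thus "(%x. indicator \<Omega> x *\<^sub>R div1 x) \<in> borel_measurable lborel" by (rule borel_measurable_integrable)
  show "integrable lborel (%x. norm (indicator \<Omega> x *\<^sub>R div1 x))" using i1 by (rule integrable_norm)
  fix n
  have "integrable lborel (%x. indicator \<Omega> x *\<^sub>R (H (1 / real (Suc n)) (u x) * div1 x))"
   using smc_integrable[OF smc_mult'[OF smHu smcd1]] by (simp add: set_integrable_def)
  thus "(%x. indicator \<Omega> x *\<^sub>R (H (1 / real (Suc n)) (u x) * div1 x)) \<in> borel_measurable lborel"
   by (rule borel_measurable_integrable)
  have "norm (indicator \<Omega> x *\<^sub>R (H (1 / real (Suc n)) (u x) * div1 x)) \<le> norm (indicator \<Omega> x *\<^sub>R div1 x)" for x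
  proof -
   have "\<bar>H (1 / real (Suc n)) (u x)\<bar> \<le> 1" using h(5) by (simp add: H_def)
   hence "\<bar>H (1 / real (Suc n)) (u x)\<bar> * \<bar>div1 x\<bar> \<le> 1 * \<bar>div1 x\<bar>" by (rule mult_right_mono) simp
   thus ?thesis by (simp add: abs_mult indicator_def)
  qed
  thus "AE x in lborel. norm (indicator \<Omega> x *\<^sub>R (H (1 / real (Suc n)) (u x) * div1 x)) \<le> norm (indicator \<Omega> x *\<^sub>R div1 x)" by simp
 next
  have "(%n. indicator \<Omega> x *\<^sub>R (H (1 / real (Suc n)) (u x) * div1 x)) \<longlonglongrightarrow> indicator \<Omega> x *\<^sub>R div1 x" for x
  proof (cases "x \<in> \<Omega>")
   case True
   then obtain N where N: "1 / real (Suc N) < u x" using u_pos nat_approx_posE by blast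
   have "H (1 / real (Suc n)) (u x) = 1" if "N \<le> n" for n
   proof (rule Hhigh)
    have "1 / real (Suc n) \<le> 1 / real (Suc N)" using that by (intro divide_left_mono) auto
    thus "1 / real (Suc n) \<le> u x" using N by simp
   qed simp
   hence "\<forall>\<^sub>F n in sequentially. indicator \<Omega> x *\<^sub>R (H (1 / real (Suc n)) (u x) * div1 x) = indicator \<Omega> x *\<^sub>R div1 x"
    by (intro eventually_sequentiallyI[of N]) simp
   thus ?thesis by (rule tendsto_eventually)
  qed simp
  thus "AE x in lborel. (%n. indicator \<Omega> x *\<^sub>R (H (1 / real (Suc n)) (u x) * div1 x)) \<longlonglongrightarrow> indicator \<Omega> x *\<^sub>R div1 x" by simp
 qed
 have "\<bar>ig div1\<bar> \<le> \<eta> * C2" if \<eta>: "0 < \<eta>" for \<eta>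
 proof -
  obtain \<epsilon>0 where \<epsilon>0: "0 < \<epsilon>0" "\<forall>x\<in>M \<inter> cball 0 R. u x \<le> \<epsilon>0 \<longrightarrow> \<bar>w x\<bar> \<le> \<eta> * q x" using small[OF \<eta>] by blast
  obtain N where N: "1 / real (Suc N) < \<epsilon>0" using \<epsilon>0(1) nat_approx_posE by blast
  have "\<bar>ig (%x. H (1 / real (Suc n)) (u x) * div1 x)\<bar> \<le> \<eta> * C2" if "N \<le> n" for n
  proof -
   have "1 / real (Suc n) \<le> 1 / real (Suc N)" using that by (intro divide_left_mono) auto
   hence le: "1 / real (Suc n) \<le> \<epsilon>0" using N by simp
   have pos: "0 < 1 / real (Suc n)" by simp
   have "\<bar>ig (%x. H' (1 / real (Suc n)) (u x) * w x)\<bar> \<le> \<eta> * C2"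
    by (rule wbound[OF \<eta> pos]) (use \<epsilon>0(2) le in force)
   thus ?thesis using flux[OF pos Y] by (simp add: div1_def w_def)
  qed
  hence "\<forall>\<^sub>F n in sequentially. \<bar>ig (%x. H (1 / real (Suc n)) (u x) * div1 x)\<bar> \<le> \<eta> * C2"
   by (rule eventually_sequentiallyI)
  thus ?thesis by (rule tendsto_upperbound[OF tendsto_rabs[OF lim]]) simp
 qed
 note bnd = this
 have "ig div1 = 0"
 proof (rule ccontr)
  assume ne: "ig div1 \<noteq> 0"
  define \<eta> where "\<eta> = \<bar>ig div1\<bar> / (2 * (C2 + 1))"
  have "0 < \<eta>" unfolding \<eta>_def using ne C20 by (intro divide_pos_pos) auto
  from bnd[OF this] have "\<bar>ig div1\<bar> \<le> \<bar>ig div1\<bar> * (C2 / (2 * (C2 + 1)))" by (simp add: \<eta>_def)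
  moreover have "C2 / (2 * (C2 + 1)) < 1" using C20 by (simp add: field_simps)
  ultimately show False using ne mult_strict_left_mono[of "C2 / (2 * (C2 + 1))" 1 "\<bar>ig div1\<bar>"] by simp
 qed
 thus ?thesis unfolding div1_def .
qed

end

section \<open>The functional \<open>sig\<close> and its computation on boundary patches\<close>

context serrin_dom
begin

text \<open>This is minus the integral of div (F Du), and \<open>- Du\<close> is the unit outward
  normal.\<close>

definition sig :: "('a \<Rightarrow> real) \<Rightarrow> real" where
 "sig F = ig (%x. real DIM('a) * F x - (SB b. pd b F x * pd b u x))"

lemma sig_smc: "smc F ==> smc (%x. real DIM('a) * F x - (SB b. pd b F x * pd b u x))"
 by (intro smc_diff smc_cmult smc_sum smc_mult smc_pd sm_pd smu)

lemma sig_div: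
 assumes F: "smc F"
 shows "ig (%x. SB b. pd b (%x. F x * pd b u x) x) = - sig F"
proof -
 have "(SB b. pd b (%x. F x * pd b u x) x) = - (real DIM('a) * F x - (SB b. pd b F x * pd b u x))" if "x \<in> \<Omega>" for x
 proof -
  have x: "x \<in> M" using that dom_sub by blast
  have "(SB b. pd b (%x. F x * pd b u x) x) = (SB b. F x * pd b (pd b u) x + pd b F x * pd b u x)"
   by (simp only: pd_mult[OF smc_sm[OF F] sm_pd[OF smu] x])
  also have "... = F x * (SB b. pd b (pd b u) x) + (SB b. pd b F x * pd b u x)"
   by (simp only: sum.distrib sum_distrib_left)
  finally show ?thesis by (simp add: lap[OF x])
 qed
 hence "ig (%x. SB b. pd b (%x. F x * pd b u x) x) = ig (%x. - (real DIM('a) * F x - (SB b. pd b F x * pd b u x)))"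
  by (rule ig_cong)
 thus ?thesis by (simp only: ig_minus sig_def)
qed

lemma sig_add: assumes "smc F" "smc G" shows "sig (%x. F x + G x) = sig F + sig G"
proof -
 have "sig (%x. F x + G x) = ig (%x. (real DIM('a) * F x - (SB b. pd b F x * pd b u x)) + (real DIM('a) * G x - (SB b. pd b G x * pd b u x)))"
  unfolding sig_def
 proof (rule ig_cong)
  fix x assume x: "x \<in> M"
  show "real DIM('a) * (F x + G x) - (SB b. pd b (%x. F x + G x) x * pd b u x) =
   (real DIM('a) * F x - (SB b. pd b F x * pd b u x)) + (real DIM('a) * G x - (SB b. pd b G x * pd b u x))"
   unfolding pd_add[OF smc_sm[OF assms(1)] smc_sm[OF assms(2)] x] by (simp add: distrib_left distrib_right sum.distrib)
 qed
 also have "... = sig F + sig G" unfolding sig_def by (rule ig_add[OF sig_smc[OF assms(1)] sig_smc[OF assms(2)]])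
 finally show ?thesis .
qed

lemma sig_cong:
 assumes "\<And>x. x \<in> M ==> F x = G x"
 shows "sig F = sig G"
 unfolding sig_def
proof (rule ig_cong)
 fix x assume x: "x \<in> M"
 show "real DIM('a) * F x - (SB b. pd b F x * pd b u x) = real DIM('a) * G x - (SB b. pd b G x * pd b u x)"
 proof -
  have "pd b F x = pd b G x" for b by (rule pd_cong[OF x assms])
  thus ?thesis using assms[OF x] by simp
 qed
qed

lemma sig_zero: "sig (%x. 0) = 0"
proof -
 have "sig (%x. 0) = ig (%x. 0)" unfolding sig_def
  by (rule ig_cong) (use dom_sub in \<open>auto simp: pd_const\<close>)
 thus ?thesis by (simp add: ig_def)
qed

lemma sig_cmult: assumes "smc F" shows "sig (%x. c * F x) = c * sig F"
proof -
 have "sig (%x. c * F x) = ig (%x. c * (real DIM('a) * F x - (SB b. pd b F x * pd b u x)))"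
  unfolding sig_def
 proof (rule ig_cong)
  fix x assume x: "x \<in> M"
  show "real DIM('a) * (c * F x) - (SB b. pd b (%x. c * F x) x * pd b u x) =
   c * (real DIM('a) * F x - (SB b. pd b F x * pd b u x))"
   unfolding pd_cmult[OF smc_sm[OF assms] x] by (simp add: right_diff_distrib sum_distrib_left mult.assoc mult.left_commute)
 qed
 thus ?thesis by (simp only: ig_cmult sig_def)
qed

lemma sig_sum: "finite I ==> (\<And>i. i \<in> I ==> smc (F i)) ==> sig (%x. \<Sum>i\<in>I. F i x) = (\<Sum>i\<in>I. sig (F i))"
 by (induction I rule: finite_induct) (simp_all add: sig_zero sig_add smc_sum)

lemma sm_gradient_inner: assumes "sm F" shows "sm (%x. gradient_within M F x \<bullet> v)"
proof -
 have eq: "gradient_within M F x \<bullet> v = (SB b. pd b F x * (v \<bullet> b))" for x by (rule gradient_inner)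
 show ?thesis unfolding eq by (intro sm_sum sm_mult sm_pd sm_const assms)
qed

text \<open>The field F v is corrected by its normal part: F v - F (Du \<bullet> v) Du is tangential
  on the boundary because |Du| = 1 there, so its divergence integrates to 0.\<close>

lemma integration_by_parts:
 assumes F: "smc F"
 shows "ig (%x. gradient_within M F x \<bullet> v) = - sig (%x. F x * (Du x \<bullet> v))"
proof -
 define G where "G = (%x. F x * (Du x \<bullet> v))"
 have smG: "smc G" unfolding G_def by (rule smc_mult[OF F sm_gradient_inner[OF smu]])
 define Y where "Y b = (%x. (v \<bullet> b) * F x - G x * pd b u x)" for b
 have smY: "smc (Y b)" for b unfolding Y_def by (intro smc_diff smc_cmult F smc_mult smG sm_pd smu)
 have sF: "sm F" "sm G" using F smG smc_sm by auto
 have "ig (%x. SB b. pd b (Y b) x) = 0"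
 proof (rule integral_divergence_tangential[OF smY])
  fix x assume x: "x \<in> frontier \<Omega>"
  have "(SB b. Y b x * pd b u x) = F x * (SB b. pd b u x * (v \<bullet> b)) - G x * (SB b. (pd b u x)\<^sup>2)"
   unfolding Y_def sum_distrib_left sum_subtractf[symmetric]
   by (rule sum.cong[OF refl]) (simp add: algebra_simps power2_eq_square)
  also have "... = 0" unfolding grad_sq[OF x] gradient_inner[of u x v, symmetric] by (simp add: G_def)
  finally show "(SB b. Y b x * pd b u x) = 0" .
 qed
 moreover have "ig (%x. SB b. pd b (Y b) x) =
   ig (%x. gradient_within M F x \<bullet> v - (SB b. pd b (%x. G x * pd b u x) x))"
 proof (rule ig_cong)
  fix x assume x: "x \<in> M"
  have "pd b (Y b) x = pd b F x * (v \<bullet> b) - pd b (%x. G x * pd b u x) x" for b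
   unfolding Y_def pd_diff[OF sm_mult[OF sm_const sF(1)] sm_mult[OF sF(2) sm_pd[OF smu]] x] pd_cmult[OF sF(1) x] by simp
  thus "(SB b. pd b (Y b) x) = gradient_within M F x \<bullet> v - (SB b. pd b (%x. G x * pd b u x) x)"
   unfolding gradient_inner[of F x v] by (simp only: sum_subtractf)
 qed
 moreover have "ig (%x. gradient_within M F x \<bullet> v - (SB b. pd b (%x. G x * pd b u x) x)) =
   ig (%x. gradient_within M F x \<bullet> v) - ig (%x. SB b. pd b (%x. G x * pd b u x) x)"
 proof (rule ig_diff)
  have eq: "gradient_within M F x \<bullet> v = (SB b. pd b F x * (v \<bullet> b))" for x by (rule gradient_inner)
  show "smc (%x. gradient_within M F x \<bullet> v)" unfolding eq by (intro smc_sum smc_mult smc_pd F sm_const)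
  show "smc (%x. SB b. pd b (%x. G x * pd b u x) x)" by (intro smc_sum smc_pd smc_mult smG sm_pd smu)
 qed
 ultimately show ?thesis using sig_div[OF smG] by (simp add: G_def)
qed

lemma line_FTC:
 assumes F: "sm F" and ab: "a \<le> b" and L: "\<And>s. s \<in> {a..b} ==> y + s *\<^sub>R v \<in> M"
 shows "(LINT s|lborel. indicator {a..b} s *\<^sub>R (gradient_within M F (y + s *\<^sub>R v) \<bullet> v)) = F (y + b *\<^sub>R v) - F (y + a *\<^sub>R v)"
proof (rule integral_FTC_Icc[OF ab])
 fix s assume s: "a \<le> s" "s \<le> b"
 have d: "((%s. y + s *\<^sub>R v) has_derivative (%h. h *\<^sub>R v)) (at s within {a..b})"
  by (auto intro!: derivative_eq_intros)
 have im: "(%s. y + s *\<^sub>R v) ` {a..b} \<subseteq> M" using L by blast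
 have "((%s. F (y + s *\<^sub>R v)) has_derivative (%h. gradient_within M F (y + s *\<^sub>R v) \<bullet> (h *\<^sub>R v))) (at s within {a..b})"
  by (rule has_derivative_in_compose[OF d], rule has_derivative_subset[OF sm_has_derivative[OF F L] im]) (use s in simp)
 thus "((%s. F (y + s *\<^sub>R v)) has_vector_derivative gradient_within M F (y + s *\<^sub>R v) \<bullet> v) (at s within {a..b})"
  by (simp add: has_vector_derivative_def)
next
 have "continuous_on {a..b} (%s. y + s *\<^sub>R v)" by (intro continuous_intros)
 from continuous_on_compose2[OF sm_continuous[OF sm_gradient_inner[OF F, of v]] this]
 show "continuous_on {a..b} (%s. gradient_within M F (y + s *\<^sub>R v) \<bullet> v)" using L by blast
qed

text \<open>Half the radius leaves room to follow a line beyond the patch within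
  \<open>ball p r\<close>, where the monotonicity of \<open>u\<close> along \<open>Du p\<close> is
  still available.\<close>

definition patch :: "'a \<Rightarrow> real \<Rightarrow> 'a set" where
 "patch p r = frontier \<Omega> \<inter> cball p (r / 2)"

lemma patch_compact: "compact (patch p r)"
 unfolding patch_def by (intro closed_Int_compact compact_cball) simp

lemma patch_sub: "bball p \<delta> r ==> patch p r \<subseteq> ball p r \<inter> frontier \<Omega>"
 using bball_delta(3)[of p \<delta> r] by (auto simp: patch_def)

text \<open>\<open>u\<close> vanishes at both points, so \<open>bball\<close> bounds the
  \<open>Du p\<close> component of x - y by \<delta> times its norm. Pythagoras gives the factor
  sqrt (1 - \<delta>^2), which is at least 1 - \<delta>.\<close>

lemma patch_proj_lower:
 assumes b: "bball p \<delta> r" and x: "x \<in> patch p r" and y: "y \<in> patch p r"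
 shows "(1 - \<delta>) * norm (x - y) \<le> norm (proj (Du p) x - proj (Du p) y)"
proof -
 have \<delta>: "0 < \<delta>" "\<delta> \<le> 1/2" using b by (simp_all add: bball_def)
 have xy: "x \<in> ball p r \<inter> M" "y \<in> ball p r \<inter> M" "u x = 0" "u y = 0"
  using x y patch_sub[OF b] frontier_sub u_zero by auto
 hence "\<bar>u x - u y - Du p \<bullet> (x - y)\<bar> \<le> \<delta> * norm (x - y)" using b unfolding bball_def by blast
 hence *: "\<bar>(x - y) \<bullet> Du p\<bar> \<le> \<delta> * norm (x - y)" using xy by (simp add: inner_commute)
 have "((x - y) \<bullet> Du p)\<^sup>2 \<le> (\<delta> * norm (x - y))\<^sup>2"
  using power_mono[OF *, of 2] by simp
 moreover have "(norm (proj (Du p) (x - y)))\<^sup>2 = (norm (x - y))\<^sup>2 - ((x - y) \<bullet> Du p)\<^sup>2"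
  by (rule proj_norm[OF bball_delta(5)[OF b]])
 ultimately have "(norm (proj (Du p) (x - y)))\<^sup>2 \<ge> (1 - \<delta>\<^sup>2) * (norm (x - y))\<^sup>2"
  by (simp add: power_mult_distrib left_diff_distrib)
 moreover have "(1 - \<delta>\<^sup>2) * (norm (x - y))\<^sup>2 \<ge> (1 - \<delta>)\<^sup>2 * (norm (x - y))\<^sup>2"
 proof (rule mult_right_mono)
  have "\<delta> * \<delta> \<le> \<delta> * 1" using \<delta> by (intro mult_left_mono) auto
  thus "(1 - \<delta>)\<^sup>2 \<le> 1 - \<delta>\<^sup>2" by (simp add: power2_eq_square algebra_simps)
 qed simp
 ultimately have "((1 - \<delta>) * norm (x - y))\<^sup>2 \<le> (norm (proj (Du p) (x - y)))\<^sup>2"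
  by (simp add: power_mult_distrib)
 hence "(1 - \<delta>) * norm (x - y) \<le> norm (proj (Du p) (x - y))"
  by (rule power2_le_imp_le) simp
 thus ?thesis by (simp add: linear_diff[OF proj_linear])
qed

lemma patch_inj: "bball p \<delta> r ==> inj_on (proj (Du p)) (patch p r)"
proof (rule inj_onI)
 fix x y assume b: "bball p \<delta> r" and xy: "x \<in> patch p r" "y \<in> patch p r" "proj (Du p) x = proj (Du p) y"
 have "(1 - \<delta>) * norm (x - y) \<le> 0" using patch_proj_lower[OF b xy(1,2)] xy(3) by simp
 thus "x = y" using bball_delta(1)[OF b] by (simp add: mult_le_0_iff)
qed

lemma patch_inverse:
 assumes b: "bball p \<delta> r"
 shows "continuous_on (proj (Du p) ` patch p r) (inv_into (patch p r) (proj (Du p)))"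
  and "compact (proj (Du p) ` patch p r)"
  and "y \<in> proj (Du p) ` patch p r ==> inv_into (patch p r) (proj (Du p)) y \<in> patch p r"
  and "x \<in> patch p r ==> inv_into (patch p r) (proj (Du p)) (proj (Du p) x) = x"
proof -
 have c: "continuous_on (patch p r) (proj (Du p))"
  unfolding proj_def by (intro continuous_intros)
 show "continuous_on (proj (Du p) ` patch p r) (inv_into (patch p r) (proj (Du p)))"
  by (rule continuous_on_inv[OF c patch_compact]) (simp add: inv_into_f_f[OF patch_inj[OF b]])
 show "compact (proj (Du p) ` patch p r)" by (rule compact_continuous_image[OF c patch_compact])
 show "y \<in> proj (Du p) ` patch p r ==> inv_into (patch p r) (proj (Du p)) y \<in> patch p r"
  by (rule inv_into_into)
 show "x \<in> patch p r ==> inv_into (patch p r) (proj (Du p)) (proj (Du p) x) = x"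
  by (rule inv_into_f_f[OF patch_inj[OF b]])
qed

lemma patch_function_measurable:
 assumes b: "bball p \<delta> r" and F: "continuous_on M F"
 shows "(%y. indicator (proj (Du p) ` patch p r) y * (F (inv_into (patch p r) (proj (Du p)) y) :: real)) \<in> borel_measurable borel"
proof -
 have "continuous_on (proj (Du p) ` patch p r) (%y. F (inv_into (patch p r) (proj (Du p)) y))"
  by (rule continuous_on_compose2[OF F patch_inverse(1)[OF b]])
   (use patch_inverse(3)[OF b] frontier_sub in \<open>auto simp: patch_def\<close>)
 moreover have "proj (Du p) ` patch p r \<in> sets borel"
  using compact_imp_closed[OF patch_inverse(2)[OF b]] by simp
 ultimately show ?thesis using borel_measurable_continuous_on_indicator by fastforce
qed

text \<open>As long as it stays in \<open>ball p r\<close>, a line in direction \<open>Du p\<close>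
  lies outside the closure before its boundary point and inside \<Omega> after it. The fundamental
  theorem of calculus then leaves minus the value at the boundary point, the upper end being outside
  the support.\<close>

lemma line_integral_inner:
 assumes b: "bball p \<delta> r" and F: "sm F" "\<And>x. x \<in> M ==> F x \<noteq> 0 ==> x \<in> cball p (r/2)" and y: "y \<bullet> Du p = 0"
 shows "(LINT s|lborel. indicator \<Omega> (y + s *\<^sub>R Du p) *\<^sub>R (gradient_within M F (y + s *\<^sub>R Du p) \<bullet> Du p)) =
  - (indicator (proj (Du p) ` patch p r) y * F (inv_into (patch p r) (proj (Du p)) y))"
proof -
 define \<nu> where "\<nu> = Du p"
 define L where "L s = y + s *\<^sub>R \<nu>" for s
 define G where "G s = indicator \<Omega> (L s) *\<^sub>R (gradient_within M F (L s) \<bullet> \<nu>)" for s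
 define C where "C = {s. L s \<in> cball p (r/2)}"
 define J where "J = {s. L s \<in> ball p r}"
 let ?D = "proj \<nu> ` patch p r" and ?\<rho> = "inv_into (patch p r) (proj \<nu>)"
 have n: "norm \<nu> = 1" unfolding \<nu>_def by (rule bball_delta(5)[OF b])
 have r: "0 < r" by (rule bball_delta(3)[OF b])
 have yn: "y \<bullet> \<nu> = 0" using y by (simp add: \<nu>_def)
 have contL: "continuous_on UNIV L" unfolding L_def by (intro continuous_intros)
 have projL: "proj \<nu> (L s) = y" for s
  using yn n by (simp add: L_def proj_def inner_add_left norm_eq_1)
 have Linj: "L s = L t ==> s = t" for s t using n by (auto simp: L_def)
 have Ldiff: "L t = L s + (t - s) *\<^sub>R \<nu>" for s t by (simp add: L_def algebra_simps)
 have grad0: "gradient_within M F x \<bullet> v = 0" if "x \<in> M" "x \<notin> cball p (r/2)" for x v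
 proof -
  have "pd b F x = 0" for b by (rule pd_zero_outside[OF closed_cball _ that]) (use F(2) in blast)
  thus ?thesis unfolding gradient_inner by simp
 qed
 have G0: "G s = 0" if "s \<notin> C" for s
  using that grad0[of "L s" \<nu>] dom_sub by (cases "L s \<in> \<Omega>") (auto simp: G_def C_def)
 have yD: "\<exists>s\<in>C. L s \<in> frontier \<Omega> \<and> ?\<rho> y = L s" if "y \<in> ?D"
 proof -
  obtain x where x: "x \<in> patch p r" "y = proj \<nu> x" using \<open>y \<in> ?D\<close> by blast
  have "x = L (x \<bullet> \<nu>)" unfolding L_def x(2) by (simp add: proj_def)
  moreover have "?\<rho> y = x" unfolding x(2) using patch_inj[OF b] x(1) by (simp add: \<nu>_def)
  ultimately show ?thesis using x(1) by (intro bexI[of _ "x \<bullet> \<nu>"]) (auto simp: C_def patch_def)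
 qed
 have "(LINT s|lborel. G s) = - (indicator ?D y * F (?\<rho> y))"
 proof (cases "C = {}")
  case True
  hence "y \<notin> ?D" using yD by blast
  moreover have "G s = 0" for s using G0 True by blast
  ultimately show ?thesis by simp
 next
  case False
  have Jo: "open J"
  proof -
   have "open (L -` ball p r)" by (rule open_vimage[OF open_ball contL])
   thus ?thesis by (simp add: J_def vimage_def)
  qed
  have CJ: "C \<subseteq> J" using r by (auto simp: C_def J_def)
  have Cc: "compact C"
  proof -
   have "closed (L -` cball p (r/2))" by (rule closed_vimage[OF closed_cball contL])
   hence "closed C" by (simp add: C_def vimage_def)
   moreover have "\<bar>s\<bar> \<le> norm p + r / 2 + norm y" if "s \<in> C" for s
   proof -
    have "\<bar>s\<bar> = norm (L s - y)" using n by (simp add: L_def)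
    also have "... \<le> norm (L s - p) + norm p + norm y"
     using norm_triangle_ineq4[of "L s" y] norm_triangle_ineq[of "L s - p" p] by simp
    also have "norm (L s - p) \<le> r / 2" using that by (simp add: C_def dist_norm norm_minus_commute)
    finally show ?thesis by simp
   qed
   hence "bounded C" unfolding bounded_iff real_norm_def by blast
   ultimately show ?thesis by (simp add: compact_eq_bounded_closed)
  qed
  obtain smin where smin: "smin \<in> C" "\<forall>s\<in>C. smin \<le> s" using compact_attains_inf[OF Cc False] by blast
  obtain smax where smax: "smax \<in> C" "\<forall>s\<in>C. s \<le> smax" using compact_attains_sup[OF Cc False] by blast
  obtain e1 where e1: "0 < e1" "ball smin e1 \<subseteq> J" using openE[OF Jo] smin(1) CJ by blast
  obtain e2 where e2: "0 < e2" "ball smax e2 \<subseteq> J" using openE[OF Jo] smax(1) CJ by blast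
  \<comment> \<open>Slightly beyond the support on both sides: the ends are outside
    \<open>C\<close>, yet the whole segment stays in \<open>ball p r\<close>.\<close>
  define a where "a = smin - e1 / 2"
  define bb where "bb = smax + e2 / 2"
  have "a \<in> ball smin e1" "bb \<in> ball smax e2" using e1 e2 by (auto simp: a_def bb_def dist_real_def)
  hence abJ: "a \<in> J" "bb \<in> J" using e1 e2 by auto
  have ab: "a < smin" "smax < bb" using e1 e2 by (auto simp: a_def bb_def)
  have aC: "a \<notin> C" "bb \<notin> C" using ab smin(2) smax(2) by force+
  have Cab: "C \<subseteq> {a..bb}" using ab smin(2) smax(2) by force
  have "convex J"
  proof -
   have "J = (%s. s *\<^sub>R \<nu>) -` ((%x. - y + x) ` ball p r)"
   proof (rule set_eqI)
    fix s
    have "s *\<^sub>R \<nu> \<in> (%x. - y + x) ` ball p r \<longleftrightarrow> L s \<in> ball p r"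
    proof
     assume "s *\<^sub>R \<nu> \<in> (%x. - y + x) ` ball p r"
     then obtain x where "x \<in> ball p r" "s *\<^sub>R \<nu> = - y + x" by blast
     thus "L s \<in> ball p r" by (simp add: L_def)
    next
     assume "L s \<in> ball p r"
     thus "s *\<^sub>R \<nu> \<in> (%x. - y + x) ` ball p r" by (intro image_eqI[of _ _ "L s"]) (simp_all add: L_def)
    qed
    thus "s \<in> J \<longleftrightarrow> s \<in> (%s. s *\<^sub>R \<nu>) -` ((%x. - y + x) ` ball p r)" by (simp add: J_def)
   qed
   moreover have "convex ((%s. s *\<^sub>R \<nu>) -` ((%x. - y + x) ` ball p r))"
    by (intro convex_linear_vimage convex_translation convex_ball linearI) (simp_all add: scaleR_left_distrib)
   ultimately show ?thesis by simp
  qed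
  hence abJ': "s \<in> J" if "s \<in> {a..bb}" for s
   using abJ that mem_is_interval_1_I[of J a bb s] by (simp add: is_interval_convex_1)
  have Fout: "F (L s) = 0" if "s \<notin> C" "L s \<in> M" for s using F(2)[OF that(2)] that(1) by (auto simp: C_def)
  have ablt: "a < bb" using ab smin(2) smax(1) by force
  \<comment> \<open>The segment has at most one frontier point. If it has none, it lies in \<Omega>
    or misses \<Omega>, and both sides are 0. A frontier point outside \<open>C\<close> is not in
    the patch, and \<open>F\<close> vanishes there, in agreement with \<open>y\<close> having no
    preimage.\<close>
  show ?thesis
  proof (cases "\<exists>s0\<in>{a..bb}. L s0 \<in> frontier \<Omega>")
   case True
   then obtain s0 where s0: "s0 \<in> {a..bb}" "L s0 \<in> frontier \<Omega>" by blast
   have s0b: "L s0 \<in> ball p r \<inter> frontier \<Omega>" using s0 abJ' by (simp add: J_def)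
   have up: "L s \<in> \<Omega>" if "s \<in> {s0<..bb}" for s
   proof -
    have "s \<in> {a..bb}" using that s0 by simp
    hence "L s \<in> ball p r" using abJ' by (simp add: J_def)
    thus ?thesis
     using bball_above[OF b s0b, of "s - s0"] that Ldiff[of s s0] by (simp add: \<nu>_def)
   qed
   have down: "L s \<notin> \<Omega>" if "s \<in> {a..<s0}" for s
   proof -
    have "s \<in> {a..bb}" using that s0 by simp
    hence "L s \<in> ball p r" using abJ' by (simp add: J_def)
    moreover have "L s = L s0 - (s0 - s) *\<^sub>R \<nu>" using Ldiff[of s s0] by (simp add: algebra_simps)
    ultimately have "L s \<notin> M" using bball_below[OF b s0b, of "s0 - s"] that by (simp add: \<nu>_def)
    thus ?thesis using dom_sub by blast
   qed
   have "(LINT s|lborel. G s) = (LINT s|lborel. indicator {s0..bb} s *\<^sub>R (gradient_within M F (L s) \<bullet> \<nu>))"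
   proof (rule Bochner_Integration.integral_cong_AE)
    have contg: "continuous_on M (%x. gradient_within M F x \<bullet> \<nu>)"
     by (rule sm_continuous[OF sm_gradient_inner[OF F(1)]])
    have "(%x. indicator \<Omega> x *\<^sub>R (gradient_within M F x \<bullet> \<nu>)) \<in> borel_measurable borel"
     by (rule borel_measurable_continuous_on_indicator) (use open_dom continuous_on_subset[OF contg dom_sub] in auto)
    moreover have "L \<in> borel_measurable borel" by (rule borel_measurable_continuous_onI[OF contL])
    ultimately have "(%s. indicator \<Omega> (L s) *\<^sub>R (gradient_within M F (L s) \<bullet> \<nu>)) \<in> borel_measurable borel"
     by (rule measurable_compose[rotated])
    thus "G \<in> borel_measurable lborel" unfolding G_def by simp
    have LM: "L ` {s0..bb} \<subseteq> M"
    proof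
     fix x assume "x \<in> L ` {s0..bb}"
     then obtain s where s: "s \<in> {s0..bb}" "x = L s" by blast
     show "x \<in> M"
     proof (cases "s = s0")
      case True thus ?thesis using s s0 frontier_sub by blast
     next
      case False thus ?thesis using s up[of s] dom_sub by auto
     qed
    qed
    have "continuous_on {s0..bb} (%s. gradient_within M F (L s) \<bullet> \<nu>)"
     by (rule continuous_on_compose2[OF contg continuous_on_subset[OF contL] LM]) simp
    hence "(%s. indicator {s0..bb} s *\<^sub>R (gradient_within M F (L s) \<bullet> \<nu>)) \<in> borel_measurable borel"
     by (intro borel_measurable_continuous_on_indicator) auto
    thus "(%s. indicator {s0..bb} s *\<^sub>R (gradient_within M F (L s) \<bullet> \<nu>)) \<in> borel_measurable lborel" by simp
    have "AE s in lborel. s \<noteq> s0" by (rule AE_lborel_singleton)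
    thus "AE s in lborel. G s = indicator {s0..bb} s *\<^sub>R (gradient_within M F (L s) \<bullet> \<nu>)"
    proof eventually_elim
     fix s assume s: "s \<noteq> s0"
     consider "s \<in> {s0<..bb}" | "s \<in> {a..<s0}" | "s \<notin> {a..bb}" using s by force
     thus "G s = indicator {s0..bb} s *\<^sub>R (gradient_within M F (L s) \<bullet> \<nu>)"
     proof cases
      case 1 thus ?thesis using up[OF 1] by (simp add: G_def)
     next
      case 2 thus ?thesis using down[OF 2] by (simp add: G_def)
     next
      case 3
      hence "s \<notin> C" "s \<notin> {s0..bb}" using Cab s0 by auto
      thus ?thesis using G0 by simp
     qed
    qed
   qed
   also have "... = F (L bb) - F (L s0)" unfolding L_def
   proof (rule line_FTC[OF F(1)])
    show "s0 \<le> bb" using s0 by simp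
    show "y + s *\<^sub>R \<nu> \<in> M" if "s \<in> {s0..bb}" for s
    proof (cases "s = s0")
     case True thus ?thesis using s0(2) frontier_sub by (auto simp: L_def)
    next
     case False thus ?thesis using that up[of s] dom_sub by (auto simp: L_def)
    qed
   qed
   also have "F (L bb) = 0"
   proof (cases "s0 = bb")
    case True thus ?thesis using Fout[OF aC(2)] s0(2) frontier_sub by blast
   next
    case False thus ?thesis using Fout[OF aC(2)] up[of bb] s0 dom_sub by auto
   qed
   also have "F (L s0) = indicator ?D y * F (?\<rho> y)"
   proof (cases "y \<in> ?D")
    case True
    then obtain s1 where s1: "s1 \<in> C" "L s1 \<in> frontier \<Omega>" "?\<rho> y = L s1" using yD by blast
    have "L s1 \<in> ball p r \<inter> frontier \<Omega>" using s1 CJ by (auto simp: J_def)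
    hence "s1 - s0 = 0" using bball_frontier_unique[OF b s0b, of "s1 - s0"] Ldiff[of s1 s0] by (simp add: \<nu>_def)
    thus ?thesis using True s1(3) by simp
   next
    case False
    have "s0 \<notin> C"
    proof
     assume "s0 \<in> C"
     hence "L s0 \<in> patch p r" using s0(2) by (simp add: patch_def C_def)
     hence "y \<in> ?D" using projL[of s0] by (metis imageI)
     thus False using False by simp
    qed
    hence "F (L s0) = 0" by (rule Fout) (use s0(2) frontier_sub in blast)
    thus ?thesis using False by simp
   qed
   finally show ?thesis by simp
  next
   case False
   hence yD': "y \<notin> ?D" using yD Cab by blast
   show ?thesis
   proof (cases "\<exists>s1\<in>{a..bb}. L s1 \<in> \<Omega>")
    case True
    have all: "L s \<in> \<Omega>" if "s \<in> {a..bb}" for s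
    proof (rule ccontr)
     assume "L s \<notin> \<Omega>"
     have "connected (L ` {a..bb})" by (intro connected_continuous_image continuous_on_subset[OF contL]) auto
     from connected_Int_frontier[OF this, of \<Omega>] have "L ` {a..bb} \<inter> frontier \<Omega> \<noteq> {}"
      using True that \<open>L s \<notin> \<Omega>\<close> by blast
     thus False using False by blast
    qed
    have "(LINT s|lborel. G s) = (LINT s|lborel. indicator {a..bb} s *\<^sub>R (gradient_within M F (L s) \<bullet> \<nu>))"
    proof (rule Bochner_Integration.integral_cong[OF refl])
     fix s
     show "G s = indicator {a..bb} s *\<^sub>R (gradient_within M F (L s) \<bullet> \<nu>)"
     proof (cases "s \<in> {a..bb}")
      case True thus ?thesis using all[OF True] by (simp add: G_def)
     next
      case False
      hence "s \<notin> C" using Cab by blast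
      thus ?thesis using False G0 by simp
     qed
    qed
    also have "... = F (L bb) - F (L a)" unfolding L_def
     by (rule line_FTC[OF F(1)]) (use ablt all dom_sub in \<open>auto simp: L_def\<close>)
    also have "F (L bb) = 0" by (rule Fout[OF aC(2)]) (use all[of bb] ablt dom_sub in auto)
    also have "F (L a) = 0" by (rule Fout[OF aC(1)]) (use all[of a] ablt dom_sub in auto)
    finally show ?thesis using yD' by simp
   next
    case none: False
    have "G s = 0" for s
    proof (cases "s \<in> {a..bb}")
     case True
     hence "L s \<notin> \<Omega>" using none by blast
     thus ?thesis by (simp add: G_def)
    next
     case False
     hence "s \<notin> C" using Cab by blast
     thus ?thesis by (rule G0)
    qed
    thus ?thesis using yD' by simp
   qed
  qed
 qed
 thus ?thesis by (simp only: G_def L_def \<nu>_def)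
qed

text \<open>Both sides are minus the integral of the derivative of \<open>F\<close> in direction
  \<open>Du p\<close>: once by \<open>integration_by_parts\<close>, once line by line.\<close>

lemma line_formula:
 assumes b: "bball p \<delta> r" and F: "smc F" "\<And>x. x \<in> M ==> F x \<noteq> 0 ==> x \<in> cball p (r/2)"
 shows "sig (%x. F x * (Du x \<bullet> Du p)) = (LINT y|plane_meas (Du p).
  indicator (proj (Du p) ` patch p r) y * F (inv_into (patch p r) (proj (Du p)) y))"
proof -
 have n: "norm (Du p) = 1" by (rule bball_delta(5)[OF b])
 have eq: "gradient_within M F x \<bullet> Du p = (SB b. pd b F x * (Du p \<bullet> b))" for x by (rule gradient_inner)
 have sg: "smc (%x. gradient_within M F x \<bullet> Du p)" unfolding eq by (intro smc_sum smc_mult smc_pd F sm_const)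
 have "ig (%x. gradient_within M F x \<bullet> Du p) =
  (LINT y|plane_meas (Du p). (LINT s|lborel. indicator \<Omega> (y + s *\<^sub>R Du p) *\<^sub>R (gradient_within M F (y + s *\<^sub>R Du p) \<bullet> Du p)))"
  unfolding ig_def set_lebesgue_integral_def
  by (rule integral_lines[OF n, symmetric]) (use smc_integrable[OF sg] in \<open>simp add: set_integrable_def\<close>)
 also have "... = (LINT y|plane_meas (Du p).
  - (indicator (proj (Du p) ` patch p r) y * F (inv_into (patch p r) (proj (Du p)) y)))"
 proof (rule integral_cong_AE)
  have "(%x. indicator \<Omega> x *\<^sub>R (gradient_within M F x \<bullet> Du p)) \<in> borel_measurable lborel"
   using smc_integrable[OF sg] unfolding set_integrable_def by (rule borel_measurable_integrable)
  hence [measurable]: "(%x. indicator \<Omega> x *\<^sub>R (gradient_within M F x \<bullet> Du p)) \<in> borel_measurable borel" by simp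
  have "(%(y, s). (%x. indicator \<Omega> x *\<^sub>R (gradient_within M F x \<bullet> Du p)) (y + s *\<^sub>R Du p)) \<in> borel_measurable (plane_meas (Du p) \<Otimes>\<^sub>M lborel)"
   by measurable
  thus "(%y. LINT s|lborel. indicator \<Omega> (y + s *\<^sub>R Du p) *\<^sub>R (gradient_within M F (y + s *\<^sub>R Du p) \<bullet> Du p)) \<in> borel_measurable (plane_meas (Du p))"
   by (intro lborel.borel_measurable_lebesgue_integral) simp
  show "AE y in plane_meas (Du p). (LINT s|lborel. indicator \<Omega> (y + s *\<^sub>R Du p) *\<^sub>R (gradient_within M F (y + s *\<^sub>R Du p) \<bullet> Du p)) =
   - (indicator (proj (Du p) ` patch p r) y * F (inv_into (patch p r) (proj (Du p)) y))"
   using AE_plane_meas[OF n]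
   by eventually_elim (rule line_integral_inner[OF b smc_sm[OF F(1)] F(2)])
  show "(%y. - (indicator (proj (Du p) ` patch p r) y * F (inv_into (patch p r) (proj (Du p)) y))) \<in> borel_measurable (plane_meas (Du p))"
   using patch_function_measurable[OF b sm_continuous[OF smc_sm[OF F(1)]]] by simp
 qed
 finally show ?thesis using integration_by_parts[OF F(1), of "Du p"] by simp
qed

end

text \<open>Positive and negative parts are compared separately: each integral against
  \<open>M\<close> lies between the one against \<open>N\<close> and \<open>K\<close> times
  that.\<close>

lemma integral_measure_compare:
 fixes \<phi> :: "'b \<Rightarrow> real"
 assumes s: "sets N = sets M" and fM: "finite_measure M"
  and le: "\<And>B. B \<in> sets M ==> emeasure N B \<le> emeasure M B" "\<And>B. B \<in> sets M ==> emeasure M B \<le> ennreal K * emeasure N B"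
  and K: "0 \<le> K" and \<phi>: "\<phi> \<in> borel_measurable M" "\<And>x. \<bar>\<phi> x\<bar> \<le> B"
 shows "\<bar>(LINT x|M. \<phi> x) - (LINT x|N. \<phi> x)\<bar> \<le> (K - 1) * (LINT x|N. \<bar>\<phi> x\<bar>)"
  and "(LINT x|N. \<bar>\<phi> x\<bar>) \<le> (LINT x|M. \<bar>\<phi> x\<bar>)" and "integrable M \<phi>"
proof -
 interpret M: finite_measure M by fact
 have sp: "space N = space M" by (rule sets_eq_imp_space_eq[OF s])
 interpret N: finite_measure N
 proof
  have "emeasure N (space N) \<le> emeasure M (space M)" unfolding sp by (rule le(1)) simp
  also have "... < top" by (simp add: M.emeasure_finite less_top[symmetric])
  finally show "emeasure N (space N) \<noteq> \<infinity>" by simp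
 qed
 have leM: "N \<le> M" by (subst le_measure[OF s]) (use le(1) s in simp)
 have leK: "M \<le> scale_measure (ennreal K) N"
  by (subst le_measure) (use le(2) s in simp_all)
 have mN: "measurable N borel = measurable M (borel :: real measure)" by (rule measurable_cong_sets[OF s refl])
 have intM: "integrable M \<psi>" "integrable N \<psi>" if "\<psi> \<in> borel_measurable M" "\<And>x. \<bar>\<psi> x\<bar> \<le> B" for \<psi> :: "'b \<Rightarrow> real"
  using that by (auto intro!: M.integrable_const_bound[of _ B] N.integrable_const_bound[of _ B] simp: mN)
 have pos: "(LINT x|N. \<psi> x) \<le> (LINT x|M. \<psi> x) \<and> (LINT x|M. \<psi> x) \<le> K * (LINT x|N. \<psi> x)"
  if \<psi>: "\<psi> \<in> borel_measurable M" "\<And>x. \<bar>\<psi> x\<bar> \<le> B" "\<And>x. 0 \<le> \<psi> x" for \<psi> :: "'b \<Rightarrow> real"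
 proof -
  have e: "(\<integral>\<^sup>+x. ennreal (\<psi> x) \<partial>M) = ennreal (LINT x|M. \<psi> x)" "(\<integral>\<^sup>+x. ennreal (\<psi> x) \<partial>N) = ennreal (LINT x|N. \<psi> x)"
   using nn_integral_eq_integral[OF intM(1)[OF \<psi>(1,2)]] nn_integral_eq_integral[OF intM(2)[OF \<psi>(1,2)]] \<psi>(3) by simp_all
  have p: "0 \<le> (LINT x|M. \<psi> x)" "0 \<le> (LINT x|N. \<psi> x)" using \<psi>(3) by (simp_all add: integral_nonneg_AE)
  have "(\<integral>\<^sup>+x. ennreal (\<psi> x) \<partial>N) \<le> (\<integral>\<^sup>+x. ennreal (\<psi> x) \<partial>M)" by (rule nn_integral_mono_measure[OF s leM])
  hence 1: "(LINT x|N. \<psi> x) \<le> (LINT x|M. \<psi> x)" unfolding e using p by (simp add: ennreal_le_iff)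
  have "(\<integral>\<^sup>+x. ennreal (\<psi> x) \<partial>M) \<le> (\<integral>\<^sup>+x. ennreal (\<psi> x) \<partial>scale_measure (ennreal K) N)"
   by (rule nn_integral_mono_measure[OF _ leK]) (simp add: s)
  also have "... = ennreal K * (\<integral>\<^sup>+x. ennreal (\<psi> x) \<partial>N)"
  proof (rule nn_integral_scale_measure)
   have "\<psi> \<in> borel_measurable N" using \<psi>(1) mN by simp
   thus "(%x. ennreal (\<psi> x)) \<in> borel_measurable N" by simp
  qed
  finally have "ennreal (LINT x|M. \<psi> x) \<le> ennreal (K * (LINT x|N. \<psi> x))"
   unfolding e using K by (simp add: ennreal_mult')
  thus ?thesis using 1 K p by (simp add: ennreal_le_iff)
 qed
 define P where "P x = max 0 (\<phi> x)" for x
 define Q where "Q x = max 0 (- \<phi> x)" for x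
 have PQ: "P \<in> borel_measurable M" "Q \<in> borel_measurable M" unfolding P_def Q_def using \<phi>(1) by simp_all
 have bPQ: "\<bar>P x\<bar> \<le> B" "\<bar>Q x\<bar> \<le> B" "0 \<le> P x" "0 \<le> Q x" for x
  using \<phi>(2)[of x] by (auto simp: P_def Q_def max_def abs_if split: if_splits)
 have d: "\<phi> x = P x - Q x" "\<bar>\<phi> x\<bar> = P x + Q x" for x by (auto simp: P_def Q_def)
 have i: "integrable M P" "integrable M Q" "integrable N P" "integrable N Q"
  using intM[OF PQ(1) bPQ(1)] intM[OF PQ(2) bPQ(2)] by auto
 have s1: "(LINT x|M. \<phi> x) = (LINT x|M. P x) - (LINT x|M. Q x)" "(LINT x|N. \<phi> x) = (LINT x|N. P x) - (LINT x|N. Q x)"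
  "(LINT x|M. \<bar>\<phi> x\<bar>) = (LINT x|M. P x) + (LINT x|M. Q x)" "(LINT x|N. \<bar>\<phi> x\<bar>) = (LINT x|N. P x) + (LINT x|N. Q x)"
  unfolding d(2) unfolding d(1) using i by simp_all
 note pP = pos[OF PQ(1) bPQ(1,3)] and pQ = pos[OF PQ(2) bPQ(2,4)]
 show "\<bar>(LINT x|M. \<phi> x) - (LINT x|N. \<phi> x)\<bar> \<le> (K - 1) * (LINT x|N. \<bar>\<phi> x\<bar>)"
  using pP pQ unfolding s1 distrib_left left_diff_distrib by linarith
 show "(LINT x|N. \<bar>\<phi> x\<bar>) \<le> (LINT x|M. \<bar>\<phi> x\<bar>)" using pP pQ unfolding s1 by linarith
 show "integrable M \<phi>" by (rule intM(1)[OF \<phi>])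
qed

subsection \<open>Identification with the Hausdorff boundary integral\<close>

locale serrin_hausdorff = serrin_dom \<Omega> u for \<Omega> :: "'a::euclidean_space set" and u +
 fixes c :: real
 assumes n2: "2 \<le> DIM('a)" and c1: "1 \<le> c"
  and hausdorff_plane: "\<And>\<nu> B. norm \<nu> = 1 ==> B \<in> sets borel ==>
   hausdorff_outer_measure (DIM('a) - 1) (B \<inter> {y :: 'a. y \<bullet> \<nu> = 0}) = ennreal c * emeasure (plane_meas \<nu>) B"
begin

lemma hd1: "1 \<le> DIM('a) - 1" using n2 by simp

text \<open>Two computations over the projected patch. The projection is 1-Lipschitz and its inverse
  1 / (1 - \<delta>)-Lipschitz, so the projected Hausdorff measure lies between \<open>N\<close>,
  which is c times plane measure, and \<open>K\<close> times \<open>N\<close>. On the other side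
  \<open>line_formula\<close> expresses \<open>sig G\<close> by plane measure with a density between
  1 and 1 / (1 - \<delta>). Each contributes one error \<open>K - 1\<close>, hence the factor
  2.\<close>

lemma local_comparison:
 assumes b: "bball p \<delta> r" and G: "smc G" "\<And>x. x \<in> M ==> G x \<noteq> 0 ==> x \<in> cball p (r/2)"
 shows "set_integrable (hausdorff_measure (DIM('a) - 1) :: 'a measure) (frontier \<Omega>) G"
  and "\<bar>c * sig G - boundary_integral \<Omega> G\<bar> \<le> 2 * ((1 / (1 - \<delta>)) ^ (DIM('a) - 1) - 1) * boundary_integral \<Omega> (%x. \<bar>G x\<bar>)"
proof -
 define \<nu> where "\<nu> = Du p"
 define Fr where "Fr = patch p r"
 define \<pi> where "\<pi> = proj \<nu>"
 define D where "D = \<pi> ` Fr"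
 define \<rho> where "\<rho> = inv_into Fr \<pi>"
 define K where "K = (1 / (1 - \<delta>)) ^ (DIM('a) - 1)"
 have n: "norm \<nu> = 1" unfolding \<nu>_def by (rule bball_delta(5)[OF b])
 have \<delta>: "0 < \<delta>" "\<delta> \<le> 1/2" "0 < 1 - \<delta>" using b by (simp_all add: bball_def)
 have \<rho>: "continuous_on D \<rho>" "compact D" "\<And>y. y \<in> D ==> \<rho> y \<in> Fr" "\<And>x. x \<in> Fr ==> \<rho> (\<pi> x) = x"
  using patch_inverse[OF b] unfolding D_def \<rho>_def \<pi>_def Fr_def \<nu>_def by blast+
 have \<pi>\<rho>: "\<pi> (\<rho> y) = y" if "y \<in> D" for y using that \<rho>(4) unfolding D_def by auto
 have FrM: "Fr \<subseteq> M" "Fr \<subseteq> frontier \<Omega>" using frontier_sub by (auto simp: Fr_def patch_def)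
 have Frb: "Fr \<in> sets borel" "D \<in> sets borel"
  using compact_imp_closed[OF patch_compact[of p r]] compact_imp_closed[OF \<rho>(2)] by (simp_all add: Fr_def)
 have m\<pi>[measurable]: "\<pi> \<in> borel_measurable borel" unfolding \<pi>_def by simp
 note [measurable] = Frb
 have K1: "1 \<le> 1 / (1 - \<delta>)" using \<delta> by simp
 have Kge: "1 \<le> K" unfolding K_def by (rule one_le_power[OF K1])
 have KK: "1 / (1 - \<delta>) \<le> K" unfolding K_def using power_increasing[OF hd1 K1] by simp
 define m where "m = distr (density (hausdorff_measure (DIM('a) - 1) :: 'a measure) (indicator Fr)) borel \<pi>"
 define N where "N = density (plane_meas \<nu>) (%y. ennreal c * indicator D y)"
 have em: "emeasure m B = hausdorff_outer_measure (DIM('a) - 1) (Fr \<inter> \<pi> -` B)" if B: "B \<in> sets borel" for B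
 proof -
  have vB: "\<pi> -` B \<in> sets borel" using measurable_sets_borel[OF m\<pi> B] by simp
  have "emeasure m B = emeasure (density (hausdorff_measure (DIM('a) - 1) :: 'a measure) (indicator Fr)) (\<pi> -` B)"
   unfolding m_def using B by (subst emeasure_distr) simp_all
  also have "... = emeasure (hausdorff_measure (DIM('a) - 1) :: 'a measure) (Fr \<inter> \<pi> -` B)" using Frb vB by (intro emeasure_restricted) simp_all
  also have "... = hausdorff_outer_measure (DIM('a) - 1) (Fr \<inter> \<pi> -` B)"
   by (rule emeasure_hausdorff_measure[OF hd1]) (use Frb vB in auto)
  finally show ?thesis .
 qed
 have eN: "emeasure N B = hausdorff_outer_measure (DIM('a) - 1) (\<pi> ` (Fr \<inter> \<pi> -` B))" if B: "B \<in> sets borel" for B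
 proof -
  have "emeasure N B = (\<integral>\<^sup>+y. (ennreal c * indicator D y) * indicator B y \<partial>plane_meas \<nu>)"
   unfolding N_def using B Frb by (intro emeasure_density) (simp_all)
  also have "... = (\<integral>\<^sup>+y. ennreal c * indicator (B \<inter> D) y \<partial>plane_meas \<nu>)"
   by (rule nn_integral_cong) (simp split: split_indicator)
  also have "... = ennreal c * emeasure (plane_meas \<nu>) (B \<inter> D)"
   using B Frb by (intro nn_integral_cmult_indicator) simp
  also have "... = hausdorff_outer_measure (DIM('a) - 1) ((B \<inter> D) \<inter> {y. y \<bullet> \<nu> = 0})"
   by (rule hausdorff_plane[OF n, symmetric]) (use B Frb in auto)
  also have "(B \<inter> D) \<inter> {y. y \<bullet> \<nu> = 0} = \<pi> ` (Fr \<inter> \<pi> -` B)"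
   using proj_inner[OF n] by (auto simp: D_def \<pi>_def)
  finally show ?thesis .
 qed
 have le1: "emeasure N B \<le> emeasure m B" if B: "B \<in> sets borel" for B
 proof -
  have "hausdorff_outer_measure (DIM('a) - 1) (\<pi> ` (Fr \<inter> \<pi> -` B)) \<le> ennreal (1 ^ (DIM('a) - 1)) * hausdorff_outer_measure (DIM('a) - 1) (Fr \<inter> \<pi> -` B)"
  proof (rule hausdorff_outer_measure_lipschitz[OF hd1])
   fix x y
   show "dist (\<pi> x) (\<pi> y) \<le> 1 * dist x y"
    using proj_norm_le[OF n, of "x - y"]
    by (simp add: dist_norm \<pi>_def linear_diff[OF proj_linear])
  qed simp
  thus ?thesis using em[OF B] eN[OF B] by simp
 qed
 have le2: "emeasure m B \<le> ennreal K * emeasure N B" if B: "B \<in> sets borel" for B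
 proof -
  have eq: "\<rho> ` (\<pi> ` (Fr \<inter> \<pi> -` B)) = Fr \<inter> \<pi> -` B" using \<rho>(4) by force
  have "hausdorff_outer_measure (DIM('a) - 1) (\<rho> ` (\<pi> ` (Fr \<inter> \<pi> -` B))) \<le> ennreal ((1 / (1 - \<delta>)) ^ (DIM('a) - 1)) * hausdorff_outer_measure (DIM('a) - 1) (\<pi> ` (Fr \<inter> \<pi> -` B))"
  proof (rule hausdorff_outer_measure_lipschitz[OF hd1])
   fix x y assume "x \<in> \<pi> ` (Fr \<inter> \<pi> -` B)" "y \<in> \<pi> ` (Fr \<inter> \<pi> -` B)"
   then obtain x' y' where *: "x = \<pi> x'" "y = \<pi> y'" "x' \<in> Fr" "y' \<in> Fr" by blast
   have "(1 - \<delta>) * norm (x' - y') \<le> norm (x - y)"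
    using patch_proj_lower[OF b, of x' y'] * by (simp add: Fr_def \<pi>_def \<nu>_def)
   thus "dist (\<rho> x) (\<rho> y) \<le> 1 / (1 - \<delta>) * dist x y"
    using \<delta> * \<rho>(4) by (simp add: dist_norm field_simps)
  qed (use \<delta> in simp)
  thus ?thesis using em[OF B] eN[OF B] unfolding eq K_def by simp
 qed
 have sets: "sets N = sets m" by (simp add: N_def m_def)
 have fm: "finite_measure m"
 proof
  have D\<nu>: "emeasure N UNIV = ennreal c * emeasure (plane_meas \<nu>) D"
  proof -
   have "emeasure N UNIV = (\<integral>\<^sup>+y. (ennreal c * indicator D y) * indicator UNIV y \<partial>plane_meas \<nu>)"
    unfolding N_def using Frb by (intro emeasure_density) simp_all
   also have "... = (\<integral>\<^sup>+y. ennreal c * indicator D y \<partial>plane_meas \<nu>)" by simp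
   also have "... = ennreal c * emeasure (plane_meas \<nu>) D" using Frb by (intro nn_integral_cmult_indicator) simp
   finally show ?thesis .
  qed
  have "emeasure (plane_meas \<nu>) D < \<infinity>"
   by (rule plane_meas_bounded_finite[OF n Frb(2) compact_imp_bounded[OF \<rho>(2)]])
  hence "emeasure N UNIV < \<infinity>" unfolding D\<nu> by (simp add: ennreal_mult_less_top)
  hence "ennreal K * emeasure N UNIV < \<infinity>" by (simp add: ennreal_mult_less_top)
  hence "emeasure m UNIV < \<infinity>" using le2[of UNIV] by (simp add: le_less_trans[of "emeasure m UNIV"])
  thus "emeasure m (space m) \<noteq> \<infinity>" by (simp add: m_def)
 qed
 have sG: "sm G" by (rule smc_sm[OF G(1)])
 obtain B where B: "\<forall>x\<in>M. \<bar>G x\<bar> \<le> B"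
 proof -
  obtain R where R: "0 < R" "\<forall>x\<in>M. G x \<noteq> 0 \<longrightarrow> norm x \<le> R" by (rule smc_bound[OF G(1)])
  hence "\<exists>B. \<forall>x\<in>M. \<bar>G x\<bar> \<le> B" by (intro continuous_bounded_support[OF sm_continuous[OF sG], of R]) simp
  thus ?thesis using that by blast
 qed
 define \<phi> where "\<phi> y = indicator D y * G (\<rho> y)" for y
 have \<phi>m: "\<phi> \<in> borel_measurable borel"
  using patch_function_measurable[OF b sm_continuous[OF sG]] unfolding \<phi>_def D_def \<rho>_def \<pi>_def Fr_def \<nu>_def .
 have \<phi>B: "\<bar>\<phi> y\<bar> \<le> \<bar>B\<bar>" for y
 proof (cases "y \<in> D")
  case True
  hence "\<bar>G (\<rho> y)\<bar> \<le> B" using B \<rho>(3) FrM by blast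
  thus ?thesis using True by (simp add: \<phi>_def)
 qed (simp add: \<phi>_def)
 have \<phi>\<pi>: "\<phi> (\<pi> x) = G x" if "x \<in> Fr" for x using that \<rho>(4) by (simp add: \<phi>_def D_def)
 have Gfr: "G x = 0" if "x \<in> frontier \<Omega>" "x \<notin> Fr" for x
 proof (rule ccontr)
  assume "G x \<noteq> 0"
  hence "x \<in> cball p (r/2)" using G(2) that frontier_sub by blast
  thus False using that by (simp add: Fr_def patch_def)
 qed
 have mm: "\<phi> \<in> borel_measurable m" using \<phi>m by (simp add: m_def)
 note cmp = integral_measure_compare[OF sets fm le1 le2 _ mm \<phi>B]
 have sm': "B \<in> sets m ==> B \<in> sets borel" for B by (simp add: m_def)
 have cmp1: "\<bar>(LINT x|m. \<phi> x) - (LINT x|N. \<phi> x)\<bar> \<le> (K - 1) * (LINT x|N. \<bar>\<phi> x\<bar>)"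
  by (rule cmp(1)[OF sm' sm']) (use Kge in auto)
 have cmp2: "(LINT x|N. \<bar>\<phi> x\<bar>) \<le> (LINT x|m. \<bar>\<phi> x\<bar>)"
  by (rule cmp(2)[OF sm' sm']) (use Kge in auto)
 have cmp3: "integrable m \<phi>"
  by (rule cmp(3)[OF sm' sm']) (use Kge in auto)
 have bi: "boundary_integral \<Omega> (%x. h (G x)) = (LINT y|m. h (\<phi> y))" if h: "h 0 = 0" "h \<in> borel_measurable borel" for h :: "real \<Rightarrow> real"
 proof -
  have "(LINT y|m. h (\<phi> y)) = (LINT x|density (hausdorff_measure (DIM('a) - 1) :: 'a measure) (indicator Fr). h (\<phi> (\<pi> x)))"
   unfolding m_def using \<phi>m h(2) by (intro integral_distr) (simp_all add: measurable_compose[OF \<phi>m h(2)])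
  also have "... = (LINT x|(hausdorff_measure (DIM('a) - 1) :: 'a measure). indicator Fr x *\<^sub>R h (\<phi> (\<pi> x)))"
  proof -
   have eq: "(indicator Fr :: 'a \<Rightarrow> ennreal) = (%x. ennreal (indicator Fr x))" by (auto simp: indicator_def)
   show ?thesis unfolding eq
    by (rule integral_density) (use Frb measurable_compose[OF m\<pi> measurable_compose[OF \<phi>m h(2)]] in simp_all)
  qed
  also have "... = (LINT x|(hausdorff_measure (DIM('a) - 1) :: 'a measure). indicator (frontier \<Omega>) x *\<^sub>R h (G x))"
  proof (rule Bochner_Integration.integral_cong[OF refl])
   fix x
   show "indicator Fr x *\<^sub>R h (\<phi> (\<pi> x)) = indicator (frontier \<Omega>) x *\<^sub>R h (G x)"
    using \<phi>\<pi>[of x] Gfr[of x] FrM h(1) by (cases "x \<in> Fr"; cases "x \<in> frontier \<Omega>") auto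
  qed
  finally show ?thesis by (simp add: boundary_integral_def set_lebesgue_integral_def)
 qed
 show "set_integrable (hausdorff_measure (DIM('a) - 1) :: 'a measure) (frontier \<Omega>) G"
 proof -
  have "integrable (density (hausdorff_measure (DIM('a) - 1) :: 'a measure) (indicator Fr)) (%x. \<phi> (\<pi> x))"
   using cmp3 unfolding m_def by (rule integrable_distr[rotated]) simp
  moreover have eq: "(indicator Fr :: 'a \<Rightarrow> ennreal) = (%x. ennreal (indicator Fr x))" by (auto simp: indicator_def)
  ultimately have "integrable (hausdorff_measure (DIM('a) - 1) :: 'a measure) (%x. indicator Fr x *\<^sub>R \<phi> (\<pi> x))"
   unfolding eq by (subst (asm) integrable_density) (use Frb measurable_compose[OF m\<pi> \<phi>m] in simp_all)
  moreover have "indicator Fr x *\<^sub>R \<phi> (\<pi> x) = indicator (frontier \<Omega>) x *\<^sub>R G x" for x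
   using \<phi>\<pi>[of x] Gfr[of x] FrM by (cases "x \<in> Fr"; cases "x \<in> frontier \<Omega>") auto
  ultimately show ?thesis unfolding set_integrable_def by simp
 qed
 have bG: "boundary_integral \<Omega> G = (LINT y|m. \<phi> y)" using bi[of "%t. t"] by simp
 have bA: "boundary_integral \<Omega> (%x. \<bar>G x\<bar>) = (LINT y|m. \<bar>\<phi> y\<bar>)" using bi[of abs] by simp
 have Nint: "(LINT y|N. \<psi> y) = c * (LINT y|plane_meas \<nu>. indicator D y * \<psi> y)" if "\<psi> \<in> borel_measurable borel" for \<psi> :: "'a \<Rightarrow> real"
 proof -
  have eq: "(%y. ennreal c * indicator D y) = (%y. ennreal (c * indicator D y))"
   using c1 by (auto simp: indicator_def)
  have "(LINT y|N. \<psi> y) = (LINT y|plane_meas \<nu>. (c * indicator D y) *\<^sub>R \<psi> y)"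
   unfolding N_def eq by (rule integral_density) (use that Frb c1 in \<open>simp_all\<close>)
  also have "... = (LINT y|plane_meas \<nu>. c * (indicator D y * \<psi> y))" by (simp add: mult.assoc)
  also have "... = c * (LINT y|plane_meas \<nu>. indicator D y * \<psi> y)" by simp
  finally show ?thesis .
 qed
 have ind: "indicator D y * \<phi> y = \<phi> y" "indicator D y * \<bar>\<phi> y\<bar> = \<bar>\<phi> y\<bar>" for y by (simp_all add: \<phi>_def indicator_def)
 have N1: "(LINT y|N. \<phi> y) = c * (LINT y|plane_meas \<nu>. \<phi> y)" using Nint[OF \<phi>m] by (simp add: ind)
 have N2: "(LINT y|N. \<bar>\<phi> y\<bar>) = c * (LINT y|plane_meas \<nu>. \<bar>\<phi> y\<bar>)"
  using Nint[of "%y. \<bar>\<phi> y\<bar>"] \<phi>m by (simp add: ind)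
 have grad_bounds: "1 - \<delta> \<le> Du x \<bullet> \<nu>" if "x \<in> ball p r \<inter> M" for x
 proof -
  have "\<bar>Du x \<bullet> \<nu> - Du p \<bullet> \<nu>\<bar> \<le> \<delta> * norm \<nu>" using b that unfolding bball_def by blast
  moreover have "Du p \<bullet> \<nu> = 1" using n by (simp add: \<nu>_def norm_eq_1)
  ultimately show ?thesis unfolding n by linarith
 qed
 \<comment> \<open>Division by the slope undoes the factor \<open>Du x \<bullet> Du p\<close> in
   \<open>line_formula\<close>; on the support of \<open>G\<close> the slope is at least 1 -
   \<delta>.\<close>
 define F where "F x = G x * inverse (Du x \<bullet> \<nu>)" for x
 have r: "0 < r" by (rule bball_delta(3)[OF b])
 have cb: "cball p (r/2) \<subseteq> ball p r" using r by auto
 have FD: "F x * (Du x \<bullet> \<nu>) = G x" if "x \<in> M" for x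
 proof (cases "G x = 0")
  case False
  hence "x \<in> ball p r \<inter> M" using G(2) that cb by blast
  hence "Du x \<bullet> \<nu> \<noteq> 0" using grad_bounds[of x] \<delta> by force
  thus ?thesis by (simp add: F_def)
 qed (simp add: F_def)
 have sF: "sm F" unfolding F_def
 proof (rule sm_quotient[OF sG sm_gradient_inner[OF smu] closed_cball])
  show "Du x \<bullet> \<nu> \<noteq> 0" if "x \<in> M" "x \<in> cball p (r/2)" for x using grad_bounds[of x] \<delta> cb that by force
 qed (use G(2) in blast)
 have suppF: "x \<in> cball p (r/2)" if "x \<in> M" "F x \<noteq> 0" for x using that G(2)[of x] by (auto simp: F_def)
 have nF: "norm x \<le> norm p + r/2" if "x \<in> M" "F x \<noteq> 0" for x
 proof -
  have "dist p x \<le> r/2" using suppF[OF that] by simp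
  thus ?thesis using norm_triangle_sub[of x p] by (simp add: dist_norm norm_minus_commute)
 qed
 have scF: "smc F" by (rule smcI[OF sF nF])

 have "sig G = sig (%x. F x * (Du x \<bullet> \<nu>))" by (rule sig_cong) (simp add: FD)
 also have "... = (LINT y|plane_meas \<nu>. indicator D y * F (\<rho> y))"
  unfolding D_def \<rho>_def \<pi>_def Fr_def \<nu>_def by (rule line_formula[OF b scF suppF])
 finally have sigG: "sig G = (LINT y|plane_meas \<nu>. indicator D y * F (\<rho> y))" .
 define \<theta> where "\<theta> y = indicator D y * F (\<rho> y)" for y
 have \<theta>m: "\<theta> \<in> borel_measurable borel"
  using patch_function_measurable[OF b sm_continuous[OF sF]] unfolding \<theta>_def D_def \<rho>_def \<pi>_def Fr_def \<nu>_def .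
 have \<theta>\<phi>: "\<bar>\<theta> y - \<phi> y\<bar> \<le> (1 / (1 - \<delta>) - 1) * \<bar>\<phi> y\<bar>" for y
 proof (cases "y \<in> D")
  case True
  define a where "a = Du (\<rho> y) \<bullet> \<nu>"
  have x: "\<rho> y \<in> Fr" by (rule \<rho>(3)[OF True])
  hence "\<rho> y \<in> ball p r \<inter> M" using patch_sub[OF b] FrM by (auto simp: Fr_def)
  hence a: "1 - \<delta> \<le> a" unfolding a_def by (rule grad_bounds)
  have "\<bar>Du (\<rho> y) \<bullet> \<nu>\<bar> \<le> norm (Du (\<rho> y)) * norm \<nu>" by (rule Cauchy_Schwarz_ineq2)
  moreover have "norm (Du (\<rho> y)) = 1" by (rule grad_one) (use x FrM in blast)
  ultimately have a1: "a \<le> 1" using n by (simp add: a_def)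
  have t1: "\<theta> y - \<phi> y = \<phi> y * (inverse a - 1)" using True by (simp add: \<theta>_def \<phi>_def F_def a_def algebra_simps)
  have t2: "0 \<le> inverse a - 1" using one_le_inverse[of a] a a1 \<delta> by linarith
  have "inverse a \<le> inverse (1 - \<delta>)" by (rule le_imp_inverse_le[OF a \<delta>(3)])
  hence t3: "inverse a - 1 \<le> 1 / (1 - \<delta>) - 1" by (simp only: inverse_eq_divide diff_right_mono)
  have "\<bar>\<theta> y - \<phi> y\<bar> = (inverse a - 1) * \<bar>\<phi> y\<bar>" unfolding t1 abs_mult abs_of_nonneg[OF t2] by (rule mult.commute)
  also have "... \<le> (1 / (1 - \<delta>) - 1) * \<bar>\<phi> y\<bar>" by (rule mult_right_mono[OF t3 abs_ge_zero])
  finally show ?thesis .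
 qed (simp add: \<theta>_def \<phi>_def)
 have bdD: "integrable (plane_meas \<nu>) \<psi>"
  if "\<psi> \<in> borel_measurable borel" "\<And>y. y \<notin> D ==> \<psi> y = 0" "\<And>y. \<bar>\<psi> y\<bar> \<le> B'" for \<psi> :: "'a \<Rightarrow> real" and B'
 proof (rule Bochner_Integration.integrable_bound[where f="%y. B' * indicator D y"])
  have "emeasure (plane_meas \<nu>) D < \<infinity>"
   by (rule plane_meas_bounded_finite[OF n Frb(2) compact_imp_bounded[OF \<rho>(2)]])
  thus "integrable (plane_meas \<nu>) (%y. B' * indicator D y)"
   using Frb by (intro integrable_mult_right integrable_real_indicator) simp_all
  show "\<psi> \<in> borel_measurable (plane_meas \<nu>)" using that(1) by simp
  have "norm (\<psi> y) \<le> norm (B' * indicator D y)" for y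
   using that(2)[of y] that(3)[of y] by (cases "y \<in> D") auto
  thus "AE y in plane_meas \<nu>. norm (\<psi> y) \<le> norm (B' * indicator D y)" by simp
 qed
 have i\<phi>: "integrable (plane_meas \<nu>) \<phi>" by (rule bdD[OF \<phi>m _ \<phi>B]) (simp add: \<phi>_def)
 have \<theta>B: "\<bar>\<theta> y\<bar> \<le> (1 / (1 - \<delta>) - 1) * \<bar>B\<bar> + \<bar>B\<bar>" for y
 proof -
  have "(1 / (1 - \<delta>) - 1) * \<bar>\<phi> y\<bar> \<le> (1 / (1 - \<delta>) - 1) * \<bar>B\<bar>" using K1 \<phi>B by (intro mult_left_mono) auto
  thus ?thesis using \<theta>\<phi>[of y] \<phi>B[of y] by linarith
 qed
 have i\<theta>: "integrable (plane_meas \<nu>) \<theta>" by (rule bdD[OF \<theta>m _ \<theta>B]) (simp add: \<theta>_def)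
 have "\<bar>sig G - (LINT y|plane_meas \<nu>. \<phi> y)\<bar> = \<bar>(LINT y|plane_meas \<nu>. \<theta> y - \<phi> y)\<bar>"
  unfolding sigG \<theta>_def[symmetric] using i\<phi> i\<theta> by simp
 also have "... \<le> (LINT y|plane_meas \<nu>. \<bar>\<theta> y - \<phi> y\<bar>)" by (rule integral_abs_bound)
 also have "... \<le> (LINT y|plane_meas \<nu>. (1 / (1 - \<delta>) - 1) * \<bar>\<phi> y\<bar>)"
  by (rule integral_mono) (use i\<phi> i\<theta> \<theta>\<phi> in auto)
 also have "... = (1 / (1 - \<delta>) - 1) * (LINT y|plane_meas \<nu>. \<bar>\<phi> y\<bar>)" by simp
 finally have s1: "\<bar>sig G - (LINT y|plane_meas \<nu>. \<phi> y)\<bar> \<le> (1 / (1 - \<delta>) - 1) * (LINT y|plane_meas \<nu>. \<bar>\<phi> y\<bar>)" .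
 define I where "I = (LINT y|plane_meas \<nu>. \<bar>\<phi> y\<bar>)"
 have I0: "0 \<le> I" unfolding I_def by (simp add: integral_nonneg_AE)
 have "\<bar>c * sig G - c * (LINT y|plane_meas \<nu>. \<phi> y)\<bar> = c * \<bar>sig G - (LINT y|plane_meas \<nu>. \<phi> y)\<bar>"
  using c1 by (simp add: abs_mult right_diff_distrib[symmetric])
 also have "... \<le> c * ((1 / (1 - \<delta>) - 1) * I)" using s1 c1 by (intro mult_left_mono) (simp_all add: I_def)
 also have "... \<le> c * ((K - 1) * I)" using KK I0 c1 by (intro mult_left_mono mult_right_mono) auto
 finally have "\<bar>c * sig G - boundary_integral \<Omega> G\<bar> \<le> c * ((K - 1) * I) + (K - 1) * (c * I)"
  using cmp1 unfolding N1 N2 I_def[symmetric] bG by linarith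
 also have "... = 2 * (K - 1) * (c * I)" by (simp add: algebra_simps)
 also have "... \<le> 2 * (K - 1) * boundary_integral \<Omega> (%x. \<bar>G x\<bar>)"
  using cmp2 Kge unfolding N2 I_def[symmetric] bA by (intro mult_left_mono) auto
 finally show "\<bar>c * sig G - boundary_integral \<Omega> G\<bar> \<le> 2 * ((1 / (1 - \<delta>)) ^ (DIM('a) - 1) - 1) * boundary_integral \<Omega> (%x. \<bar>G x\<bar>)"
  by (simp only: K_def)
qed

text \<open>The local comparison holds with arbitrarily small relative error; a partition of unity makes it exact.\<close>

lemma boundary_integral_sig:
 assumes F: "smc F"
 shows "set_integrable (hausdorff_measure (DIM('a) - 1) :: 'a measure) (frontier \<Omega>) F" and "boundary_integral \<Omega> F = c * sig F"
proof -
 have sF: "sm F" by (rule smc_sm[OF F])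
 define S where "S = closure {x \<in> M. F x \<noteq> 0}"
 have S: "compact S" using F unfolding S_def smc_def by (simp add: compact_closure)
 have "{x \<in> M. F x \<noteq> 0} \<subseteq> M" by blast
 hence SM: "S \<subseteq> M" unfolding S_def by (rule closure_minimal) simp
 have FS: "x \<in> S" if "x \<in> M" "F x \<noteq> 0" for x unfolding S_def by (rule subsetD[OF closure_subset]) (use that in simp)
 have main: "set_integrable (hausdorff_measure (DIM('a) - 1) :: 'a measure) (frontier \<Omega>) F \<and> \<bar>c * sig F - boundary_integral \<Omega> F\<bar> \<le> \<eta> * boundary_integral \<Omega> (%x. \<bar>F x\<bar>)"
  if \<eta>: "0 < \<eta>" for \<eta>
 proof -
  have "((%\<delta>. 2 * ((1 / (1 - \<delta>)) ^ (DIM('a) - 1) - 1)) \<longlongrightarrow> 2 * ((1 / (1 - 0)) ^ (DIM('a) - 1) - 1)) (at_right (0::real))"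
   by (intro tendsto_intros) simp_all
  hence "\<forall>\<^sub>F \<delta> in at_right (0::real). 2 * ((1 / (1 - \<delta>)) ^ (DIM('a) - 1) - 1) < \<eta>"
   by (rule order_tendstoD(2)) (use \<eta> in simp)
  moreover have "\<forall>\<^sub>F \<delta> in at_right (0::real). \<delta> \<in> {0<..<1/2}" by (rule eventually_at_right_real) simp
  ultimately have "\<forall>\<^sub>F \<delta> in at_right (0::real). 2 * ((1 / (1 - \<delta>)) ^ (DIM('a) - 1) - 1) < \<eta> \<and> \<delta> \<in> {0<..<1/2}"
   by (rule eventually_conj)
  then obtain \<delta> where \<delta>: "2 * ((1 / (1 - \<delta>)) ^ (DIM('a) - 1) - 1) < \<eta>" "0 < \<delta>" "\<delta> \<le> 1/2"
   using eventually_happens'[OF trivial_limit_at_right_real] by (metis (no_types, lifting) greaterThanLessThan_iff less_imp_le)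
  \<comment> \<open>Interior points get a radius as well, so that the whole support can be covered;
    for functions supported near them \<open>sig\<close> and the boundary integral both
    vanish.\<close>
  have good: "\<exists>\<rho>>0. \<forall>G. smc G \<and> (\<forall>x\<in>M. G x \<noteq> 0 \<longrightarrow> x \<in> cball p \<rho>) \<longrightarrow>
    set_integrable (hausdorff_measure (DIM('a) - 1) :: 'a measure) (frontier \<Omega>) G \<and> \<bar>c * sig G - boundary_integral \<Omega> G\<bar> \<le> \<eta> * boundary_integral \<Omega> (%x. \<bar>G x\<bar>)"
   if p: "p \<in> M" for p
  proof (cases "p \<in> frontier \<Omega>")
   case True
   obtain r where b: "bball p \<delta> r" using bball_exists[OF True \<delta>(2,3)] by blast
   show ?thesis
   proof (intro exI[of _ "r/2"] conjI allI impI)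
    show "0 < r / 2" using bball_delta(3)[OF b] by simp
    fix G assume G: "smc G \<and> (\<forall>x\<in>M. G x \<noteq> 0 \<longrightarrow> x \<in> cball p (r/2))"
    thus "set_integrable (hausdorff_measure (DIM('a) - 1) :: 'a measure) (frontier \<Omega>) G" by (intro local_comparison(1)[OF b]) simp_all
    have "\<bar>c * sig G - boundary_integral \<Omega> G\<bar> \<le> 2 * ((1 / (1 - \<delta>)) ^ (DIM('a) - 1) - 1) * boundary_integral \<Omega> (%x. \<bar>G x\<bar>)"
     using G by (intro local_comparison(2)[OF b]) simp_all
    also have "... \<le> \<eta> * boundary_integral \<Omega> (%x. \<bar>G x\<bar>)"
    proof (rule mult_right_mono)
     show "0 \<le> boundary_integral \<Omega> (%x. \<bar>G x\<bar>)"
      unfolding boundary_integral_def set_lebesgue_integral_def by (intro integral_nonneg_AE) simp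
    qed (use \<delta>(1) in simp)
    finally show "\<bar>c * sig G - boundary_integral \<Omega> G\<bar> \<le> \<eta> * boundary_integral \<Omega> (%x. \<bar>G x\<bar>)" .
   qed
  next
   case False
   hence "p \<in> \<Omega>" using p frontier_dom by blast
   then obtain e where e: "0 < e" "cball p e \<subseteq> \<Omega>" using open_contains_cball open_dom by blast
   show ?thesis
   proof (intro exI[of _ e] conjI allI impI)
    show "0 < e" by fact
    fix G assume G: "smc G \<and> (\<forall>x\<in>M. G x \<noteq> 0 \<longrightarrow> x \<in> cball p e)"
    have fr: "G x = 0" if "x \<in> frontier \<Omega>" for x
    proof (rule ccontr)
     assume "G x \<noteq> 0"
     hence "x \<in> cball p e" using G that frontier_sub by blast
     hence "x \<in> \<Omega>" using e by blast
     thus False using that frontier_dom by blast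
    qed
    have z: "indicator (frontier \<Omega>) x *\<^sub>R G x = 0" for x using fr[of x] by (cases "x \<in> frontier \<Omega>") auto
    show "set_integrable (hausdorff_measure (DIM('a) - 1) :: 'a measure) (frontier \<Omega>) G" unfolding set_integrable_def z by simp
    have "boundary_integral \<Omega> G = 0" unfolding boundary_integral_def set_lebesgue_integral_def z by simp
    moreover have "sig G = 0"
    proof -
     have smG: "sm G" using G smc_sm by blast
     have "ig (%x. SB b. pd b (%x. G x * pd b u x) x) = (SB b. ig (pd b (%x. G x * pd b u x)))"
      by (rule ig_sum) (intro smc_pd smc_mult sm_pd smu, use G in blast)
     also have "... = 0"
     proof (rule sum.neutral, rule ballI)
      fix b :: 'a assume b: "b \<in> Basis"
      show "ig (pd b (%x. G x * pd b u x)) = 0"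
       by (rule integral_pd_interior[OF sm_mult[OF smG sm_pd[OF smu]] compact_cball e(2) _ b])
        (use G in auto)
     qed
     finally show ?thesis using sig_div[of G] G by simp
    qed
    moreover have "0 \<le> boundary_integral \<Omega> (%x. \<bar>G x\<bar>)"
     unfolding boundary_integral_def set_lebesgue_integral_def by (intro integral_nonneg_AE) simp
    ultimately show "\<bar>c * sig G - boundary_integral \<Omega> G\<bar> \<le> \<eta> * boundary_integral \<Omega> (%x. \<bar>G x\<bar>)"
     using \<eta> by simp
   qed
  qed
  then obtain \<rho> where \<rho>: "\<And>p. p \<in> M ==> 0 < \<rho> p"
   "\<And>p G. p \<in> M ==> smc G ==> (\<forall>x\<in>M. G x \<noteq> 0 \<longrightarrow> x \<in> cball p (\<rho> p)) ==>
    set_integrable (hausdorff_measure (DIM('a) - 1) :: 'a measure) (frontier \<Omega>) G \<and> \<bar>c * sig G - boundary_integral \<Omega> G\<bar> \<le> \<eta> * boundary_integral \<Omega> (%x. \<bar>G x\<bar>)"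
   by metis
  have "S \<subseteq> (\<Union>p\<in>S. ball p (\<rho> p))"
  proof
   fix x assume "x \<in> S"
   thus "x \<in> (\<Union>p\<in>S. ball p (\<rho> p))" using \<rho>(1)[of x] SM by (intro UN_I[of x]) auto
  qed
  then obtain I where I: "I \<subseteq> S" "finite I" "S \<subseteq> (\<Union>p\<in>I. ball p (\<rho> p))"
   using compactE_image[OF S, of S "%p. ball p (\<rho> p)"] by auto
  have "\<forall>p\<in>I. \<exists>b :: 'a \<Rightarrow> real. smooth_on UNIV b \<and> (\<forall>x. 0 \<le> b x) \<and> (\<forall>x. 0 < b x \<longleftrightarrow> x \<in> ball p (\<rho> p))"
  proof
   fix p assume "p \<in> I"
   hence "0 < \<rho> p" using I SM \<rho>(1) by blast
   then obtain b :: "'a \<Rightarrow> real" where "smooth_on UNIV b" "\<And>x. 0 \<le> b x" "\<And>x. 0 < b x \<longleftrightarrow> x \<in> ball p (\<rho> p)"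
    using smooth_ball_function[of "\<rho> p" p] by metis
   thus "\<exists>b :: 'a \<Rightarrow> real. smooth_on UNIV b \<and> (\<forall>x. 0 \<le> b x) \<and> (\<forall>x. 0 < b x \<longleftrightarrow> x \<in> ball p (\<rho> p))"
    by (intro exI[of _ b]) simp
  qed
  then obtain bf :: "'a \<Rightarrow> 'a \<Rightarrow> real" where bf: "\<And>p. p \<in> I ==> smooth_on UNIV (bf p)" "\<And>p x. p \<in> I ==> 0 \<le> bf p x"
   "\<And>p x. p \<in> I ==> 0 < bf p x \<longleftrightarrow> x \<in> ball p (\<rho> p)"
   by metis
  define Bs where "Bs x = (\<Sum>p\<in>I. bf p x)" for x
  have smBs: "sm Bs" unfolding Bs_def by (intro sm_sum sm_of_smooth bf)
  have Bs0: "0 \<le> Bs x" for x unfolding Bs_def by (intro sum_nonneg bf)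
  have Bpos: "0 < Bs x" if xS: "x \<in> S" for x
  proof -
   obtain p where p: "p \<in> I" "x \<in> ball p (\<rho> p)" using I(3) xS by blast
   have "0 < bf p x" using bf(3)[OF p(1)] p(2) by blast
   moreover have "bf p x \<le> Bs x" unfolding Bs_def using I(2) p(1) bf(2) by (intro member_le_sum) auto
   ultimately show ?thesis by linarith
  qed
  define Q where "Q x = F x * inverse (Bs x)" for x
  have smQ: "sm Q" unfolding Q_def
   by (rule sm_quotient[OF sF smBs compact_imp_closed[OF S]]) (use FS Bpos in force)+
  obtain R where R: "0 < R" "\<forall>x\<in>M. F x \<noteq> 0 \<longrightarrow> norm x \<le> R" by (rule smc_bound[OF F])
  have scQ: "smc Q" by (rule smcI[OF smQ, of R]) (use R in \<open>auto simp: Q_def\<close>)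
  define G where "G p = (%x. Q x * bf p x)" for p
  have scG: "smc (G p)" if "p \<in> I" for p unfolding G_def by (intro smc_mult scQ sm_of_smooth bf that)
  have QB: "Q x * Bs x = F x" if "x \<in> M" for x
  proof (cases "F x = 0")
   case False
   thus ?thesis using Bpos[OF FS[OF that False]] by (simp add: Q_def)
  qed (simp add: Q_def)
  have sumG: "(\<Sum>p\<in>I. G p x) = F x" if "x \<in> M" for x
   unfolding G_def sum_distrib_left[symmetric] Bs_def[symmetric] by (rule QB[OF that])
  \<comment> \<open>The bumps are nonnegative, so the absolute values add up to that of
    \<open>F\<close>: the relative error does not grow with the number of patches.\<close>
  have sumA: "(\<Sum>p\<in>I. \<bar>G p x\<bar>) = \<bar>F x\<bar>" if "x \<in> M" for x
  proof -
   have "(\<Sum>p\<in>I. \<bar>G p x\<bar>) = (\<Sum>p\<in>I. \<bar>Q x\<bar> * bf p x)"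
    by (rule sum.cong[OF refl]) (simp add: G_def abs_mult bf(2))
   also have "... = \<bar>Q x\<bar> * Bs x" by (simp add: Bs_def sum_distrib_left)
   also have "... = \<bar>Q x * Bs x\<bar>" using Bs0[of x] by (simp add: abs_mult)
   finally show ?thesis using QB[OF that] by simp
  qed
  have each: "set_integrable (hausdorff_measure (DIM('a) - 1) :: 'a measure) (frontier \<Omega>) (G p) \<and> \<bar>c * sig (G p) - boundary_integral \<Omega> (G p)\<bar> \<le> \<eta> * boundary_integral \<Omega> (%x. \<bar>G p x\<bar>)"
   if p: "p \<in> I" for p
  proof (rule \<rho>(2)[OF _ scG[OF p]])
   show "p \<in> M" using p I SM by blast
   show "\<forall>x\<in>M. G p x \<noteq> 0 \<longrightarrow> x \<in> cball p (\<rho> p)"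
   proof (intro ballI impI)
    fix x assume "G p x \<noteq> 0"
    hence "0 < bf p x" using bf(2)[OF p, of x] by (auto simp: G_def)
    thus "x \<in> cball p (\<rho> p)" using bf(3)[OF p] by auto
   qed
  qed
  have ic: "indicator (frontier \<Omega>) x *\<^sub>R F x = (\<Sum>p\<in>I. indicator (frontier \<Omega>) x *\<^sub>R G p x)"
   "indicator (frontier \<Omega>) x *\<^sub>R \<bar>F x\<bar> = (\<Sum>p\<in>I. indicator (frontier \<Omega>) x *\<^sub>R \<bar>G p x\<bar>)" for x
   using sumG[of x] sumA[of x] frontier_sub by (cases "x \<in> frontier \<Omega>"; auto simp: sum_distrib_left[symmetric])+
  have iG: "integrable (hausdorff_measure (DIM('a) - 1) :: 'a measure) (%x. indicator (frontier \<Omega>) x *\<^sub>R G p x)" if "p \<in> I" for p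
   using each[OF that] by (simp add: set_integrable_def)
  have iA: "integrable (hausdorff_measure (DIM('a) - 1) :: 'a measure) (%x. indicator (frontier \<Omega>) x *\<^sub>R \<bar>G p x\<bar>)" if "p \<in> I" for p
   using set_integrable_abs[of "hausdorff_measure (DIM('a) - 1) :: 'a measure" "frontier \<Omega>" "G p"] each[OF that] by (simp add: set_integrable_def)
  have 1: "set_integrable (hausdorff_measure (DIM('a) - 1) :: 'a measure) (frontier \<Omega>) F" unfolding set_integrable_def ic by (rule Bochner_Integration.integrable_sum) (rule iG)
  have 2: "boundary_integral \<Omega> F = (\<Sum>p\<in>I. boundary_integral \<Omega> (G p))"
   unfolding boundary_integral_def set_lebesgue_integral_def ic by (rule Bochner_Integration.integral_sum) (rule iG)
  have 3: "boundary_integral \<Omega> (%x. \<bar>F x\<bar>) = (\<Sum>p\<in>I. boundary_integral \<Omega> (%x. \<bar>G p x\<bar>))"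
   unfolding boundary_integral_def set_lebesgue_integral_def ic by (rule Bochner_Integration.integral_sum) (rule iA)
  have "sig F = sig (%x. \<Sum>p\<in>I. G p x)" by (rule sig_cong) (simp add: sumG)
  also have "... = (\<Sum>p\<in>I. sig (G p))" by (rule sig_sum[OF I(2) scG])
  finally have 4: "c * sig F = (\<Sum>p\<in>I. c * sig (G p))" by (simp add: sum_distrib_left)
  have "\<bar>c * sig F - boundary_integral \<Omega> F\<bar> \<le> (\<Sum>p\<in>I. \<bar>c * sig (G p) - boundary_integral \<Omega> (G p)\<bar>)"
   unfolding 2 4 sum_subtractf[symmetric] by (rule sum_abs)
  also have "... \<le> (\<Sum>p\<in>I. \<eta> * boundary_integral \<Omega> (%x. \<bar>G p x\<bar>))" by (rule sum_mono) (use each in blast)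
  also have "... = \<eta> * boundary_integral \<Omega> (%x. \<bar>F x\<bar>)" unfolding 3 by (simp add: sum_distrib_left)
  finally show ?thesis using 1 by blast
 qed
 show "set_integrable (hausdorff_measure (DIM('a) - 1) :: 'a measure) (frontier \<Omega>) F" using main[of 1] by simp
 define A where "A = boundary_integral \<Omega> (%x. \<bar>F x\<bar>)"
 have A0: "0 \<le> A" unfolding A_def boundary_integral_def set_lebesgue_integral_def by (intro integral_nonneg_AE) simp
 have bnd: "\<bar>c * sig F - boundary_integral \<Omega> F\<bar> \<le> \<eta> * A" if "0 < \<eta>" for \<eta> using main[OF that] by (simp add: A_def)
 show "boundary_integral \<Omega> F = c * sig F"
 proof (rule ccontr)
  assume "boundary_integral \<Omega> F \<noteq> c * sig F"
  hence pos: "0 < \<bar>c * sig F - boundary_integral \<Omega> F\<bar>" by simp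
  define \<eta> where "\<eta> = \<bar>c * sig F - boundary_integral \<Omega> F\<bar> / (2 * (A + 1))"
  have \<eta>: "0 < \<eta>" unfolding \<eta>_def using pos A0 by (intro divide_pos_pos) auto
  have "\<eta> * A \<le> \<eta> * (A + 1)" using \<eta> by simp
  also have "... = \<bar>c * sig F - boundary_integral \<Omega> F\<bar> / 2" using A0 by (simp add: \<eta>_def field_simps)
  finally show False using order_trans[OF bnd[OF \<eta>]] pos by fastforce
 qed
qed

end

subsection \<open>Interior gradient bound\<close>

context smooth_dom
begin

lemma line_derivative_interior:
 assumes f: "sm f" and x: "x + t *\<^sub>R b \<in> \<Omega>"
 shows "((%t. f (x + t *\<^sub>R b)) has_real_derivative pd b f (x + t *\<^sub>R b)) (at t)"
proof -
 have "((%t. x + t *\<^sub>R b) has_derivative (%h. h *\<^sub>R b)) (at t)" by (auto intro!: derivative_eq_intros)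
 from has_derivative_compose[OF this sm_has_derivative_interior[OF f x]]
 show ?thesis by (simp add: has_field_derivative_def pd_def mult_commute_abs)
qed

lemma interior_max:
 assumes f: "sm f" and x: "x \<in> \<Omega>" and U: "open U" "x \<in> U" and max: "\<And>y. y \<in> U \<inter> \<Omega> ==> f y \<le> f x"
 shows "pd b f x = 0" and "pd b (pd b f) x \<le> 0"
proof -
 have "open ((%t::real. x + t *\<^sub>R b) -` (U \<inter> \<Omega>))"
  by (rule open_vimage[OF open_Int[OF U(1) open_dom]]) (intro continuous_intros)
 moreover have "0 \<in> (%t::real. x + t *\<^sub>R b) -` (U \<inter> \<Omega>)" using x U by simp
 ultimately obtain e where e: "0 < e" "ball 0 e \<subseteq> (%t::real. x + t *\<^sub>R b) -` (U \<inter> \<Omega>)" using openE by metis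
 have inU: "x + t *\<^sub>R b \<in> U \<inter> \<Omega>" if "\<bar>t\<bar> < e" for t
 proof -
  have "t \<in> ball 0 e" using that by (simp add: dist_real_def)
  thus ?thesis using e(2) by blast
 qed
 have d: "((%t. f (x + t *\<^sub>R b)) has_real_derivative pd b f (x + t *\<^sub>R b)) (at t)" if "\<bar>t\<bar> < e" for t
  by (rule line_derivative_interior[OF f]) (use inU[OF that] in blast)
 have d0: "((%t. f (x + t *\<^sub>R b)) has_real_derivative pd b f x) (at 0)" using d[of 0] e(1) by simp
 show z: "pd b f x = 0"
  by (rule DERIV_local_max[OF d0 e(1)]) (use max inU in simp)
 have d1: "((%t. pd b f (x + t *\<^sub>R b)) has_real_derivative pd b (pd b f) x) (at 0)"
  using line_derivative_interior[OF sm_pd[OF f], of x 0 b b] x by simp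
 show "pd b (pd b f) x \<le> 0"
 proof (rule ccontr)
  assume "\<not> pd b (pd b f) x \<le> 0"
  hence "0 < pd b (pd b f) x" by simp
  from DERIV_pos_inc_right[OF d1 this] z obtain e1 where e1: "0 < e1" "\<And>h. 0 < h ==> h < e1 ==> 0 < pd b f (x + h *\<^sub>R b)" by auto
  define h where "h = min e e1 / 2"
  have h: "0 < h" "h < e" "h < e1" using e e1 by (auto simp: h_def)
  have "\<exists>z. 0 < z \<and> z < h \<and> f (x + h *\<^sub>R b) - f (x + 0 *\<^sub>R b) = (h - 0) * pd b f (x + z *\<^sub>R b)"
   by (rule MVT2[OF h(1)], rule d) (use h in simp)
  then obtain z where z: "0 < z" "z < h" "f (x + h *\<^sub>R b) - f x = h * pd b f (x + z *\<^sub>R b)" by auto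
  have "0 < h * pd b f (x + z *\<^sub>R b)" using e1(2)[of z] z h by simp
  moreover have "f (x + h *\<^sub>R b) \<le> f x" by (rule max[OF inU]) (use h in simp)
  ultimately show False using z(3) by simp
 qed
qed

lemma sm_dist_sq: "sm (%z. (z - x) \<bullet> (z - x))"
 by (rule sm_of_smooth[OF smooth_on_inner_self])

lemma pd_dist_sq: "z \<in> M ==> pd b (%z. (z - x) \<bullet> (z - x)) z = 2 * ((z - x) \<bullet> b)"
proof -
 assume z: "z \<in> M"
 have "((%z. (z - x) \<bullet> (z - x)) has_derivative (%h. (z - x) \<bullet> h + h \<bullet> (z - x))) (at z within M)"
  by (auto intro!: derivative_eq_intros)
 from pd_eqI[OF z this, of b] show ?thesis by (simp add: inner_commute)
qed

lemma sm_diff_inner: "sm (%z. (z - x) \<bullet> b)"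
 using sm_diff[OF sm_inner[of b] sm_const[of "x \<bullet> b"]] by (simp add: inner_diff_left)

lemma pd_diff_inner: "z \<in> M ==> pd b (%z. (z - x) \<bullet> c) z = b \<bullet> c"
 using pd_diff[OF sm_inner[of c] sm_const[of "x \<bullet> c"], of z b] pd_inner[of z b c] pd_const[of z b] by (simp add: inner_diff_left)

lemma pd2_dist_sq: "z \<in> M ==> b \<in> Basis ==> pd b (pd b (%z. (z - x) \<bullet> (z - x))) z = 2"
proof -
 assume z: "z \<in> M" and b: "b \<in> Basis"
 have "pd b (pd b (%z. (z - x) \<bullet> (z - x))) z = pd b (%z. 2 * ((z - x) \<bullet> b)) z"
  by (rule pd_cong[OF z]) (rule pd_dist_sq)
 also have "... = 2 * (b \<bullet> b)" by (simp only: pd_cmult[OF sm_diff_inner z] pd_diff_inner[OF z])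
 finally show ?thesis using b by simp
qed

end

context serrin_dom
begin

text \<open>Comparison with a barrier. Its Laplacian is - n / 2, so the difference \<open>w\<close>
  has the negative Laplacian - n / 2 and no interior minimum, while on the sphere only
  \<open>u \<ge> 0\<close> is left. The factor 1/4 instead of 1/2 is what makes the comparison
  strict.\<close>

lemma u_lower_ball:
 assumes d: "0 < d" "ball x d \<subseteq> \<Omega>" and z: "z \<in> cball x d"
 shows "(d\<^sup>2 - (z - x) \<bullet> (z - x)) / 4 \<le> u z"
proof -
 have cM: "cball x d \<subseteq> M" using closure_mono[OF d(2)] d(1) by simp
 define w where "w z = (u z + (1/4) * ((z - x) \<bullet> (z - x))) - d\<^sup>2 / 4" for z
 have sw: "sm w" unfolding w_def by (intro sm_diff sm_add sm_mult sm_const smu sm_dist_sq)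
 obtain z0 where z0: "z0 \<in> cball x d" "\<forall>z\<in>cball x d. w z0 \<le> w z"
  using continuous_attains_inf[OF compact_cball, of x d w] continuous_on_subset[OF sm_continuous[OF sw] cM] d(1) by auto
 have "0 \<le> w z0"
 proof (cases "z0 \<in> ball x d")
  case True
  hence z\<Omega>: "z0 \<in> \<Omega>" "z0 \<in> M" using d dom_sub by auto
  have "pd b (pd b (%z. - w z)) z0 \<le> 0" for b
   by (rule interior_max(2)[OF sm_minus[OF sw] z\<Omega>(1) open_ball True]) (use z0 in auto)
  moreover have "pd b (pd b (%z. - w z)) z0 = - (pd b (pd b u) z0 + 1/2)" if b: "b \<in> Basis" for b
  proof -
   have p1: "pd b (%z. - w z) y = - (pd b u y + (1/4) * pd b (%z. (z - x) \<bullet> (z - x)) y)" if y: "y \<in> M" for y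
    unfolding pd_minus[OF sw y]
    unfolding w_def pd_diff[OF sm_add[OF smu sm_mult[OF sm_const sm_dist_sq]] sm_const y] pd_const[OF y]
     pd_add[OF smu sm_mult[OF sm_const sm_dist_sq] y] pd_cmult[OF sm_dist_sq y] by simp
   have "pd b (pd b (%z. - w z)) z0 = pd b (%y. - (pd b u y + (1/4) * pd b (%z. (z - x) \<bullet> (z - x)) y)) z0"
    by (rule pd_cong[OF z\<Omega>(2) p1])
   also have "... = - (pd b (pd b u) z0 + (1/4) * pd b (pd b (%z. (z - x) \<bullet> (z - x))) z0)"
    by (simp only: pd_minus[OF sm_add[OF sm_pd[OF smu] sm_mult[OF sm_const sm_pd[OF sm_dist_sq]]] z\<Omega>(2)]
      pd_add[OF sm_pd[OF smu] sm_mult[OF sm_const sm_pd[OF sm_dist_sq]] z\<Omega>(2)] pd_cmult[OF sm_pd[OF sm_dist_sq] z\<Omega>(2)])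
   finally show ?thesis by (simp add: pd2_dist_sq[OF z\<Omega>(2) b])
  qed
  ultimately have "- (pd b (pd b u) z0 + 1/2) \<le> 0" if "b \<in> Basis" for b using that by metis
  hence "(\<Sum>b\<in>(Basis::'a set). - (pd b (pd b u) z0 + 1/2)) \<le> 0" by (intro sum_nonpos) auto
  also have "(\<Sum>b\<in>(Basis::'a set). - (pd b (pd b u) z0 + 1/2)) = - ((SB b. pd b (pd b u) z0) + real DIM('a) / 2)"
   unfolding sum_negf sum.distrib by simp
  finally have "real DIM('a) \<le> 0" using lap[OF z\<Omega>(2)] by simp
  thus ?thesis by simp
 next
  case False
  hence "dist x z0 = d" using z0 by auto
  hence "(z0 - x) \<bullet> (z0 - x) = d\<^sup>2" by (simp add: dist_norm norm_minus_commute dot_square_norm)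
  thus ?thesis using u_nonneg[of z0] z0 cM by (auto simp: w_def)
 qed
 hence "0 \<le> w z" by (rule order_trans) (use z0 z in blast)
 thus ?thesis by (simp add: w_def field_simps)
qed

text \<open>The barrier on the inscribed ball of radius d forces the value t (2 d - t) / 4 at
  distance \<open>t\<close> from the touching point \<open>y\<close>, while |Du| = 1 at
  \<open>y\<close> allows at most 3 t / 2 for small \<open>t\<close>. With t \<le> 1 this bounds d
  by 7/2.\<close>

lemma nearest_boundary_point:
 assumes x: "x \<in> \<Omega>"
 obtains y where "y \<in> frontier \<Omega>" "0 < dist x y" "dist x y \<le> 4" "ball x (dist x y) \<subseteq> \<Omega>"
proof -
 have ballsub: "ball x d \<subseteq> \<Omega>" if "\<And>y. y \<in> frontier \<Omega> ==> d \<le> dist x y" for d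
 proof
  fix z assume z: "z \<in> ball x d"
  show "z \<in> \<Omega>"
  proof (rule ccontr)
   assume "z \<notin> \<Omega>"
   hence "ball x d \<inter> frontier \<Omega> \<noteq> {}"
    using connected_Int_frontier[OF connected_ball[of x d], of \<Omega>] z x by (metis Diff_iff IntI centre_in_ball empty_iff mem_ball order_le_less_trans zero_le_dist)
   thus False using that by force
  qed
 qed
 have ne: "frontier \<Omega> \<noteq> {}"
 proof
  assume e: "frontier \<Omega> = {}"
  \<comment> \<open>Without boundary every ball would be inscribed; this radius makes d^2 / 4 exceed
    \<open>u x\<close>, against \<open>u_lower_ball\<close>.\<close>
  define d where "d = 2 * sqrt (u x) + 1"
  have ux: "0 < u x" by (rule u_pos[OF x])
  hence d: "0 < d" by (simp add: d_def add_nonneg_pos)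
  have "d\<^sup>2 / 4 \<le> u x" using u_lower_ball[OF d, of x x] ballsub[of d] e d by simp
  moreover have "(2 * sqrt (u x))\<^sup>2 < d\<^sup>2" unfolding d_def using ux by (intro power_strict_mono) auto
  ultimately show False using ux by (simp add: power_mult_distrib)
 qed
 obtain y where y: "y \<in> frontier \<Omega>" "\<And>z. z \<in> frontier \<Omega> ==> dist x y \<le> dist x z"
  using distance_attains_inf[OF frontier_closed ne, of x] by blast
 have sub: "ball x (dist x y) \<subseteq> \<Omega>" by (rule ballsub[OF y(2)])
 have "y \<noteq> x" using y(1) x frontier_dom by blast
 hence d: "0 < dist x y" by simp
 define dd where "dd = dist x y"
 define e where "e = (x - y) /\<^sub>R dd"
 have e: "norm e = 1" "x - y = dd *\<^sub>R e" using d by (simp_all add: e_def dd_def dist_norm)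
 obtain r where b: "bball y (1/2) r" using bball_exists[OF y(1), of "1/2"] by auto
 have r: "0 < r" by (rule bball_delta(3)[OF b])
 define t where "t = min 1 (min (r/2) dd)"
 have t: "0 < t" "t \<le> 1" "t < r" "t \<le> dd" using r d by (auto simp: t_def dd_def)
 let ?z = "y + t *\<^sub>R e"
 have zx: "?z - x = (t - dd) *\<^sub>R e" using e(2) by (simp add: algebra_simps)
 have zz: "(?z - x) \<bullet> (?z - x) = (dd - t)\<^sup>2" unfolding zx using e(1) by (simp add: norm_eq_1 power2_eq_square algebra_simps)
 have zb: "?z \<in> cball x dd"
 proof -
  have "norm (?z - x) \<le> dd" unfolding zx using e(1) t by simp
  thus ?thesis by (simp add: dist_norm norm_minus_commute)
 qed
 have zM: "?z \<in> M"
 proof -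
  have "cball x dd \<subseteq> M" using closure_mono[OF sub] d by (simp add: dd_def)
  thus ?thesis using zb by blast
 qed
 have low: "(dd\<^sup>2 - (dd - t)\<^sup>2) / 4 \<le> u ?z"
  using u_lower_ball[of "dd" x ?z] d sub zb by (simp only: dd_def zz)
 have "\<bar>u ?z - u y - Du y \<bullet> (?z - y)\<bar> \<le> (1/2) * norm (?z - y)"
 proof -
  have "?z \<in> ball y r \<inter> M" using zM e(1) t by (simp add: dist_norm)
  moreover have "y \<in> ball y r \<inter> M" using y(1) frontier_sub r by auto
  ultimately show ?thesis using b unfolding bball_def by blast
 qed
 from abs_le_D1[OF this] have "u ?z \<le> t * (Du y \<bullet> e) + t / 2" using u_zero[OF y(1)] e t by simp
 moreover have "Du y \<bullet> e \<le> 1" using Cauchy_Schwarz_ineq2[of "Du y" e] grad_one[OF y(1)] e by simp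
 hence "t * (Du y \<bullet> e) \<le> t * 1" using t by (intro mult_left_mono) auto
 ultimately have up: "u ?z \<le> t * (3/2)" by simp
 have "dd\<^sup>2 - (dd - t)\<^sup>2 = t * (2 * dd - t)" by (simp add: power2_eq_square algebra_simps)
 hence "t * ((2 * dd - t) / 4) \<le> t * (3/2)" using low up by simp
 hence "(2 * dd - t) / 4 \<le> 3/2" using t by simp
 hence "dd \<le> 4" using t by simp
 thus ?thesis using that[OF y(1) d _ sub] by (simp add: dd_def)
qed

text \<open>A partial derivative of log (1 + u). The shift by 1 keeps the denominator positive up to
  the boundary, where the squared gradient \<open>lgF\<close> becomes 1.\<close>

definition lg :: "'a \<Rightarrow> 'a \<Rightarrow> real" where
 "lg b x = pd b u x * inverse (1 + u x)"

definition lgF :: "'a \<Rightarrow> real" where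
 "lgF x = (SB b. (lg b x)\<^sup>2)"

lemma sm_ia: "sm (%x. inverse (1 + u x))"
 by (rule sm_inverse[OF sm_add[OF sm_const smu]]) (use u_nonneg in force)

lemma sm_lg: "sm (lg b)" unfolding lg_def by (intro sm_mult sm_pd smu sm_ia)

lemma sm_lgF: "sm lgF" unfolding lgF_def by (intro sm_sum sm_power2 sm_lg)

lemma lgF_nonneg: "0 \<le> lgF x" unfolding lgF_def by (intro sum_nonneg) auto

lemma pd_ia: assumes x: "x \<in> M" shows "pd b (%x. inverse (1 + u x)) x = - (inverse (1 + u x) * lg b x)"
proof -
 have "1 + u x \<noteq> 0" using u_nonneg[OF x] by simp
 from pd_inverse[OF sm_add[OF sm_const[of 1] smu] x this, of b] show ?thesis
  by (simp add: pd_add[OF sm_const smu x] pd_const[OF x] lg_def)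
qed

lemma pd_lg: assumes x: "x \<in> M" shows "pd c (lg b) x = pd c (pd b u) x * inverse (1 + u x) - lg b x * lg c x"
proof -
 have "lg b = (%x. pd b u x * inverse (1 + u x))" by (simp add: fun_eq_iff lg_def)
 hence "pd c (lg b) x = pd b u x * - (inverse (1 + u x) * lg c x) + pd c (pd b u) x * inverse (1 + u x)"
  by (simp only: pd_mult[OF sm_pd[OF smu] sm_ia x] pd_ia[OF x])
 thus ?thesis by (simp add: lg_def)
qed

lemma pd_lg_commute: assumes x: "x \<in> M" shows "pd c (lg b) x = pd b (lg c) x"
 unfolding pd_lg[OF x] pd_commute[OF smu x, of c b] by simp

lemma div_lg: assumes x: "x \<in> M"
 shows "(SB b. pd b (lg b) x) = - (real DIM('a) * inverse (1 + u x) + lgF x)"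
proof -
 have "(SB b. pd b (lg b) x) = (SB b. pd b (pd b u) x) * inverse (1 + u x) - (SB b. (lg b x)\<^sup>2)"
  unfolding pd_lg[OF x] sum_subtractf sum_distrib_right by (simp add: power2_eq_square)
 thus ?thesis by (simp add: lap[OF x] lgF_def)
qed

lemma lap_lg: assumes x: "x \<in> M" and b: "b \<in> Basis"
 shows "(SB c. pd c (pd c (lg b)) x) = real DIM('a) * inverse (1 + u x) * lg b x - pd b lgF x"
proof -
 have "(SB c. pd c (pd c (lg b)) x) = (SB c. pd b (pd c (lg c)) x)"
 proof (rule sum.cong[OF refl])
  fix c :: 'a
  have "pd c (pd c (lg b)) x = pd c (pd b (lg c)) x" by (rule pd_cong[OF x pd_lg_commute])
  also have "... = pd b (pd c (lg c)) x" by (rule pd_commute[OF sm_lg x])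
  finally show "pd c (pd c (lg b)) x = pd b (pd c (lg c)) x" .
 qed
 also have "... = pd b (%x. SB c. pd c (lg c) x) x" by (rule pd_sum[OF finite_Basis sm_pd[OF sm_lg] x, symmetric])
 also have "... = pd b (%x. - (real DIM('a) * inverse (1 + u x) + lgF x)) x" by (rule pd_cong[OF x div_lg])
 also have "... = - (real DIM('a) * pd b (%x. inverse (1 + u x)) x + pd b lgF x)"
  unfolding pd_minus[OF sm_add[OF sm_mult[OF sm_const sm_ia] sm_lgF] x] pd_add[OF sm_mult[OF sm_const sm_ia] sm_lgF x]
   pd_cmult[OF sm_ia x] ..
 finally show ?thesis unfolding pd_ia[OF x] by simp
qed

lemma pd_lgF: assumes x: "x \<in> M" shows "pd c lgF x = 2 * (SB b. lg b x * pd c (lg b) x)"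
proof -
 have "pd c lgF x = (SB b. pd c (%x. (lg b x)\<^sup>2) x)"
  unfolding lgF_def by (rule pd_sum[OF finite_Basis sm_power2[OF sm_lg] x])
 thus ?thesis unfolding pd_power2[OF sm_lg x] by (simp add: sum_distrib_left mult.assoc)
qed

text \<open>Bochner's formula for v = log (1 + u), whose Laplacian is - (n / (1 + u) +
  \<open>lgF\<close>). By Cauchy-Schwarz |D^2v|^2 is at least 1 / n times the square of that, hence
  at least \<open>lgF\<close>^2 / n. The remaining term with n / (1 + u) has a favourable sign and
  is dropped.\<close>

lemma lap_lgF:
 assumes x: "x \<in> M"
 shows "(2 / real DIM('a)) * (lgF x)\<^sup>2 - 2 * (SB b. lg b x * pd b lgF x) \<le> (SB c. pd c (pd c lgF) x)"
proof -
 let ?n = "real DIM('a)" and ?a = "inverse (1 + u x)"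
 have a0: "0 \<le> ?a" using u_nonneg[OF x] by simp
 have second: "pd c (pd c lgF) x = 2 * (SB b. (pd c (lg b) x)\<^sup>2 + lg b x * pd c (pd c (lg b)) x)" for c
 proof -
  have s: "sm (%x. lg b x * pd c (lg b) x)" for b by (intro sm_mult sm_lg sm_pd)
  have "pd c (pd c lgF) x = pd c (%x. 2 * (SB b. lg b x * pd c (lg b) x)) x" by (rule pd_cong[OF x pd_lgF])
  also have "... = 2 * (SB b. pd c (%x. lg b x * pd c (lg b) x) x)"
   unfolding pd_cmult[OF sm_sum[OF s] x] pd_sum[OF finite_Basis s x] ..
  also have "(SB b. pd c (%x. lg b x * pd c (lg b) x) x) = (SB b. (pd c (lg b) x)\<^sup>2 + lg b x * pd c (pd c (lg b)) x)"
   unfolding pd_mult[OF sm_lg sm_pd[OF sm_lg] x] by (simp add: power2_eq_square add.commute)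
  finally show ?thesis .
 qed
 have "(SB c. pd c (pd c lgF) x) = 2 * (SB c. SB b. (pd c (lg b) x)\<^sup>2) + 2 * (SB c. SB b. lg b x * pd c (pd c (lg b)) x)"
  unfolding second by (simp add: sum_distrib_left sum.distrib distrib_left)
 also have "(SB c. SB b. lg b x * pd c (pd c (lg b)) x) = (SB b. lg b x * (SB c. pd c (pd c (lg b)) x))"
  by (subst sum.swap) (simp add: sum_distrib_left)
 also have "... = (SB b. ?n * ?a * (lg b x)\<^sup>2 - lg b x * pd b lgF x)"
  by (rule sum.cong[OF refl]) (simp add: lap_lg[OF x] power2_eq_square algebra_simps)
 also have "... = ?n * ?a * lgF x - (SB b. lg b x * pd b lgF x)"
  by (simp add: sum_subtractf lgF_def sum_distrib_left)
 finally have eq: "(SB c. pd c (pd c lgF) x) = 2 * (SB c. SB b. (pd c (lg b) x)\<^sup>2)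
   + 2 * (?n * ?a * lgF x - (SB b. lg b x * pd b lgF x))" .
 have "(lgF x)\<^sup>2 \<le> (?n * ?a + lgF x)\<^sup>2" using a0 lgF_nonneg[of x] by (intro power_mono) auto
 also have "... = (SB b. pd b (lg b) x)\<^sup>2" unfolding div_lg[OF x] by (simp only: power2_minus)
 also have "... \<le> (SB b. (pd b (lg b) x)\<^sup>2) * ?n"
  using sum_squared_le_sum_of_squares[of "%b. pd b (lg b) x" Basis] by simp
 also have "... \<le> (SB c. SB b. (pd c (lg b) x)\<^sup>2) * ?n"
 proof (intro mult_right_mono sum_mono)
  fix c :: 'a assume "c \<in> Basis"
  thus "(pd c (lg c) x)\<^sup>2 \<le> (SB b. (pd c (lg b) x)\<^sup>2)" by (intro member_le_sum) auto
 qed simp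
 finally have cs: "(lgF x)\<^sup>2 / ?n \<le> (SB c. SB b. (pd c (lg b) x)\<^sup>2)" by (simp add: divide_le_eq)
 have "0 \<le> ?n * ?a * lgF x" using a0 lgF_nonneg[of x] by simp
 thus ?thesis unfolding eq using cs by simp
qed

text \<open>The maximum principle for \<open>\<psi> F\<close> with the cutoff \<open>\<psi> = (1 - |x - x0|^2)^2\<close> (Cheng--Yau).\<close>

lemma lgF_bound:
 assumes x0: "x0 \<in> \<Omega>"
 shows "lgF x0 \<le> 32 * real DIM('a) + 20 * (real DIM('a))\<^sup>2"
proof -
 let ?n = "real DIM('a)"
 have n1: "1 \<le> ?n" using DIM_positive[where 'a='a] by linarith
 have C1: "1 \<le> 32 * ?n + 20 * ?n\<^sup>2" using n1 zero_le_power2[of ?n] by linarith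
 define \<theta> where "\<theta> = (%z. 1 - (z - x0) \<bullet> (z - x0))"
 define \<psi> where "\<psi> = (%z. (\<theta> z)\<^sup>2)"
 define G where "G = (%z. \<psi> z * lgF z)"
 have s\<theta>: "sm \<theta>" unfolding \<theta>_def by (intro sm_diff sm_const sm_dist_sq)
 have s\<psi>: "sm \<psi>" unfolding \<psi>_def by (rule sm_power2[OF s\<theta>])
 have sG: "sm G" unfolding G_def by (rule sm_mult[OF s\<psi> sm_lgF])
 have K: "compact (M \<inter> cball x0 1)" by (intro closed_Int_compact) auto
 have xK: "x0 \<in> M \<inter> cball x0 1" using x0 dom_sub by auto
 obtain x where x: "x \<in> M \<inter> cball x0 1" "\<forall>z\<in>M \<inter> cball x0 1. G z \<le> G x"
  using continuous_attains_sup[OF K _ continuous_on_subset[OF sm_continuous[OF sG]], of] xK by (metis Int_lower1 empty_iff)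
 have "lgF x0 = G x0" by (simp add: G_def \<psi>_def \<theta>_def)
 also have "... \<le> G x" using x(2) xK by blast
 also have "G x \<le> 32 * ?n + 20 * ?n\<^sup>2"
 proof (cases "x \<in> frontier \<Omega>")
  case True
  \<comment> \<open>A maximum on the boundary is harmless: there u = 0 and |Du| = 1 give the value
    directly.\<close>
  have "lgF x = 1" unfolding lgF_def lg_def using u_zero[OF True] grad_sq[OF True] by simp
  moreover have "\<psi> x \<le> 1"
  proof -
   have "norm (x - x0) \<le> 1" using x(1) by (simp add: dist_norm norm_minus_commute)
   hence "(norm (x - x0))\<^sup>2 \<le> 1" using power_mono[of "norm (x - x0)" 1 2] by simp
   hence "0 \<le> \<theta> x" "\<theta> x \<le> 1" by (simp_all add: \<theta>_def dot_square_norm)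
   thus ?thesis unfolding \<psi>_def using power_mono[of "\<theta> x" 1 2] by simp
  qed
  ultimately show ?thesis using C1 by (simp add: G_def)
 next
  case False
  hence x\<Omega>: "x \<in> \<Omega>" and xM: "x \<in> M" using x(1) frontier_dom by blast+
  show ?thesis
  proof (cases "G x = 0")
   case True thus ?thesis using C1 by simp
  next
   case G0: False
   define q where "q = (x - x0) \<bullet> (x - x0)"
   have q01: "0 \<le> q" "q \<le> 1"
   proof -
    have "norm (x - x0) \<le> 1" using x(1) by (simp add: dist_norm norm_minus_commute)
    hence "(norm (x - x0))\<^sup>2 \<le> 1" using power_mono[of "norm (x - x0)" 1 2] by simp
    thus "0 \<le> q" "q \<le> 1" by (simp_all add: q_def dot_square_norm)
   qed
   have \<theta>q: "\<theta> x = 1 - q" by (simp add: \<theta>_def q_def)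
   have "\<theta> x \<noteq> 0" using G0 by (auto simp: G_def \<psi>_def)
   hence \<theta>0: "0 < \<theta> x" "\<theta> x \<le> 1" using q01 \<theta>q by auto
   have Gpos: "0 < G x" using G0 lgF_nonneg[of x] by (simp add: G_def \<psi>_def less_le)
   have "norm (x - x0) < 1"
   proof (rule ccontr)
    assume "\<not> norm (x - x0) < 1"
    hence "1 \<le> (norm (x - x0))\<^sup>2" using power_mono[of 1 "norm (x - x0)" 2] by simp
    thus False using \<theta>0 \<theta>q by (simp add: q_def dot_square_norm)
   qed
   hence xb: "x \<in> ball x0 1" by (simp add: dist_norm norm_minus_commute)
   have mx: "G y \<le> G x" if "y \<in> ball x0 1 \<inter> \<Omega>" for y using x(2) that dom_sub by auto
   have G1: "pd b G x = 0" and G2: "pd b (pd b G) x \<le> 0" for b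
    using interior_max[OF sG x\<Omega> open_ball xb mx] by blast+
   have p\<theta>: "pd b \<theta> y = - 2 * ((y - x0) \<bullet> b)" if "y \<in> M" for y b
    unfolding \<theta>_def pd_diff[OF sm_const sm_dist_sq that] pd_const[OF that] pd_dist_sq[OF that] by simp
   have p\<psi>: "pd b \<psi> y = 2 * \<theta> y * pd b \<theta> y" if "y \<in> M" for y b
    unfolding \<psi>_def by (rule pd_power2[OF s\<theta> that])
   have pp\<theta>: "pd b (pd b \<theta>) x = - 2" if b: "b \<in> Basis" for b
   proof -
    have "pd b (pd b \<theta>) x = pd b (%y. - 2 * ((y - x0) \<bullet> b)) x" by (rule pd_cong[OF xM p\<theta>])
    also have "... = - 2 * (b \<bullet> b)" by (simp only: pd_cmult[OF sm_diff_inner xM] pd_diff_inner[OF xM])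
    finally show ?thesis using b by simp
   qed
   have pp\<psi>: "pd b (pd b \<psi>) x = 2 * (pd b \<theta> x)\<^sup>2 + 2 * \<theta> x * pd b (pd b \<theta>) x" for b
   proof -
    have "pd b (pd b \<psi>) x = pd b (%y. 2 * \<theta> y * pd b \<theta> y) x" by (rule pd_cong[OF xM p\<psi>])
    also have "... = 2 * \<theta> x * pd b (pd b \<theta>) x + (2 * pd b \<theta> x) * pd b \<theta> x"
     unfolding pd_mult[OF sm_mult[OF sm_const s\<theta>] sm_pd[OF s\<theta>] xM] pd_cmult[OF s\<theta> xM] ..
    finally show ?thesis by (simp add: power2_eq_square)
   qed
   have sq\<theta>: "(SB b. (pd b \<theta> x)\<^sup>2) = 4 * q"
   proof -
    have "(SB b. (pd b \<theta> x)\<^sup>2) = 4 * (SB b. ((x - x0) \<bullet> b)\<^sup>2)"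
     unfolding p\<theta>[OF xM] by (simp add: power_mult_distrib sum_distrib_left)
    also have "(SB b. ((x - x0) \<bullet> b)\<^sup>2) = q" unfolding q_def
     by (subst euclidean_inner[of "x - x0" "x - x0"]) (simp add: power2_eq_square)
    finally show ?thesis .
   qed
   have lap\<psi>: "- 4 * ?n \<le> (SB b. pd b (pd b \<psi>) x)"
   proof -
    have "(SB b. pd b (pd b \<psi>) x) = (SB b. 2 * (pd b \<theta> x)\<^sup>2 + 2 * \<theta> x * (-2))"
     by (rule sum.cong[OF refl]) (simp add: pp\<psi> pp\<theta>)
    also have "... = 8 * q - 4 * \<theta> x * ?n" unfolding sum.distrib sum_distrib_left[symmetric] sq\<theta> by simp
    finally have e: "(SB b. pd b (pd b \<psi>) x) = 8 * q - 4 * (\<theta> x * ?n)" by simp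
    have "\<theta> x * ?n \<le> 1 * ?n" using \<theta>0 n1 by (intro mult_right_mono) auto
    thus ?thesis using q01 unfolding e by linarith
   qed
   have grad\<psi>: "(SB b. (pd b \<psi> x)\<^sup>2) \<le> 16 * \<psi> x"
   proof -
    have "(SB b. (pd b \<psi> x)\<^sup>2) = 4 * (\<theta> x)\<^sup>2 * (SB b. (pd b \<theta> x)\<^sup>2)"
     unfolding p\<psi>[OF xM] by (simp add: power_mult_distrib sum_distrib_left)
    also have "... = (16 * \<psi> x) * q" by (simp add: sq\<theta> \<psi>_def)
    also have "... \<le> (16 * \<psi> x) * 1" using q01 by (intro mult_left_mono) (auto simp: \<psi>_def)
    finally show ?thesis by simp
   qed
   have pG: "pd b G y = \<psi> y * pd b lgF y + pd b \<psi> y * lgF y" if "y \<in> M" for y b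
    unfolding G_def by (rule pd_mult[OF s\<psi> sm_lgF that])
   have first: "\<psi> x * pd b lgF x = - (pd b \<psi> x * lgF x)" for b using G1[of b] pG[OF xM, of b] by simp
   have ppG: "pd b (pd b G) x = \<psi> x * pd b (pd b lgF) x + 2 * (pd b \<psi> x * pd b lgF x) + pd b (pd b \<psi>) x * lgF x" for b
   proof -
    have "pd b (pd b G) x = pd b (%y. \<psi> y * pd b lgF y + pd b \<psi> y * lgF y) x" by (rule pd_cong[OF xM pG])
    also have "... = (\<psi> x * pd b (pd b lgF) x + pd b \<psi> x * pd b lgF x) + (pd b \<psi> x * pd b lgF x + pd b (pd b \<psi>) x * lgF x)"
     unfolding pd_add[OF sm_mult[OF s\<psi> sm_pd[OF sm_lgF]] sm_mult[OF sm_pd[OF s\<psi>] sm_lgF] xM]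
      pd_mult[OF s\<psi> sm_pd[OF sm_lgF] xM] pd_mult[OF sm_pd[OF s\<psi>] sm_lgF xM] ..
    finally show ?thesis by simp
   qed
   have "(SB b. pd b (pd b G) x) \<le> 0" by (rule sum_nonpos) (rule G2)
   hence S: "\<psi> x * (SB b. pd b (pd b lgF) x) + 2 * (SB b. pd b \<psi> x * pd b lgF x) + (SB b. pd b (pd b \<psi>) x) * lgF x \<le> 0"
    unfolding ppG by (simp add: sum.distrib sum_distrib_left sum_distrib_right)
   define LF where "LF = (SB b. pd b (pd b lgF) x)"
   define L\<psi> where "L\<psi> = (SB b. pd b (pd b \<psi>) x)"
   define P where "P = (SB b. lg b x * pd b \<psi> x)"
   have \<psi>0: "0 < \<psi> x" using \<theta>0 by (simp add: \<psi>_def)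
   \<comment> \<open>The first-order condition D(\<psi> F) = 0 eliminates DF at the price of one
     factor \<psi>. Therefore the inequalities are multiplied by \<psi> until only \<open>G\<close>
     and bounded quantities remain.\<close>
   have c1: "\<psi> x * (SB b. pd b \<psi> x * pd b lgF x) = - (lgF x * (SB b. (pd b \<psi> x)\<^sup>2))"
   proof -
    have "\<psi> x * (SB b. pd b \<psi> x * pd b lgF x) = (SB b. pd b \<psi> x * (\<psi> x * pd b lgF x))"
     unfolding sum_distrib_left by (rule sum.cong[OF refl]) simp
    also have "... = - (lgF x * (SB b. (pd b \<psi> x)\<^sup>2))"
     unfolding first sum_distrib_left sum_negf[symmetric] by (rule sum.cong[OF refl]) (simp add: power2_eq_square)
    finally show ?thesis .
   qed
   have c2: "\<psi> x * (SB b. lg b x * pd b lgF x) = - (lgF x * P)"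
   proof -
    have "\<psi> x * (SB b. lg b x * pd b lgF x) = (SB b. lg b x * (\<psi> x * pd b lgF x))"
     unfolding sum_distrib_left by (rule sum.cong[OF refl]) simp
    also have "... = - (lgF x * P)"
     unfolding first P_def sum_distrib_left sum_negf[symmetric] by (rule sum.cong[OF refl]) simp
    finally show ?thesis .
   qed
   \<comment> \<open>The weights are chosen so that G / n, half of the leading term 2 G / n, is
     spent; the rest is a constant.\<close>
   have amgm: "- (2 * P) \<le> G x / ?n + 16 * ?n"
   proof -
    have "- (2 * P) = (SB b. - (4 * \<theta> x * lg b x * pd b \<theta> x))"
     unfolding P_def p\<psi>[OF xM] sum_distrib_left sum_negf[symmetric] by (rule sum.cong[OF refl]) simp
    also have "... \<le> (SB b. (\<theta> x)\<^sup>2 * (lg b x)\<^sup>2 / ?n + 4 * ?n * (pd b \<theta> x)\<^sup>2)"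
    proof (rule sum_mono)
     fix b :: 'a
     have "0 \<le> (\<theta> x * lg b x + 2 * ?n * pd b \<theta> x)\<^sup>2 / ?n" using n1 by simp
     also have "... = (\<theta> x)\<^sup>2 * (lg b x)\<^sup>2 / ?n + 4 * ?n * (pd b \<theta> x)\<^sup>2 + 4 * \<theta> x * lg b x * pd b \<theta> x"
      using n1 by (simp add: power2_eq_square field_simps)
     finally show "- (4 * \<theta> x * lg b x * pd b \<theta> x) \<le> (\<theta> x)\<^sup>2 * (lg b x)\<^sup>2 / ?n + 4 * ?n * (pd b \<theta> x)\<^sup>2" by simp
    qed
    also have "... = G x / ?n + 4 * ?n * (4 * q)"
     unfolding sum.distrib sum_distrib_left[symmetric] sum_divide_distrib[symmetric] sq\<theta> by (simp add: G_def \<psi>_def lgF_def)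
    also have "... \<le> G x / ?n + 16 * ?n" using q01 n1 by simp
    finally show ?thesis .
   qed
   have "\<psi> x * (\<psi> x * ((2 / ?n) * (lgF x)\<^sup>2 - 2 * (SB b. lg b x * pd b lgF x))) \<le> \<psi> x * (\<psi> x * LF)"
    using lap_lgF[OF xM] \<psi>0 unfolding LF_def by (intro mult_left_mono) auto
   also have "\<psi> x * (\<psi> x * ((2 / ?n) * (lgF x)\<^sup>2 - 2 * (SB b. lg b x * pd b lgF x))) =
     (2 / ?n) * (G x)\<^sup>2 - 2 * \<psi> x * (\<psi> x * (SB b. lg b x * pd b lgF x))"
    by (simp add: G_def power2_eq_square algebra_simps)
   also have "... = (2 / ?n) * (G x)\<^sup>2 + 2 * G x * P" unfolding c2 by (simp add: G_def)
   finally have A1: "(2 / ?n) * (G x)\<^sup>2 + 2 * G x * P \<le> \<psi> x * (\<psi> x * LF)" .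
   have "\<psi> x * (\<psi> x * LF + 2 * (SB b. pd b \<psi> x * pd b lgF x) + L\<psi> * lgF x) \<le> 0"
    using S \<psi>0 unfolding LF_def L\<psi>_def by (simp add: mult_le_0_iff)
   hence A2: "\<psi> x * (\<psi> x * LF) \<le> 2 * lgF x * (SB b. (pd b \<psi> x)\<^sup>2) - L\<psi> * G x"
    using c1 by (simp add: distrib_left G_def algebra_simps)
   have A3: "2 * lgF x * (SB b. (pd b \<psi> x)\<^sup>2) \<le> 2 * lgF x * (16 * \<psi> x)"
    using grad\<psi> lgF_nonneg[of x] by (intro mult_left_mono) auto
   have A4: "- (L\<psi> * G x) \<le> 4 * ?n * G x"
    using mult_right_mono[OF lap\<psi>, of "G x"] Gpos unfolding L\<psi>_def by simp
   have A5: "- (2 * P) * G x \<le> (G x / ?n + 16 * ?n) * G x"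
    using mult_right_mono[OF amgm, of "G x"] Gpos by simp
   have "(2 / ?n) * (G x)\<^sup>2 \<le> 32 * G x + 4 * ?n * G x + (G x / ?n + 16 * ?n) * G x"
    using A1 A2 A3 A4 A5 by (simp add: G_def algebra_simps)
   hence "(2 / ?n * G x) * G x \<le> (32 + 4 * ?n + (G x / ?n + 16 * ?n)) * G x"
    by (simp add: power2_eq_square algebra_simps)
   hence "2 / ?n * G x \<le> 32 + 4 * ?n + (G x / ?n + 16 * ?n)" using Gpos by (simp only: mult_le_cancel_right_pos)
   hence "G x / ?n \<le> 32 + 20 * ?n" by simp
   thus ?thesis using n1 by (simp add: divide_le_eq power2_eq_square algebra_simps)
  qed
 qed
 finally show ?thesis .
qed

text \<open>The gradient of log (1 + u) is at most sqrt C, and every point of \<Omega> is joined to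
  the boundary, where log (1 + u) = 0, by a segment of length at most 4 inside the domain; hence
  \<open>E = exp (4 * sqrt C)\<close>. The bound for \<open>Du\<close> follows by multiplying back
  with 1 + u.\<close>

lemma u_gradient_bounded:
 obtains B where "1 \<le> B" "\<And>x. x \<in> M ==> u x \<le> B" "\<And>x. x \<in> M ==> (SB b. (pd b u x)\<^sup>2) \<le> B"
proof -
 define C where "C = 32 * real DIM('a) + 20 * (real DIM('a))\<^sup>2"
 have C: "lgF x \<le> C" if "x \<in> \<Omega>" for x using lgF_bound[OF that] by (simp add: C_def)
 have C0: "0 \<le> C" by (simp add: C_def)
 define E where "E = exp (4 * sqrt C)"
 have E1: "1 \<le> E" using C0 by (simp add: E_def)
 have lgrad: "\<bar>Du x \<bullet> v\<bar> * inverse (1 + u x) \<le> sqrt C * norm v" if x: "x \<in> \<Omega>" for x v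
 proof -
  have u0: "0 \<le> inverse (1 + u x)" using u_pos[OF x] by simp
  have "(norm (Du x) * inverse (1 + u x))\<^sup>2 = lgF x"
   unfolding power_mult_distrib norm_gradient lgF_def lg_def sum_distrib_right ..
  hence "norm (Du x) * inverse (1 + u x) \<le> sqrt C" using C[OF x] by (intro real_le_rsqrt) simp
  hence "norm (Du x) * inverse (1 + u x) * norm v \<le> sqrt C * norm v" by (rule mult_right_mono) simp
  moreover have "\<bar>Du x \<bullet> v\<bar> * inverse (1 + u x) \<le> (norm (Du x) * norm v) * inverse (1 + u x)"
   using Cauchy_Schwarz_ineq2[of "Du x" v] u0 by (rule mult_right_mono)
  ultimately show ?thesis by (simp add: mult.commute mult.left_commute)
 qed
 have uE: "1 + u x \<le> E" if x: "x \<in> \<Omega>" for x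
 proof -
  obtain y where y: "y \<in> frontier \<Omega>" "0 < dist x y" "dist x y \<le> 4" "ball x (dist x y) \<subseteq> \<Omega>"
   by (rule nearest_boundary_point[OF x])
  define v where "v = x - y"
  have nv: "norm v \<le> 4" "norm v = dist x y" using y(3) by (simp_all add: v_def dist_norm)
  have in\<Omega>: "y + t *\<^sub>R v \<in> \<Omega>" if "0 < t" "t \<le> 1" for t
  proof -
   have "y + t *\<^sub>R v - x = (t - 1) *\<^sub>R v" by (simp add: v_def algebra_simps)
   hence "dist (y + t *\<^sub>R v) x = (1 - t) * norm v" using that unfolding dist_norm by simp
   hence "dist x (y + t *\<^sub>R v) = (1 - t) * dist x y" by (simp only: nv(2) dist_commute)
   also have "... < dist x y" using that y(2) by simp
   finally show ?thesis using y(4) by auto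
  qed
  have inM: "y + t *\<^sub>R v \<in> M" if "t \<in> {0..1}" for t
  proof (cases "t = 0")
   case True thus ?thesis using y(1) frontier_sub by auto
  next
   case False thus ?thesis using in\<Omega>[of t] that dom_sub by auto
  qed
  define h where "h = (%t. ln (1 + u (y + t *\<^sub>R v)))"
  have "\<exists>\<xi>\<in>{0<..<1}. h 1 - h 0 = (Du (y + \<xi> *\<^sub>R v) \<bullet> v) * inverse (1 + u (y + \<xi> *\<^sub>R v)) * (1 - 0)"
  proof (rule mvt_simple[of 0 1 h "%t s. (Du (y + t *\<^sub>R v) \<bullet> v) * inverse (1 + u (y + t *\<^sub>R v)) * s"])
   fix t :: real assume t: "0 \<le> t" "t \<le> 1"
   have d: "((%t. y + t *\<^sub>R v) has_derivative (%s. s *\<^sub>R v)) (at t within {0..1})"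
    by (auto intro!: derivative_eq_intros)
   have im: "(%t. y + t *\<^sub>R v) ` {0..1} \<subseteq> M" using inM by blast
   have tM: "y + t *\<^sub>R v \<in> M" using inM t by simp
   have d2: "((%t. 1 + u (y + t *\<^sub>R v)) has_derivative (%s. Du (y + t *\<^sub>R v) \<bullet> (s *\<^sub>R v))) (at t within {0..1})"
    using has_derivative_add[OF has_derivative_const[of 1] has_derivative_in_compose[OF d has_derivative_subset[OF sm_has_derivative[OF smu tM] im]]]
    by simp
   have "0 < 1 + u (y + t *\<^sub>R v)" using u_nonneg[OF tM] by simp
   from has_derivative_ln[OF this d2]
   show "(h has_derivative (%s. (Du (y + t *\<^sub>R v) \<bullet> v) * inverse (1 + u (y + t *\<^sub>R v)) * s)) (at t within {0..1})"
    unfolding h_def by (simp add: divide_inverse mult.commute mult.left_commute)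
  qed simp
  then obtain \<xi> where \<xi>: "0 < \<xi>" "\<xi> < 1" "h 1 - h 0 = (Du (y + \<xi> *\<^sub>R v) \<bullet> v) * inverse (1 + u (y + \<xi> *\<^sub>R v))" by auto
  have x\<Omega>: "y + \<xi> *\<^sub>R v \<in> \<Omega>" using in\<Omega>[of \<xi>] \<xi> by simp
  have "h 1 - h 0 \<le> \<bar>Du (y + \<xi> *\<^sub>R v) \<bullet> v\<bar> * inverse (1 + u (y + \<xi> *\<^sub>R v))"
   unfolding \<xi>(3) using u_pos[OF x\<Omega>] by (intro mult_right_mono) auto
  also have "... \<le> sqrt C * norm v" by (rule lgrad[OF x\<Omega>])
  also have "... \<le> sqrt C * 4" using nv C0 by (intro mult_left_mono) auto
  finally have "h 1 - h 0 \<le> 4 * sqrt C" by simp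
  moreover have "h 0 = 0" using u_zero[OF y(1)] by (simp add: h_def)
  moreover have "h 1 = ln (1 + u x)" by (simp add: h_def v_def)
  ultimately have "ln (1 + u x) \<le> 4 * sqrt C" by simp
  thus ?thesis unfolding E_def using u_pos[OF x] by (simp add: ln_le_cancel_iff[symmetric] ln_ge_iff[symmetric] del: ln_le_cancel_iff)
 qed
 have gE: "(SB b. (pd b u x)\<^sup>2) \<le> C * E\<^sup>2" if x: "x \<in> \<Omega>" for x
 proof -
  have "1 + u x \<noteq> 0" using u_pos[OF x] by simp
  hence "pd b u x = lg b x * (1 + u x)" for b by (simp add: lg_def)
  hence "(SB b. (pd b u x)\<^sup>2) = lgF x * (1 + u x)\<^sup>2"
   by (simp add: power_mult_distrib lgF_def sum_distrib_right)
  also have "... \<le> C * E\<^sup>2" using C[OF x] uE[OF x] u_pos[OF x] C0 by (intro mult_mono power_mono) auto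
  finally show ?thesis .
 qed
 show ?thesis
 proof (rule that[of "1 + E + C * E\<^sup>2"])
  have p: "0 \<le> C * E\<^sup>2" using C0 by simp
  show "1 \<le> 1 + E + C * E\<^sup>2" using E1 p by simp
  fix x assume x: "x \<in> M"
  show "u x \<le> 1 + E + C * E\<^sup>2"
   using uE[of x] u_zero[of x] x frontier_dom E1 p by (cases "x \<in> \<Omega>") auto
  show "(SB b. (pd b u x)\<^sup>2) \<le> 1 + E + C * E\<^sup>2"
   using gE[of x] grad_sq[of x] x frontier_dom E1 p by (cases "x \<in> \<Omega>") auto
 qed
qed

end

subsection \<open>The second variation\<close>

context serrin_dom
begin

text \<open>A component of D^2u Du, half the gradient of |Du|^2.\<close>

definition hess_grad :: "'a \<Rightarrow> 'a \<Rightarrow> real" where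
 "hess_grad c x = (SB b. pd c (pd b u) x * pd b u x)"

definition hess_sq :: "'a \<Rightarrow> real" where
 "hess_sq x = (SB b. SB c. (pd c (pd b u) x)\<^sup>2)"

text \<open>Equals \<open>n - H\<close> on the boundary.\<close>

definition kap :: "'a \<Rightarrow> real" where
 "kap x = - (SB c. hess_grad c x * pd c u x)"

definition grads :: "('a \<Rightarrow> real) \<Rightarrow> ('a \<Rightarrow> real) \<Rightarrow> 'a \<Rightarrow> real" where
 "grads f g x = (SB b. pd b f x * pd b g x)"

text \<open>Opposite in sign to the second variation: stability for \<open>f\<close> means
  \<open>stab f f \<le> 0\<close>. It is polarised because test functions will be corrected by
  multiples of a fixed cutoff.\<close>

definition stab :: "('a \<Rightarrow> real) \<Rightarrow> ('a \<Rightarrow> real) \<Rightarrow> real" where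
 "stab f g = sig (%x. kap x * (f x * g x)) - ig (grads f g)"

lemma sm_hess_grad: "sm (hess_grad c)"
 unfolding hess_grad_def[abs_def] by (intro sm_sum sm_mult sm_pd smu)

lemma sm_hess_sq: "sm hess_sq"
 unfolding hess_sq_def[abs_def] by (intro sm_sum sm_power2 sm_pd smu)

lemma sm_kap: "sm kap"
 unfolding kap_def[abs_def] by (intro sm_minus sm_sum sm_mult sm_hess_grad sm_pd smu)

lemma smc_grads: "smc f ==> sm g ==> smc (grads f g)"
 unfolding grads_def[abs_def] by (intro smc_sum smc_mult smc_pd sm_pd)

text \<open>\<open>integration_by_parts\<close> in each coordinate. With \<open>sig\<close> in the
  role of the boundary integral this is the divergence theorem for arbitrary fields; the sign is
  that of the outward normal \<open>- Du\<close>.\<close>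

lemma sig_flux:
 assumes Y: "\<And>b. b \<in> Basis ==> smc (Y b)"
 shows "ig (%x. SB b. pd b (Y b) x) = - sig (%x. SB b. Y b x * pd b u x)"
proof -
 have "ig (%x. SB b. pd b (Y b) x) = (SB b. ig (pd b (Y b)))"
  by (rule ig_sum) (intro smc_pd Y)
 also have "... = (SB b. - sig (%x. Y b x * pd b u x))"
 proof (rule sum.cong[OF refl])
  fix b :: 'a assume b: "b \<in> Basis"
  show "ig (pd b (Y b)) = - sig (%x. Y b x * pd b u x)"
   using integration_by_parts[OF Y[OF b], of b] unfolding pd_def[abs_def] .
 qed
 also have "... = - sig (%x. SB b. Y b x * pd b u x)"
  unfolding sum_negf by (subst sig_sum) (auto intro: smc_mult Y sm_pd smu)
 finally show ?thesis .
qed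

lemma lap_pd: assumes x: "x \<in> M" shows "(SB c. pd c (pd c (pd b u)) x) = 0"
proof -
 have "(SB c. pd c (pd c (pd b u)) x) = (SB c. pd b (pd c (pd c u)) x)"
 proof (rule sum.cong[OF refl])
  fix c :: 'a
  have "pd c (pd c (pd b u)) x = pd c (pd b (pd c u)) x" by (rule pd_cong[OF x pd_commute[OF smu]])
  also have "... = pd b (pd c (pd c u)) x" by (rule pd_commute[OF sm_pd[OF smu] x])
  finally show "pd c (pd c (pd b u)) x = pd b (pd c (pd c u)) x" .
 qed
 also have "... = pd b (%x. SB c. pd c (pd c u) x) x"
  by (rule pd_sum[symmetric, OF finite_Basis _ x]) (intro sm_pd smu)
 also have "... = pd b (%x. - real DIM('a)) x" by (rule pd_cong[OF x lap])
 also have "... = 0" by (rule pd_const[OF x])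
 finally show ?thesis .
qed

text \<open>Bochner's formula for |Du|^2 / 2; the third derivatives drop out because the components
  of \<open>Du\<close> are harmonic.\<close>

lemma div_hess_grad: assumes x: "x \<in> M" shows "(SB c. pd c (hess_grad c) x) = hess_sq x"
proof -
 have "pd c (hess_grad c) x = (SB b. pd c (pd c (pd b u)) x * pd b u x + (pd c (pd b u) x)\<^sup>2)" for c
 proof -
  have "pd c (hess_grad c) x = (SB b. pd c (%x. pd c (pd b u) x * pd b u x) x)"
   unfolding hess_grad_def[abs_def] by (rule pd_sum[OF finite_Basis _ x]) (intro sm_mult sm_pd smu)
  thus ?thesis
   by (simp only: pd_mult[OF sm_pd[OF sm_pd[OF smu]] sm_pd[OF smu] x] power2_eq_square add.commute)
 qed
 hence "(SB c. pd c (hess_grad c) x) =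
   (SB b. (SB c. pd c (pd c (pd b u)) x * pd b u x + (pd c (pd b u) x)\<^sup>2))"
  by (simp only:) (rule sum.swap)
 also have "... = (SB b. (SB c. pd c (pd c (pd b u)) x) * pd b u x + (SB c. (pd c (pd b u) x)\<^sup>2))"
  by (simp only: sum.distrib sum_distrib_right)
 also have "... = hess_sq x" by (simp only: lap_pd[OF x] hess_sq_def mult_zero_left add_0)
 finally show ?thesis .
qed

text \<open>\<open>kap\<close> is minus the component of the field \<open>hess_grad\<close> along
  \<open>Du\<close>, so \<open>sig_flux\<close> turns the curvature term into an interior
  divergence.\<close>

lemma sig_kap:
 assumes G: "smc G"
 shows "sig (%x. kap x * G x) = ig (%x. hess_sq x * G x + (SB c. hess_grad c x * pd c G x))"
proof -
 have "sig (%x. kap x * G x) = sig (%x. - 1 * (SB c. (hess_grad c x * G x) * pd c u x))"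
  by (rule sig_cong) (simp add: kap_def sum_distrib_left sum_negf mult_ac)
 also have "... = - sig (%x. SB c. (hess_grad c x * G x) * pd c u x)"
  by (subst sig_cmult, rule smc_sum, rule smc_mult, rule smc_mult'[OF sm_hess_grad G], rule sm_pd[OF smu]) simp
 also have "... = ig (%x. SB c. pd c (%x. hess_grad c x * G x) x)"
  by (rule sig_flux[symmetric]) (intro smc_mult' sm_hess_grad G)
 also have "... = ig (%x. hess_sq x * G x + (SB c. hess_grad c x * pd c G x))"
 proof (rule ig_cong)
  fix x assume x: "x \<in> M"
  show "(SB c. pd c (%x. hess_grad c x * G x) x) = hess_sq x * G x + (SB c. hess_grad c x * pd c G x)"
   by (simp only: pd_mult[OF sm_hess_grad smc_sm[OF G] x] sum.distrib sum_distrib_right[symmetric] div_hess_grad[OF x] add.commute)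
 qed
 finally show ?thesis .
qed

text \<open>The squares of the diagonal entries of D^2u + Id are nonnegative; expand their sum with
  trace - n.\<close>

lemma hess_sq_lower: assumes x: "x \<in> M" shows "real DIM('a) \<le> hess_sq x"
proof -
 have "(SB b::'a. 0) \<le> (SB b. (pd b (pd b u) x + 1)\<^sup>2)" by (intro sum_mono) simp
 also have "... = (SB b. (pd b (pd b u) x)\<^sup>2 + (2 * pd b (pd b u) x + 1))"
  by (rule sum.cong) (simp_all add: power2_eq_square algebra_simps)
 also have "... = (SB b. (pd b (pd b u) x)\<^sup>2) + (2 * (SB b. pd b (pd b u) x) + real DIM('a))"
  by (simp add: sum.distrib sum_distrib_left)
 also have "... = (SB b. (pd b (pd b u) x)\<^sup>2) - real DIM('a)" by (simp add: lap[OF x])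
 finally have "real DIM('a) \<le> (SB b. (pd b (pd b u) x)\<^sup>2)" by simp
 also have "... \<le> hess_sq x" unfolding hess_sq_def
 proof (rule sum_mono)
  fix b :: 'a assume "b \<in> Basis"
  thus "(pd b (pd b u) x)\<^sup>2 \<le> (SB c. (pd c (pd b u) x)\<^sup>2)"
   using member_le_sum[of b Basis "%c. (pd c (pd b u) x)\<^sup>2"] by simp
 qed
 finally show ?thesis .
qed

lemma stab_interior:
 assumes f: "smc f"
 shows "stab f f = ig (%x. hess_sq x * (f x)\<^sup>2 + 2 * f x * (SB c. hess_grad c x * pd c f x) - grads f f x)"
proof -
 have "sig (%x. kap x * (f x * f x)) = ig (%x. hess_sq x * (f x * f x) + (SB c. hess_grad c x * pd c (%x. f x * f x) x))"
  by (rule sig_kap[OF smc_mult[OF f smc_sm[OF f]]])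
 also have "... = ig (%x. hess_sq x * (f x)\<^sup>2 + 2 * f x * (SB c. hess_grad c x * pd c f x))"
 proof (rule ig_cong)
  fix x assume x: "x \<in> M"
  show "hess_sq x * (f x * f x) + (SB c. hess_grad c x * pd c (%x. f x * f x) x) =
   hess_sq x * (f x)\<^sup>2 + 2 * f x * (SB c. hess_grad c x * pd c f x)"
   unfolding pd_mult[OF smc_sm[OF f] smc_sm[OF f] x] sum_distrib_left
   by (simp add: power2_eq_square) (rule sum.cong, simp_all)
 qed
 moreover have "smc (%x. hess_sq x * (f x)\<^sup>2 + 2 * f x * (SB c. hess_grad c x * pd c f x))"
  by (intro smc_add smc_mult'[OF sm_hess_sq] smc_power2 f smc_mult'[OF _ smc_sum] sm_mult sm_const smc_sm[OF f] smc_mult'[OF sm_hess_grad] smc_pd)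
 ultimately show ?thesis unfolding stab_def
  by (simp add: ig_diff[OF _ smc_grads[OF f smc_sm[OF f]]])
qed

text \<open>The cross term 2 f D^2u(Du, Df) is absorbed entry by entry: it is at least - |D^2u|^2
  f^2 / 2 - 2 |Du|^2 |Df|^2. Half of |D^2u|^2 \<ge> n is left over.\<close>

lemma stab_lower:
 assumes f: "smc f" and B: "\<And>x. x \<in> M ==> (SB b. (pd b u x)\<^sup>2) \<le> B"
 shows "(1/2) * real DIM('a) * ig (%x. (f x)\<^sup>2) - (2 * B + 1) * ig (grads f f) \<le> stab f f"
proof -
 have sc: "smc (%x. (1/2) * real DIM('a) * (f x)\<^sup>2 - (2 * B + 1) * grads f f x)"
  by (intro smc_diff smc_cmult smc_power2 smc_grads f smc_sm[OF f])
 have sc2: "smc (%x. hess_sq x * (f x)\<^sup>2 + 2 * f x * (SB c. hess_grad c x * pd c f x) - grads f f x)"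
  by (intro smc_diff smc_grads smc_add smc_mult'[OF sm_hess_sq] smc_power2 f smc_mult'[OF _ smc_sum] sm_mult sm_const smc_sm[OF f] smc_mult'[OF sm_hess_grad] smc_pd)
 have "(1/2) * real DIM('a) * ig (%x. (f x)\<^sup>2) - (2 * B + 1) * ig (grads f f) =
  ig (%x. (1/2) * real DIM('a) * (f x)\<^sup>2 - (2 * B + 1) * grads f f x)"
  by (subst ig_diff) (auto simp only: ig_cmult intro!: smc_cmult smc_power2 smc_grads f smc_sm[OF f])
 also have "... \<le> ig (%x. hess_sq x * (f x)\<^sup>2 + 2 * f x * (SB c. hess_grad c x * pd c f x) - grads f f x)"
 proof (rule ig_mono'[OF sc sc2])
  fix x assume x: "x \<in> M"
  have g0: "0 \<le> grads f f x" unfolding grads_def by (intro sum_nonneg) simp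
  have "- ((1/2) * (f x)\<^sup>2 * hess_sq x + 2 * ((SB b. (pd b u x)\<^sup>2) * grads f f x)) =
   (SB b. SB c. - ((1/2) * (f x)\<^sup>2 * (pd c (pd b u) x)\<^sup>2 + 2 * ((pd b u x)\<^sup>2 * (pd c f x * pd c f x))))"
   unfolding grads_def sum_product unfolding hess_sq_def sum_negf sum.distrib sum_distrib_left ..
  also have "... \<le> (SB b. SB c. 2 * f x * (pd c (pd b u) x * pd b u x * pd c f x))"
  proof (intro sum_mono)
   fix b c :: 'a
   have "0 \<le> (f x * pd c (pd b u) x + 2 * (pd b u x * pd c f x))\<^sup>2" by simp
   thus "- ((1/2) * (f x)\<^sup>2 * (pd c (pd b u) x)\<^sup>2 + 2 * ((pd b u x)\<^sup>2 * (pd c f x * pd c f x))) \<le> 2 * f x * (pd c (pd b u) x * pd b u x * pd c f x)"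
    by (simp add: power2_eq_square algebra_simps)
  qed
  also have "... = 2 * f x * (SB c. hess_grad c x * pd c f x)"
   unfolding hess_grad_def sum_distrib_left sum_distrib_right by (rule sum.swap)
  finally have 1: "- ((1/2) * (f x)\<^sup>2 * hess_sq x + 2 * ((SB b. (pd b u x)\<^sup>2) * grads f f x)) \<le> 2 * f x * (SB c. hess_grad c x * pd c f x)" .
  have 2: "(SB b. (pd b u x)\<^sup>2) * grads f f x \<le> B * grads f f x" by (rule mult_right_mono[OF B[OF x] g0])
  have 3: "(1/2) * (f x)\<^sup>2 * real DIM('a) \<le> (1/2) * (f x)\<^sup>2 * hess_sq x" by (rule mult_left_mono[OF hess_sq_lower[OF x]]) simp
  show "(1/2) * real DIM('a) * (f x)\<^sup>2 - (2 * B + 1) * grads f f x \<le> hess_sq x * (f x)\<^sup>2 + 2 * f x * (SB c. hess_grad c x * pd c f x) - grads f f x"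
   using 1 2 3 by (simp add: algebra_simps)
 qed
 finally show ?thesis by (simp only: stab_interior[OF f])
qed

lemma stab_add_cmult:
 assumes f: "smc f" and g: "smc g"
 shows "stab (%x. f x + a * g x) (%x. f x + a * g x) = stab f f + 2 * a * stab f g + a\<^sup>2 * stab g g"
proof -
 note s = smc_sm[OF f] smc_sm[OF g]
 have k: "smc (%x. kap x * (f x * f x))" "smc (%x. kap x * (f x * g x))" "smc (%x. kap x * (g x * g x))"
  by (intro smc_mult'[OF sm_kap] smc_mult f g s)+
 have gr: "smc (grads f f)" "smc (grads f g)" "smc (grads g g)" by (intro smc_grads f g s)+
 have "sig (%x. kap x * ((f x + a * g x) * (f x + a * g x))) =
  sig (%x. (kap x * (f x * f x) + (2 * a) * (kap x * (f x * g x))) + a\<^sup>2 * (kap x * (g x * g x)))"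
  by (rule sig_cong) (simp add: power2_eq_square algebra_simps)
 also have "... = sig (%x. kap x * (f x * f x)) + (2 * a) * sig (%x. kap x * (f x * g x)) + a\<^sup>2 * sig (%x. kap x * (g x * g x))"
  by (simp only: sig_add[OF smc_add[OF k(1) smc_cmult[OF k(2)]] smc_cmult[OF k(3)]] sig_add[OF k(1) smc_cmult[OF k(2)]] sig_cmult[OF k(2)] sig_cmult[OF k(3)])
 finally have 1: "sig (%x. kap x * ((f x + a * g x) * (f x + a * g x))) = sig (%x. kap x * (f x * f x)) + (2 * a) * sig (%x. kap x * (f x * g x)) + a\<^sup>2 * sig (%x. kap x * (g x * g x))" .
 have "ig (grads (%x. f x + a * g x) (%x. f x + a * g x)) = ig (%x. (grads f f x + (2 * a) * grads f g x) + a\<^sup>2 * grads g g x)"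
 proof (rule ig_cong)
  fix x assume x: "x \<in> M"
  have p: "pd b (%x. f x + a * g x) x = pd b f x + a * pd b g x" for b
   by (simp only: pd_add[OF s(1) smc_sm[OF smc_cmult[OF g]] x] pd_cmult[OF s(2) x])
  show "grads (%x. f x + a * g x) (%x. f x + a * g x) x = (grads f f x + (2 * a) * grads f g x) + a\<^sup>2 * grads g g x"
   unfolding grads_def p sum_distrib_left sum.distrib[symmetric]
   by (rule sum.cong[OF refl]) (simp add: power2_eq_square algebra_simps)
 qed
 also have "... = ig (grads f f) + (2 * a) * ig (grads f g) + a\<^sup>2 * ig (grads g g)"
  by (simp only: ig_add[OF smc_add[OF gr(1) smc_cmult[OF gr(2)]] smc_cmult[OF gr(3)]] ig_add[OF gr(1) smc_cmult[OF gr(2)]] ig_cmult)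
 finally show ?thesis unfolding stab_def 1 by (simp add: algebra_simps)
qed

lemma stab_cong:
 assumes "\<And>x. x \<in> M ==> f x * g x = f' x * g' x" "\<And>x. x \<in> M ==> grads f g x = grads f' g' x"
 shows "stab f g = stab f' g'"
proof -
 have "sig (%x. kap x * (f x * g x)) = sig (%x. kap x * (f' x * g' x))" by (rule sig_cong) (simp only: assms(1))
 moreover have "ig (grads f g) = ig (grads f' g')" by (rule ig_cong) (rule assms(2))
 ultimately show ?thesis by (simp add: stab_def)
qed

end

locale stable_dom = serrin_hausdorff +
 assumes stable: "weakly_stable \<Omega>"
begin

text \<open>\<open>sig\<close> is an interior integral; that it sees boundary values only comes from
  its identification with the boundary integral, where \<open>c\<close> is not 0.\<close>

lemma sig_cong_frontier:
 assumes F: "smc F" and G: "smc G" and eq: "\<And>x. x \<in> frontier \<Omega> ==> F x = G x"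
 shows "sig F = sig G"
proof -
 have "boundary_integral \<Omega> F = boundary_integral \<Omega> G"
  unfolding boundary_integral_def set_lebesgue_integral_def
  by (rule Bochner_Integration.integral_cong) (auto simp: eq indicator_def)
 thus ?thesis using boundary_integral_sig(2)[OF F] boundary_integral_sig(2)[OF G] c1 by simp
qed

lemma grads_nonneg: "0 \<le> grads f f x" unfolding grads_def by (intro sum_nonneg) simp

text \<open>Weak stability bounds \<open>c\<close> times the curvature term, while \<open>c\<close>
  cancels in the constraint. If the curvature term is positive, \<open>c \<ge> 1\<close> makes the
  inequality without \<open>c\<close> the weaker one; if not, it is trivial since the Dirichlet
  integral is nonnegative.\<close>

lemma stab_nonpos:
 assumes f: "smc f" and z: "sig f = 0"
 shows "stab f f \<le> 0"
proof -
 have "{x \<in> M. f x \<noteq> 0} = {x \<in> closure \<Omega>. f x \<noteq> 0}" by simp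
 have sc: "smooth_compact_support M f" unfolding smooth_compact_support_def
  using f by (simp add: smc_def compact_closure)
 have b0: "boundary_integral \<Omega> f = 0" using boundary_integral_sig(2)[OF f] z by simp
 have k: "smc (%x. kap x * (f x * f x))" by (intro smc_mult'[OF sm_kap] smc_mult f smc_sm[OF f])
 have kp: "real DIM('a) - mean_curvature \<Omega> x = kap x" if "x \<in> frontier \<Omega>" for x
  unfolding mean_curvature_eq[OF that] kap_def hess_grad_def sum_distrib_right by (subst sum.swap) (rule refl)
 have "boundary_integral \<Omega> (%x. (real DIM('a) - mean_curvature \<Omega> x) * (f x)\<^sup>2) = boundary_integral \<Omega> (%x. kap x * (f x * f x))"
  unfolding boundary_integral_def set_lebesgue_integral_def
  by (rule Bochner_Integration.integral_cong) (auto simp: kp indicator_def power2_eq_square)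
 also have "... = c * sig (%x. kap x * (f x * f x))" by (rule boundary_integral_sig(2)[OF k])
 finally have "c * sig (%x. kap x * (f x * f x)) \<le> (LINT x : \<Omega> | lborel. (norm (gradient_within (closure \<Omega>) f x))\<^sup>2)"
  using stable sc b0 unfolding weakly_stable_def by metis
 also have "(%x. (norm (gradient_within (closure \<Omega>) f x))\<^sup>2) = grads f f"
  unfolding fun_eq_iff norm_gradient unfolding grads_def power2_eq_square by simp
 also have "(LINT x : \<Omega> | lborel. grads f f x) = ig (grads f f)" by (simp only: ig_def)
 finally have le: "c * sig (%x. kap x * (f x * f x)) \<le> ig (grads f f)" .
 show ?thesis
 proof (cases "sig (%x. kap x * (f x * f x)) \<le> 0")
  case True
  have "ig (%x. 0) \<le> ig (grads f f)" by (rule ig_mono'[OF smc_zero smc_grads[OF f smc_sm[OF f]] grads_nonneg])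
  hence "0 \<le> ig (grads f f)" by (simp add: ig_def)
  thus ?thesis using True by (simp add: stab_def)
 next
  case False
  hence "sig (%x. kap x * (f x * f x)) \<le> c * sig (%x. kap x * (f x * f x))" using c1 by simp
  thus ?thesis using le by (simp add: stab_def)
 qed
qed

end

subsection \<open>Finite volume\<close>

context smooth_dom
begin

abbreviation "meas S \<equiv> measure lborel (\<Omega> \<inter> S)"

lemma finite_meas_bounded:
 assumes "S \<in> sets borel" "bounded S"
 shows "emeasure lborel (\<Omega> \<inter> S) \<noteq> \<infinity>"
proof -
 have "bounded (\<Omega> \<inter> S)" using assms(2) by (rule bounded_subset) auto
 thus ?thesis using emeasure_bounded_finite[of "\<Omega> \<inter> S"] by simp
qed

lemma meas_indicator:
 assumes S: "S \<in> sets borel" "emeasure lborel (\<Omega> \<inter> S) \<noteq> \<infinity>"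
 shows "set_integrable lborel \<Omega> (%x. a * indicator S x)" and "ig (%x. a * indicator S x) = a * meas S"
proof -
 have m: "\<Omega> \<inter> S \<in> sets lborel" using S(1) open_dom by simp
 have eq: "indicator \<Omega> x *\<^sub>R (a * indicator S x) = a * indicator (\<Omega> \<inter> S) x" for x by (simp add: indicator_def)
 have i: "integrable lborel (%x. indicator (\<Omega> \<inter> S) x :: real)" using m S(2) by (intro integrable_real_indicator) (simp_all add: less_top)
 show "set_integrable lborel \<Omega> (%x. a * indicator S x)" unfolding set_integrable_def eq using i by simp
 show "ig (%x. a * indicator S x) = a * meas S" unfolding ig_def set_lebesgue_integral_def eq using m by simp
qed

lemma ig_le_meas:
 assumes "smc f" "S \<in> sets borel" "emeasure lborel (\<Omega> \<inter> S) \<noteq> \<infinity>" "\<And>x. x \<in> \<Omega> ==> x \<in> M ==> f x \<le> a * indicator S x"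
 shows "ig f \<le> a * meas S"
 unfolding meas_indicator(2)[OF assms(2,3), symmetric]
 by (rule ig_mono[OF smc_integrable[OF assms(1)] meas_indicator(1)[OF assms(2,3)] assms(4)])

lemma meas_le_ig:
 assumes "smc f" "S \<in> sets borel" "emeasure lborel (\<Omega> \<inter> S) \<noteq> \<infinity>" "\<And>x. x \<in> \<Omega> ==> a * indicator S x \<le> f x"
 shows "a * meas S \<le> ig f"
 unfolding meas_indicator(2)[OF assms(2,3), symmetric]
 by (rule ig_mono[OF meas_indicator(1)[OF assms(2,3)] smc_integrable[OF assms(1)] assms(4)])

lemma ig_nonneg: "smc f ==> (\<And>x. x \<in> \<Omega> ==> 0 \<le> f x) ==> 0 \<le> ig f"
 using ig_mono'[OF smc_zero, of f] by (simp add: ig_def)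

lemma ig_nonpos_imp_zero:
 assumes f: "smc f" and nn: "\<And>x. x \<in> \<Omega> ==> 0 \<le> f x" and le: "ig f \<le> 0" and x: "x \<in> \<Omega>"
 shows "f x = 0"
proof (rule ccontr)
 assume "f x \<noteq> 0"
 hence fx: "0 < f x" using nn[OF x] by simp
 have "continuous (at x) f" using has_derivative_continuous[OF sm_has_derivative_interior[OF smc_sm[OF f] x]] by simp
 then obtain d where d: "0 < d" "\<And>y. dist y x < d ==> dist (f y) (f x) < f x / 2"
  unfolding continuous_at_eps_delta using fx by (metis half_gt_zero_iff dist_norm real_norm_def)
 obtain e where e: "0 < e" "ball x e \<subseteq> \<Omega>" using open_contains_ball open_dom x by blast
 define S where "S = ball x (min d e)"
 have S: "S \<in> sets borel" "emeasure lborel (\<Omega> \<inter> S) \<noteq> \<infinity>"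
  unfolding S_def by (simp, intro finite_meas_bounded) auto
 have "(f x / 2) * meas S \<le> ig f"
 proof (rule meas_le_ig[OF f S])
  fix y assume y: "y \<in> \<Omega>"
  show "f x / 2 * indicator S y \<le> f y"
  proof (cases "y \<in> S")
   case True
   hence "dist (f y) (f x) < f x / 2" using d(2)[of y] by (simp add: S_def dist_commute)
   hence "f x / 2 < f y" using abs_ge_minus_self[of "f y - f x"] unfolding dist_real_def by linarith
   thus ?thesis using True by simp
  qed (use nn[OF y] in simp)
 qed
 moreover have eq: "\<Omega> \<inter> S = ball x (min d e)" using e(2) by (auto simp: S_def)
 moreover have "0 < (f x / 2) * meas S" unfolding eq using fx d(1) e(1) by (intro mult_pos_pos) (simp_all add: content_ball_pos)
 ultimately show False using le by linarith
qed

lemma meas_mono: "S \<subseteq> T ==> S \<in> sets borel ==> T \<in> sets borel ==> emeasure lborel (\<Omega> \<inter> T) \<noteq> \<infinity> ==> meas S \<le> meas T"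
 using open_dom by (intro measure_mono_fmeasurable) (auto simp: fmeasurable_def less_top)

lemma meas_cball_growth: "0 \<le> R ==> meas (cball 0 R) \<le> unit_ball_vol (real DIM('a)) * R ^ DIM('a)"
proof -
 assume R: "0 \<le> R"
 have "meas (cball 0 R) \<le> measure lborel (cball (0::'a) R)"
  using open_dom emeasure_bounded_finite[of "cball (0::'a) R"] by (intro measure_mono_fmeasurable) (auto simp: fmeasurable_def)
 thus ?thesis using R by (simp add: content_cball)
qed

text \<open>A doubling inequality with a gain \<open>1 / R\<^sup>2\<close> lowers the order of polynomial growth step by step.\<close>

lemma doubling_bounded:
 fixes V :: "real \<Rightarrow> real"
 assumes K: "0 \<le> K" and D: "0 \<le> D" and w: "0 \<le> w" and R1: "1 \<le> R1"
  and growth: "\<And>R. R1 \<le> R ==> V R \<le> w * R ^ m"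
  and step: "\<And>R. R1 \<le> R ==> V R \<le> K + D / R\<^sup>2 * V (2 * R)"
 shows "\<exists>C. \<forall>R\<ge>R1. V R \<le> C"
proof -
 \<comment> \<open>\<open>R ^ m / (R\<^sup>2) ^ k\<close> stands for growth of order m - 2 k without
   subtracting exponents; each use of the doubling inequality raises \<open>k\<close> by
   one.\<close>
 have ind: "\<exists>C\<ge>0. \<forall>R\<ge>R1. V R \<le> C * (1 + R ^ m / (R\<^sup>2) ^ k)" for k
 proof (induction k)
  case 0
  have "V R \<le> w * (1 + R ^ m / (R\<^sup>2) ^ 0)" if "R1 \<le> R" for R
   using growth[OF that] w by (simp add: algebra_simps)
  thus ?case using w by blast
 next
  case (Suc k)
  then obtain C where C: "0 \<le> C" "\<And>R. R1 \<le> R ==> V R \<le> C * (1 + R ^ m / (R\<^sup>2) ^ k)" by blast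
  have "V R \<le> (K + D * C + D * C * 2 ^ m) * (1 + R ^ m / (R\<^sup>2) ^ Suc k)" if R: "R1 \<le> R" for R
  proof -
   have R1': "1 \<le> R" using R R1 by simp
   have P: "1 \<le> R\<^sup>2" "0 < R\<^sup>2" using R1' one_le_power[OF R1', of 2] by (simp_all)
   define T where "T = R ^ m / (R\<^sup>2) ^ Suc k"
   have T: "0 \<le> T" using R1' by (simp add: T_def)
   have le1: "D / R\<^sup>2 \<le> D" using P D by (simp add: divide_le_eq mult_le_cancel_left1)
   have "(2 * R) ^ m / ((2 * R)\<^sup>2) ^ k \<le> 2 ^ m * (R ^ m / (R\<^sup>2) ^ k)"
   proof -
    have "(R\<^sup>2) ^ k \<le> ((2 * R)\<^sup>2) ^ k" by (rule power_mono) (simp_all add: power_mult_distrib)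
    hence "(2 * R) ^ m / ((2 * R)\<^sup>2) ^ k \<le> (2 * R) ^ m / (R\<^sup>2) ^ k"
     using P R1' by (intro divide_left_mono mult_pos_pos) auto
    thus ?thesis by (simp add: power_mult_distrib)
   qed
   hence "1 + (2 * R) ^ m / ((2 * R)\<^sup>2) ^ k \<le> 1 + 2 ^ m * (R ^ m / (R\<^sup>2) ^ k)" by simp
   hence "C * (1 + (2 * R) ^ m / ((2 * R)\<^sup>2) ^ k) \<le> C * (1 + 2 ^ m * (R ^ m / (R\<^sup>2) ^ k))"
    using C(1) by (rule mult_left_mono)
   hence V2: "V (2 * R) \<le> C * (1 + 2 ^ m * (R ^ m / (R\<^sup>2) ^ k))" using C(2)[of "2 * R"] R R1 by simp
   have "V R \<le> K + D / R\<^sup>2 * V (2 * R)" by (rule step[OF R])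
   also have "... \<le> K + D / R\<^sup>2 * (C * (1 + 2 ^ m * (R ^ m / (R\<^sup>2) ^ k)))"
    using V2 D P by (intro add_left_mono mult_left_mono) auto
   also have "... = K + (D / R\<^sup>2) * C + D * C * 2 ^ m * T" using P R1' by (simp add: T_def field_simps)
   also have "... \<le> K + D * C + D * C * 2 ^ m * T" using mult_right_mono[OF le1 C(1)] by simp
   also have "... \<le> (K + D * C + D * C * 2 ^ m) * (1 + T)"
   proof -
    have "0 \<le> (K + D * C) * T" "0 \<le> D * C * 2 ^ m" using K D C(1) T by simp_all
    thus ?thesis unfolding distrib_left distrib_right mult_1_right by linarith
   qed
   finally show ?thesis by (simp only: T_def)
  qed
  thus ?case using K D C(1) by (intro exI[of _ "K + D * C + D * C * 2 ^ m"]) simp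
 qed
 \<comment> \<open>k = m is more than enough, since R \<ge> 1 makes
   \<open>R ^ m / (R\<^sup>2) ^ m\<close> at most 1.\<close>
 obtain C where C: "0 \<le> C" "\<And>R. R1 \<le> R ==> V R \<le> C * (1 + R ^ m / (R\<^sup>2) ^ m)" using ind[of m] by blast
 have "V R \<le> C * 2" if R: "R1 \<le> R" for R
 proof -
  have R1': "1 \<le> R" using R R1 by simp
  have "R \<le> R\<^sup>2" using R1' by (simp add: power2_eq_square)
  hence "R ^ m \<le> (R\<^sup>2) ^ m" using R1' by (intro power_mono) auto
  hence "R ^ m / (R\<^sup>2) ^ m \<le> 1" using R1' by (simp add: divide_le_eq)
  hence "C * (1 + R ^ m / (R\<^sup>2) ^ m) \<le> C * 2" using C(1) by (intro mult_left_mono) auto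
  thus ?thesis using C(2)[OF R] by linarith
 qed
 thus ?thesis by blast
qed

end

context stable_dom
begin

lemma grads_sum_sq: "grads f f x = (SB b. (pd b f x)\<^sup>2)"
 by (simp add: grads_def power2_eq_square)

lemma cutoff_grads:
 assumes z: "cutoff \<zeta> C" and R: "0 < R" and x: "x \<in> M"
 shows "grads (\<zeta> R) (\<zeta> R) x \<le> C / R\<^sup>2 * indicator (cball 0 (2 * R)) x"
  and "grads (\<zeta> R) (\<zeta> R) x \<le> C / R\<^sup>2 * indicator (- ball 0 R) x"
proof -
 have C: "0 \<le> C / R\<^sup>2" using cutoffD(1)[OF z] by simp
 have le: "grads (\<zeta> R) (\<zeta> R) x \<le> C / R\<^sup>2" unfolding grads_sum_sq by (rule cutoffD(8)[OF z R x])
 have z0: "grads (\<zeta> R) (\<zeta> R) x = 0" if "norm x < R \<or> 2 * R < norm x"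
  unfolding grads_def cutoffD(7)[OF z R x that] by simp
 show "grads (\<zeta> R) (\<zeta> R) x \<le> C / R\<^sup>2 * indicator (cball 0 (2 * R)) x"
  using le z0 by (cases "2 * R < norm x") simp_all
 show "grads (\<zeta> R) (\<zeta> R) x \<le> C / R\<^sup>2 * indicator (- ball 0 R) x"
  using le z0 by (cases "norm x < R") simp_all
qed

text \<open>Either no cutoff destabilises, or one of them does and then, by subtracting a multiple of it,
 the stability inequality holds for all functions supported away from it.\<close>

lemma volume_doubling:
 "\<exists>K D R1. 0 \<le> K \<and> 0 \<le> D \<and> 1 \<le> R1 \<and> (\<forall>R\<ge>R1. meas (cball 0 R) \<le> K + D / R\<^sup>2 * meas (cball 0 (2 * R)))"
proof -
 let ?n = "real DIM('a)" and ?V = "%R. meas (cball 0 R)"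
 have n0: "0 < ?n" using DIM_positive[where 'a='a] by simp
 obtain \<zeta> C where z: "cutoff \<zeta> C" using cutoff_exists by blast
 obtain B where B: "1 \<le> B" "\<And>x. x \<in> M ==> (SB b. (pd b u x)\<^sup>2) \<le> B" using u_gradient_bounded by metis
 have C: "0 < C" by (rule cutoffD(1)[OF z])
 have bs: "cball 0 R \<in> sets borel" "emeasure lborel (\<Omega> \<inter> cball 0 R) \<noteq> \<infinity>" for R :: real
  by (simp, rule finite_meas_bounded) simp_all
 have gz: "ig (grads (\<zeta> R) (\<zeta> R)) \<le> C / R\<^sup>2 * ?V (2 * R)" if R: "0 < R" for R
  by (rule ig_le_meas[OF smc_grads[OF cutoff_smc[OF z R] smc_sm[OF cutoff_smc[OF z R]]] bs])
   (use cutoff_grads(1)[OF z R] dom_sub in blast)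
 \<comment> \<open>The outer factor 2 is for the second case below, where the gradient of a product
   of two cutoff functions is estimated.\<close>
 define D where "D = 2 * (2 * (2 * B + 1) / ?n * C)"
 have D0: "0 \<le> D" using B C n0 by (simp add: D_def)
 have from_stab: "ig (%x. (f x)\<^sup>2) \<le> 2 * (2 * B + 1) / ?n * ig (grads f f)" if f: "smc f" "stab f f \<le> 0" for f
  using stab_lower[OF f(1) B(2)] f(2) n0 by (simp add: field_simps)
 show ?thesis
 proof (cases "\<forall>R\<ge>1. stab (\<zeta> R) (\<zeta> R) \<le> 0")
  case True
  have "?V R \<le> 0 + D / R\<^sup>2 * ?V (2 * R)" if R: "1 \<le> R" for R
  proof -
   have R0: "0 < R" using R by simp
   note sz = cutoff_smc[OF z R0]
   have "1 * ?V R \<le> ig (%x. (\<zeta> R x)\<^sup>2)"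
    by (rule meas_le_ig[OF smc_power2[OF sz] bs]) (use cutoffD(5)[OF z R0] in \<open>simp add: indicator_def\<close>)
   also have "... \<le> 2 * (2 * B + 1) / ?n * ig (grads (\<zeta> R) (\<zeta> R))" by (rule from_stab[OF sz]) (use True R in blast)
   also have "... \<le> 2 * (2 * B + 1) / ?n * (C / R\<^sup>2 * ?V (2 * R))" using gz[OF R0] B n0 by (intro mult_left_mono) auto
   also have "... \<le> 2 * (2 * (2 * B + 1) / ?n * (C / R\<^sup>2 * ?V (2 * R)))"
   proof -
    have "0 \<le> 2 * (2 * B + 1) / ?n * (C / R\<^sup>2 * ?V (2 * R))"
     using B C n0 by (intro mult_nonneg_nonneg divide_nonneg_nonneg) auto
    thus ?thesis by linarith
   qed
   finally show ?thesis by (simp add: D_def)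
  qed
  thus ?thesis using D0 by (intro exI[of _ 0] exI[of _ D] exI[of _ 1]) simp
 next
  case False
  then obtain R0 where R0: "1 \<le> R0" "0 < stab (\<zeta> R0) (\<zeta> R0)" by force
  have R00: "0 < R0" "0 < 3 * R0" using R0 by simp_all
  \<comment> \<open>\<open>\<eta>\<close> lives in the ball of radius 2 R0, while
    \<open>1 - \<xi>\<close> vanishes up to radius 3 R0 and is 1 from 6 R0 on: functions with the
    factor \<open>1 - \<xi>\<close> do not interact with \<open>\<eta>\<close>.\<close>
  define \<eta> where "\<eta> = \<zeta> R0"
  define \<xi> where "\<xi> = \<zeta> (3 * R0)"
  note s\<eta> = cutoff_smc[OF z R00(1), folded \<eta>_def] and s\<xi> = cutoff_smc[OF z R00(2), folded \<xi>_def]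
  \<comment> \<open>Otherwise \<open>\<eta>\<close> itself would be admissible, against its positive
    \<open>stab\<close>.\<close>
  have sg: "sig \<eta> \<noteq> 0" using stab_nonpos[OF s\<eta>] R0(2) by (auto simp: \<eta>_def)
  define K where "K = ?V (6 * R0) + 2 * (2 * (2 * B + 1) / ?n * ig (grads \<xi> \<xi>))"
  have g\<xi>: "0 \<le> ig (grads \<xi> \<xi>)" by (rule ig_nonneg[OF smc_grads[OF s\<xi> smc_sm[OF s\<xi>]] grads_nonneg])
  have "?V R \<le> K + D / R\<^sup>2 * ?V (2 * R)" if R: "6 * R0 \<le> R" for R
  proof -
   have Rp: "0 < R" using R R0 by simp
   note sz = cutoff_smc[OF z Rp]
   define f where "f x = (1 + (-1) * \<xi> x) * \<zeta> R x" for x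
   have s1: "sm (%x. 1 + (-1) * \<xi> x)" by (intro sm_add sm_const sm_mult smc_sm[OF s\<xi>])
   have sf: "smc f" unfolding f_def by (rule smc_mult'[OF s1 sz])
   have pf: "pd b f x = (1 - \<xi> x) * pd b (\<zeta> R) x - \<zeta> R x * pd b \<xi> x" if x: "x \<in> M" for b x
    unfolding f_def[abs_def] pd_mult[OF s1 smc_sm[OF sz] x] pd_add[OF sm_const sm_mult[OF sm_const smc_sm[OF s\<xi>]] x]
     pd_cmult[OF smc_sm[OF s\<xi>] x] pd_const[OF x] by simp
   have cross: "stab f \<eta> = 0"
   proof -
    have "stab f \<eta> = stab (%x. 0) (%x. 0)"
    proof (rule stab_cong)
     fix x assume x: "x \<in> M"
     show "f x * \<eta> x = 0 * 0"
     proof (cases "norm x \<le> 3 * R0")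
      case True
      thus ?thesis using cutoffD(5)[OF z R00(2)] by (simp add: f_def \<xi>_def)
     next
      case False
      thus ?thesis using cutoffD(6)[OF z R00(1), of x] R00 by (simp add: \<eta>_def)
     qed
    next
     fix x assume x: "x \<in> M"
     have pz: "pd b f x * pd b \<eta> x = 0" for b
     proof (cases "norm x < 3 * R0")
      case True
      hence "pd b f x = 0" unfolding pf[OF x]
       using cutoffD(5)[OF z R00(2), of x] cutoffD(7)[OF z R00(2) x, of b] by (simp add: \<xi>_def)
      thus ?thesis by simp
     next
      case False
      thus ?thesis using cutoffD(7)[OF z R00(1) x, of b] R00 by (simp add: \<eta>_def)
     qed
     show "grads f \<eta> x = grads (%x. 0) (%x. 0) x" by (simp only: grads_def pd_const[OF x] pz mult_zero_left)
    qed
    also have "... = 0"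
    proof -
     have "ig (grads (%x. 0) (%x. 0)) = ig (%x. 0)" by (rule ig_cong) (use dom_sub in \<open>auto simp: grads_def pd_const\<close>)
     thus ?thesis by (simp add: stab_def sig_zero ig_def)
    qed
    finally show ?thesis .
   qed
   define a where "a = - sig f / sig \<eta>"
   have "sig (%x. f x + a * \<eta> x) = sig f + a * sig \<eta>" by (simp only: sig_add[OF sf smc_cmult[OF s\<eta>]] sig_cmult[OF s\<eta>])
   hence "sig (%x. f x + a * \<eta> x) = 0" using sg by (simp add: a_def)
   hence "stab (%x. f x + a * \<eta> x) (%x. f x + a * \<eta> x) \<le> 0" by (rule stab_nonpos[OF smc_add[OF sf smc_cmult[OF s\<eta>]]])
   \<comment> \<open>No cross term remains and \<open>stab \<eta> \<eta>\<close> is positive, so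
     stability for the corrected function gives stability for \<open>f\<close> itself.\<close>
   hence "stab f f + a\<^sup>2 * stab \<eta> \<eta> \<le> 0" unfolding stab_add_cmult[OF sf s\<eta>] cross by simp
   moreover have "0 \<le> a\<^sup>2 * stab \<eta> \<eta>" using R0(2) by (simp add: \<eta>_def)
   ultimately have sf0: "stab f f \<le> 0" by linarith
   have gf: "ig (grads f f) \<le> 2 * ig (grads \<xi> \<xi>) + 2 * ig (grads (\<zeta> R) (\<zeta> R))"
   proof -
    have g: "smc (grads f f)" "smc (grads \<xi> \<xi>)" "smc (grads (\<zeta> R) (\<zeta> R))" by (intro smc_grads sf s\<xi> sz smc_sm)+
    have "ig (grads f f) \<le> ig (%x. 2 * grads \<xi> \<xi> x + 2 * grads (\<zeta> R) (\<zeta> R) x)"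
    proof (rule ig_mono'[OF g(1) smc_add[OF smc_cmult[OF g(2)] smc_cmult[OF g(3)]]])
     fix x assume x: "x \<in> M"
     define p q where "p = 1 - \<xi> x" and "q = \<zeta> R x"
     have pq: "0 \<le> p" "p \<le> 1" "0 \<le> q" "q \<le> 1"
      using cutoffD(3,4)[OF z R00(2), of x] cutoffD(3,4)[OF z Rp, of x] by (simp_all add: p_def q_def \<xi>_def)
     show "grads f f x \<le> 2 * grads \<xi> \<xi> x + 2 * grads (\<zeta> R) (\<zeta> R) x"
      unfolding grads_sum_sq sum_distrib_left sum.distrib[symmetric]
     proof (rule sum_mono)
      fix b :: 'a
      define s t where "s = pd b (\<zeta> R) x" and "t = pd b \<xi> x"
      have "(p * s - q * t)\<^sup>2 \<le> 2 * (p * s)\<^sup>2 + 2 * (q * t)\<^sup>2"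
       using zero_le_power2[of "p * s + q * t"] by (simp add: power2_eq_square algebra_simps)
      also have "... \<le> 2 * s\<^sup>2 + 2 * t\<^sup>2"
       unfolding power_mult_distrib using pq by (intro add_mono mult_left_mono mult_left_le_one_le) (simp_all add: power_le_one)
      finally show "(pd b f x)\<^sup>2 \<le> 2 * (pd b \<xi> x)\<^sup>2 + 2 * (pd b (\<zeta> R) x)\<^sup>2"
       unfolding pf[OF x] by (simp add: p_def q_def s_def t_def)
     qed
    qed
    also have "... = 2 * ig (grads \<xi> \<xi>) + 2 * ig (grads (\<zeta> R) (\<zeta> R))"
     by (simp only: ig_add[OF smc_cmult[OF g(2)] smc_cmult[OF g(3)]] ig_cmult)
    finally show ?thesis .
   qed
   define A where "A = cball 0 R - cball (0::'a) (6 * R0)"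
   have A: "A \<in> sets borel" "emeasure lborel (\<Omega> \<inter> A) \<noteq> \<infinity>"
    unfolding A_def by (simp, intro finite_meas_bounded) (auto intro: bounded_diff)
   have "1 * meas A \<le> ig (%x. (f x)\<^sup>2)"
   proof (rule meas_le_ig[OF smc_power2[OF sf] A])
    fix x
    show "1 * indicator A x \<le> (f x)\<^sup>2"
    proof (cases "x \<in> A")
     case True
     hence "f x = 1" using cutoffD(5)[OF z Rp, of x] cutoffD(6)[OF z R00(2), of x] by (simp add: f_def \<xi>_def A_def)
     thus ?thesis by (simp add: indicator_def)
    qed simp
   qed
   also have "... \<le> 2 * (2 * B + 1) / ?n * ig (grads f f)" by (rule from_stab[OF sf sf0])
   also have "... \<le> 2 * (2 * B + 1) / ?n * (2 * ig (grads \<xi> \<xi>) + 2 * (C / R\<^sup>2 * ?V (2 * R)))"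
    using gf gz[OF Rp] B n0 by (intro mult_left_mono) auto
   finally have "meas A \<le> 2 * (2 * (2 * B + 1) / ?n * ig (grads \<xi> \<xi>)) + D / R\<^sup>2 * ?V (2 * R)"
    unfolding D_def distrib_left by simp
   moreover have "?V R \<le> ?V (6 * R0) + meas A"
   proof -
    have eq: "\<Omega> \<inter> cball 0 R = (\<Omega> \<inter> cball 0 (6 * R0)) \<union> (\<Omega> \<inter> A)" using R by (auto simp: A_def)
    show ?thesis unfolding eq using open_dom A(1) by (intro measure_Un_le) auto
   qed
   ultimately show ?thesis by (simp add: K_def)
  qed
  moreover have "0 \<le> K" using g\<xi> B n0 by (simp add: K_def)
  ultimately show ?thesis using D0 R0 by (intro exI[of _ K] exI[of _ D] exI[of _ "6 * R0"]) simp
 qed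
qed

lemma finite_volume: "emeasure lborel \<Omega> \<noteq> \<infinity>"
proof -
 obtain K D R1 where KD: "0 \<le> K" "0 \<le> D" "1 \<le> R1" "\<And>R. R1 \<le> R ==> meas (cball 0 R) \<le> K + D / R\<^sup>2 * meas (cball 0 (2 * R))"
  using volume_doubling by blast
 have "\<exists>C. \<forall>R\<ge>R1. meas (cball 0 R) \<le> C"
  by (rule doubling_bounded[OF KD(1,2) _ KD(3) meas_cball_growth KD(4)]) (use KD(3) in auto)
 then obtain C where C: "\<And>R. R1 \<le> R ==> meas (cball 0 R) \<le> C" by blast
 have bs: "emeasure lborel (\<Omega> \<inter> cball 0 R) \<noteq> \<infinity>" for R :: real
  by (rule finite_meas_bounded) simp_all
 have le: "emeasure lborel (\<Omega> \<inter> cball 0 (real i)) \<le> ennreal C" for i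
 proof -
  define r where "r = max R1 (real i)"
  have "emeasure lborel (\<Omega> \<inter> cball 0 (real i)) \<le> emeasure lborel (\<Omega> \<inter> cball 0 r)"
   using open_dom by (intro emeasure_mono) (auto simp: r_def)
  also have "... = ennreal (meas (cball 0 r))" using bs by (intro emeasure_eq_ennreal_measure) simp
  also have "... \<le> ennreal C" using C[of r] by (intro ennreal_leI) (simp add: r_def)
  finally show ?thesis .
 qed
 have "\<Omega> = (\<Union>i. \<Omega> \<inter> cball 0 (real i))" using real_arch_simple by fastforce
 moreover have "(SUP i. emeasure lborel (\<Omega> \<inter> cball 0 (real i))) = emeasure lborel (\<Union>i. \<Omega> \<inter> cball 0 (real i))"
  by (rule SUP_emeasure_incseq) (use open_dom in \<open>auto simp: incseq_def\<close>)
 moreover have "(SUP i. emeasure lborel (\<Omega> \<inter> cball 0 (real i))) \<le> ennreal C" by (rule SUP_least) (rule le)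
 ultimately have "emeasure lborel \<Omega> \<le> ennreal C" by simp
 thus ?thesis using ennreal_less_top[of C] by (metis infinity_ennreal_def leD)
qed

lemma meas_tail: assumes "0 < \<epsilon>" shows "\<exists>R0. \<forall>R\<ge>R0. meas (- ball 0 R) < \<epsilon>"
proof -
 define A where "A i = \<Omega> \<inter> (- ball 0 (real i))" for i
 have fin: "emeasure lborel (\<Omega> \<inter> S) \<noteq> \<infinity>" if "S \<in> sets borel" for S
 proof -
  have "emeasure lborel (\<Omega> \<inter> S) \<le> emeasure lborel \<Omega>" using open_dom by (intro emeasure_mono) auto
  thus ?thesis using finite_volume by (auto simp: top_unique)
 qed
 have "(%i. measure lborel (A i)) \<longlonglongrightarrow> measure lborel (\<Inter>i. A i)"
 proof (rule Lim_measure_decseq)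
  show "range A \<subseteq> sets lborel" using open_dom by (auto simp: A_def)
  show "decseq A" by (auto simp: A_def decseq_def)
  show "emeasure lborel (A i) \<noteq> \<infinity>" for i unfolding A_def by (rule fin) simp
 qed
 moreover have "(\<Inter>i. A i) = {}"
 proof -
  have "x \<notin> (\<Inter>i. A i)" for x
  proof -
   obtain i where "norm x < real i" using reals_Archimedean2 by blast
   hence "x \<notin> A i" by (simp add: A_def)
   thus ?thesis by blast
  qed
  thus ?thesis by blast
 qed
 ultimately have "(%i. measure lborel (A i)) \<longlonglongrightarrow> 0" by simp
 hence "\<forall>\<^sub>F i in sequentially. measure lborel (A i) < \<epsilon>" by (rule order_tendstoD(2)) (rule assms)
 then obtain i where i: "measure lborel (A i) < \<epsilon>" by (auto simp: eventually_sequentially)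
 have "meas (- ball 0 R) < \<epsilon>" if "real i \<le> R" for R
 proof -
  have "meas (- ball 0 R) \<le> meas (- ball 0 (real i))" by (rule meas_mono) (use that fin in auto)
  thus ?thesis using i by (simp add: A_def)
 qed
 thus ?thesis by blast
qed

end

subsection \<open>The Jacobi field of dilations\<close>

context serrin_dom
begin

text \<open>Components of \<open>Du + x\<close>, which is locally constant exactly when \<open>D\<^sup>2u = - Id\<close>.\<close>

definition dev :: "'a \<Rightarrow> 'a \<Rightarrow> real" where
 "dev b x = pd b u x + x \<bullet> b"

definition dev_grad :: "'a \<Rightarrow> 'a \<Rightarrow> real" where
 "dev_grad c x = (SB b. pd c (dev b) x * dev b x)"

definition dev_sq :: "'a \<Rightarrow> real" where
 "dev_sq x = (SB b. SB c. (pd c (dev b) x)\<^sup>2)"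

text \<open>On the boundary, \<open>1\<close> is the normal speed of parallel surfaces and \<open>- x \<bullet> \<mu>\<close> that of contracting dilations.\<close>

definition jac :: "'a \<Rightarrow> real" where
 "jac x = 1 + (SB b. (x \<bullet> b) * pd b u x) - 2 * u x"

lemma sm_dev: "sm (dev b)" unfolding dev_def[abs_def] by (intro sm_add sm_pd smu sm_inner)

lemma sm_dev_grad: "sm (dev_grad c)" unfolding dev_grad_def[abs_def] by (intro sm_sum sm_mult sm_pd sm_dev)

lemma sm_dev_sq: "sm dev_sq" unfolding dev_sq_def[abs_def] by (intro sm_sum sm_power2 sm_pd sm_dev)

lemma sm_jac: "sm jac" unfolding jac_def[abs_def] by (intro sm_diff sm_add sm_const sm_sum sm_mult sm_pd smu sm_inner)

lemma pd_dev: "x \<in> M ==> pd c (dev b) x = pd c (pd b u) x + c \<bullet> b"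
 unfolding dev_def[abs_def] by (simp only: pd_add[OF sm_pd[OF smu] sm_inner] pd_inner)

lemma sum_inner_Basis: "c \<in> Basis ==> (SB b. (c \<bullet> b) * f b) = (f (c::'a) :: real)"
 by (subst sum.mono_neutral_right[of Basis "{c}"]) (auto simp: inner_Basis)

lemma div_dev: assumes x: "x \<in> M" shows "(SB b. pd b (dev b) x) = 0"
proof -
 have "(SB b. pd b (dev b) x) = (SB b. pd b (pd b u) x + 1)"
  by (rule sum.cong[OF refl]) (simp add: pd_dev[OF x])
 thus ?thesis by (simp add: sum.distrib lap[OF x])
qed

lemma lap_dev: assumes x: "x \<in> M" shows "(SB c. pd c (pd c (dev b)) x) = 0"
proof -
 have "pd c (pd c (dev b)) x = pd c (pd c (pd b u)) x" for c
 proof -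
  have "pd c (pd c (dev b)) x = pd c (%x. pd c (pd b u) x + c \<bullet> b) x" by (rule pd_cong[OF x pd_dev])
  thus ?thesis by (simp add: pd_add[OF sm_pd[OF sm_pd[OF smu]] sm_const x] pd_const[OF x])
 qed
 thus ?thesis by (simp only: lap_pd[OF x])
qed

lemma div_dev_grad: assumes x: "x \<in> M" shows "(SB c. pd c (dev_grad c) x) = dev_sq x"
proof -
 have "pd c (dev_grad c) x = (SB b. pd c (pd c (dev b)) x * dev b x + (pd c (dev b) x)\<^sup>2)" for c
 proof -
  have "pd c (dev_grad c) x = (SB b. pd c (%x. pd c (dev b) x * dev b x) x)"
   unfolding dev_grad_def[abs_def] by (rule pd_sum[OF finite_Basis _ x]) (intro sm_mult sm_pd sm_dev)
  thus ?thesis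
   by (simp only: pd_mult[OF sm_pd[OF sm_dev] sm_dev x] power2_eq_square add.commute)
 qed
 hence "(SB c. pd c (dev_grad c) x) =
   (SB b. (SB c. pd c (pd c (dev b)) x * dev b x + (pd c (dev b) x)\<^sup>2))"
  by (simp only:) (rule sum.swap)
 also have "... = (SB b. (SB c. pd c (pd c (dev b)) x) * dev b x + (SB c. (pd c (dev b) x)\<^sup>2))"
  by (simp only: sum.distrib sum_distrib_right)
 also have "... = dev_sq x" by (simp only: lap_dev[OF x] dev_sq_def mult_zero_left add_0)
 finally show ?thesis .
qed

lemma pd_jac: assumes x: "x \<in> M" and c: "c \<in> Basis"
 shows "pd c jac x = (SB b. (x \<bullet> b) * pd c (pd b u) x) - pd c u x"
proof -
 have s: "sm (%x. (x \<bullet> b) * pd b u x)" for b by (intro sm_mult sm_inner sm_pd smu)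
 have "pd c jac x = (SB b. pd c (%x. (x \<bullet> b) * pd b u x) x) - 2 * pd c u x"
  unfolding jac_def[abs_def] pd_diff[OF sm_add[OF sm_const sm_sum[OF s]] sm_mult[OF sm_const smu] x]
   pd_add[OF sm_const sm_sum[OF s] x] pd_sum[OF finite_Basis s x] pd_const[OF x] pd_cmult[OF smu x] by simp
 also have "(SB b. pd c (%x. (x \<bullet> b) * pd b u x) x) = (SB b. (x \<bullet> b) * pd c (pd b u) x) + (SB b. (c \<bullet> b) * pd b u x)"
  unfolding pd_mult[OF sm_inner sm_pd[OF smu] x] pd_inner[OF x] sum.distrib ..
 finally show ?thesis by (simp only: sum_inner_Basis[OF c, of "%b. pd b u x"])
qed

text \<open>x \<bullet> Du has Laplacian 2 \<Delta>u because \<Delta>u is constant, and - 2 u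
  cancels it. As u = 0 on the boundary, that term makes \<open>jac\<close> harmonic without changing
  its boundary values.\<close>

lemma lap_jac: assumes x: "x \<in> M" shows "(SB c. pd c (pd c jac) x) = 0"
proof -
 have s: "sm (%x. (x \<bullet> b) * pd c (pd b u) x)" for b c by (intro sm_mult sm_inner sm_pd smu)
 have "pd c (pd c jac) x = (SB b. (x \<bullet> b) * pd c (pd c (pd b u)) x)" if c: "c \<in> Basis" for c
 proof -
  have "pd c (pd c jac) x = pd c (%x. (SB b. (x \<bullet> b) * pd c (pd b u) x) - pd c u x) x"
   by (rule pd_cong[OF x pd_jac[OF _ c]])
  also have "... = (SB b. (x \<bullet> b) * pd c (pd c (pd b u)) x) + (SB b. (c \<bullet> b) * pd c (pd b u) x) - pd c (pd c u) x"
   unfolding pd_diff[OF sm_sum[OF s] sm_pd[OF smu] x] pd_sum[OF finite_Basis s x]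
    pd_mult[OF sm_inner sm_pd[OF sm_pd[OF smu]] x] pd_inner[OF x] sum.distrib ..
  finally show ?thesis by (simp add: sum_inner_Basis[OF c, of "%b. pd c (pd b u) x"])
 qed
 hence "(SB c. pd c (pd c jac) x) = (SB c. SB b. (x \<bullet> b) * pd c (pd c (pd b u)) x)" by simp
 also have "... = (SB b. (x \<bullet> b) * (SB c. pd c (pd c (pd b u)) x))"
  unfolding sum_distrib_left by (rule sum.swap)
 finally show ?thesis by (simp add: lap_pd[OF x])
qed

lemma hess_grad_commute: "x \<in> M ==> (SB c. pd c (pd b u) x * pd c u x) = hess_grad b x"
 unfolding hess_grad_def using pd_commute[OF smu, of x] by simp

lemma hess_grad_frontier:
 assumes x: "x \<in> frontier \<Omega>" and b: "b \<in> Basis"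
 shows "hess_grad b x = - kap x * pd b u x"
proof -
 have "(SB b. SB c. pd c (pd b u) x * pd b u x * pd c u x) = - kap x"
  unfolding kap_def hess_grad_def sum_distrib_right by (subst sum.swap) simp
 thus ?thesis using hessian_normal[OF x b] by (simp add: hess_grad_def)
qed

text \<open>Consequences of u = 0, |Du| = 1 and D^2u Du = - \<open>kap\<close> Du on the boundary.
  The last two parts are the derivatives along \<open>Du\<close> of \<open>jac\<close> and of half
  of |Du + x|^2, in the form in which their curvature terms match in
  \<open>stab_jac\<close>.\<close>

lemma jac_frontier:
 assumes x: "x \<in> frontier \<Omega>"
 shows "jac x = (SB b. dev b x * pd b u x)"
  and "jac x = 1 + (SB b. (x \<bullet> b) * pd b u x)"
  and "(SB c. pd c jac x * pd c u x) = - kap x * jac x + kap x - 1"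
  and "(SB c. dev_grad c x * pd c u x) = (1 - kap x) * jac x"
proof -
 have xM: "x \<in> M" using x frontier_sub by blast
 show e: "jac x = 1 + (SB b. (x \<bullet> b) * pd b u x)" by (simp add: jac_def u_zero[OF x])
 show d: "jac x = (SB b. dev b x * pd b u x)"
  unfolding e dev_def distrib_right sum.distrib using grad_sq[OF x] by (simp add: power2_eq_square)
 have "(SB c. pd c jac x * pd c u x) = (SB c. (SB b. (x \<bullet> b) * (pd c (pd b u) x * pd c u x)) - (pd c u x)\<^sup>2)"
  by (rule sum.cong[OF refl]) (simp add: pd_jac[OF xM] left_diff_distrib sum_distrib_right power2_eq_square mult.assoc)
 also have "... = (SB b. (x \<bullet> b) * (SB c. pd c (pd b u) x * pd c u x)) - 1"
  unfolding sum_subtractf grad_sq[OF x] sum_distrib_left by (subst sum.swap) (rule refl)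
 also have "... = (SB b. (- kap x) * ((x \<bullet> b) * pd b u x)) - 1"
  unfolding hess_grad_commute[OF xM] by (simp add: hess_grad_frontier[OF x] mult_ac)
 also have "... = - kap x * (jac x - 1) - 1" unfolding sum_distrib_left[symmetric] e by simp
 finally show "(SB c. pd c jac x * pd c u x) = - kap x * jac x + kap x - 1" by (simp add: algebra_simps)
 have "(SB c. dev_grad c x * pd c u x) = (SB b. dev b x * (SB c. pd c (dev b) x * pd c u x))"
  unfolding dev_grad_def sum_distrib_right sum_distrib_left by (subst sum.swap) (simp add: mult_ac)
 also have "... = (SB b. (1 - kap x) * (dev b x * pd b u x))"
 proof (rule sum.cong[OF refl])
  fix b :: 'a assume b: "b \<in> Basis"
  have "(SB c. pd c (dev b) x * pd c u x) = hess_grad b x + (SB c. (b \<bullet> c) * pd c u x)"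
   unfolding pd_dev[OF xM] distrib_right sum.distrib hess_grad_commute[OF xM] by (simp add: inner_commute)
  also have "... = (1 - kap x) * pd b u x"
   unfolding sum_inner_Basis[OF b, of "%c. pd c u x"] hess_grad_frontier[OF x b] by (simp add: algebra_simps)
  finally show "dev b x * (SB c. pd c (dev b) x * pd c u x) = (1 - kap x) * (dev b x * pd b u x)" by simp
 qed
 finally show "(SB c. dev_grad c x * pd c u x) = (1 - kap x) * jac x" by (simp only: d sum_distrib_left)
qed

end

context stable_dom
begin

text \<open>As \<open>jac\<close> is harmonic, the Dirichlet integral of the product is a flux of
  its gradient plus a term with the cutoff gradient only. On the boundary the curvature terms
  quadratic in \<open>jac\<close> cancel, and what is left is minus the \<open>Du\<close> component
  of \<zeta>^2 \<open>dev_grad\<close>, a field with divergence \<zeta>^2 \<open>dev_sq\<close> up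
  to a cutoff term.\<close>

lemma stab_jac:
 assumes z: "smc \<zeta>"
 shows "stab (%x. \<zeta> x * jac x) (%x. \<zeta> x * jac x) =
  ig (%x. (\<zeta> x)\<^sup>2 * dev_sq x + 2 * \<zeta> x * (SB c. pd c \<zeta> x * dev_grad c x)) - ig (%x. (jac x)\<^sup>2 * grads \<zeta> \<zeta> x)"
proof -
 note sz = smc_sm[OF z]
 define f where "f = (%x. \<zeta> x * jac x)"
 define G where "G = (%x. (\<zeta> x)\<^sup>2 * jac x)"
 have sf: "smc f" and sG: "smc G" unfolding f_def G_def by (intro smc_mult smc_power2 z sm_jac)+
 have sY: "smc (%x. (\<zeta> x)\<^sup>2 * dev_grad c x)" for c by (intro smc_mult smc_power2 z sm_dev_grad)
 have sJ: "smc (%x. G x * pd c jac x)" for c by (intro smc_mult sG sm_pd sm_jac)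
 have pG: "pd b G x = 2 * \<zeta> x * pd b \<zeta> x * jac x + (\<zeta> x)\<^sup>2 * pd b jac x" if x: "x \<in> M" for x b
  unfolding G_def pd_mult[OF sm_power2[OF sz] sm_jac x] pd_power2[OF sz x] by simp
 have pf: "pd b f x = \<zeta> x * pd b jac x + pd b \<zeta> x * jac x" if x: "x \<in> M" for x b
  unfolding f_def by (rule pd_mult[OF sz sm_jac x])
 have "ig (grads f f) = ig (%x. grads G jac x + (jac x)\<^sup>2 * grads \<zeta> \<zeta> x)"
 proof (rule ig_cong)
  fix x assume x: "x \<in> M"
  show "grads f f x = grads G jac x + (jac x)\<^sup>2 * grads \<zeta> \<zeta> x"
   unfolding grads_def pf[OF x] pG[OF x] sum_distrib_left sum.distrib[symmetric]
   by (rule sum.cong[OF refl]) (simp add: power2_eq_square algebra_simps)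
 qed
 also have "... = ig (grads G jac) + ig (%x. (jac x)\<^sup>2 * grads \<zeta> \<zeta> x)"
  by (rule ig_add[OF smc_grads[OF sG sm_jac] smc_mult'[OF sm_power2[OF sm_jac] smc_grads[OF z sz]]])
 also have "ig (grads G jac) = ig (%x. SB c. pd c (%x. G x * pd c jac x) x)"
 proof (rule ig_cong)
  fix x assume x: "x \<in> M"
  show "grads G jac x = (SB c. pd c (%x. G x * pd c jac x) x)"
   unfolding pd_mult[OF smc_sm[OF sG] sm_pd[OF sm_jac] x] sum.distrib sum_distrib_left[symmetric] lap_jac[OF x]
   by (simp add: grads_def)
 qed
 also have "... = - sig (%x. SB c. (G x * pd c jac x) * pd c u x)" by (rule sig_flux[OF sJ])
 finally have 1: "ig (grads f f) = - sig (%x. SB c. (G x * pd c jac x) * pd c u x) + ig (%x. (jac x)\<^sup>2 * grads \<zeta> \<zeta> x)" .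
 have k: "smc (%x. kap x * (f x * f x))" by (intro smc_mult'[OF sm_kap] smc_mult sf smc_sm)
 have j: "smc (%x. SB c. (G x * pd c jac x) * pd c u x)" by (intro smc_sum smc_mult[OF sJ] sm_pd smu)
 have y: "smc (%x. SB c. ((\<zeta> x)\<^sup>2 * dev_grad c x) * pd c u x)" by (intro smc_sum smc_mult[OF sY] sm_pd smu)
 have "sig (%x. kap x * (f x * f x)) + sig (%x. SB c. (G x * pd c jac x) * pd c u x) =
  sig (%x. kap x * (f x * f x) + (SB c. (G x * pd c jac x) * pd c u x))" by (rule sig_add[OF k j, symmetric])
 also have "... = sig (%x. - 1 * (SB c. ((\<zeta> x)\<^sup>2 * dev_grad c x) * pd c u x))"
 proof (rule sig_cong_frontier[OF smc_add[OF k j] smc_cmult[OF y]])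
  fix x assume x: "x \<in> frontier \<Omega>"
  have a: "(SB c. (G x * pd c jac x) * pd c u x) = G x * (- kap x * jac x + kap x - 1)"
   unfolding mult.assoc sum_distrib_left[symmetric] jac_frontier(3)[OF x] ..
  have b: "(SB c. ((\<zeta> x)\<^sup>2 * dev_grad c x) * pd c u x) = (\<zeta> x)\<^sup>2 * ((1 - kap x) * jac x)"
   unfolding mult.assoc sum_distrib_left[symmetric] jac_frontier(4)[OF x] ..
  show "kap x * (f x * f x) + (SB c. (G x * pd c jac x) * pd c u x) = - 1 * (SB c. ((\<zeta> x)\<^sup>2 * dev_grad c x) * pd c u x)"
   unfolding a b by (simp add: f_def G_def power2_eq_square algebra_simps)
 qed
 also have "... = ig (%x. SB c. pd c (%x. (\<zeta> x)\<^sup>2 * dev_grad c x) x)"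
  unfolding sig_cmult[OF y] sig_flux[OF sY] by simp
 also have "... = ig (%x. (\<zeta> x)\<^sup>2 * dev_sq x + 2 * \<zeta> x * (SB c. pd c \<zeta> x * dev_grad c x))"
 proof (rule ig_cong)
  fix x assume x: "x \<in> M"
  show "(SB c. pd c (%x. (\<zeta> x)\<^sup>2 * dev_grad c x) x) = (\<zeta> x)\<^sup>2 * dev_sq x + 2 * \<zeta> x * (SB c. pd c \<zeta> x * dev_grad c x)"
   unfolding pd_mult[OF sm_power2[OF sz] sm_dev_grad x] pd_power2[OF sz x] sum.distrib div_dev_grad[OF x, symmetric] sum_distrib_left
   by (simp add: mult_ac)
 qed
 finally show ?thesis using 1 unfolding stab_def f_def[symmetric] by linarith
qed

text \<open>Half of \<zeta>^2 \<open>dev_sq\<close> absorbs the mixed term in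
  \<open>stab_jac\<close>, by the same completion of squares as in
  \<open>stab_lower\<close>.\<close>

lemma dev_sq_bound:
 assumes z: "smc \<zeta>"
 shows "(1/2) * ig (%x. (\<zeta> x)\<^sup>2 * dev_sq x) \<le> stab (%x. \<zeta> x * jac x) (%x. \<zeta> x * jac x) +
  ig (%x. (2 * (SB b. (dev b x)\<^sup>2) + (jac x)\<^sup>2) * grads \<zeta> \<zeta> x)"
proof -
 note sz = smc_sm[OF z]
 have s1: "smc (%x. (\<zeta> x)\<^sup>2 * dev_sq x + 2 * \<zeta> x * (SB c. pd c \<zeta> x * dev_grad c x))"
  by (intro smc_add smc_mult'[OF _ smc_sum] smc_mult smc_power2 z sm_dev_sq sm_mult sm_const sz smc_pd sm_dev_grad)
 have s2: "smc (%x. (jac x)\<^sup>2 * grads \<zeta> \<zeta> x)" by (intro smc_mult'[OF sm_power2[OF sm_jac]] smc_grads z sz)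
 have s3: "smc (%x. (2 * (SB b. (dev b x)\<^sup>2) + (jac x)\<^sup>2) * grads \<zeta> \<zeta> x)"
  by (intro smc_mult' sm_add sm_mult sm_const sm_sum sm_power2 sm_dev sm_jac smc_grads z sz)
 have s4: "smc (%x. (\<zeta> x)\<^sup>2 * dev_sq x)" by (intro smc_mult smc_power2 z sm_dev_sq)
 have "ig (%x. (1/2) * ((\<zeta> x)\<^sup>2 * dev_sq x)) \<le> ig (%x. ((\<zeta> x)\<^sup>2 * dev_sq x + 2 * \<zeta> x * (SB c. pd c \<zeta> x * dev_grad c x) - (jac x)\<^sup>2 * grads \<zeta> \<zeta> x)
  + (2 * (SB b. (dev b x)\<^sup>2) + (jac x)\<^sup>2) * grads \<zeta> \<zeta> x)"
 proof (rule ig_mono'[OF smc_cmult[OF s4] smc_add[OF smc_diff[OF s1 s2] s3]])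
  fix x
  have "- ((1/2) * ((\<zeta> x)\<^sup>2 * dev_sq x) + 2 * ((SB b. (dev b x)\<^sup>2) * grads \<zeta> \<zeta> x)) =
   (SB b. SB c. - ((1/2) * ((\<zeta> x)\<^sup>2 * (pd c (dev b) x)\<^sup>2) + 2 * ((dev b x)\<^sup>2 * (pd c \<zeta> x * pd c \<zeta> x))))"
   unfolding grads_def sum_product unfolding dev_sq_def sum_negf sum.distrib sum_distrib_left ..
  also have "... \<le> (SB b. SB c. 2 * \<zeta> x * (pd c \<zeta> x * (pd c (dev b) x * dev b x)))"
  proof (intro sum_mono)
   fix b c :: 'a
   have "0 \<le> (\<zeta> x * pd c (dev b) x + 2 * (dev b x * pd c \<zeta> x))\<^sup>2" by simp
   thus "- ((1/2) * ((\<zeta> x)\<^sup>2 * (pd c (dev b) x)\<^sup>2) + 2 * ((dev b x)\<^sup>2 * (pd c \<zeta> x * pd c \<zeta> x))) \<le> 2 * \<zeta> x * (pd c \<zeta> x * (pd c (dev b) x * dev b x))"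
    by (simp add: power2_eq_square algebra_simps)
  qed
  also have "... = 2 * \<zeta> x * (SB c. pd c \<zeta> x * dev_grad c x)"
   unfolding dev_grad_def sum_distrib_left by (rule sum.swap)
  finally show "(1/2) * ((\<zeta> x)\<^sup>2 * dev_sq x) \<le> ((\<zeta> x)\<^sup>2 * dev_sq x + 2 * \<zeta> x * (SB c. pd c \<zeta> x * dev_grad c x) - (jac x)\<^sup>2 * grads \<zeta> \<zeta> x)
   + (2 * (SB b. (dev b x)\<^sup>2) + (jac x)\<^sup>2) * grads \<zeta> \<zeta> x"
   unfolding distrib_right by linarith
 qed
 thus ?thesis unfolding stab_jac[OF z] ig_cmult ig_add[OF smc_diff[OF s1 s2] s3] ig_diff[OF s1 s2] .
qed

text \<open>On the shell 1 + |x|^2 is at most 5 R^2, while squared cutoff gradients are at most C /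
  R^2: the powers of \<open>R\<close> cancel, and smallness is left to the volume of the
  tail.\<close>

lemma cutoff_weight:
 assumes z: "cutoff \<zeta> C" and R: "1 \<le> R" and x: "x \<in> M" and E: "0 \<le> E" and w: "w \<le> E * (1 + (norm x)\<^sup>2)"
 shows "w * grads (\<zeta> R) (\<zeta> R) x \<le> 5 * E * C * indicator (- ball 0 R) x"
proof -
 have R0: "0 < R" using R by simp
 have g0: "0 \<le> grads (\<zeta> R) (\<zeta> R) x" by (rule grads_nonneg)
 have C: "0 < C" by (rule cutoffD(1)[OF z])
 show ?thesis
 proof (cases "norm x < R \<or> 2 * R < norm x")
  case True
  hence "grads (\<zeta> R) (\<zeta> R) x = 0" unfolding grads_def cutoffD(7)[OF z R0 x True] by simp
  thus ?thesis using E C by simp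
 next
  case False
  have "(norm x)\<^sup>2 \<le> (2 * R)\<^sup>2" using False by (intro power_mono) auto
  moreover have "1 \<le> R\<^sup>2" using R by simp
  ultimately have "1 + (norm x)\<^sup>2 \<le> 5 * R\<^sup>2" by (simp add: power_mult_distrib)
  hence "E * (1 + (norm x)\<^sup>2) \<le> E * (5 * R\<^sup>2)" using E by (rule mult_left_mono)
  hence "w \<le> E * (5 * R\<^sup>2)" using w by linarith
  hence "w * grads (\<zeta> R) (\<zeta> R) x \<le> E * (5 * R\<^sup>2) * grads (\<zeta> R) (\<zeta> R) x" using g0 by (rule mult_right_mono)
  also have "... \<le> E * (5 * R\<^sup>2) * (C / R\<^sup>2)"
  proof (rule mult_left_mono)
   show "grads (\<zeta> R) (\<zeta> R) x \<le> C / R\<^sup>2" unfolding grads_sum_sq by (rule cutoffD(8)[OF z R0 x])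
  qed (use E in simp)
  also have "... = 5 * E * C" using R0 by simp
  finally show ?thesis using False by simp
 qed
qed

text \<open>Cauchy-Schwarz and \<open>cutoff_weight\<close> bound the square of the sum; |t| \<le> 1
  + t^2 turns this into a bound for the sum, crude but uniform in \<open>R\<close>.\<close>

lemma cutoff_flux:
 assumes z: "cutoff \<zeta> C" and R: "1 \<le> R" and x: "x \<in> M" and E: "0 \<le> E" and w: "(SB b. (Z b)\<^sup>2) \<le> E * (1 + (norm x)\<^sup>2)"
 shows "\<bar>SB b. pd b (\<zeta> R) x * Z b\<bar> \<le> (1 + 5 * E * C) * indicator (- ball 0 R) x"
proof (cases "norm x < R")
 case True
 have "(SB b. pd b (\<zeta> R) x * Z b) = 0" using cutoffD(7)[OF z _ x, of R] R True by simp
 thus ?thesis using True by simp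
next
 case False
 define t where "t = (SB b. pd b (\<zeta> R) x * Z b)"
 have "t\<^sup>2 \<le> (SB b. (pd b (\<zeta> R) x)\<^sup>2) * (SB b. (Z b)\<^sup>2)" unfolding t_def by (rule Cauchy_Schwarz_ineq_sum)
 also have "... = (SB b. (Z b)\<^sup>2) * grads (\<zeta> R) (\<zeta> R) x" by (simp add: grads_sum_sq)
 also have "... \<le> 5 * E * C" using cutoff_weight[OF z R x E w] False by simp
 finally have "t\<^sup>2 \<le> 5 * E * C" .
 moreover have "\<bar>t\<bar> \<le> 1 + t\<^sup>2"
 proof -
  have "0 \<le> (\<bar>t\<bar> - 1)\<^sup>2 + \<bar>t\<bar>" by simp
  thus ?thesis by (simp add: power2_eq_square algebra_simps)
 qed
 ultimately show ?thesis using False by (simp add: t_def)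
qed

lemma growth_bound:
 obtains E where "0 \<le> E" "\<And>x. x \<in> M ==> (SB b. (pd b u x)\<^sup>2) \<le> E * (1 + (norm x)\<^sup>2)"
  "\<And>x. x \<in> M ==> (SB b. (dev b x)\<^sup>2) \<le> E * (1 + (norm x)\<^sup>2)"
  "\<And>x. x \<in> M ==> 2 * (SB b. (dev b x)\<^sup>2) + (jac x)\<^sup>2 \<le> E * (1 + (norm x)\<^sup>2)"
proof -
 obtain B where B: "1 \<le> B" "\<And>x. x \<in> M ==> u x \<le> B" "\<And>x. x \<in> M ==> (SB b. (pd b u x)\<^sup>2) \<le> B" using u_gradient_bounded by metis
 define E where "E = 4 * B + 4 + 3 * (1 + 4 * B\<^sup>2 + B)"
 have bounds: "(SB b. (pd b u x)\<^sup>2) \<le> E * (1 + (norm x)\<^sup>2) \<and> (SB b. (dev b x)\<^sup>2) \<le> E * (1 + (norm x)\<^sup>2) \<and>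
  2 * (SB b. (dev b x)\<^sup>2) + (jac x)\<^sup>2 \<le> E * (1 + (norm x)\<^sup>2)" if x: "x \<in> M" for x
 proof -
  define N where "N = (norm x)\<^sup>2"
  have N: "N = (SB b. (x \<bullet> b)\<^sup>2)" "0 \<le> N"
   unfolding N_def power2_norm_eq_inner by (subst euclidean_inner, simp add: power2_eq_square, simp)
  have "(SB b. (dev b x)\<^sup>2) \<le> (SB b. 2 * (pd b u x)\<^sup>2 + 2 * (x \<bullet> b)\<^sup>2)"
  proof (rule sum_mono)
   fix b :: 'a
   have "0 \<le> (pd b u x - x \<bullet> b)\<^sup>2" by simp
   thus "(dev b x)\<^sup>2 \<le> 2 * (pd b u x)\<^sup>2 + 2 * (x \<bullet> b)\<^sup>2" by (simp add: dev_def power2_eq_square algebra_simps)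
  qed
  also have "... = 2 * (SB b. (pd b u x)\<^sup>2) + 2 * N" by (simp add: sum.distrib sum_distrib_left N(1))
  finally have d: "(SB b. (dev b x)\<^sup>2) \<le> 2 * B + 2 * N" using B(3)[OF x] by linarith
  define s where "s = (SB b. (x \<bullet> b) * pd b u x)"
  have "s\<^sup>2 \<le> N * (SB b. (pd b u x)\<^sup>2)" unfolding s_def N(1) by (rule Cauchy_Schwarz_ineq_sum)
  also have "... \<le> N * B" using B(3)[OF x] N(2) by (rule mult_left_mono)
  finally have s: "s\<^sup>2 \<le> N * B" .
  have u2: "(u x)\<^sup>2 \<le> B\<^sup>2" using B(2)[OF x] u_nonneg[OF x] by (intro power_mono) auto
  have "0 \<le> (1 - s)\<^sup>2 + (1 + 2 * u x)\<^sup>2 + (s + 2 * u x)\<^sup>2" by simp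
  hence "(1 + s - 2 * u x)\<^sup>2 \<le> 3 * (1 + s\<^sup>2 + 4 * (u x)\<^sup>2)" by (simp add: power2_eq_square algebra_simps)
  hence j: "(jac x)\<^sup>2 \<le> 3 * (1 + N * B + 4 * B\<^sup>2)" using s u2 by (simp add: jac_def s_def)
  have NB: "0 \<le> N * B" "0 \<le> N * B\<^sup>2" "0 \<le> B\<^sup>2" using N(2) B(1) by simp_all
  have eE: "E * (1 + N) = (4 * B + 4 * N + 3 * (1 + N * B + 4 * B\<^sup>2)) + (4 + 3 * B + 4 * (N * B) + 3 * N + 12 * (N * B\<^sup>2))"
   by (simp add: E_def algebra_simps)
  have "0 \<le> 4 + 3 * B + 4 * (N * B) + 3 * N + 12 * (N * B\<^sup>2)" using NB N(2) B(1) by simp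
  hence le: "4 * B + 4 * N + 3 * (1 + N * B + 4 * B\<^sup>2) \<le> E * (1 + N)" unfolding eE by (simp only: le_add_same_cancel1)
  have nn: "0 \<le> 3 * (1 + N * B + 4 * B\<^sup>2)" using NB by simp
  have "B \<le> 4 * B + 4 * N" "2 * B + 2 * N \<le> 4 * B + 4 * N" using B(1) N(2) by simp_all
  moreover have "4 * B + 4 * N \<le> E * (1 + N)" by (rule order_trans[OF _ le]) (use nn in simp)
  ultimately have "B \<le> E * (1 + N)" "2 * B + 2 * N \<le> E * (1 + N)" by (meson order_trans)+
  moreover have "2 * (SB b. (dev b x)\<^sup>2) + (jac x)\<^sup>2 \<le> E * (1 + N)"
   using add_mono[OF mult_left_mono[OF d, of 2] j] le by simp
  ultimately show ?thesis unfolding N_def[symmetric] using B(3)[OF x] d by (meson order_trans)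
 qed
 moreover have "0 \<le> E" using B(1) by (simp add: E_def add_nonneg_nonneg)
 ultimately show ?thesis using that[of E] by blast
qed

text \<open>The test function is \<open>jac\<close> times a large cutoff, corrected by
  \<open>a\<close> times a fixed cutoff. Its \<open>sig\<close> is a flux of the divergence-free
  field Du + x times the cutoff, hence bounded by the volume of the tail. So \<open>a\<close>, the
  correction terms and the cutoff errors are all bounded by multiples of that volume, which tends to
  0.\<close>

lemma dev_sq_zero: assumes x: "x \<in> \<Omega>" shows "dev_sq x = 0"
proof -
 let ?n = "real DIM('a)" and ?T = "%R. meas (- ball 0 R)"
 obtain \<zeta> C where z: "cutoff \<zeta> C" using cutoff_exists by blast
 have C: "0 < C" by (rule cutoffD(1)[OF z])
 obtain E where E: "0 \<le> E" "\<And>x. x \<in> M ==> (SB b. (pd b u x)\<^sup>2) \<le> E * (1 + (norm x)\<^sup>2)"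
  "\<And>x. x \<in> M ==> (SB b. (dev b x)\<^sup>2) \<le> E * (1 + (norm x)\<^sup>2)"
  "\<And>x. x \<in> M ==> 2 * (SB b. (dev b x)\<^sup>2) + (jac x)\<^sup>2 \<le> E * (1 + (norm x)\<^sup>2)" by (rule growth_bound) blast
 have tb: "- ball 0 R \<in> sets borel" "emeasure lborel (\<Omega> \<inter> - ball 0 R) \<noteq> \<infinity>" for R
 proof -
  have "emeasure lborel (\<Omega> \<inter> - ball 0 R) \<le> emeasure lborel \<Omega>" using open_dom by (intro emeasure_mono) auto
  thus "emeasure lborel (\<Omega> \<inter> - ball 0 R) \<noteq> \<infinity>" using finite_volume by (auto simp: top_unique)
 qed simp
 define K1 where "K1 = 1 + 5 * E * C"
 have K1: "0 < K1" using E(1) C by (simp add: K1_def add_pos_nonneg)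
 have T0: "0 \<le> ?T R" for R by simp
 have flux: "\<bar>ig (%x. SB b. pd b (\<zeta> R) x * Z b x)\<bar> \<le> K1 * ?T R"
  if R: "1 \<le> R" and Z: "\<And>b. sm (Z b)" "\<And>x. x \<in> M ==> (SB b. (Z b x)\<^sup>2) \<le> E * (1 + (norm x)\<^sup>2)" for R Z
 proof -
  have R0: "0 < R" using R by simp
  have s: "smc (%x. SB b. pd b (\<zeta> R) x * Z b x)" by (intro smc_sum smc_mult smc_pd cutoff_smc[OF z R0] Z(1))
  have b: "\<bar>SB b. pd b (\<zeta> R) y * Z b y\<bar> \<le> K1 * indicator (- ball 0 R) y" if "y \<in> \<Omega>" for y
   unfolding K1_def by (rule cutoff_flux[OF z R _ E(1) Z(2)]) (use that dom_sub in auto)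
  have "ig (%x. SB b. pd b (\<zeta> R) x * Z b x) \<le> K1 * ?T R"
   by (rule ig_le_meas[OF s tb abs_le_D1[OF b]])
  moreover have "ig (%x. - (SB b. pd b (\<zeta> R) x * Z b x)) \<le> K1 * ?T R"
   by (rule ig_le_meas[OF smc_minus[OF s] tb abs_le_D2[OF b]])
  ultimately show ?thesis unfolding ig_minus by linarith
 qed
 \<comment> \<open>For large radii \<open>sig\<close> of the cutoff is n times its integral, which
   is at least the volume of a small ball around \<open>x\<close>, up to a flux that the tail volume
   makes smaller.\<close>
 obtain R0 where R0: "1 \<le> R0" "sig (\<zeta> R0) \<noteq> 0"
 proof -
  obtain e where e: "0 < e" "ball x e \<subseteq> \<Omega>" using open_contains_ball open_dom x by blast
  define m where "m = meas (ball x e)"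
  have "\<Omega> \<inter> ball x e = ball x e" using e(2) by blast
  hence m: "0 < m" using e(1) by (simp add: m_def content_ball_pos)
  have n: "1 \<le> ?n" using n2 by linarith
  obtain R' where R': "\<And>R. R' \<le> R ==> ?T R < m / K1" using meas_tail[of "m / K1"] m K1 by auto
  define R where "R = max (max 1 R') (norm x + e)"
  have R: "1 \<le> R" "R' \<le> R" "norm x + e \<le> R" "0 < R" by (auto simp: R_def)
  note sz = cutoff_smc[OF z R(4)]
  have "1 * meas (ball x e) \<le> ig (\<zeta> R)"
  proof (rule meas_le_ig[OF sz])
   show "ball x e \<in> sets borel" "emeasure lborel (\<Omega> \<inter> ball x e) \<noteq> \<infinity>" by (simp, intro finite_meas_bounded) auto
   fix y
   show "1 * indicator (ball x e) y \<le> \<zeta> R y"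
   proof (cases "y \<in> ball x e")
    case True
    hence "norm y \<le> R" using norm_triangle_sub[of y x] R(3) by (simp add: dist_norm norm_minus_commute)
    thus ?thesis using cutoffD(5)[OF z R(4)] by (simp add: indicator_def)
   qed (simp add: cutoffD(3)[OF z R(4)])
  qed
  hence i: "m \<le> ig (\<zeta> R)" by (simp add: m_def)
  have s: "smc (%x. SB b. pd b (\<zeta> R) x * pd b u x)" by (intro smc_sum smc_mult smc_pd sz sm_pd smu)
  have "sig (\<zeta> R) = ?n * ig (\<zeta> R) - ig (%x. SB b. pd b (\<zeta> R) x * pd b u x)"
   unfolding sig_def ig_diff[OF smc_cmult[OF sz] s] ig_cmult ..
  moreover have "\<bar>ig (%x. SB b. pd b (\<zeta> R) x * pd b u x)\<bar> \<le> K1 * ?T R"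
   by (rule flux[OF R(1) sm_pd[OF smu] E(2)])
  moreover have "K1 * ?T R < m" using R'[OF R(2)] K1 by (simp add: field_simps)
  moreover have "1 * ig (\<zeta> R) \<le> ?n * ig (\<zeta> R)" using n m i by (intro mult_right_mono) auto
  ultimately have "sig (\<zeta> R) \<noteq> 0" using i by linarith
  thus ?thesis using that R(1) by blast
 qed
 have R00: "0 < R0" using R0 by simp
 define \<eta> where "\<eta> = \<zeta> R0"
 note s\<eta> = cutoff_smc[OF z R00, folded \<eta>_def]
 define S1 S2 L where "S1 = \<bar>stab jac \<eta>\<bar>" and "S2 = \<bar>stab \<eta> \<eta>\<bar>" and "L = K1 / \<bar>sig \<eta>\<bar>"
 have L: "0 \<le> L" using K1 by (simp add: L_def)
 define K2 where "K2 = 2 * (2 * L * S1 + L\<^sup>2 * S2 + 5 * E * C)"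
 have K2: "0 \<le> K2" using L E(1) C by (simp add: K2_def S1_def S2_def)
 have key: "ig (%x. (\<zeta> R x)\<^sup>2 * dev_sq x) \<le> K2 * ?T R" if R: "2 * R0 < R" "?T R \<le> 1" for R
 proof -
  have Rp: "1 \<le> R" "0 < R" using R R0 by simp_all
  note sz = cutoff_smc[OF z Rp(2)]
  define f where "f x = \<zeta> R x * jac x" for x
  have sf: "smc f" unfolding f_def by (rule smc_mult[OF sz sm_jac])
  \<comment> \<open>\<open>f\<close> agrees with \<open>jac\<close> on the support of
    \<open>\<eta>\<close>, so the cross term does not depend on \<open>R\<close>.\<close>
  have cross: "stab f \<eta> = stab jac \<eta>"
  proof (rule stab_cong)
   fix x assume x: "x \<in> M"
   show "f x * \<eta> x = jac x * \<eta> x"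
   proof (cases "norm x < R")
    case True
    thus ?thesis using cutoffD(5)[OF z Rp(2), of x] by (simp add: f_def)
   next
    case False
    thus ?thesis using cutoffD(6)[OF z R00, of x] R by (simp add: \<eta>_def)
   qed
  next
   fix x assume x: "x \<in> M"
   have pz: "pd b f x * pd b \<eta> x = pd b jac x * pd b \<eta> x" for b
   proof (cases "norm x < R")
    case True
    thus ?thesis unfolding f_def[abs_def] pd_mult[OF smc_sm[OF sz] sm_jac x]
     using cutoffD(5)[OF z Rp(2), of x] cutoffD(7)[OF z Rp(2) x, of b] by simp
   next
    case False
    thus ?thesis using cutoffD(7)[OF z R00 x, of b] R by (simp add: \<eta>_def)
   qed
   show "grads f \<eta> x = grads jac \<eta> x" by (simp only: grads_def pz)
  qed
  have sfl: "\<bar>sig f\<bar> \<le> K1 * ?T R"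
  proof -
   have sY: "smc (%x. \<zeta> R x * dev b x)" for b by (intro smc_mult sz sm_dev)
   have "sig f = sig (%x. SB b. (\<zeta> R x * dev b x) * pd b u x)"
   proof (rule sig_cong_frontier[OF sf])
    show "smc (%x. SB b. (\<zeta> R x * dev b x) * pd b u x)" by (intro smc_sum smc_mult[OF sY] sm_pd smu)
   qed (simp add: f_def jac_frontier(1) sum_distrib_left mult.assoc)
   also have "... = - ig (%x. SB b. pd b (%x. \<zeta> R x * dev b x) x)" unfolding sig_flux[OF sY] by simp
   also have "ig (%x. SB b. pd b (%x. \<zeta> R x * dev b x) x) = ig (%x. SB b. pd b (\<zeta> R) x * dev b x)"
   proof (rule ig_cong)
    fix x assume x: "x \<in> M"
    show "(SB b. pd b (%x. \<zeta> R x * dev b x) x) = (SB b. pd b (\<zeta> R) x * dev b x)"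
     unfolding pd_mult[OF smc_sm[OF sz] sm_dev x] sum.distrib sum_distrib_left[symmetric] div_dev[OF x] by simp
   qed
   finally show ?thesis using flux[OF Rp(1) sm_dev E(3)] by simp
  qed
  define a where "a = - sig f / sig \<eta>"
  have "\<bar>a\<bar> = \<bar>sig f\<bar> / \<bar>sig \<eta>\<bar>" by (simp add: a_def)
  also have "... \<le> K1 * ?T R / \<bar>sig \<eta>\<bar>" using sfl by (rule divide_right_mono) simp
  finally have a: "\<bar>a\<bar> \<le> L * ?T R" by (simp add: L_def)
  have "a\<^sup>2 \<le> (L * ?T R)\<^sup>2" using a by (metis abs_ge_zero power2_abs power_mono)
  also have "... = L\<^sup>2 * (?T R * ?T R)" by (simp add: power_mult_distrib power2_eq_square)
  \<comment> \<open>The tail volume is at most 1, so its square is bounded by itself and all errors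
    are linear in it.\<close>
  also have "... \<le> L\<^sup>2 * (?T R * 1)" using R(2) T0 by (intro mult_left_mono) auto
  finally have a2: "a\<^sup>2 \<le> L\<^sup>2 * ?T R" by simp
  have "sig (%x. f x + a * \<eta> x) = sig f + a * sig \<eta>" by (simp only: sig_add[OF sf smc_cmult[OF s\<eta>]] sig_cmult[OF s\<eta>])
  hence "sig (%x. f x + a * \<eta> x) = 0" using R0(2) by (simp add: a_def \<eta>_def)
  hence "stab (%x. f x + a * \<eta> x) (%x. f x + a * \<eta> x) \<le> 0" by (rule stab_nonpos[OF smc_add[OF sf smc_cmult[OF s\<eta>]]])
  hence "stab f f \<le> - (2 * (a * stab jac \<eta>)) - a\<^sup>2 * stab \<eta> \<eta>" unfolding stab_add_cmult[OF sf s\<eta>] cross by simp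
  also have "... \<le> 2 * (\<bar>a\<bar> * S1) + a\<^sup>2 * S2"
   using abs_ge_minus_self[of "a * stab jac \<eta>"] abs_ge_minus_self[of "a\<^sup>2 * stab \<eta> \<eta>"]
   by (simp add: abs_mult S1_def S2_def)
  also have "... \<le> 2 * ((L * ?T R) * S1) + (L\<^sup>2 * ?T R) * S2"
   using a a2 by (intro add_mono mult_left_mono mult_right_mono) (simp_all add: S1_def S2_def)
  finally have st: "stab f f \<le> 2 * ((L * ?T R) * S1) + (L\<^sup>2 * ?T R) * S2" .
  have "ig (%x. (2 * (SB b. (dev b x)\<^sup>2) + (jac x)\<^sup>2) * grads (\<zeta> R) (\<zeta> R) x) \<le> (5 * E * C) * ?T R"
  proof (rule ig_le_meas[OF _ tb])
   show "smc (%x. (2 * (SB b. (dev b x)\<^sup>2) + (jac x)\<^sup>2) * grads (\<zeta> R) (\<zeta> R) x)"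
    by (intro smc_mult' sm_add sm_mult sm_const sm_sum sm_power2 sm_dev sm_jac smc_grads sz smc_sm)
   fix y assume y: "y \<in> M"
   show "(2 * (SB b. (dev b y)\<^sup>2) + (jac y)\<^sup>2) * grads (\<zeta> R) (\<zeta> R) y \<le> (5 * E * C) * indicator (- ball 0 R) y"
    by (rule cutoff_weight[OF z Rp(1) y E(1) E(4)[OF y]])
  qed
  hence "(1/2) * ig (%x. (\<zeta> R x)\<^sup>2 * dev_sq x) \<le> 2 * ((L * ?T R) * S1) + (L\<^sup>2 * ?T R) * S2 + (5 * E * C) * ?T R"
   using dev_sq_bound[OF sz] st unfolding f_def[abs_def] by linarith
  also have "... = (K2 / 2) * ?T R" by (simp add: K2_def algebra_simps)
  finally show ?thesis by simp
 qed
 \<comment> \<open>A fixed cutoff equal to 1 at \<open>x\<close>: the integral to be made small must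
   not change with \<epsilon>, while the larger cutoffs that dominate it may.\<close>
 define R1 where "R1 = norm x + 1"
 have R1: "0 < R1" by (simp add: R1_def add_nonneg_pos)
 note s1 = cutoff_smc[OF z R1]
 have nn: "0 \<le> (\<zeta> r y)\<^sup>2 * dev_sq y" for r y unfolding dev_sq_def by (intro mult_nonneg_nonneg sum_nonneg) auto
 have sc: "smc (%y. (\<zeta> R1 y)\<^sup>2 * dev_sq y)" by (intro smc_mult smc_power2 s1 sm_dev_sq)
 have "ig (%y. (\<zeta> R1 y)\<^sup>2 * dev_sq y) \<le> \<epsilon>" if \<epsilon>: "0 < \<epsilon>" for \<epsilon>
 proof -
  have "0 < min 1 (\<epsilon> / (K2 + 1))" using \<epsilon> K2 by simp
  then obtain R' where R': "\<And>R. R' \<le> R ==> ?T R < min 1 (\<epsilon> / (K2 + 1))" using meas_tail by blast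
  define R where "R = max (max (2 * R0 + 1) (2 * R1)) R'"
  have R: "2 * R0 < R" "2 * R1 \<le> R" "R' \<le> R" "0 < R" using R1 by (auto simp: R_def)
  have "ig (%y. (\<zeta> R1 y)\<^sup>2 * dev_sq y) \<le> ig (%y. (\<zeta> R y)\<^sup>2 * dev_sq y)"
  proof (rule ig_mono'[OF sc])
   show "smc (%y. (\<zeta> R y)\<^sup>2 * dev_sq y)" by (intro smc_mult smc_power2 cutoff_smc[OF z R(4)] sm_dev_sq)
   fix y
   show "(\<zeta> R1 y)\<^sup>2 * dev_sq y \<le> (\<zeta> R y)\<^sup>2 * dev_sq y"
   proof (cases "norm y \<le> R")
    case True
    have "(\<zeta> R1 y)\<^sup>2 \<le> 1" using cutoffD(3,4)[OF z R1, of y] by (simp add: power_le_one)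
    moreover have "0 \<le> dev_sq y" unfolding dev_sq_def by (intro sum_nonneg) auto
    ultimately have "(\<zeta> R1 y)\<^sup>2 * dev_sq y \<le> 1 * dev_sq y" by (rule mult_right_mono)
    thus ?thesis using cutoffD(5)[OF z R(4) True] by simp
   next
    case False
    thus ?thesis using cutoffD(6)[OF z R1, of y] R(2) nn[of R y] by simp
   qed
  qed
  also have "... \<le> K2 * ?T R" by (rule key[OF R(1)]) (use R'[OF R(3)] in simp)
  also have "... \<le> K2 * (\<epsilon> / (K2 + 1))" using R'[OF R(3)] K2 by (intro mult_left_mono) auto
  also have "... \<le> \<epsilon>" using K2 \<epsilon> by (simp add: field_simps)
  finally show ?thesis .
 qed
 hence "ig (%y. (\<zeta> R1 y)\<^sup>2 * dev_sq y) \<le> 0" by (rule field_le_epsilon[where y=0, simplified])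
 from ig_nonpos_imp_zero[OF sc nn this x] show ?thesis using cutoffD(5)[OF z R1, of x] by (simp add: R1_def)
qed

end

subsection \<open>Rigidity\<close>

context stable_dom
begin

lemma constant_on_connected:
 assumes f: "sm f" and z: "\<And>x b. x \<in> \<Omega> ==> b \<in> Basis ==> pd b f x = 0"
  and S: "connected S" "open S" "S \<subseteq> \<Omega>" and xy: "x \<in> S" "y \<in> S"
 shows "f x = f y"
proof (rule has_derivative_zero_unique_connected[OF S(2,1) _ xy])
 fix x assume "x \<in> S"
 hence x: "x \<in> \<Omega>" using S(3) by blast
 have eq: "(%h. gradient_within M f x \<bullet> h) = (%h. 0)" by (rule ext) (simp add: gradient_inner z[OF x])
 show "(f has_derivative (%h. 0)) (at x)" using sm_has_derivative_interior[OF f x] unfolding eq .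
qed

lemma pd_dev_zero: assumes x: "x \<in> \<Omega>" and b: "b \<in> Basis" "d \<in> Basis" shows "pd d (dev b) x = 0"
proof -
 have "(SB d. (pd d (dev b) x)\<^sup>2) = 0"
  using dev_sq_zero[OF x] b(1) unfolding dev_sq_def by (subst (asm) sum_nonneg_eq_0_iff) (auto intro: sum_nonneg)
 thus ?thesis using b(2) by (subst (asm) sum_nonneg_eq_0_iff) auto
qed

text \<open>For u = (1 - |x - a|^2) / 2 this is the centre a, at every x.\<close>

definition center :: "'a \<Rightarrow> 'a" where
 "center x = x + Du x"

lemma center_inner: "center x \<bullet> b = dev b x"
 by (simp add: center_def dev_def pd_def inner_add_left)

lemma center_continuous: "continuous_on M center"
 unfolding center_def[abs_def] by (intro continuous_intros Du_continuous)

lemma center_constant: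
 assumes S: "connected S" "open S" "S \<subseteq> \<Omega>" and xy: "x \<in> S" "y \<in> S"
 shows "center x = center y"
proof (rule euclidean_eqI)
 fix b :: 'a assume b: "b \<in> Basis"
 show "center x \<bullet> b = center y \<bullet> b" unfolding center_inner
  by (rule constant_on_connected[OF sm_dev pd_dev_zero[OF _ b] S xy])
qed

lemma Du_center: "(SB b. (pd b u x)\<^sup>2) = (norm (center x - x))\<^sup>2"
 unfolding norm_gradient[of u x, symmetric] center_def by simp

text \<open>On each component \<open>u\<close> is a paraboloid, so the component is the ball on which it is positive.\<close>

lemma component_ball:
 assumes x: "x \<in> \<Omega>"
 shows "connected_component_set \<Omega> x = ball (center x) 1"
proof -
 define S where "S = connected_component_set \<Omega> x"
 define a where "a = center x"
 \<comment> \<open>The P-function |Du|^2 + 2 u has gradient 2 (D^2u + Id) Du, so it is constant on a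
   component once D^2u = - Id; the boundary data give the value 1.\<close>
 define P where "P y = (SB b. (pd b u y)\<^sup>2) + 2 * u y" for y
 have S: "connected S" "open S" "S \<subseteq> \<Omega>" "x \<in> S"
  using open_connected_component[OF open_dom] connected_component_subset connected_component_refl[OF x] unfolding S_def by auto
 have SM: "closure S \<subseteq> M" using closure_mono[OF S(3)] .
 have smP: "sm P" unfolding P_def[abs_def] by (intro sm_add sm_sum sm_power2 sm_pd smu sm_mult sm_const)
 have "pd c P y = 0" if y: "y \<in> \<Omega>" and c: "c \<in> Basis" for y c
 proof -
  have yM: "y \<in> M" using y dom_sub by blast
  have "pd c P y = (SB b. 2 * pd b u y * pd c (pd b u) y) + 2 * pd c u y"
   unfolding P_def[abs_def] pd_add[OF sm_sum[OF sm_power2[OF sm_pd[OF smu]]] sm_mult[OF sm_const smu] yM]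
    pd_sum[OF finite_Basis sm_power2[OF sm_pd[OF smu]] yM] pd_power2[OF sm_pd[OF smu] yM] pd_cmult[OF smu yM] ..
  also have "... = (SB b. 2 * pd b u y * (- (c \<bullet> b))) + 2 * pd c u y"
  proof -
   have "pd c (pd b u) y = - (c \<bullet> b)" if "b \<in> Basis" for b
    using pd_dev_zero[OF y that c] pd_dev[OF yM, of c b] by simp
   thus ?thesis by simp
  qed
  also have "(SB b. 2 * pd b u y * (- (c \<bullet> b))) = (SB b. (c \<bullet> b) * (- 2 * pd b u y))"
   by (rule sum.cong) simp_all
  also have "... = - 2 * pd c u y" by (rule sum_inner_Basis[OF c])
  finally show ?thesis by simp
 qed
 hence p: "P y = P x" if "y \<in> S" for y using constant_on_connected[OF smP _ S(1-3) that S(4)] by blast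
 have ca: "center y = a" if "y \<in> closure S" for y
  by (rule continuous_constant_on_closure[OF continuous_on_subset[OF center_continuous SM] _ that])
   (use center_constant[OF S(1-3) _ S(4)] in \<open>simp add: a_def\<close>)
 have Pp: "P y = P x" if "y \<in> closure S" for y
  by (rule continuous_constant_on_closure[OF continuous_on_subset[OF sm_continuous[OF smP] SM] p that])
 have sq: "2 * u y = P x - (norm (a - y))\<^sup>2" if "y \<in> closure S" for y
  using Pp[OF that] ca[OF that] Du_center[of y] by (simp add: P_def)
 have fr: "frontier S \<subseteq> frontier \<Omega>" unfolding S_def by (rule frontier_of_connected_component_subset)
 have "frontier \<Omega> \<noteq> {}" using nearest_boundary_point[OF x] by blast
 hence "S \<noteq> UNIV" using S(3) frontier_dom by auto
 hence "frontier S \<noteq> {}" using S(4) by (auto simp: frontier_eq_empty)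
 then obtain y where y: "y \<in> frontier S" by blast
 have n1: "(norm (a - y))\<^sup>2 = 1" if "y \<in> frontier S" for y
 proof -
  have "y \<in> closure S" using that by (simp add: frontier_def)
  thus ?thesis using grad_sq[of y] Du_center[of y] ca[of y] fr that by auto
 qed
 have "y \<in> closure S" using y by (simp add: frontier_def)
 hence "P x = 1" using sq[of y] n1[OF y] u_zero[of y] fr y by auto
 have Sb: "S \<subseteq> ball a 1"
 proof
  fix z assume z: "z \<in> S"
  hence "0 < u z" using u_pos S(3) by blast
  hence "(norm (a - z))\<^sup>2 < 1" using sq[of z] z closure_subset[of S] \<open>P x = 1\<close> by auto
  thus "z \<in> ball a 1" by (simp add: dist_norm power_less_one_iff)
 qed
 \<comment> \<open>All frontier points of \<open>S\<close> have distance exactly 1 from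
   \<open>a\<close>, so the open ball, being connected, cannot meet \<open>S\<close> and leave
   it.\<close>
 have "ball a 1 \<subseteq> S"
 proof (rule ccontr)
  assume "\<not> ball a 1 \<subseteq> S"
  hence "ball a 1 \<inter> frontier S \<noteq> {}" using S(4) Sb by (intro connected_Int_frontier) auto
  then obtain z where "z \<in> ball a 1" "z \<in> frontier S" by blast
  moreover from this have "(norm (a - z))\<^sup>2 < 1" by (simp add: dist_norm power_less_one_iff)
  ultimately show False using n1[of z] by simp
 qed
 thus ?thesis using Sb by (auto simp: S_def a_def)
qed

lemma ball_center:
 assumes x: "x \<in> \<Omega>"
 shows "ball (center x) 1 \<subseteq> \<Omega>" "x \<in> ball (center x) 1" "\<And>y. y \<in> ball (center x) 1 ==> center y = center x"
proof -
 note eq = component_ball[OF x, symmetric]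
 show s: "ball (center x) 1 \<subseteq> \<Omega>" unfolding eq by (rule connected_component_subset)
 show m: "x \<in> ball (center x) 1" unfolding eq using x by simp
 show "center y = center x" if "y \<in> ball (center x) 1" for y
  by (rule center_constant[OF connected_ball open_ball s that m])
qed

text \<open>\<open>center y\<close> lies in both unit balls, and \<open>center\<close> is constant
  on each of them.\<close>

lemma center_separated:
 assumes x: "x \<in> \<Omega>" "y \<in> \<Omega>" and d: "dist (center x) (center y) < 1"
 shows "center x = center y"
proof -
 have "center y \<in> ball (center x) 1" "center y \<in> ball (center y) 1" using d by simp_all
 thus ?thesis using ball_center(3)[OF x(1), of "center y"] ball_center(3)[OF x(2), of "center y"] by simp
qed

text \<open>Near \<open>x\<close> continuity puts the centres at distance below 1 from each other,
  where distinct centres cannot be. This includes boundary points, so components do not touch there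
  and functions of the centre are smooth up to the boundary.\<close>

lemma center_locally_constant:
 assumes x: "x \<in> M"
 obtains U where "open U" "x \<in> U" "\<forall>y\<in>U \<inter> M. center y = center x"
proof -
 obtain d where d: "0 < d" "\<And>y. y \<in> M ==> dist y x < d ==> dist (center y) (center x) < 1/2"
  using center_continuous x unfolding continuous_on_iff by (metis half_gt_zero zero_less_one)
 let ?U = "ball x d"
 have UM: "?U \<inter> M \<subseteq> closure (?U \<inter> \<Omega>)" by (rule open_Int_closure_subset) simp
 have "x \<in> closure (?U \<inter> \<Omega>)" using UM x d(1) by auto
 then obtain z where z: "z \<in> ?U" "z \<in> \<Omega>" by (metis IntE closure_empty empty_iff ex_in_conv)
 have c: "center y = center z" if "y \<in> ?U \<inter> \<Omega>" for y
 proof (rule center_separated)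
  have "dist (center y) (center x) < 1/2" "dist (center z) (center x) < 1/2"
   using d(2)[of y] d(2)[of z] that z dom_sub by (auto simp: dist_commute)
  thus "dist (center y) (center z) < 1" using dist_triangle_half_l[of "center y" "center x" 1 "center z"] by (simp add: dist_commute)
 qed (use that z in auto)
 have "closure (?U \<inter> \<Omega>) \<subseteq> M" by (rule closure_mono) auto
 hence cc: "center y = center z" if "y \<in> ?U \<inter> M" for y
  using continuous_constant_on_closure[OF continuous_on_subset[OF center_continuous] c] that UM by blast
 have "center y = center x" if "y \<in> ?U \<inter> M" for y using cc[OF that] cc[of x] x d(1) by simp
 thus ?thesis using that[of ?U] d(1) by simp
qed

lemma center_unique:
 assumes x: "x1 \<in> \<Omega>" "x2 \<in> \<Omega>"
 shows "center x1 = center x2"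
proof (rule ccontr)
 assume ne: "center x1 \<noteq> center x2"
 let ?n = "real DIM('a)"
 define a1 a2 where "a1 = center x1" and "a2 = center x2"
 \<comment> \<open>The test function is defined through the centres rather than the balls, so that
   it has values on the boundary and is locally constant there too.\<close>
 define g where "g y = (if y = a1 then 1 else if y = a2 then - 1 else 0 :: real)" for y
 define f where "f y = g (center y)" for y
 have n0: "0 < ?n" using n2 by simp
 obtain B where B: "1 \<le> B" "\<And>x. x \<in> M ==> (SB b. (pd b u x)\<^sup>2) \<le> B" using u_gradient_bounded by metis
 have smf: "sm f"
  unfolding smooth_on_subset_def
 proof
  fix x assume "x \<in> M"
  then obtain U where "open U" "x \<in> U" "\<forall>y\<in>U \<inter> M. center y = center x" by (rule center_locally_constant)
  thus "\<exists>U h. open U \<and> x \<in> U \<and> smooth_on U h \<and> (\<forall>y\<in>U \<inter> M. h y = f y)"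
   by (intro exI[of _ U] exI[of _ "%_. f x"]) (simp add: smooth_on_const f_def)
 qed
 have pf: "pd b f x = 0" if x: "x \<in> M" for b x
 proof -
  obtain U where U: "open U" "x \<in> U" "\<forall>y\<in>U \<inter> M. center y = center x" using x by (rule center_locally_constant)
  have "pd b (%_. f x) x = pd b f x"
   by (rule pd_cong_local[OF U(2,1) x _ sm_const]) (use U(3) in \<open>simp add: f_def\<close>)
  thus ?thesis by (simp add: pd_const[OF x])
 qed
 have scf: "smc f"
 proof (rule smcI[OF smf])
  fix y assume y: "y \<in> M" "f y \<noteq> 0"
  hence "center y = a1 \<or> center y = a2" by (auto simp: f_def g_def split: if_splits)
  hence c: "norm (center y) \<le> norm a1 + norm a2" by auto
  \<comment> \<open>The distance to the centre is |Du|, and |Du|^2 is at most \<open>B\<close>,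
    hence at most its square as \<open>B\<close> is at least 1.\<close>
  have "(norm (center y - y))\<^sup>2 \<le> B\<^sup>2" using B(2)[OF y(1)] B(1) unfolding Du_center by (smt (verit) power2_eq_square mult_le_cancel_left1)
  hence "norm (center y - y) \<le> B" by (rule power2_le_imp_le) (use B(1) in simp)
  thus "norm y \<le> norm a1 + norm a2 + B" using c norm_triangle_ineq4[of "center y" "center y - y"] by simp
 qed
 have val: "f y = indicator (ball a1 1) y - indicator (ball a2 1) y" "(f y)\<^sup>2 = indicator (ball a1 1) y + indicator (ball a2 1) y" if y: "y \<in> \<Omega>" for y
 proof -
  have iff: "y \<in> ball a1 1 \<longleftrightarrow> center y = a1" "y \<in> ball a2 1 \<longleftrightarrow> center y = a2"
   using ball_center(3)[OF x(1), of y] ball_center(3)[OF x(2), of y] ball_center(2)[OF y] by (auto simp: a1_def a2_def)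
  show "f y = indicator (ball a1 1) y - indicator (ball a2 1) y" "(f y)\<^sup>2 = indicator (ball a1 1) y + indicator (ball a2 1) y"
   unfolding indicator_def iff f_def g_def using ne by (auto simp: a1_def a2_def)
 qed
 have ms: "meas (ball a1 1) = unit_ball_vol ?n" "meas (ball a2 1) = unit_ball_vol ?n"
 proof -
  have "\<Omega> \<inter> ball a1 1 = ball a1 1" "\<Omega> \<inter> ball a2 1 = ball a2 1"
   using ball_center(1)[OF x(1)] ball_center(1)[OF x(2)] by (auto simp: a1_def a2_def)
  thus "meas (ball a1 1) = unit_ball_vol ?n" "meas (ball a2 1) = unit_ball_vol ?n" by (simp_all add: content_ball)
 qed
 have bb: "ball a 1 \<in> sets borel" "emeasure lborel (\<Omega> \<inter> ball a 1) \<noteq> \<infinity>" for a :: 'a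
  by (simp, rule finite_meas_bounded) auto
 note mi = meas_indicator[OF bb, of 1, simplified mult_1]
 have "ig f = ig (%y. indicator (ball a1 1) y - indicator (ball a2 1) y)" by (rule ig_cong) (rule val(1))
 also have "... = ig (%y. indicator (ball a1 1) y) - ig (%y. indicator (ball a2 1) y)"
  unfolding ig_def by (rule set_integral_diff[OF mi(1) mi(1)])
 finally have i1: "ig f = 0" by (simp add: mi(2) ms)
 have "ig (%y. (f y)\<^sup>2) = ig (%y. indicator (ball a1 1) y + indicator (ball a2 1) y)" by (rule ig_cong) (rule val(2))
 also have "... = ig (%y. indicator (ball a1 1) y) + ig (%y. indicator (ball a2 1) y)"
  unfolding ig_def by (rule set_integral_add[OF mi(1) mi(1)])
 finally have i2: "ig (%y. (f y)\<^sup>2) = 2 * unit_ball_vol ?n" by (simp add: mi(2) ms)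
 \<comment> \<open>Locally constant functions have no gradient term in \<open>sig\<close>, so the
   mean-zero condition says that the two balls have equal volume.\<close>
 have "sig f = ig (%x. ?n * f x)" unfolding sig_def by (rule ig_cong) (use pf dom_sub in auto)
 hence "sig f = 0" by (simp add: ig_cmult i1)
 hence "stab f f \<le> 0" by (rule stab_nonpos[OF scf])
 moreover have "ig (grads f f) = 0"
 proof -
  have "ig (grads f f) = ig (%x. 0)" by (rule ig_cong) (use pf dom_sub in \<open>auto simp: grads_def\<close>)
  thus ?thesis by (simp add: ig_def)
 qed
 moreover have "?n * unit_ball_vol ?n \<le> stab f f + (2 * B + 1) * ig (grads f f)" using stab_lower[OF scf B(2)] by (simp add: i2)
 ultimately have "?n * unit_ball_vol ?n \<le> 0" by simp
 moreover have "0 < ?n * unit_ball_vol ?n" by (rule mult_pos_pos[OF n0 unit_ball_vol_pos]) (use n0 in simp)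
 ultimately show False by linarith
qed

lemma unit_ball: "\<exists>a. \<Omega> = ball a 1"
proof -
 obtain x where x: "x \<in> \<Omega>" using dom_nonempty by blast
 have "y \<in> ball (center x) 1" if "y \<in> \<Omega>" for y
  using ball_center(2)[OF that] center_unique[OF that x] by simp
 hence "\<Omega> = ball (center x) 1" using ball_center(1)[OF x] by blast
 thus ?thesis by blast
qed

end

theorem theorem2:
 fixes \<Omega> :: "(real ^ 'n) set"
 assumes "2 \<le> CARD('n)"
  and "smooth_domain \<Omega>"
  and "serrin_solution \<Omega>"
  and "weakly_stable \<Omega>"
 shows "\<exists>c. \<Omega> = ball c 1"
proof -
 obtain u where u: "smooth_on_subset (closure \<Omega>) u" "\<forall>x\<in>\<Omega>. - laplacian u x = real DIM(real ^ 'n)"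
  "\<forall>x\<in>\<Omega>. 0 < u x" "\<forall>x\<in>frontier \<Omega>. u x = 0" "\<forall>x\<in>frontier \<Omega>. norm (gradient_within (closure \<Omega>) u x) = 1"
  using assms(3) unfolding serrin_solution_def by blast
 obtain c :: real where c: "1 \<le> c" "\<And>\<nu> B. norm \<nu> = 1 ==> B \<in> sets borel ==>
   hausdorff_outer_measure (CARD('n) - 1) (B \<inter> {y. y \<bullet> \<nu> = 0}) = ennreal c * emeasure (plane_meas (\<nu> :: real ^ 'n)) B"
  using hausdorff_hyperplane[OF assms(1)] by metis
 interpret stable_dom \<Omega> u c
  by unfold_locales (use assms u c in auto)
 show ?thesis by (rule unit_ball)
qed

end
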